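(* Let $\phi\in\mathcal{OP}(\mathbb{D})$, let $\tau=(\Delta\phi)^{-1/2}$, and let $K$ be the Bergman kernel for $AL^{2}_{\phi}(\mathbb{D})$. Then there exist positive constants $C$ and $\sigma$ such that for all $z,w\in\mathbb{D}$, $$|K(z,w)|\,e^{-(\phi(z)+\phi(w))}\leq C\,\frac{1}{\tau(z)\tau(w)}\exp\bigl(-\sigma\, d_{\phi}(z,w)\bigr).$$
   Context: $\mathbb{D}$ is the open unit disc in $\mathbb{C}$, $d\lambda$ is Lebesgue measure on $\mathbb{D}$, and $\Delta$ is the Laplace operator. The class $\mathcal{OP}(\mathbb{D})$: let $\phi:\mathbb{D}\to\mathbb{R}$ be in $C^{2}(\mathbb{D})$ with $\Delta\phi>0$ on $\mathbb{D}$, and put $\tau=(\Delta\phi)^{-1/2}$. One says $\phi\in\mathcal{OP}(\mathbb{D})$ if the following three conditions hold: (1) there exists $C_{1}>0$ such that $|\tau(z)-\tau(w)|\leq C_{1}|z-w|$ for all $z,w\in\mathbb{D}$; (2) there exists $C_{2}>0$ such that $\tau(z)\leq C_{2}(1-|z|)$ for all $z\in\mathbb{D}$; (3) there exist $0<C_{3}<1$ and $a>0$ such that $\tau(w)\leq\tau(z)+C_{3}|z-w|$ for all $z,w\in\mathbb{D}$ with $w\notin D(z,a\tau(z))$, where $D(z,a\tau(z))=\{w\in\mathbb{D}: |w-z|\leq a\tau(z)\}$. Weighted Bergman space: $L^{2}_{\phi}(\mathbb{D})$ is the Hilbert space of measurable functions $f$ on $\mathbb{D}$ with $\|f\|_{L^{2}_{\phi}}=\bigl(\int_{\mathbb{D}}|f|^{2}e^{-2\phi}\,d\lambda\bigr)^{1/2}<\infty$,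 and $AL^{2}_{\phi}(\mathbb{D})$ is its closed subspace consisting of the holomorphic functions. The Bergman kernel $K:\mathbb{D}\times\mathbb{D}\to\mathbb{C}$ is the reproducing kernel of $AL^{2}_{\phi}(\mathbb{D})$, i.e. $K(\cdot,w)\in AL^{2}_{\phi}(\mathbb{D})$ for each $w\in\mathbb{D}$, $K(z,w)=\overline{K(w,z)}$, and the orthogonal projection $P$ of $L^{2}_{\phi}(\mathbb{D})$ onto $AL^{2}_{\phi}(\mathbb{D})$ is given by $Pf(z)=\int_{\mathbb{D}}K(z,w)f(w)e^{-2\phi(w)}\,d\lambda(w)$. Distance: $d_{\phi}$ is the distance on $\mathbb{D}$ induced by the metric $\tau(z)^{-2}dz\otimes d\bar z$, that is, $$d_{\phi}(z,w)=\inf_{\gamma}\int_{0}^{1}\frac{|\gamma'(t)|}{\tau(\gamma(t))}\,dt,$$ where $\gamma$ runs over the piecewise $C^{1}$ curves $\gamma:[0,1]\to\mathbb{D}$ with $\gamma(0)=z$ and $\gamma(1)=w$. *)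

theory Defs
  imports "HOL-Analysis.Analysis"
begin

abbreviation disc :: "complex set" where
  "disc \<equiv> ball 0 1"

text \<open>
  Functions on the disc are represented by total functions on the complex plane; every notion
  below depends only on their values in the disc.
\<close>

text \<open>Twice continuously (Frechet) differentiable; intended for open \<open>S\<close>.\<close>

definition C2_on :: "'a::real_normed_vector set \<Rightarrow> ('a \<Rightarrow> real) \<Rightarrow> bool" where
  "C2_on S f \<longleftrightarrow>
     (\<exists>(f' :: 'a \<Rightarrow> ('a \<Rightarrow>\<^sub>L real)) (f'' :: 'a \<Rightarrow> ('a \<Rightarrow>\<^sub>L ('a \<Rightarrow>\<^sub>L real))).
        (\<forall>x\<in>S. (f has_derivative blinfun_apply (f' x)) (at x)) \<and>
        (\<forall>x\<in>S. (f' has_derivative blinfun_apply (f'' x)) (at x)) \<and>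
        continuous_on S f'')"

definition laplacian :: "(complex \<Rightarrow> real) \<Rightarrow> complex \<Rightarrow> real" where
  "laplacian \<phi> z =
     (deriv ^^ 2) (\<lambda>x. \<phi> (Complex x (Im z))) (Re z) +
     (deriv ^^ 2) (\<lambda>y. \<phi> (Complex (Re z) y)) (Im z)"

definition tau :: "(complex \<Rightarrow> real) \<Rightarrow> complex \<Rightarrow> real" where
  "tau \<phi> z = laplacian \<phi> z powr (- 1 / 2)"

definition tau_disc :: "(complex \<Rightarrow> real) \<Rightarrow> complex \<Rightarrow> real \<Rightarrow> complex set" where
  "tau_disc \<phi> z a = {w \<in> disc. cmod (w - z) \<le> a * tau \<phi> z}"

definition OP_disc :: "(complex \<Rightarrow> real) set" where
  "OP_disc = {\<phi>. C2_on disc \<phi> \<and> (\<forall>z\<in>disc. laplacian \<phi> z > 0) \<and>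
     (\<exists>C\<^sub>1>0. \<forall>z\<in>disc. \<forall>w\<in>disc. \<bar>tau \<phi> z - tau \<phi> w\<bar> \<le> C\<^sub>1 * cmod (z - w)) \<and>
     (\<exists>C\<^sub>2>0. \<forall>z\<in>disc. tau \<phi> z \<le> C\<^sub>2 * (1 - cmod z)) \<and>
     (\<exists>C\<^sub>3 a. 0 < C\<^sub>3 \<and> C\<^sub>3 < 1 \<and> 0 < a \<and>
        (\<forall>z\<in>disc. \<forall>w\<in>disc. w \<notin> tau_disc \<phi> z a \<longrightarrow>
           tau \<phi> w \<le> tau \<phi> z + C\<^sub>3 * cmod (z - w)))}"

definition L2_phi :: "(complex \<Rightarrow> real) \<Rightarrow> (complex \<Rightarrow> complex) set" where
  "L2_phi \<phi> = {f. f \<in> borel_measurable (lebesgue_on disc) \<and>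
     integrable (lebesgue_on disc) (\<lambda>w. (cmod (f w))\<^sup>2 * exp (- 2 * \<phi> w))}"

definition AL2_phi :: "(complex \<Rightarrow> real) \<Rightarrow> (complex \<Rightarrow> complex) set" where
  "AL2_phi \<phi> = {f \<in> L2_phi \<phi>. f holomorphic_on disc}"

definition inner_phi ::
  "(complex \<Rightarrow> real) \<Rightarrow> (complex \<Rightarrow> complex) \<Rightarrow> (complex \<Rightarrow> complex) \<Rightarrow> complex" where
  "inner_phi \<phi> f g =
     (\<integral>w. f w * cnj (g w) * of_real (exp (- 2 * \<phi> w)) \<partial>lebesgue_on disc)"

text \<open>
  \<open>g\<close> is the (holomorphic representative of the) orthogonal projection of \<open>f\<close> onto \<open>AL2_phi\<close>.
\<close>

definition is_bergman_projection ::
  "(complex \<Rightarrow> real) \<Rightarrow> (complex \<Rightarrow> complex) \<Rightarrow> (complex \<Rightarrow> complex) \<Rightarrow> bool" where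
  "is_bergman_projection \<phi> f g \<longleftrightarrow>
     g \<in> AL2_phi \<phi> \<and> (\<forall>h\<in>AL2_phi \<phi>. inner_phi \<phi> (\<lambda>z. f z - g z) h = 0)"

text \<open>These conditions determine \<open>K\<close> uniquely on \<open>disc \<times> disc\<close>.\<close>

definition is_bergman_kernel ::
  "(complex \<Rightarrow> real) \<Rightarrow> (complex \<Rightarrow> complex \<Rightarrow> complex) \<Rightarrow> bool" where
  "is_bergman_kernel \<phi> K \<longleftrightarrow>
     (\<forall>w\<in>disc. (\<lambda>z. K z w) \<in> AL2_phi \<phi>) \<and>
     (\<forall>z\<in>disc. \<forall>w\<in>disc. K z w = cnj (K w z)) \<and>
     (\<forall>f\<in>L2_phi \<phi>. is_bergman_projection \<phi> f
        (\<lambda>z. \<integral>w. K z w * f w * of_real (exp (- 2 * \<phi> w)) \<partial>lebesgue_on disc))"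

text \<open>
  Piecewise \<open>C\<^sup>1\<close> in the usual sense: continuously differentiable, with one-sided derivatives at
  the end points, on each closed interval of a partition \<open>S\<close>. The predicate \<open>valid_path\<close> is
  weaker, since it allows the derivative to be unbounded near the break points; the integral
  defining the length could then diverge, and would be \<open>0\<close> by the convention for
  non-integrable functions.
\<close>

definition piecewise_C1_curve :: "(real \<Rightarrow> complex) \<Rightarrow> bool" where
  "piecewise_C1_curve \<gamma> \<longleftrightarrow> continuous_on {0..1} \<gamma> \<and>
     (\<exists>S. finite S \<and> S \<subseteq> {0..1} \<and> 0 \<in> S \<and> 1 \<in> S \<and>
        (\<forall>a\<in>S. \<forall>b\<in>S. a < b \<longrightarrow> {a<..<b} \<inter> S = {} \<longrightarrow>
           (\<exists>\<gamma>'. continuous_on {a..b} \<gamma>' \<and>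
              (\<forall>t\<in>{a..b}. (\<gamma> has_vector_derivative \<gamma>' t) (at t within {a..b})))))"

definition curve_length_phi :: "(complex \<Rightarrow> real) \<Rightarrow> (real \<Rightarrow> complex) \<Rightarrow> real" where
  "curve_length_phi \<phi> \<gamma> =
     integral {0..1} (\<lambda>t. cmod (vector_derivative \<gamma> (at t)) / tau \<phi> (\<gamma> t))"

definition d_phi :: "(complex \<Rightarrow> real) \<Rightarrow> complex \<Rightarrow> complex \<Rightarrow> real" where
  "d_phi \<phi> z w = Inf (curve_length_phi \<phi> `
     {\<gamma>. piecewise_C1_curve \<gamma> \<and> \<gamma> ` {0..1} \<subseteq> disc \<and> \<gamma> 0 = z \<and> \<gamma> 1 = w})"

end

theory Submission
  imports Defs "HOL-Complex_Analysis.Complex_Analysis"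
begin

text \<open>
  The decay of the Bergman kernel is the decay of minimal solutions of the equation
  \<open>dbar u = f\<close>, where \<open>dbar\<close> stands for the Cauchy-Riemann operator \<open>\<partial>/\<partial>cnj z\<close>, and \<open>\<partial>\<close> for \<open>\<partial>/\<partial>z\<close>.

  Let \<open>\<chi>\<close> be a bump of size \<open>\<tau> z\<close> around \<open>z\<close>, let \<open>K\<^sub>w = K (\<cdot>, w)\<close>, and let
  \<open>J z w\<close> be the integral of \<open>\<chi> |K\<^sub>w|\<^sup>2 exp (-2\<phi>)\<close>.  The function \<open>|K\<^sub>w|\<^sup>2 exp (-2\<phi>)\<close> is almost
  subharmonic where \<open>\<Delta>\<phi>\<close> is comparable with \<open>1/(\<tau> z)\<^sup>2\<close> (\<open>weighted_mean_value\<close>), so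
  \<open>|K (z, w)|\<^sup>2 exp (-2 \<phi> z)\<close> is at most a constant times \<open>J z w / (\<tau> z)\<^sup>2\<close>.
  With the projection \<open>P\<close> and the symmetry of \<open>K\<close>, the number \<open>J z w\<close> is the value of
  \<open>P (\<chi> K\<^sub>w)\<close> at \<open>w\<close>.  If \<open>w\<close> lies outside the support of \<open>\<chi>\<close>, this is \<open>- u w\<close> for
  \<open>u = \<chi> K\<^sub>w - P (\<chi> K\<^sub>w)\<close>, a function that is orthogonal to the holomorphic functions and
  solves \<open>dbar u = K\<^sub>w dbar \<chi>\<close>, whose right-hand side lives near \<open>z\<close>.  It is enough to show that
  \<open>u\<close> decays in the mean; the submean inequality at \<open>w\<close> then gives decay of \<open>u w\<close>
  (\<open>cutoff_estimate\<close>).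

  Let \<open>D\<close> be the adjoint of \<open>dbar\<close> in the weighted space.  Since \<open>u\<close> is orthogonal to the
  holomorphic functions, Weyl's lemma shows that it is a limit of functions \<open>D \<alpha>\<close> with test
  functions \<open>\<alpha>\<close> (\<open>dstar_approximation\<close>).  Integration by parts gives
  \<open>\<integral> \<Delta>\<phi> |\<beta>|\<^sup>2 \<le> 2 \<parallel>D \<beta>\<parallel>\<^sup>2\<close> (\<open>basic_inequality\<close>), and for a real weight \<open>\<eta> = exp \<rho>\<close> the identity
  \<open>Re \<langle>D \<alpha>, D (\<eta>\<^sup>2 \<alpha>)\<rangle> = \<parallel>D (\<eta> \<alpha>)\<parallel>\<^sup>2 - \<parallel>(\<partial>\<rho>) \<eta> \<alpha>\<parallel>\<^sup>2\<close> has a last term that the inequality absorbs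
  as soon as \<open>4 |\<partial>\<rho>|\<^sup>2 \<le> \<Delta>\<phi> = 1/\<tau>\<^sup>2\<close>.  This is Agmon's method.  Half of any function that is
  1-Lipschitz for the metric \<open>|dz|/\<tau>\<close> is such a weight up to smoothing, in particular half of
  \<open>d_phi z\<close>, truncated in order to be bounded (\<open>Agmon_step\<close>, \<open>Lipschitz_regularization\<close>,
  \<open>d_phi_Lipschitz\<close>).  The outcome is that \<open>\<integral> |u|\<^sup>2\<close> near \<open>w\<close> is at most of order
  \<open>exp (- d_phi z w)\<close> times \<open>\<integral> |dbar u|\<^sup>2/\<Delta>\<phi>\<close> (\<open>Agmon_estimate\<close>), and the last integral is at most a
  constant times \<open>\<parallel>K\<^sub>w\<parallel>\<^sup>2 = K (w, w)\<close>.

  The submean inequality applied to \<open>K\<^sub>w\<close> at \<open>w\<close> bounds \<open>K (w, w) exp (-2 \<phi> w)\<close> by a constant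
  times \<open>1/(\<tau> w)\<^sup>2\<close> (\<open>diagonal_bound\<close>).  This closes the estimate, and it also settles the points
  \<open>z\<close>, \<open>w\<close> that are too close for the argument above, where \<open>d_phi z w \<le> 2\<close>.
\<close>

section \<open>Wirtinger derivatives\<close>

text \<open>
  The real derivative of \<open>f\<close> at \<open>z\<close>, recorded by its coefficients \<open>a = \<partial>f/\<partial>z\<close> and
  \<open>b = \<partial>f/\<partial>cnj z\<close>.  A relation instead of two operators keeps differentiability and the values of
  the derivatives together, so that the rules of calculus compose by resolution.
\<close>

definition wirtinger :: "(complex \<Rightarrow> complex) \<Rightarrow> complex \<Rightarrow> complex \<Rightarrow> complex \<Rightarrow> bool" where
  "wirtinger f a b z \<longleftrightarrow> (f has_derivative (\<lambda>h. a * h + b * cnj h)) (at z)"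

definition C1w ::
  "complex set \<Rightarrow> (complex \<Rightarrow> complex) \<Rightarrow> (complex \<Rightarrow> complex) \<Rightarrow> (complex \<Rightarrow> complex) \<Rightarrow> bool" where
  "C1w S f a b \<longleftrightarrow> (\<forall>z\<in>S. wirtinger f (a z) (b z) z) \<and> continuous_on S a \<and> continuous_on S b"

text \<open>
  \<open>c\<close> is the coefficient of both mixed derivatives, that is, a quarter of the Laplacian of \<open>f\<close>;
  equality of the mixed derivatives is part of the definition and has to be proved for a given \<open>f\<close>.
\<close>

definition C2w where
  "C2w S f a b aa c bb \<longleftrightarrow> C1w S f a b \<and> C1w S a aa c \<and> C1w S b c bb"

text \<open>
  Evaluation at \<open>1\<close> and \<open>\<i>\<close> determines a real linear map of the plane; these are its Wirtinger
  coefficients.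
\<close>

lemma wirtinger_real_linear:
  assumes "linear (L :: complex \<Rightarrow> complex)"
  shows "L h = (L 1 - \<i> * L \<i>) / 2 * h + (L 1 + \<i> * L \<i>) / 2 * cnj h"
proof -
  have "L h = L (Re h *\<^sub>R 1 + Im h *\<^sub>R \<i>)"
    by (rule arg_cong[where f = L]) (simp add: complex_eq_iff)
  also have "\<dots> = Re h *\<^sub>R L 1 + Im h *\<^sub>R L \<i>"
    by (simp add: linear_add[OF assms] linear_scale[OF assms])
  also have "\<dots> = (L 1 - \<i> * L \<i>) / 2 * h + (L 1 + \<i> * L \<i>) / 2 * cnj h"
    by (simp add: complex_eq_iff field_simps)
  finally show ?thesis .
qed

lemma wirtinger_coeffs:
  assumes "\<And>h. a * h + b * cnj h = a' * h + b' * cnj h"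
  shows "a = a'" "b = b'"
proof -
  from assms[of 1] assms[of \<i>] have 1: "a + b = a' + b'" and 2: "\<i> * (a - b) = \<i> * (a' - b')"
    by (simp_all add: algebra_simps)
  from 2 have 3: "a - b = a' - b'" by simp
  have "2 * a = 2 * a'" using arg_cong2[OF 1 3, of "(+)"] by simp
  then show "a = a'" by simp
  then show "b = b'" using 1 by simp
qed

lemma wirtinger_unique:
  assumes "wirtinger f a b z" "wirtinger f a' b' z"
  shows "a = a'" "b = b'"
proof -
  have "(\<lambda>h. a * h + b * cnj h) = (\<lambda>h. a' * h + b' * cnj h)"
    using assms has_derivative_unique unfolding wirtinger_def by blast
  then have "a * h + b * cnj h = a' * h + b' * cnj h" for h by meson
  then show "a = a'" "b = b'" using wirtinger_coeffs by blast+
qed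

lemma wirtinger_const: "wirtinger (\<lambda>_. c) 0 0 z"
  unfolding wirtinger_def by simp

lemma wirtinger_add:
  "wirtinger f a b z \<Longrightarrow> wirtinger g a' b' z \<Longrightarrow> wirtinger (\<lambda>z. f z + g z) (a + a') (b + b') z"
  unfolding wirtinger_def by (drule (1) has_derivative_add) (simp add: algebra_simps)

lemma wirtinger_mult:
  assumes "wirtinger f a b z" "wirtinger g a' b' z"
  shows "wirtinger (\<lambda>z. f z * g z) (a * g z + f z * a') (b * g z + f z * b') z"
  using has_derivative_mult[OF assms[unfolded wirtinger_def]]
  unfolding wirtinger_def by (simp add: algebra_simps)

lemma wirtinger_cnj:
  assumes "wirtinger f a b z"
  shows "wirtinger (\<lambda>z. cnj (f z)) (cnj b) (cnj a) z"
  using has_derivative_cnj[OF assms[unfolded wirtinger_def]]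
  unfolding wirtinger_def by (simp add: algebra_simps)

lemma wirtinger_chain:
  assumes "wirtinger f a b z" "(g has_field_derivative g') (at (f z))"
  shows "wirtinger (\<lambda>z. g (f z)) (g' * a) (g' * b) z"
  using has_derivative_compose[OF assms(1)[unfolded wirtinger_def], of g "(*) g'"] assms(2)
  unfolding wirtinger_def has_field_derivative_def by (simp add: algebra_simps)

lemma wirtinger_field_derivative:
  "wirtinger f a 0 z \<longleftrightarrow> (f has_field_derivative a) (at z)"
  unfolding wirtinger_def has_field_derivative_def by (simp add: fun_eq_iff[of "\<lambda>x. a * x"])

lemma wirtinger_affine:
  assumes "wirtinger f a b (z + c * w)"
  shows "wirtinger (\<lambda>w. f (z + c * w)) (c * a) (cnj c * b) w"
proof -
  have "((\<lambda>w. z + c * w) has_derivative (\<lambda>h. c * h)) (at w)"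
    by (auto intro!: derivative_eq_intros)
  from has_derivative_compose[OF this assms[unfolded wirtinger_def]] show ?thesis
    unfolding wirtinger_def by (simp add: algebra_simps)
qed

lemma wirtinger_transform:
  assumes "wirtinger f a b z" "open S" "z \<in> S" "\<And>x. x \<in> S \<Longrightarrow> f x = g x"
  shows "wirtinger g a b z"
  using assms unfolding wirtinger_def
  by (meson has_derivative_transform_within_open)

lemma C1wD: "C1w S f a b \<Longrightarrow> z \<in> S \<Longrightarrow> wirtinger f (a z) (b z) z"
  unfolding C1w_def by blast

lemma C1w_continuous: "C1w S f a b \<Longrightarrow> continuous_on S f"
  by (meson C1wD continuous_at_imp_continuous_on has_derivative_continuous wirtinger_def)

lemma C1w_continuous_d: "C1w S f a b \<Longrightarrow> continuous_on S a" "C1w S f a b \<Longrightarrow> continuous_on S b"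
  by (auto simp: C1w_def)

lemma C1w_subset: "C1w S f a b \<Longrightarrow> T \<subseteq> S \<Longrightarrow> C1w T f a b"
  unfolding C1w_def by (meson continuous_on_subset subsetD)

lemma C1w_const: "C1w S (\<lambda>_. c) (\<lambda>_. 0) (\<lambda>_. 0)"
  by (simp add: C1w_def wirtinger_const)

lemma C1w_id: "C1w S (\<lambda>z. z) (\<lambda>_. 1) (\<lambda>_. 0)"
  by (auto simp: C1w_def wirtinger_field_derivative)

lemma C1w_add:
  "C1w S f a b \<Longrightarrow> C1w S g a' b' \<Longrightarrow> C1w S (\<lambda>z. f z + g z) (\<lambda>z. a z + a' z) (\<lambda>z. b z + b' z)"
  by (auto simp: C1w_def intro!: wirtinger_add continuous_intros)

lemma C1w_mult:
  assumes "C1w S f a b" "C1w S g a' b'"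
  shows "C1w S (\<lambda>z. f z * g z) (\<lambda>z. a z * g z + f z * a' z) (\<lambda>z. b z * g z + f z * b' z)"
  using assms C1w_continuous[OF assms(1)] C1w_continuous[OF assms(2)]
  by (auto simp: C1w_def intro!: wirtinger_mult continuous_intros)

lemma C1w_cong:
  assumes "C1w S f a b" "f = f'" "\<And>z. z \<in> S \<Longrightarrow> a z = a' z" "\<And>z. z \<in> S \<Longrightarrow> b z = b' z"
  shows "C1w S f' a' b'"
  using assms unfolding C1w_def by (metis continuous_on_cong)

lemma C1w_transform:
  assumes "C1w S f a b" "open S" "\<And>z. z \<in> S \<Longrightarrow> f z = f' z"
  shows "C1w S f' a b"
  using assms unfolding C1w_def by (meson wirtinger_transform)

lemma C1w_cmult: "C1w S f a b \<Longrightarrow> C1w S (\<lambda>z. c * f z) (\<lambda>z. c * a z) (\<lambda>z. c * b z)"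
  by (rule C1w_cong[OF C1w_mult[OF C1w_const[of _ c]]]) auto

lemma C1w_cnj: "C1w S f a b \<Longrightarrow> C1w S (\<lambda>z. cnj (f z)) (\<lambda>z. cnj (b z)) (\<lambda>z. cnj (a z))"
  by (auto simp: C1w_def intro!: wirtinger_cnj continuous_intros)

lemma C1w_exp:
  assumes "C1w S f a b"
  shows "C1w S (\<lambda>z. exp (f z)) (\<lambda>z. exp (f z) * a z) (\<lambda>z. exp (f z) * b z)"
  using assms C1w_continuous[OF assms]
  by (auto simp: C1w_def intro!: wirtinger_chain[where g = exp] continuous_intros DERIV_exp)

lemma C1w_holomorphic:
  assumes "f holomorphic_on S" "open S"
  shows "C1w S f (deriv f) (\<lambda>_. 0)"
  using assms holomorphic_on_imp_continuous_on[OF holomorphic_deriv[OF assms]]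
  by (auto simp: C1w_def wirtinger_field_derivative holomorphic_derivI)

lemma C1w_imp_holomorphic:
  assumes "C1w S f a b" "open S" "\<And>z. z \<in> S \<Longrightarrow> b z = 0"
  shows "f holomorphic_on S"
  using assms unfolding C1w_def
  by (metis holomorphic_on_open wirtinger_field_derivative)

lemma C1w_affine:
  assumes "C1w S f a b"
  shows "C1w {w. z + c * w \<in> S} (\<lambda>w. f (z + c * w)) (\<lambda>w. c * a (z + c * w)) (\<lambda>w. cnj c * b (z + c * w))"
  unfolding C1w_def
proof (intro conjI ballI)
  fix w assume "w \<in> {w. z + c * w \<in> S}"
  then show "wirtinger (\<lambda>w. f (z + c * w)) (c * a (z + c * w)) (cnj c * b (z + c * w)) w"
    using assms by (auto intro!: wirtinger_affine simp: C1w_def)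
next
  have ab: "continuous_on S a" "continuous_on S b" using assms by (auto simp: C1w_def)
  have aff: "continuous_on {w. z + c * w \<in> S} (\<lambda>w. z + c * w)" by (intro continuous_intros)
  show "continuous_on {w. z + c * w \<in> S} (\<lambda>w. c * a (z + c * w))"
    by (rule continuous_on_mult_left, rule continuous_on_compose2[OF ab(1) aff]) auto
  show "continuous_on {w. z + c * w \<in> S} (\<lambda>w. cnj c * b (z + c * w))"
    by (rule continuous_on_mult_left, rule continuous_on_compose2[OF ab(2) aff]) auto
qed

lemma C1w_translate: "C1w UNIV f a b \<Longrightarrow> C1w UNIV (\<lambda>w. f (w - z)) (\<lambda>w. a (w - z)) (\<lambda>w. b (w - z))"
  using C1w_affine[of UNIV f a b "- z" 1] by simp

lemma C1w_vanish:
  assumes "C1w UNIV f a b" "closed K" "\<And>z. z \<notin> K \<Longrightarrow> f z = 0" "z \<notin> K"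
  shows "a z = 0" "b z = 0"
proof -
  have "wirtinger f 0 0 z"
    by (rule wirtinger_transform[OF wirtinger_const[of 0], where S = "- K"])
       (use assms in \<open>auto simp: open_Compl\<close>)
  moreover have "wirtinger f (a z) (b z) z" using assms(1) by (simp add: C1w_def)
  ultimately show "a z = 0" "b z = 0" using wirtinger_unique by blast+
qed

lemma continuous_on_cutoff:
  fixes f F :: "complex \<Rightarrow> complex"
  assumes "continuous_on UNIV f" "closed K" "\<And>z. z \<notin> K \<Longrightarrow> f z = 0" "K \<subseteq> S" "open S" "continuous_on S F"
  shows "continuous_on UNIV (\<lambda>z. f z * F z)"
proof -
  have "continuous_on (S \<union> - K) (\<lambda>z. f z * F z)"
  proof (rule continuous_on_open_Un)
    show "continuous_on S (\<lambda>z. f z * F z)"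
      using assms by (auto intro!: continuous_intros intro: continuous_on_subset)
    show "continuous_on (- K) (\<lambda>z. f z * F z)"
      by (rule continuous_on_eq[of _ "\<lambda>_. 0"]) (use assms in auto)
  qed (use assms in auto)
  moreover have "S \<union> - K = UNIV" using assms by auto
  ultimately show ?thesis by simp
qed

text \<open>
  A function that is smooth only on \<open>S\<close> becomes smooth on the whole plane after multiplication by
  one supported in a closed subset of \<open>S\<close>.  This is why all integrations by parts below can be
  carried out on the whole plane.
\<close>

lemma C1w_cutoff:
  assumes f: "C1w UNIV f a b" and K: "closed K" "\<And>z. z \<notin> K \<Longrightarrow> f z = 0" "K \<subseteq> S" "open S"
    and F: "C1w S F a' b'"
  shows "C1w UNIV (\<lambda>z. f z * F z) (\<lambda>z. a z * F z + f z * a' z) (\<lambda>z. b z * F z + f z * b' z)"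
  unfolding C1w_def
proof (intro conjI ballI)
  fix z
  show "wirtinger (\<lambda>z. f z * F z) (a z * F z + f z * a' z) (b z * F z + f z * b' z) z"
  proof (cases "z \<in> S")
    case True
    then show ?thesis using f F by (auto intro!: wirtinger_mult simp: C1w_def)
  next
    case False
    then have "z \<notin> K" using K by auto
    moreover from this have "a z = 0" "b z = 0" "f z = 0" using C1w_vanish[OF f K(1,2)] K by auto
    ultimately show ?thesis
      by (auto intro!: wirtinger_transform[OF wirtinger_const[of 0], where S = "- K"] simp: K open_Compl)
  qed
next
  note v = C1w_vanish[OF f K(1,2)]
  note c = continuous_on_cutoff[OF _ K(1) _ K(3,4)]
  show "continuous_on UNIV (\<lambda>z. a z * F z + f z * a' z)"
    "continuous_on UNIV (\<lambda>z. b z * F z + f z * b' z)"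
    using f F v K C1w_continuous[OF f] C1w_continuous[OF F]
    by (auto intro!: continuous_on_add c simp: C1w_def)
qed

lemma C2w_subset: "C2w S f a b aa c bb \<Longrightarrow> T \<subseteq> S \<Longrightarrow> C2w T f a b aa c bb"
  unfolding C2w_def using C1w_subset by blast

lemma C2w_add:
  "C2w S f a b aa c bb \<Longrightarrow> C2w S g a' b' aa' c' bb' \<Longrightarrow>
    C2w S (\<lambda>z. f z + g z) (\<lambda>z. a z + a' z) (\<lambda>z. b z + b' z) (\<lambda>z. aa z + aa' z) (\<lambda>z. c z + c' z) (\<lambda>z. bb z + bb' z)"
  unfolding C2w_def by (intro conjI C1w_add) auto

lemma C2w_cmult:
  "C2w S f a b aa c bb \<Longrightarrow> C2w S (\<lambda>z. k * f z) (\<lambda>z. k * a z) (\<lambda>z. k * b z) (\<lambda>z. k * aa z) (\<lambda>z. k * c z) (\<lambda>z. k * bb z)"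
  unfolding C2w_def by (intro conjI C1w_cmult) auto

lemma C2w_mult:
  assumes f: "C2w S f a b aa c bb" and F: "C2w S F a' b' aa' c' bb'"
  shows "C2w S (\<lambda>z. f z * F z) (\<lambda>z. a z * F z + f z * a' z) (\<lambda>z. b z * F z + f z * b' z)
     (\<lambda>z. aa z * F z + a z * a' z + (a z * a' z + f z * aa' z))
     (\<lambda>z. c z * F z + a z * b' z + (b z * a' z + f z * c' z))
     (\<lambda>z. bb z * F z + b z * b' z + (b z * b' z + f z * bb' z))"
proof -
  have 1: "C1w S f a b" "C1w S a aa c" "C1w S b c bb" using f by (auto simp: C2w_def)
  have 2: "C1w S F a' b'" "C1w S a' aa' c'" "C1w S b' c' bb'" using F by (auto simp: C2w_def)
  have 3: "C1w S (\<lambda>z. b z * F z + f z * b' z)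
     (\<lambda>z. c z * F z + b z * a' z + (a z * b' z + f z * c' z))
     (\<lambda>z. bb z * F z + b z * b' z + (b z * b' z + f z * bb' z))"
    by (rule C1w_add[OF C1w_mult[OF 1(3) 2(1)] C1w_mult[OF 1(1) 2(3)]])
  have 4: "C1w S (\<lambda>z. b z * F z + f z * b' z)
     (\<lambda>z. c z * F z + a z * b' z + (b z * a' z + f z * c' z))
     (\<lambda>z. bb z * F z + b z * b' z + (b z * b' z + f z * bb' z))"
    by (rule C1w_cong[OF 3]) (simp_all add: algebra_simps)
  show ?thesis
    unfolding C2w_def
    by (intro conjI 4 C1w_mult[OF 1(1) 2(1)] C1w_add[OF C1w_mult[OF 1(2) 2(1)] C1w_mult[OF 1(1) 2(2)]])
qed

lemma C2w_exp:
  assumes "C2w S f a b aa c bb"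
  shows "C2w S (\<lambda>z. exp (f z)) (\<lambda>z. exp (f z) * a z) (\<lambda>z. exp (f z) * b z)
    (\<lambda>z. exp (f z) * (a z * a z + aa z)) (\<lambda>z. exp (f z) * (a z * b z + c z)) (\<lambda>z. exp (f z) * (b z * b z + bb z))"
proof -
  have 1: "C1w S f a b" "C1w S a aa c" "C1w S b c bb" using assms by (auto simp: C2w_def)
  show ?thesis
    unfolding C2w_def
    by (intro conjI C1w_exp[OF 1(1)] C1w_cong[OF C1w_mult[OF C1w_exp[OF 1(1)] 1(2)]] C1w_cong[OF C1w_mult[OF C1w_exp[OF 1(1)] 1(3)]])
       (simp_all add: algebra_simps)
qed

lemma C2w_translate:
  "C2w UNIV f a b aa c bb \<Longrightarrow>
    C2w UNIV (\<lambda>w. f (w - z)) (\<lambda>w. a (w - z)) (\<lambda>w. b (w - z)) (\<lambda>w. aa (w - z)) (\<lambda>w. c (w - z)) (\<lambda>w. bb (w - z))"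
  unfolding C2w_def by (auto intro: C1w_translate)

lemma C2w_cutoff:
  assumes f: "C2w UNIV f a b aa c bb" and K: "closed K" "\<And>z. z \<notin> K \<Longrightarrow> f z = 0" "K \<subseteq> S" "open S"
    and F: "C2w S F a' b' aa' c' bb'"
  shows "C2w UNIV (\<lambda>z. f z * F z) (\<lambda>z. a z * F z + f z * a' z) (\<lambda>z. b z * F z + f z * b' z)
     (\<lambda>z. aa z * F z + a z * a' z + (a z * a' z + f z * aa' z))
     (\<lambda>z. c z * F z + a z * b' z + (b z * a' z + f z * c' z))
     (\<lambda>z. bb z * F z + b z * b' z + (b z * b' z + f z * bb' z))"
proof -
  have 1: "C1w UNIV f a b" "C1w UNIV a aa c" "C1w UNIV b c bb" using f by (auto simp: C2w_def)
  have 2: "C1w S F a' b'" "C1w S a' aa' c'" "C1w S b' c' bb'" using F by (auto simp: C2w_def)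
  note v = C1w_vanish[OF 1(1) K(1,2)]
  have 3: "C1w UNIV (\<lambda>z. f z * F z) (\<lambda>z. a z * F z + f z * a' z) (\<lambda>z. b z * F z + f z * b' z)"
    by (rule C1w_cutoff[OF 1(1) K 2(1)])
  have 4: "C1w UNIV (\<lambda>z. a z * F z + f z * a' z)
     (\<lambda>z. aa z * F z + a z * a' z + (a z * a' z + f z * aa' z))
     (\<lambda>z. c z * F z + a z * b' z + (b z * a' z + f z * c' z))"
    by (rule C1w_add[OF C1w_cutoff[OF 1(2) K(1) v(1) K(3,4) 2(1)] C1w_cutoff[OF 1(1) K 2(2)]])
  have 5: "C1w UNIV (\<lambda>z. b z * F z + f z * b' z)
     (\<lambda>z. c z * F z + b z * a' z + (a z * b' z + f z * c' z))
     (\<lambda>z. bb z * F z + b z * b' z + (b z * b' z + f z * bb' z))"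
    by (rule C1w_add[OF C1w_cutoff[OF 1(3) K(1) v(2) K(3,4) 2(1)] C1w_cutoff[OF 1(1) K 2(3)]])
  have 6: "C1w UNIV (\<lambda>z. b z * F z + f z * b' z)
     (\<lambda>z. c z * F z + a z * b' z + (b z * a' z + f z * c' z))
     (\<lambda>z. bb z * F z + b z * b' z + (b z * b' z + f z * bb' z))"
    by (rule C1w_cong[OF 5]) (simp_all add: algebra_simps)
  show ?thesis unfolding C2w_def using 3 4 6 by blast
qed

section \<open>Differentiation under the integral sign\<close>

lemma integrable_compact_support:
  fixes f :: "complex \<Rightarrow> 'b::{banach, second_countable_topology}"
  assumes "continuous_on UNIV f" "compact K" "\<And>z. z \<notin> K \<Longrightarrow> f z = 0"
  shows "integrable lborel f"
proof -
  have "integrable lborel (\<lambda>x. indicator K x *\<^sub>R f x)"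
    using assms by (intro borel_integrable_compact) (auto intro: continuous_on_subset)
  moreover have "(\<lambda>x. indicator K x *\<^sub>R f x) = f" using assms(3) by (auto simp: indicator_def)
  ultimately show ?thesis by simp
qed

text \<open>
  Dominated convergence, applied to the difference quotients at \<open>x0\<close>, for which \<open>B\<close> is a majorant.
\<close>

lemma has_derivative_integral:
  fixes f :: "'p::real_normed_vector \<Rightarrow> 'y \<Rightarrow> complex"
  assumes \<rho>: "\<rho> > 0"
    and int: "\<And>x. x \<in> ball x0 \<rho> \<Longrightarrow> integrable M (f x)"
    and der: "\<And>y. y \<in> space M \<Longrightarrow> ((\<lambda>x. f x y) has_derivative f' y) (at x0)"
    and lip: "\<And>x y. x \<in> ball x0 \<rho> \<Longrightarrow> y \<in> space M \<Longrightarrow> norm (f x y - f x0 y) \<le> B y * norm (x - x0)"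
    and B: "integrable M B"
  shows "((\<lambda>x. \<integral>y. f x y \<partial>M) has_derivative (\<lambda>h. \<integral>y. f' y h \<partial>M)) (at x0)"
    and "\<And>h. integrable M (\<lambda>y. f' y h)"
proof -
  have x0: "x0 \<in> ball x0 \<rho>" using \<rho> by simp
  have lin: "bounded_linear (f' y)" if "y \<in> space M" for y
    using der[OF that] has_derivative_bounded_linear by blast
  have lim: "(\<lambda>n. of_nat (Suc n) * (f (x0 + (1 / real (Suc n)) *\<^sub>R h) y - f x0 y)) \<longlonglongrightarrow> f' y h"
    if y: "y \<in> space M" for y h
  proof -
    have "((\<lambda>t. f (x0 + t *\<^sub>R h) y) has_derivative (\<lambda>t. f' y (t *\<^sub>R h))) (at 0)"
    proof (rule has_derivative_compose[of "\<lambda>t. x0 + t *\<^sub>R h" "\<lambda>t. t *\<^sub>R h" 0 UNIV "\<lambda>x. f x y" "f' y"])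
      show "((\<lambda>t. x0 + t *\<^sub>R h) has_derivative (\<lambda>t. t *\<^sub>R h)) (at 0)"
        by (auto intro!: derivative_eq_intros)
    qed (use der[OF y] in simp)
    then have *: "((\<lambda>t. norm (f (x0 + t *\<^sub>R h) y - f x0 y - t *\<^sub>R f' y h) / norm t) \<longlongrightarrow> 0) (at 0)"
      by (simp add: linear_scale[OF bounded_linear.linear[OF lin[OF y]]] has_derivative_iff_norm)
    have "((\<lambda>t. (f (x0 + t *\<^sub>R h) y - f x0 y) /\<^sub>R t - f' y h) \<longlongrightarrow> 0) (at 0)"
    proof (rule tendsto_norm_zero_cancel, rule Lim_transform_eventually[OF *])
      have "norm (f (x0 + t *\<^sub>R h) y - f x0 y - t *\<^sub>R f' y h) / norm t =
          norm ((f (x0 + t *\<^sub>R h) y - f x0 y) /\<^sub>R t - f' y h)" if "t \<noteq> 0" for t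
      proof -
        have "(f (x0 + t *\<^sub>R h) y - f x0 y) /\<^sub>R t - f' y h =
            (f (x0 + t *\<^sub>R h) y - f x0 y - t *\<^sub>R f' y h) /\<^sub>R t"
          using that by (simp add: scaleR_diff_right)
        then show ?thesis by (simp add: divide_inverse mult.commute)
      qed
      then show "\<forall>\<^sub>F t in at 0. norm (f (x0 + t *\<^sub>R h) y - f x0 y - t *\<^sub>R f' y h) / norm t =
          norm ((f (x0 + t *\<^sub>R h) y - f x0 y) /\<^sub>R t - f' y h)"
        by (auto simp: eventually_at_filter)
    qed
    then have "((\<lambda>t. (f (x0 + t *\<^sub>R h) y - f x0 y) /\<^sub>R t) \<longlongrightarrow> f' y h) (at 0)"
      by (simp add: LIM_zero_iff)
    moreover have "filterlim (\<lambda>n. 1 / real (Suc n)) (at 0) sequentially"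
      unfolding filterlim_at using LIMSEQ_inverse_real_of_nat by (auto simp: inverse_eq_divide)
    ultimately have "(\<lambda>n. (f (x0 + (1 / real (Suc n)) *\<^sub>R h) y - f x0 y) /\<^sub>R (1 / real (Suc n))) \<longlonglongrightarrow> f' y h"
      by (rule filterlim_compose)
    then show ?thesis by (simp add: scaleR_conv_of_real)
  qed
  have ev: "eventually (\<lambda>n. x0 + (1 / real (Suc n)) *\<^sub>R h \<in> ball x0 \<rho>) sequentially" for h
  proof -
    have "(\<lambda>n. x0 + (1 / real (Suc n)) *\<^sub>R h) \<longlonglongrightarrow> x0 + 0 *\<^sub>R h"
      using LIMSEQ_inverse_real_of_nat by (intro tendsto_intros) (auto simp: inverse_eq_divide)
    then show ?thesis using \<rho> by (intro topological_tendstoD) auto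
  qed
  have meas: "(\<lambda>y. f' y h) \<in> borel_measurable M" for h
  proof -
    obtain N where N: "\<And>n. n \<ge> N \<Longrightarrow> x0 + (1 / real (Suc n)) *\<^sub>R h \<in> ball x0 \<rho>"
      using ev[of h] by (auto simp: eventually_sequentially)
    show ?thesis
    proof (rule borel_measurable_LIMSEQ_metric)
      fix n
      show "(\<lambda>y. of_nat (Suc (n + N)) * (f (x0 + (1 / real (Suc (n + N))) *\<^sub>R h) y - f x0 y)) \<in> borel_measurable M"
        using int[OF N[of "n + N"]] int[OF x0] by (intro borel_measurable_times borel_measurable_diff) auto
    next
      fix y assume "y \<in> space M"
      from LIMSEQ_ignore_initial_segment[OF lim[OF this], of N]
      show "(\<lambda>n. of_nat (Suc (n + N)) * (f (x0 + (1 / real (Suc (n + N))) *\<^sub>R h) y - f x0 y)) \<longlonglongrightarrow> f' y h"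
        by simp
    qed
  qed
  have bd: "norm (f' y h) \<le> B y * norm h" if y: "y \<in> space M" for y h
  proof (rule Lim_norm_ubound[OF _ lim[OF y]])
    show "eventually (\<lambda>n. norm (of_nat (Suc n) * (f (x0 + (1 / real (Suc n)) *\<^sub>R h) y - f x0 y)) \<le> B y * norm h) sequentially"
      using ev[of h]
    proof eventually_elim
      case (elim n)
      from lip[OF this y] have "norm (f (x0 + (1 / real (Suc n)) *\<^sub>R h) y - f x0 y) \<le> B y * norm h / real (Suc n)"
        by (simp add: divide_simps)
      then show ?case by (simp add: norm_mult divide_simps mult.commute del: of_nat_Suc)
    qed
  qed simp
  show int': "integrable M (\<lambda>y. f' y h)" for h
  proof (rule Bochner_Integration.integrable_bound[OF _ meas])
    show "integrable M (\<lambda>y. B y * norm h)" using B by simp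
    have "norm (f' y h) \<le> norm (B y * norm h)" if "y \<in> space M" for y
      using bd[OF that, of h] by simp
    then show "AE y in M. norm (f' y h) \<le> norm (B y * norm h)" by (intro AE_I2)
  qed
  have "linear (\<lambda>h. \<integral>y. f' y h \<partial>M)"
  proof (rule linearI)
    fix h k :: 'p and r :: real
    have "(\<integral>y. f' y (h + k) \<partial>M) = (\<integral>y. f' y h + f' y k \<partial>M)"
      by (rule Bochner_Integration.integral_cong) (auto simp: linear_add[OF bounded_linear.linear[OF lin]])
    then show "(\<integral>y. f' y (h + k) \<partial>M) = (\<integral>y. f' y h \<partial>M) + (\<integral>y. f' y k \<partial>M)"
      using int' by simp
    have "(\<integral>y. f' y (r *\<^sub>R h) \<partial>M) = (\<integral>y. r *\<^sub>R f' y h \<partial>M)"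
      by (rule Bochner_Integration.integral_cong) (auto simp: linear_scale[OF bounded_linear.linear[OF lin]])
    then show "(\<integral>y. f' y (r *\<^sub>R h) \<partial>M) = r *\<^sub>R (\<integral>y. f' y h \<partial>M)"
      by simp
  qed
  moreover have "norm (\<integral>y. f' y h \<partial>M) \<le> norm h * (\<integral>y. B y \<partial>M)" for h
  proof -
    have "norm (\<integral>y. f' y h \<partial>M) \<le> (\<integral>y. B y * norm h \<partial>M)"
      using B int' bd by (intro order_trans[OF integral_norm_bound] integral_mono_AE AE_I2) auto
    then show ?thesis by (simp add: mult.commute)
  qed
  ultimately have blin: "bounded_linear (\<lambda>h. \<integral>y. f' y h \<partial>M)"
    by (intro bounded_linear_intro[where K = "\<integral>y. B y \<partial>M"] linear_add linear_scale)
  show "((\<lambda>x. \<integral>y. f x y \<partial>M) has_derivative (\<lambda>h. \<integral>y. f' y h \<partial>M)) (at x0)"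
    unfolding has_derivative_iff_norm tendsto_at_iff_sequentially
  proof (intro conjI blin allI impI)
    fix X assume X: "\<forall>i. X i \<in> UNIV - {x0}" "X \<longlonglongrightarrow> x0"
    have "eventually (\<lambda>n. X n \<in> ball x0 \<rho>) sequentially"
      using X \<rho> by (intro topological_tendstoD) auto
    then obtain N where N: "\<And>n. n \<ge> N \<Longrightarrow> X n \<in> ball x0 \<rho>" by (auto simp: eventually_sequentially)
    define Y where "Y n = X (n + N)" for n
    have Y: "Y n \<in> ball x0 \<rho>" "Y n \<noteq> x0" for n using N X by (auto simp: Y_def)
    have Ylim: "Y \<longlonglongrightarrow> x0" unfolding Y_def by (rule LIMSEQ_ignore_initial_segment[OF X(2)])
    define G where "G n y = norm (f (Y n) y - f x0 y - f' y (Y n - x0)) / norm (Y n - x0)" for n y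
    have G_lim: "(\<lambda>n. \<integral>y. G n y \<partial>M) \<longlonglongrightarrow> (\<integral>y. 0 \<partial>M)"
    proof (rule integral_dominated_convergence[where w = "\<lambda>y. 2 * B y"])
      show "G n \<in> borel_measurable M" for n
        unfolding G_def using int[OF Y(1)] int[OF x0] meas
        by (intro borel_measurable_divide borel_measurable_norm borel_measurable_diff) auto
      show "integrable M (\<lambda>y. 2 * B y)" using B by simp
      show "AE y in M. (\<lambda>n. G n y) \<longlonglongrightarrow> 0"
      proof (rule AE_I2)
        fix y assume "y \<in> space M"
        with der have "((\<lambda>x. norm (f x y - f x0 y - f' y (x - x0)) / norm (x - x0)) \<longlongrightarrow> 0) (at x0)"
          by (simp add: has_derivative_iff_norm)
        moreover have "filterlim Y (at x0) sequentially"
          using Ylim Y by (auto simp: filterlim_at)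
        ultimately show "(\<lambda>n. G n y) \<longlonglongrightarrow> 0"
          unfolding G_def by (rule filterlim_compose)
      qed
      fix n
      show "AE y in M. norm (G n y) \<le> 2 * B y"
      proof (rule AE_I2)
        fix y assume y: "y \<in> space M"
        have "norm (f (Y n) y - f x0 y - f' y (Y n - x0)) \<le> 2 * B y * norm (Y n - x0)"
          using lip[OF Y(1) y, of n] bd[OF y, of "Y n - x0"]
            norm_triangle_ineq4[of "f (Y n) y - f x0 y" "f' y (Y n - x0)"] by simp
        then show "norm (G n y) \<le> 2 * B y" using Y(2)[of n] by (simp add: G_def divide_simps)
      qed
    qed simp
    have G_le: "norm (norm ((\<integral>y. f (Y n) y \<partial>M) - (\<integral>y. f x0 y \<partial>M) - (\<integral>y. f' y (Y n - x0) \<partial>M)) / norm (Y n - x0))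
        \<le> (\<integral>y. G n y \<partial>M)" for n
    proof -
      have "(\<integral>y. f (Y n) y \<partial>M) - (\<integral>y. f x0 y \<partial>M) - (\<integral>y. f' y (Y n - x0) \<partial>M)
        = (\<integral>y. f (Y n) y - f x0 y - f' y (Y n - x0) \<partial>M)"
        using int[OF Y(1)] int[OF x0] int' by simp
      then show ?thesis unfolding G_def by (simp add: divide_right_mono integral_norm_bound)
    qed
    have "(\<lambda>n. norm ((\<integral>y. f (Y n) y \<partial>M) - (\<integral>y. f x0 y \<partial>M) - (\<integral>y. f' y (Y n - x0) \<partial>M)) / norm (Y n - x0)) \<longlonglongrightarrow> 0"
      by (rule Lim_null_comparison[OF always_eventually G_lim[unfolded Bochner_Integration.integral_zero]])
         (use G_le in blast)
    then show "((\<lambda>y. norm ((\<integral>ya. f y ya \<partial>M) - (\<integral>y. f x0 y \<partial>M) - (\<integral>ya. f' ya (y - x0) \<partial>M)) / norm (y - x0)) \<circ> X) \<longlonglongrightarrow> 0"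
      unfolding Y_def comp_def by (rule LIMSEQ_offset)
  qed
qed

lemma wirtinger_norm_bound: "cmod (a * h + b * cnj h) \<le> (cmod a + cmod b) * cmod h"
  by (metis complex_mod_cnj distrib_right norm_mult norm_triangle_ineq)

lemma C1w_Lipschitz:
  assumes "C1w S f a b" "convex T" "T \<subseteq> S" "\<And>z. z \<in> T \<Longrightarrow> cmod (a z) + cmod (b z) \<le> L"
    and "x \<in> T" "y \<in> T"
  shows "cmod (f x - f y) \<le> L * cmod (x - y)"
proof (rule differentiable_bound[OF assms(2), of f "\<lambda>z h. a z * h + b z * cnj h"])
  show "(f has_derivative (\<lambda>h. a z * h + b z * cnj h)) (at z within T)" if "z \<in> T" for z
    using assms(1,3) that unfolding C1w_def wirtinger_def by (meson has_derivative_at_withinI subsetD)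
  show "onorm (\<lambda>h. a z * h + b z * cnj h) \<le> L" if "z \<in> T" for z
  proof (rule onorm_bound)
    show "0 \<le> L" using assms(4)[OF that] norm_ge_zero by (smt (verit))
    show "cmod (a z * h + b z * cnj h) \<le> L * cmod h" for h
      by (meson assms(4) mult_right_mono norm_ge_zero order_trans that wirtinger_norm_bound)
  qed
qed (use assms in auto)

lemma C1w_compact_bounds:
  assumes "C1w UNIV f a b" "compact K" "\<And>z. z \<notin> K \<Longrightarrow> f z = 0"
  obtains L where "L \<ge> 0" "\<And>z. cmod (f z) \<le> L" "\<And>z. cmod (a z) + cmod (b z) \<le> L"
    "\<And>x y. cmod (f x - f y) \<le> L * cmod (x - y)"
proof -
  note c = C1w_continuous[OF assms(1)] C1w_continuous_d[OF assms(1)]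
  have "compact ((\<lambda>z. cmod (f z) + (cmod (a z) + cmod (b z))) ` K)"
    using assms(2) c
    by (intro compact_continuous_image continuous_on_add continuous_on_norm)
       (auto intro: continuous_on_subset)
  from bounded_imp_bdd_above[OF compact_imp_bounded[OF this]]
  obtain L0 where L0: "\<And>t. t \<in> (\<lambda>z. cmod (f z) + (cmod (a z) + cmod (b z))) ` K \<Longrightarrow> t \<le> L0"
    unfolding bdd_above_def by blast
  define L where "L = max 0 L0"
  have S: "cmod (f z) + (cmod (a z) + cmod (b z)) \<le> L" for z
    using L0[OF imageI, of z] C1w_vanish[OF assms(1) compact_imp_closed[OF assms(2)] assms(3), of z] assms(3)[of z]
    by (cases "z \<in> K") (auto simp: L_def)
  have *: "cmod (f z) \<le> L" for z
    using S[of z] norm_ge_zero[of "a z"] norm_ge_zero[of "b z"] by linarith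
  have **: "cmod (a z) + cmod (b z) \<le> L" for z
    using S[of z] norm_ge_zero[of "f z"] by linarith
  have "L \<ge> 0" by (simp add: L_def)
  moreover have "cmod (f x - f y) \<le> L * cmod (x - y)" for x y
    by (rule C1w_Lipschitz[OF assms(1) convex_UNIV]) (use ** in auto)
  ultimately show ?thesis using that * ** by blast
qed

lemma lborel_integral_translation:
  fixes f :: "complex \<Rightarrow> complex"
  assumes [measurable]: "f \<in> borel_measurable borel"
  shows "(\<integral>w. f (w + x) \<partial>lborel) = (\<integral>w. f w \<partial>lborel)"
proof -
  have "(\<integral>w. f w \<partial>lborel) = (\<integral>w. f w \<partial>(distr lborel borel (\<lambda>w. x + w)))"
    by (simp add: lborel_distr_plus)
  also have "\<dots> = (\<integral>w. f (x + w) \<partial>lborel)" by (subst integral_distr) auto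
  finally show ?thesis by (simp add: add.commute)
qed

lemma lborel_integrable_translation:
  fixes f :: "complex \<Rightarrow> complex"
  assumes "integrable lborel f"
  shows "integrable lborel (\<lambda>w. f (w + x))"
proof -
  have "integrable (distr lborel borel ((+) x)) f" using assms by (simp add: lborel_distr_plus)
  then have "integrable lborel (\<lambda>w. f (x + w))" by (rule integrable_distr[rotated]) simp
  then show ?thesis by (simp add: add.commute)
qed

text \<open>
  The integral of \<open>f (w + x)\<close> over \<open>w\<close> does not depend on \<open>x\<close>, hence its derivative at \<open>x = 0\<close>
  vanishes; differentiation under the integral sign gives the claim.  This is the form in which
  integration by parts is used throughout.
\<close>

lemma integral_wirtinger_zero:
  assumes f: "C1w UNIV f a b" and K: "compact K" "\<And>z. z \<notin> K \<Longrightarrow> f z = 0"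
  shows "(\<integral>w. a w \<partial>lborel) = 0" "(\<integral>w. b w \<partial>lborel) = 0"
proof -
  obtain L where L: "L \<ge> 0" "\<And>x y. cmod (f x - f y) \<le> L * cmod (x - y)"
    using C1w_compact_bounds[OF f K] by metis
  obtain R where R: "K \<subseteq> ball 0 R" using K(1) compact_imp_bounded bounded_subset_ballD by blast
  define K' where "K' = cball (0::complex) (R + 1)"
  have fm: "f \<in> borel_measurable borel" using C1w_continuous[OF f] borel_measurable_continuous_onI by blast
  have D: "((\<lambda>x. \<integral>w. f (w + x) \<partial>lborel) has_derivative (\<lambda>h. \<integral>w. a w * h + b w * cnj h \<partial>lborel)) (at 0)"
  proof (rule has_derivative_integral(1)[where \<rho> = 1 and B = "\<lambda>w. L * indicator K' w"])
    show "integrable lborel (\<lambda>w. f (w + x))" for x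
    proof (rule integrable_compact_support[where K = "(\<lambda>w. w - x) ` K"])
      show "continuous_on UNIV (\<lambda>w. f (w + x))"
        by (intro continuous_on_compose2[OF C1w_continuous[OF f]] continuous_intros) auto
      show "compact ((\<lambda>w. w - x) ` K)" by (intro compact_continuous_image continuous_intros K)
      show "f (z + x) = 0" if "z \<notin> (\<lambda>w. w - x) ` K" for z
        using K(2)[of "z + x"] that by (force simp: image_iff)
    qed
    show "((\<lambda>x. f (w + x)) has_derivative (\<lambda>h. a w * h + b w * cnj h)) (at 0)" for w
      using wirtinger_affine[of f "a w" "b w" w 1 0] C1wD[OF f, of w] by (simp add: wirtinger_def)
    show "norm (f (w + x) - f (w + 0)) \<le> L * indicator K' w * norm (x - 0)" if "x \<in> ball 0 1" for w x
    proof (cases "w \<in> K'")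
      case True then show ?thesis using L(2)[of "w + x" w] by simp
    next
      case False
      then have "cmod w > R + 1" by (simp add: K'_def)
      moreover have "cmod (w + x) \<ge> cmod w - cmod x" by (rule norm_diff_ineq)
      ultimately have "w \<notin> K" "w + x \<notin> K" using R that by auto
      then show ?thesis using K(2) L(1) by simp
    qed
    have "integrable lborel (indicator K' :: complex \<Rightarrow> real)"
      unfolding K'_def by (rule integrable_real_indicator) (simp, rule emeasure_bounded_finite, simp)
    then show "integrable lborel (\<lambda>w. L * indicator K' w)"
      using integrable_mult_right by blast
  qed simp
  have "(\<lambda>x. \<integral>w. f (w + x) \<partial>lborel) = (\<lambda>x. \<integral>w. f w \<partial>lborel)"
    using lborel_integral_translation[OF fm] by auto
  then have "((\<lambda>x. \<integral>w. f (w + x) \<partial>lborel) has_derivative (\<lambda>h. 0)) (at 0)" by simp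
  from has_derivative_unique[OF D this]
  have z: "(\<integral>w. a w * h + b w * cnj h \<partial>lborel) = 0" for h by meson
  have "integrable lborel a" "integrable lborel b"
    using C1w_continuous_d[OF f] C1w_vanish[OF f compact_imp_closed[OF K(1)] K(2)] K
    by (auto intro!: integrable_compact_support[where K = K])
  then have "(\<integral>w. a w \<partial>lborel) * h + (\<integral>w. b w \<partial>lborel) * cnj h = 0 * h + 0 * cnj h" for h
    using z[of h] by simp
  from wirtinger_coeffs[OF this] show "(\<integral>w. a w \<partial>lborel) = 0" "(\<integral>w. b w \<partial>lborel) = 0" .
qed

section \<open>Bumps and mean values of subharmonic functions\<close>

text \<open>
  The powers of \<open>1 - |z|\<^sup>2\<close> are closed under differentiation up to the factors \<open>z\<close> and
  \<open>cnj z\<close>, which makes every constant explicit.  The values are complex because the bump is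
  multiplied with complex functions; they are nonnegative reals.
\<close>

definition bump :: "nat \<Rightarrow> complex \<Rightarrow> complex" where
  "bump m z = of_real (max 0 (1 - (cmod z)\<^sup>2) ^ m)"

lemma bump_eq_0: "m > 0 \<Longrightarrow> 1 \<le> cmod z \<Longrightarrow> bump m z = 0"
  by (simp add: bump_def max_def power_le_one_iff one_le_power zero_power)

lemma bump_norm_le: "cmod (bump m z) \<le> 1"
proof -
  have "max 0 (1 - (cmod z)\<^sup>2) ^ m \<le> 1 ^ m" by (intro power_mono) auto
  then show ?thesis by (simp add: bump_def del: of_real_power)
qed

lemma cnj_bump [simp]: "cnj (bump m z) = bump m z"
  by (simp add: bump_def)

lemma bump_minus [simp]: "bump m (- z) = bump m z"
  by (simp add: bump_def)

lemma continuous_on_bump [continuous_intros]: "continuous_on S f \<Longrightarrow> continuous_on S (\<lambda>x. bump m (f x))"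
  unfolding bump_def by (intro continuous_intros)

lemma DERIV_max_power:
  assumes "m > 0"
  shows "((\<lambda>x::real. max 0 x ^ Suc m) has_real_derivative (real (Suc m) * max 0 x ^ m)) (at x)"
proof -
  consider "x > 0" | "x < 0" | "x = 0" by linarith
  then show ?thesis
  proof cases
    case 1
    have "((\<lambda>x::real. x ^ Suc m) has_real_derivative (real (Suc m) * max 0 x ^ m)) (at x)"
      using 1 DERIV_pow[of "Suc m" x] by (simp add: max_def)
    then show ?thesis
      by (rule has_field_derivative_transform_within_open[where S = "{0<..}"]) (use 1 in auto)
  next
    case 2
    have "((\<lambda>x::real. 0) has_real_derivative (real (Suc m) * max 0 x ^ m)) (at x)"
      using 2 assms by (auto simp: max_def zero_power)
    then show ?thesis
      by (rule has_field_derivative_transform_within_open[where S = "{..<0}"]) (use 2 in auto)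
  next
    case 3
    have "((\<lambda>h. max 0 h ^ Suc m / h) \<longlongrightarrow> 0) (at (0::real))"
    proof (rule Lim_null_comparison)
      have "norm (max 0 h ^ Suc m / h) \<le> \<bar>h\<bar> ^ m" for h :: real
        by (cases "h > 0") (auto simp: max_def)
      then show "\<forall>\<^sub>F h in at (0::real). norm (max 0 h ^ Suc m / h) \<le> \<bar>h\<bar> ^ m" by simp
      have "((\<lambda>h::real. \<bar>h\<bar> ^ m) \<longlongrightarrow> \<bar>0\<bar> ^ m) (at 0)" by (intro tendsto_intros)
      then show "((\<lambda>h::real. \<bar>h\<bar> ^ m) \<longlongrightarrow> 0) (at 0)" using assms by (simp add: zero_power)
    qed
    then show ?thesis using 3 assms by (simp add: DERIV_def zero_power)
  qed
qed

lemma C1w_bump: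
  assumes "m > 0"
  shows "C1w UNIV (bump (Suc m)) (\<lambda>z. - of_nat (Suc m) * cnj z * bump m z) (\<lambda>z. - of_nat (Suc m) * z * bump m z)"
  unfolding C1w_def
proof (intro conjI ballI)
  fix z
  have "((\<lambda>z::complex. 1 - (cmod z)\<^sup>2) has_derivative (\<lambda>h. - (2 * inner z h))) (at z)"
    unfolding power2_norm_eq_inner by (auto intro!: derivative_eq_intros simp: inner_commute)
  from has_derivative_compose[OF this DERIV_max_power[OF assms, unfolded has_field_derivative_def]]
  have "((\<lambda>z. of_real (max 0 (1 - (cmod z)\<^sup>2) ^ Suc m)) has_derivative
      (\<lambda>h. complex_of_real (real (Suc m) * max 0 (1 - (cmod z)\<^sup>2) ^ m * - (2 * inner z h)))) (at z)"
    by (rule has_derivative_of_real)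
  moreover have "complex_of_real (real (Suc m) * max 0 (1 - (cmod z)\<^sup>2) ^ m * - (2 * inner z h))
      = (- of_nat (Suc m) * cnj z * bump m z) * h + (- of_nat (Suc m) * z * bump m z) * cnj h" for h
  proof -
    have *: "complex_of_real (2 * inner z h) = cnj z * h + z * cnj h"
      by (simp add: complex_eq_iff inner_complex_def algebra_simps)
    have "complex_of_real (real (Suc m) * max 0 (1 - (cmod z)\<^sup>2) ^ m * - (2 * inner z h))
      = - of_nat (Suc m) * bump m z * complex_of_real (2 * inner z h)"
      by (simp only: bump_def of_real_mult of_real_minus of_real_of_nat_eq mult_minus_left mult_minus_right)
    then show ?thesis unfolding * by (simp only: distrib_left mult_minus_left mult_minus_right minus_add_distrib mult_ac)
  qed
  ultimately show "wirtinger (bump (Suc m)) (- of_nat (Suc m) * cnj z * bump m z) (- of_nat (Suc m) * z * bump m z) z"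
    unfolding wirtinger_def bump_def[abs_def] by simp
qed (intro continuous_intros)+

text \<open>
  The exponent 3 is the smallest one for which the bump is twice continuously differentiable.
\<close>

lemma C2w_bump3:
  "C2w UNIV (bump 3) (\<lambda>z. - 3 * cnj z * bump 2 z) (\<lambda>z. - 3 * z * bump 2 z)
    (\<lambda>z. 6 * cnj z * cnj z * bump 1 z) (\<lambda>z. 6 * z * cnj z * bump 1 z - 3 * bump 2 z)
    (\<lambda>z. 6 * z * z * bump 1 z)"
  unfolding C2w_def
proof (intro conjI)
  have 2: "C1w UNIV (bump 2) (\<lambda>z. - 2 * cnj z * bump 1 z) (\<lambda>z. - 2 * z * bump 1 z)"
    using C1w_bump[of 1] by (simp add: numeral_eq_Suc)
  show "C1w UNIV (bump 3) (\<lambda>z. - 3 * cnj z * bump 2 z) (\<lambda>z. - 3 * z * bump 2 z)"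
    using C1w_bump[of 2] by (simp add: numeral_eq_Suc)
  show "C1w UNIV (\<lambda>z. - 3 * z * bump 2 z) (\<lambda>z. 6 * z * cnj z * bump 1 z - 3 * bump 2 z) (\<lambda>z. 6 * z * z * bump 1 z)"
    by (rule C1w_cong[OF C1w_mult[OF C1w_cmult[OF C1w_id, where c = "-3"] 2]]) (auto simp: algebra_simps)
  show "C1w UNIV (\<lambda>z. - 3 * cnj z * bump 2 z) (\<lambda>z. 6 * cnj z * cnj z * bump 1 z) (\<lambda>z. 6 * z * cnj z * bump 1 z - 3 * bump 2 z)"
    by (rule C1w_cong[OF C1w_mult[OF C1w_cmult[OF C1w_cnj[OF C1w_id], where c = "-3"] 2]]) (auto simp: algebra_simps)
qed

definition bump_mass :: real where
  "bump_mass = (\<integral>w. max 0 (1 - (cmod w)\<^sup>2) ^ 3 \<partial>lborel)"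

lemma integrable_bump: "m > 0 \<Longrightarrow> integrable lborel (bump m)"
  by (rule integrable_compact_support[of _ "cball 0 1"])
     (auto intro!: continuous_on_bump[where f = "\<lambda>x. x"] continuous_intros bump_eq_0)

lemma integrable_bump3_real: "integrable lborel (\<lambda>w::complex. max 0 (1 - (cmod w)\<^sup>2) ^ 3 :: real)"
proof -
  have "integrable lborel (\<lambda>w. Re (bump 3 w))" by (intro integrable_Re integrable_bump) simp
  then show ?thesis by (simp only: bump_def Re_complex_of_real)
qed

lemma integral_bump3: "(\<integral>w. bump 3 w \<partial>lborel) = of_real bump_mass"
  unfolding bump_mass_def bump_def by (rule integral_of_real[OF integrable_bump3_real])

lemma bump_mass_pos: "bump_mass > 0"
proof -
  have "0 < 27/64 * measure lborel (ball (0::complex) (1/2))"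
    using content_ball_pos[of "1/2" "0::complex"] by simp
  also have "\<dots> = (\<integral>w. 27/64 * indicator (ball (0::complex) (1/2)) w \<partial>lborel)"
    by simp
  also have "\<dots> \<le> bump_mass"
    unfolding bump_mass_def
  proof (rule integral_mono)
    have "integrable lborel (indicator (ball (0::complex) (1/2)) :: complex \<Rightarrow> real)"
      by (rule integrable_real_indicator) (simp, rule emeasure_bounded_finite, simp)
    then show "integrable lborel (\<lambda>w. 27/64 * indicator (ball (0::complex) (1/2)) w :: real)" by simp
    fix w :: complex
    show "27/64 * indicator (ball (0::complex) (1/2)) w \<le> (max 0 (1 - (cmod w)\<^sup>2) ^ 3 :: real)"
    proof (cases "w \<in> ball 0 (1/2)")
      case True
      then have "(cmod w)\<^sup>2 \<le> (1/2)\<^sup>2" by (intro power_mono) auto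
      then have "(3/4::real) ^ 3 \<le> max 0 (1 - (cmod w)\<^sup>2) ^ 3" by (intro power_mono) (auto simp: power2_eq_square)
      then show ?thesis using True by (simp add: power3_eq_cube)
    qed simp
  qed (rule integrable_bump3_real)
  finally show ?thesis .
qed

lemma lborel_integral_affine:
  fixes f :: "complex \<Rightarrow> 'a::{banach, second_countable_topology}"
  assumes "c \<noteq> 0" and [measurable]: "f \<in> borel_measurable borel"
  shows "(\<integral>w. f w \<partial>lborel) = c\<^sup>2 *\<^sub>R (\<integral>w. f (z + of_real c * w) \<partial>lborel)"
proof -
  have "(\<integral>w. f w \<partial>lborel) = (\<integral>w. f w \<partial>density (distr lborel borel (\<lambda>x. z + c *\<^sub>R x)) (\<lambda>_. ennreal (\<bar>c\<bar> ^ 2)))"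
    using lborel_affine[OF assms(1), of z] by (simp add: ennreal_power)
  also have "\<dots> = (\<integral>w. \<bar>c\<bar> ^ 2 *\<^sub>R f w \<partial>distr lborel borel (\<lambda>x. z + c *\<^sub>R x))"
    by (rule integral_density) auto
  also have "\<dots> = (\<integral>w. \<bar>c\<bar> ^ 2 *\<^sub>R f (z + c *\<^sub>R w) \<partial>lborel)"
    by (rule integral_distr) auto
  finally show ?thesis by (simp add: scaleR_conv_of_real[of _ "_ :: complex"])
qed

text \<open>
  Differentiation under the integral brings down \<open>w\<close> times the \<open>z\<close>-derivative of \<open>s\<close> plus
  \<open>cnj w\<close> times the other one.  Since \<open>- w * bump 3 w\<close> and \<open>- cnj w * bump 3 w\<close> are the two
  derivatives of \<open>bump 4 w / 4\<close>, an integration by parts moves one more derivative to \<open>s\<close> and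
  leaves an average of \<open>c + c'\<close>, which is half of the Laplacian of \<open>s\<close>.
\<close>

lemma radial_mean_derivative:
  assumes s: "C1w (ball z R) s a b" "C1w (ball z R) a aa c" "C1w (ball z R) b c' bb" and r: "\<bar>r\<bar> < R"
  shows "((\<lambda>r. \<integral>w. bump 3 w * s (z + of_real r * w) \<partial>lborel) has_vector_derivative
      of_real r * (\<integral>w. bump 4 w / 4 * (c (z + of_real r * w) + c' (z + of_real r * w)) \<partial>lborel)) (at r)"
    and "integrable lborel (\<lambda>w. bump 3 w * s (z + of_real r * w))"
    and "integrable lborel (\<lambda>w. bump 4 w / 4 * (c (z + of_real r * w) + c' (z + of_real r * w)))"
proof -
  define U where "U r = {w. z + of_real r * w \<in> ball z R}" for r
  have openU: "open (U r)" for r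
  proof -
    have "U r = (\<lambda>w. z + of_real r * w) -` ball z R" by (auto simp: U_def)
    then show ?thesis by (simp, intro open_vimage) (auto intro!: continuous_intros)
  qed
  have subU: "cball 0 1 \<subseteq> U r" if "\<bar>r\<bar> < R" for r
  proof
    fix w :: complex assume "w \<in> cball 0 1"
    then have "\<bar>r\<bar> * cmod w \<le> \<bar>r\<bar> * 1" by (intro mult_left_mono) auto
    then show "w \<in> U r" using that by (simp add: U_def dist_norm norm_mult)
  qed
  have contU: "continuous_on (U r) (\<lambda>w. g (z + of_real r * w))" if "continuous_on (ball z R) g" for g :: "complex \<Rightarrow> complex" and r
    by (rule continuous_on_compose2[OF that]) (auto simp: U_def intro!: continuous_intros)
  have bc: "continuous_on UNIV (bump m)" for m using continuous_on_bump[of UNIV "\<lambda>x. x" m] by simp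
  have cont: "continuous_on UNIV (\<lambda>w. bump m w * g (z + of_real r * w))"
    and int: "integrable lborel (\<lambda>w. bump m w * g (z + of_real r * w))"
    if g: "continuous_on (ball z R) g" and r: "\<bar>r\<bar> < R" and m: "m > 0" for g :: "complex \<Rightarrow> complex" and r m
  proof -
    show *: "continuous_on UNIV (\<lambda>w. bump m w * g (z + of_real r * w))"
      by (rule continuous_on_cutoff[OF bc closed_cball _ subU[OF r] openU contU[OF g]])
         (use m in \<open>auto intro!: bump_eq_0\<close>)
    show "integrable lborel (\<lambda>w. bump m w * g (z + of_real r * w))"
      by (rule integrable_compact_support[OF * compact_cball[of 0 1]]) (use m in \<open>auto intro!: bump_eq_0\<close>)
  qed
  note cs = C1w_continuous[OF s(1)] C1w_continuous_d[OF s(1)] C1w_continuous_d[OF s(2)] C1w_continuous_d[OF s(3)]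
  show int3: "integrable lborel (\<lambda>w. bump 3 w * s (z + of_real r * w))"
    by (rule int) (use cs r in auto)
  show int4: "integrable lborel (\<lambda>w. bump 4 w / 4 * (c (z + of_real r * w) + c' (z + of_real r * w)))"
  proof -
    have "continuous_on (ball z R) (\<lambda>\<zeta>. (c \<zeta> + c' \<zeta>) / 4)"
      using cs(5,6) by (intro continuous_on_divide continuous_on_add continuous_on_const) auto
    from int[OF this r, of 4] show ?thesis by simp
  qed
  define \<rho> where "\<rho> = (R - \<bar>r\<bar>) / 2"
  have \<rho>: "\<rho> > 0" "\<bar>r\<bar> + \<rho> < R" using r by (auto simp: \<rho>_def field_simps)
  have "compact ((\<lambda>\<zeta>. cmod (a \<zeta>) + cmod (b \<zeta>)) ` cball z (\<bar>r\<bar> + \<rho>))"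
    using cs \<rho> by (intro compact_continuous_image continuous_on_add continuous_on_norm compact_cball)
      (auto intro!: continuous_on_subset[of "ball z R"])
  from bounded_imp_bdd_above[OF compact_imp_bounded[OF this]]
  obtain L0 where L0: "\<And>t. t \<in> (\<lambda>\<zeta>. cmod (a \<zeta>) + cmod (b \<zeta>)) ` cball z (\<bar>r\<bar> + \<rho>) \<Longrightarrow> t \<le> L0"
    unfolding bdd_above_def by blast
  define L where "L = max 0 L0"
  have L: "L \<ge> 0" "\<And>\<zeta>. \<zeta> \<in> cball z (\<bar>r\<bar> + \<rho>) \<Longrightarrow> cmod (a \<zeta>) + cmod (b \<zeta>) \<le> L"
    using L0[OF imageI] by (auto simp: L_def le_max_iff_disj)
  have bump0: "bump 3 w = 0" if "w \<notin> cball 0 1" for w by (rule bump_eq_0) (use that in auto)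
  have D: "((\<lambda>r. \<integral>w. bump 3 w * s (z + of_real r * w) \<partial>lborel) has_derivative
      (\<lambda>h. \<integral>w. bump 3 w * (of_real h * (a (z + of_real r * w) * w + b (z + of_real r * w) * cnj w)) \<partial>lborel)) (at r)"
  proof (rule has_derivative_integral(1)[where \<rho> = \<rho> and B = "\<lambda>w. L * indicator (cball 0 1) w"])
    show "integrable lborel (\<lambda>w. bump 3 w * s (z + of_real x * w))" if "x \<in> ball r \<rho>" for x
      by (rule int) (use that \<rho> cs in \<open>auto simp: dist_real_def\<close>)
    show "((\<lambda>x. bump 3 w * s (z + of_real x * w)) has_derivative
        (\<lambda>h. bump 3 w * (of_real h * (a (z + of_real r * w) * w + b (z + of_real r * w) * cnj w)))) (at r)" for w
    proof (cases "w \<in> cball 0 1")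
      case True
      then have "z + of_real r * w \<in> ball z R" using subU[OF r] by (auto simp: U_def)
      from C1wD[OF s(1) this] have d: "(s has_derivative (\<lambda>h. a (z + of_real r * w) * h + b (z + of_real r * w) * cnj h)) (at (z + of_real r * w))"
        by (simp add: wirtinger_def)
      have "((\<lambda>x. z + of_real x * w) has_derivative (\<lambda>h. of_real h * w)) (at r)"
        by (auto intro!: derivative_eq_intros)
      from has_derivative_compose[OF this d]
      have "((\<lambda>x. s (z + of_real x * w)) has_derivative (\<lambda>h. of_real h * (a (z + of_real r * w) * w + b (z + of_real r * w) * cnj w))) (at r)"
        by (simp add: algebra_simps)
      then show ?thesis by (rule has_derivative_mult_right)
    next
      case False then show ?thesis by (simp add: bump0)
    qed
    show "norm (bump 3 w * s (z + of_real x * w) - bump 3 w * s (z + of_real r * w)) \<le> L * indicator (cball 0 1) w * norm (x - r)"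
      if x: "x \<in> ball r \<rho>" for x w
    proof (cases "w \<in> cball 0 1")
      case True
      have mem: "z + of_real y * w \<in> cball z (\<bar>r\<bar> + \<rho>)" if "\<bar>y\<bar> \<le> \<bar>r\<bar> + \<rho>" for y
      proof -
        have "\<bar>y\<bar> * cmod w \<le> (\<bar>r\<bar> + \<rho>) * 1" using True that by (intro mult_mono) auto
        then show ?thesis by (simp add: dist_norm norm_mult)
      qed
      have "cmod (s (z + of_real x * w) - s (z + of_real r * w)) \<le> L * cmod ((z + of_real x * w) - (z + of_real r * w))"
      proof (rule C1w_Lipschitz[OF s(1) convex_cball _ L(2)])
        show "z + of_real x * w \<in> cball z (\<bar>r\<bar> + \<rho>)" "z + of_real r * w \<in> cball z (\<bar>r\<bar> + \<rho>)"
          by (rule mem, use \<rho> x in \<open>simp add: dist_real_def\<close>)+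
      qed (use \<rho> in auto)
      also have "(z + of_real x * w) - (z + of_real r * w) = of_real (x - r) * w" by (simp add: algebra_simps)
      also have "L * cmod (of_real (x - r) * w) \<le> L * (\<bar>x - r\<bar> * 1)"
        unfolding norm_mult norm_of_real using True L(1) by (intro mult_left_mono) auto
      finally have le: "cmod (s (z + of_real x * w) - s (z + of_real r * w)) \<le> L * \<bar>x - r\<bar>" by simp
      have "norm (bump 3 w * s (z + of_real x * w) - bump 3 w * s (z + of_real r * w)) =
        cmod (bump 3 w) * cmod (s (z + of_real x * w) - s (z + of_real r * w))"
        by (metis norm_mult right_diff_distrib)
      also have "\<dots> \<le> 1 * (L * \<bar>x - r\<bar>)"
        using le bump_norm_le L(1) by (intro mult_mono) auto
      finally show ?thesis using True by simp
    next
      case False then show ?thesis by (simp add: bump0 L)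
    qed
    have "integrable lborel (indicator (cball 0 1) :: complex \<Rightarrow> real)"
      by (rule integrable_real_indicator) (simp, rule emeasure_bounded_finite, simp)
    then show "integrable lborel (\<lambda>w. L * indicator (cball (0::complex) 1) w)" using integrable_mult_right by blast
  qed (rule \<rho>)
  have k4: "C1w UNIV (\<lambda>w. bump 4 w / 4) (\<lambda>w. - cnj w * bump 3 w) (\<lambda>w. - w * bump 3 w)"
    using C1w_cmult[OF C1w_bump[of 3], of "1/4"] by (simp add: numeral_eq_Suc)
  have v4: "bump 4 w / 4 = 0" if "w \<notin> cball 0 1" for w using that by (auto intro!: bump_eq_0)
  have ba: "C1w UNIV (\<lambda>w. bump 4 w / 4 * a (z + of_real r * w))
      (\<lambda>w. - cnj w * bump 3 w * a (z + of_real r * w) + bump 4 w / 4 * (of_real r * aa (z + of_real r * w)))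
      (\<lambda>w. - w * bump 3 w * a (z + of_real r * w) + bump 4 w / 4 * (of_real r * c (z + of_real r * w)))"
    by (rule C1w_cutoff[OF k4 closed_cball v4 subU[OF r] openU
          C1w_affine[OF s(2), of z "of_real r", folded U_def, unfolded complex_cnj_complex_of_real]])
  have bb: "C1w UNIV (\<lambda>w. bump 4 w / 4 * b (z + of_real r * w))
      (\<lambda>w. - cnj w * bump 3 w * b (z + of_real r * w) + bump 4 w / 4 * (of_real r * c' (z + of_real r * w)))
      (\<lambda>w. - w * bump 3 w * b (z + of_real r * w) + bump 4 w / 4 * (of_real r * bb (z + of_real r * w)))"
    by (rule C1w_cutoff[OF k4 closed_cball v4 subU[OF r] openU
          C1w_affine[OF s(3), of z "of_real r", folded U_def, unfolded complex_cnj_complex_of_real]])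
  have ia: "integrable lborel (\<lambda>w. - w * bump 3 w * a (z + of_real r * w) + bump 4 w / 4 * (of_real r * c (z + of_real r * w)))"
    using C1w_continuous_d(2)[OF ba]
    by (rule integrable_compact_support[OF _ compact_cball[of 0 1]]) (auto simp: bump_eq_0)
  have ib: "integrable lborel (\<lambda>w. - cnj w * bump 3 w * b (z + of_real r * w) + bump 4 w / 4 * (of_real r * c' (z + of_real r * w)))"
    using C1w_continuous_d(1)[OF bb]
    by (rule integrable_compact_support[OF _ compact_cball[of 0 1]]) (auto simp: bump_eq_0)
  have za: "(\<integral>w. - w * bump 3 w * a (z + of_real r * w) + bump 4 w / 4 * (of_real r * c (z + of_real r * w)) \<partial>lborel) = 0"
    by (rule integral_wirtinger_zero(2)[OF ba compact_cball[of 0 1]]) (auto simp: bump_eq_0)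
  have zb: "(\<integral>w. - cnj w * bump 3 w * b (z + of_real r * w) + bump 4 w / 4 * (of_real r * c' (z + of_real r * w)) \<partial>lborel) = 0"
    by (rule integral_wirtinger_zero(1)[OF bb compact_cball[of 0 1]]) (auto simp: bump_eq_0)
  have "(\<integral>w. bump 3 w * (of_real h * (a (z + of_real r * w) * w + b (z + of_real r * w) * cnj w)) \<partial>lborel)
    = h *\<^sub>R (of_real r * (\<integral>w. bump 4 w / 4 * (c (z + of_real r * w) + c' (z + of_real r * w)) \<partial>lborel))" for h
  proof -
    have "(\<integral>w. bump 3 w * (of_real h * (a (z + of_real r * w) * w + b (z + of_real r * w) * cnj w)) \<partial>lborel)
      = (\<integral>w. of_real h * (of_real r * (bump 4 w / 4 * (c (z + of_real r * w) + c' (z + of_real r * w)))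
        - (- w * bump 3 w * a (z + of_real r * w) + bump 4 w / 4 * (of_real r * c (z + of_real r * w)))
        - (- cnj w * bump 3 w * b (z + of_real r * w) + bump 4 w / 4 * (of_real r * c' (z + of_real r * w)))) \<partial>lborel)"
      by (rule Bochner_Integration.integral_cong) (simp_all add: field_simps)
    also have "\<dots> = of_real h * ((of_real r * (\<integral>w. bump 4 w / 4 * (c (z + of_real r * w) + c' (z + of_real r * w)) \<partial>lborel)) - 0 - 0)"
      unfolding integral_mult_right_zero
      by (subst Bochner_Integration.integral_diff, intro Bochner_Integration.integrable_diff integrable_mult_right int4 ia, rule ib,
          subst Bochner_Integration.integral_diff, intro integrable_mult_right int4, rule ia)
         (simp only: za zb integral_mult_right_zero)
    finally show ?thesis by (simp add: scaleR_conv_of_real)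
  qed
  then show "((\<lambda>r. \<integral>w. bump 3 w * s (z + of_real r * w) \<partial>lborel) has_vector_derivative
      of_real r * (\<integral>w. bump 4 w / 4 * (c (z + of_real r * w) + c' (z + of_real r * w)) \<partial>lborel)) (at r)"
    using D unfolding has_vector_derivative_def by simp
qed

text \<open>
  The Laplacian of \<open>f\<close> vanishes, so the averages have derivative 0 in the radius.
\<close>

lemma holomorphic_mean_value:
  assumes f: "f holomorphic_on ball z R" and r: "0 \<le> r" "r < R"
  shows "(\<integral>w. bump 3 w * f (z + of_real r * w) \<partial>lborel) = of_real bump_mass * f z"
proof -
  have f1: "C1w (ball z R) f (deriv f) (\<lambda>_. 0)" by (rule C1w_holomorphic[OF f]) simp
  have f2: "C1w (ball z R) (deriv f) (deriv (deriv f)) (\<lambda>_. 0)"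
    by (rule C1w_holomorphic[OF holomorphic_deriv[OF f]]) simp_all
  define M where "M r = (\<integral>w. bump 3 w * f (z + of_real r * w) \<partial>lborel)" for r
  have D: "(M has_vector_derivative 0) (at x)" if "\<bar>x\<bar> < R" for x
    using radial_mean_derivative(1)[OF f1 f2 C1w_const[of _ 0] that] unfolding M_def
    by (simp only: add_0_right mult_zero_right Bochner_Integration.integral_zero)
  have "M r = M 0"
  proof (cases "r = 0")
    case False
    have "(M has_derivative (\<lambda>h. 0)) (at x within {0..r})" if "x \<in> {0..r}" for x
    proof (rule has_derivative_at_withinI)
      have "\<bar>x\<bar> < R" using that r by auto
      from D[OF this] show "(M has_derivative (\<lambda>h. 0)) (at x)"
        by (simp add: has_vector_derivative_def)
    qed
    from has_derivative_zero_unique[OF convex_real_interval(5) this, of r 0]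
    show ?thesis using r by auto
  qed simp
  then show ?thesis by (simp add: M_def integral_bump3)
qed

text \<open>
  The averages increase with the radius, because their derivative is an average of a nonnegative
  Laplacian.
\<close>

lemma subharmonic_mean_value:
  assumes s: "C1w (ball z R) s a b" "C1w (ball z R) a aa c" "C1w (ball z R) b c' bb" and r: "0 \<le> r" "r < R"
    and sub: "\<And>w. w \<in> ball z R \<Longrightarrow> 0 \<le> Re (c w + c' w)"
  shows "bump_mass * Re (s z) \<le> Re (\<integral>w. bump 3 w * s (z + of_real r * w) \<partial>lborel)"
proof -
  define M where "M r = Re (\<integral>w. bump 3 w * s (z + of_real r * w) \<partial>lborel)" for r
  define M' where "M' r = Re (of_real r * (\<integral>w. bump 4 w / 4 * (c (z + of_real r * w) + c' (z + of_real r * w)) \<partial>lborel))" for r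
  have D: "(M has_real_derivative M' x) (at x)" if "\<bar>x\<bar> < R" for x
    unfolding M_def M'_def has_real_derivative_iff_has_vector_derivative
    by (rule bounded_linear.has_vector_derivative[OF bounded_linear_Re radial_mean_derivative(1)[OF s that]])
  have M': "M' x \<ge> 0" if x: "0 \<le> x" "x \<le> r" for x
  proof -
    have "0 \<le> (\<integral>w. Re (bump 4 w / 4 * (c (z + of_real x * w) + c' (z + of_real x * w))) \<partial>lborel)"
    proof (rule integral_nonneg_AE, rule AE_I2)
      fix w :: complex
      show "0 \<le> Re (bump 4 w / 4 * (c (z + of_real x * w) + c' (z + of_real x * w)))"
      proof (cases "cmod w < 1")
        case True
        then have "x * cmod w \<le> x * 1" using x by (intro mult_left_mono) auto
        then have "z + of_real x * w \<in> ball z R" using x r by (simp add: dist_norm norm_mult)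
        from sub[OF this] show ?thesis unfolding bump_def by (simp del: of_real_power)
      next
        case False then show ?thesis by (simp add: bump_eq_0)
      qed
    qed
    moreover have "\<bar>x\<bar> < R" using x r by simp
    note integral_Re[OF radial_mean_derivative(3)[OF s this]]
    ultimately have "0 \<le> Re (\<integral>w. bump 4 w / 4 * (c (z + of_real x * w) + c' (z + of_real x * w)) \<partial>lborel)"
      by (simp only:)
    then show ?thesis using x
      unfolding M'_def by (simp only: times_complex.sel Re_complex_of_real Im_complex_of_real mult_zero_left diff_0_right mult_nonneg_nonneg)
  qed
  have "M 0 \<le> M r"
  proof (intro DERIV_nonneg_imp_nondecreasing[of 0 r M])
    fix x assume x: "0 \<le> x" "x \<le> r"
    then have "(M has_real_derivative M' x) (at x)" using r by (intro D) auto
    then show "\<exists>y. (M has_real_derivative y) (at x) \<and> 0 \<le> y" using M'[OF x] by blast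
  qed (rule r)
  then show ?thesis by (simp add: M_def integral_bump3)
qed

section \<open>Convolution\<close>

lemma convolution_integrable:
  fixes f k :: "complex \<Rightarrow> complex"
  assumes f: "integrable lborel f" and k: "continuous_on UNIV k" "\<And>z. cmod (k z) \<le> L"
  shows "integrable lborel (\<lambda>w. f w * k (z - w))"
proof (rule Bochner_Integration.integrable_bound)
  show "integrable lborel (\<lambda>w. L * cmod (f w))" using f by simp
  have "continuous_on UNIV (\<lambda>w. k (z - w))"
    by (intro continuous_on_compose2[OF k(1)] continuous_intros) auto
  then have [measurable]: "(\<lambda>w. k (z - w)) \<in> borel_measurable borel" by (rule borel_measurable_continuous_onI)
  have [measurable]: "f \<in> borel_measurable borel" using f by simp
  show "(\<lambda>w. f w * k (z - w)) \<in> borel_measurable lborel" by measurable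
  have "cmod (f w * k (z - w)) \<le> L * cmod (f w)" for w
    unfolding norm_mult mult.commute[of L] by (intro mult_left_mono k) simp
  moreover have "L \<ge> 0" using k(2)[of 0] norm_ge_zero order_trans by blast
  ultimately show "AE w in lborel. norm (f w * k (z - w)) \<le> norm (L * cmod (f w))" by simp
qed

lemma convolution_continuous:
  fixes f k :: "complex \<Rightarrow> complex"
  assumes f: "integrable lborel f" and k: "continuous_on UNIV k" "\<And>z. cmod (k z) \<le> L"
  shows "continuous_on UNIV (\<lambda>z. \<integral>w. f w * k (z - w) \<partial>lborel)"
  unfolding continuous_on_sequentially
proof (intro allI ballI impI, elim conjE)
  fix X and z :: complex assume X: "X \<longlonglongrightarrow> z"
  have L: "L \<ge> 0" using k(2)[of 0] norm_ge_zero order_trans by blast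
  show "((\<lambda>z. \<integral>w. f w * k (z - w) \<partial>lborel) \<circ> X) \<longlonglongrightarrow> (\<integral>w. f w * k (z - w) \<partial>lborel)"
    unfolding comp_def
  proof (rule integral_dominated_convergence[where w = "\<lambda>w. L * cmod (f w)"])
    show "(\<lambda>w. f w * k (z - w)) \<in> borel_measurable lborel" for z
      using convolution_integrable[OF assms] by simp
    then show "(\<lambda>w. f w * k (X n - w)) \<in> borel_measurable lborel" for n .
    show "integrable lborel (\<lambda>w. L * cmod (f w))" using f by simp
    have "isCont k x" for x using k(1) by (simp add: continuous_on_eq_continuous_at)
    then show "AE w in lborel. (\<lambda>n. f w * k (X n - w)) \<longlonglongrightarrow> f w * k (z - w)"
      by (intro AE_I2 tendsto_mult tendsto_const isCont_tendsto_compose[of _ k] tendsto_diff X)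
    have "cmod (f w * k (X n - w)) \<le> L * cmod (f w)" for w n
      unfolding norm_mult mult.commute[of L] by (intro mult_left_mono k) simp
    then show "AE w in lborel. norm (f w * k (X n - w)) \<le> L * cmod (f w)" for n by simp
  qed
qed

lemma C1w_convolution:
  assumes f: "integrable lborel f" and k: "C1w UNIV k a b" and K: "compact K" "\<And>z. z \<notin> K \<Longrightarrow> k z = 0"
  shows "C1w UNIV (\<lambda>z. \<integral>w. f w * k (z - w) \<partial>lborel) (\<lambda>z. \<integral>w. f w * a (z - w) \<partial>lborel) (\<lambda>z. \<integral>w. f w * b (z - w) \<partial>lborel)"
proof -
  obtain L where L: "L \<ge> 0" "\<And>z. cmod (k z) \<le> L" "\<And>z. cmod (a z) + cmod (b z) \<le> L"
    "\<And>x y. cmod (k x - k y) \<le> L * cmod (x - y)"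
    using C1w_compact_bounds[OF k K] by metis
  have ab: "cmod (a z) \<le> L" "cmod (b z) \<le> L" for z
    using L(3)[of z] norm_ge_zero[of "a z"] norm_ge_zero[of "b z"] by linarith+
  note c = C1w_continuous[OF k] C1w_continuous_d[OF k]
  have "wirtinger (\<lambda>z. \<integral>w. f w * k (z - w) \<partial>lborel) (\<integral>w. f w * a (z - w) \<partial>lborel) (\<integral>w. f w * b (z - w) \<partial>lborel) z" for z
  proof -
    have "((\<lambda>z. \<integral>w. f w * k (z - w) \<partial>lborel) has_derivative
        (\<lambda>h. \<integral>w. f w * (a (z - w) * h + b (z - w) * cnj h) \<partial>lborel)) (at z)"
    proof (rule has_derivative_integral(1)[where \<rho> = 1 and B = "\<lambda>w. L * cmod (f w)"])
      show "integrable lborel (\<lambda>w. f w * k (x - w))" for x by (rule convolution_integrable[OF f c(1) L(2)])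
      show "integrable lborel (\<lambda>w. L * cmod (f w))" using f by simp
      show "((\<lambda>x. f w * k (x - w)) has_derivative (\<lambda>h. f w * (a (z - w) * h + b (z - w) * cnj h))) (at z)" for w
        using wirtinger_affine[of k "a (z - w)" "b (z - w)" "- w" 1 z] C1wD[OF k, of "z - w"]
        by (intro has_derivative_mult_right) (simp add: wirtinger_def)
      show "cmod (f w * k (x - w) - f w * k (z - w)) \<le> L * cmod (f w) * norm (x - z)" for w x
      proof -
        have "cmod (f w * k (x - w) - f w * k (z - w)) = cmod (f w) * cmod (k (x - w) - k (z - w))"
          by (metis norm_mult right_diff_distrib)
        also have "\<dots> \<le> cmod (f w) * (L * cmod ((x - w) - (z - w)))" by (intro mult_left_mono L) simp
        finally show ?thesis by (simp add: mult_ac)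
      qed
    qed simp
    moreover have "(\<integral>w. f w * (a (z - w) * h + b (z - w) * cnj h) \<partial>lborel)
        = (\<integral>w. f w * a (z - w) \<partial>lborel) * h + (\<integral>w. f w * b (z - w) \<partial>lborel) * cnj h" for h
    proof -
      have "(\<integral>w. f w * (a (z - w) * h + b (z - w) * cnj h) \<partial>lborel)
          = (\<integral>w. (f w * a (z - w)) * h + (f w * b (z - w)) * cnj h \<partial>lborel)"
        by (rule Bochner_Integration.integral_cong) (simp_all add: algebra_simps)
      also have "\<dots> = (\<integral>w. f w * a (z - w) \<partial>lborel) * h + (\<integral>w. f w * b (z - w) \<partial>lborel) * cnj h"
        using convolution_integrable[OF f c(2) ab(1)] convolution_integrable[OF f c(3) ab(2)]
        by (subst Bochner_Integration.integral_add) auto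
      finally show ?thesis .
    qed
    ultimately show ?thesis unfolding wirtinger_def by simp
  qed
  then show ?thesis
    unfolding C1w_def using convolution_continuous[OF f c(2) ab(1)] convolution_continuous[OF f c(3) ab(2)] by blast
qed

lemma C2w_convolution:
  assumes f: "integrable lborel f" and k: "C2w UNIV k a b aa c bb" and K: "compact K" "\<And>z. z \<notin> K \<Longrightarrow> k z = 0"
  shows "C2w UNIV (\<lambda>z. \<integral>w. f w * k (z - w) \<partial>lborel) (\<lambda>z. \<integral>w. f w * a (z - w) \<partial>lborel) (\<lambda>z. \<integral>w. f w * b (z - w) \<partial>lborel)
     (\<lambda>z. \<integral>w. f w * aa (z - w) \<partial>lborel) (\<lambda>z. \<integral>w. f w * c (z - w) \<partial>lborel) (\<lambda>z. \<integral>w. f w * bb (z - w) \<partial>lborel)"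
proof -
  have 1: "C1w UNIV k a b" "C1w UNIV a aa c" "C1w UNIV b c bb" using k by (auto simp: C2w_def)
  note v = C1w_vanish[OF 1(1) compact_imp_closed[OF K(1)] K(2)]
  show ?thesis
    unfolding C2w_def
    by (intro conjI C1w_convolution[OF f 1(1) K] C1w_convolution[OF f 1(2) K(1)] C1w_convolution[OF f 1(3) K(1)] v)
qed

text \<open>
  Convolution with \<open>k\<close> can be moved from \<open>f\<close> to the function that it is integrated against.
\<close>

lemma convolution_Fubini:
  fixes f g k :: "complex \<Rightarrow> complex"
  assumes f: "integrable lborel f" and g: "integrable lborel g" and k: "continuous_on UNIV k" "\<And>z. cmod (k z) \<le> L"
  shows "(\<integral>z. g z * (\<integral>w. f w * k (z - w) \<partial>lborel) \<partial>lborel) = (\<integral>w. f w * (\<integral>z. g z * k (z - w) \<partial>lborel) \<partial>lborel)"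
proof -
  have L: "L \<ge> 0" using k(2)[of 0] norm_ge_zero order_trans by blast
  have [measurable]: "f \<in> borel_measurable borel" "g \<in> borel_measurable borel" "k \<in> borel_measurable borel"
    using f g borel_measurable_continuous_onI[OF k(1)] by auto
  have le: "cmod (g z * (f w * k (z - w))) \<le> cmod (g z) * cmod (f w) * L" for z w
    unfolding norm_mult mult.assoc by (intro mult_left_mono k) auto
  have int: "integrable (lborel \<Otimes>\<^sub>M lborel) (\<lambda>(z, w). g z * (f w * k (z - w)))"
  proof (rule Bochner_Integration.integrable_bound)
    show "integrable (lborel \<Otimes>\<^sub>M lborel) (\<lambda>(z, w). cmod (g z) * cmod (f w) * L)"
    proof (rule lborel_pair.Fubini_integrable)
      show "(\<lambda>(z, w). cmod (g z) * cmod (f w) * L) \<in> borel_measurable (lborel \<Otimes>\<^sub>M lborel)" by measurable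
      show "integrable lborel (\<lambda>x. \<integral>y. norm (case (x, y) of (z, w) \<Rightarrow> cmod (g z) * cmod (f w) * L) \<partial>lborel)"
        using g f L by (simp add: abs_mult)
      show "AE x in lborel. integrable lborel (\<lambda>y. case (x, y) of (z, w) \<Rightarrow> cmod (g z) * cmod (f w) * L)"
        using f by simp
    qed
    show "(\<lambda>(z, w). g z * (f w * k (z - w))) \<in> borel_measurable (lborel \<Otimes>\<^sub>M lborel)" by measurable
    have "cmod (g z * (f w * k (z - w))) \<le> \<bar>cmod (g z) * cmod (f w) * L\<bar>" for z w
      using le[of z w] by linarith
    then show "AE x in lborel \<Otimes>\<^sub>M lborel. norm (case x of (z, w) \<Rightarrow> g z * (f w * k (z - w)))
        \<le> norm (case x of (z, w) \<Rightarrow> cmod (g z) * cmod (f w) * L)"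
      by (intro AE_I2) (auto simp: case_prod_beta)
  qed
  have "(\<integral>z. g z * (\<integral>w. f w * k (z - w) \<partial>lborel) \<partial>lborel) = (\<integral>z. (\<integral>w. g z * (f w * k (z - w)) \<partial>lborel) \<partial>lborel)"
    by simp
  also have "\<dots> = (\<integral>w. (\<integral>z. g z * (f w * k (z - w)) \<partial>lborel) \<partial>lborel)"
    by (rule lborel_pair.Fubini_integral[symmetric, OF int])
  also have "\<dots> = (\<integral>w. (\<integral>z. f w * (g z * k (z - w)) \<partial>lborel) \<partial>lborel)"
    by (simp add: mult_ac)
  finally show ?thesis by simp
qed

section \<open>Square-integrable functions\<close>

definition L2 :: "'a measure \<Rightarrow> ('a \<Rightarrow> complex) set" where
  "L2 M = {f \<in> borel_measurable M. integrable M (\<lambda>x. (cmod (f x))\<^sup>2)}"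

definition ip :: "'a measure \<Rightarrow> ('a \<Rightarrow> complex) \<Rightarrow> ('a \<Rightarrow> complex) \<Rightarrow> complex" where
  "ip M f g = (\<integral>x. f x * cnj (g x) \<partial>M)"

definition sqnorm :: "'a measure \<Rightarrow> ('a \<Rightarrow> complex) \<Rightarrow> real" where
  "sqnorm M f = (\<integral>x. (cmod (f x))\<^sup>2 \<partial>M)"

lemma L2_integrable: "f \<in> L2 M \<Longrightarrow> integrable M (\<lambda>x. (cmod (f x))\<^sup>2)"
  by (simp add: L2_def)

lemma sqnorm_nonneg: "0 \<le> sqnorm M f"
  by (simp add: sqnorm_def)

lemma cmod_mult_le: "cmod (a * b) \<le> (cmod a)\<^sup>2 + (cmod b)\<^sup>2"
proof -
  have "0 \<le> (cmod a - cmod b)\<^sup>2" "0 \<le> (cmod a)\<^sup>2" "0 \<le> (cmod b)\<^sup>2" by simp_all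
  then show ?thesis unfolding norm_mult power2_diff by linarith
qed

lemma cmod_add_sq_le: "(cmod (a + b))\<^sup>2 \<le> 2 * (cmod a)\<^sup>2 + 2 * (cmod b)\<^sup>2"
proof -
  have "(cmod (a + b))\<^sup>2 \<le> (cmod a + cmod b)\<^sup>2" by (intro power_mono norm_triangle_ineq) simp
  moreover have "0 \<le> (cmod a - cmod b)\<^sup>2" by simp
  ultimately show ?thesis unfolding power2_diff power2_sum by linarith
qed

lemma L2_add:
  assumes "f \<in> L2 M" "g \<in> L2 M"
  shows "(\<lambda>x. f x + g x) \<in> L2 M"
proof -
  have m: "f \<in> borel_measurable M" "g \<in> borel_measurable M" using assms by (auto simp: L2_def)
  have "integrable M (\<lambda>x. (cmod (f x + g x))\<^sup>2)"
  proof (rule Bochner_Integration.integrable_bound)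
    show "integrable M (\<lambda>x. 2 * (cmod (f x))\<^sup>2 + 2 * (cmod (g x))\<^sup>2)"
      using assms by (auto simp: L2_def)
    show "(\<lambda>x. (cmod (f x + g x))\<^sup>2) \<in> borel_measurable M" using m by measurable
    show "AE x in M. norm ((cmod (f x + g x))\<^sup>2) \<le> norm (2 * (cmod (f x))\<^sup>2 + 2 * (cmod (g x))\<^sup>2)"
      using cmod_add_sq_le by simp
  qed
  then show ?thesis using m by (simp add: L2_def)
qed

lemma L2_cmult:
  assumes "f \<in> L2 M"
  shows "(\<lambda>x. c * f x) \<in> L2 M"
  using assms by (auto simp: L2_def norm_mult power_mult_distrib)

lemma L2_diff:
  assumes "f \<in> L2 M" "g \<in> L2 M"
  shows "(\<lambda>x. f x - g x) \<in> L2 M"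
  using L2_add[OF assms(1) L2_cmult[OF assms(2), of "-1"]] by simp

lemma L2_mult_integrable:
  assumes "f \<in> L2 M" "g \<in> L2 M"
  shows "integrable M (\<lambda>x. f x * cnj (g x))"
proof (rule Bochner_Integration.integrable_bound)
  have [measurable]: "f \<in> borel_measurable M" "g \<in> borel_measurable M" using assms by (auto simp: L2_def)
  have [measurable]: "cnj \<in> borel_measurable borel" by (intro borel_measurable_continuous_onI continuous_intros)
  show "(\<lambda>x. f x * cnj (g x)) \<in> borel_measurable M" by measurable
  show "integrable M (\<lambda>x. (cmod (f x))\<^sup>2 + (cmod (g x))\<^sup>2)" using assms by (auto simp: L2_def)
  show "AE x in M. norm (f x * cnj (g x)) \<le> norm ((cmod (f x))\<^sup>2 + (cmod (g x))\<^sup>2)"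
    using cmod_mult_le[of "f _" "cnj (g _)"] by simp
qed

lemma ip_diff_left: "f \<in> L2 M \<Longrightarrow> f' \<in> L2 M \<Longrightarrow> g \<in> L2 M \<Longrightarrow> ip M (\<lambda>x. f x - f' x) g = ip M f g - ip M f' g"
  unfolding ip_def left_diff_distrib by (intro Bochner_Integration.integral_diff L2_mult_integrable)

lemma ip_cnj: "cnj (ip M f g) = ip M g f"
  unfolding ip_def Bochner_Integration.integral_cnj[symmetric] by (simp add: mult.commute)

lemma ip_self: "f \<in> L2 M \<Longrightarrow> ip M f f = of_real (sqnorm M f)"
  unfolding ip_def sqnorm_def complex_norm_square[symmetric] by (rule integral_of_real) (simp add: L2_def)

text \<open>
  The expansion of the square; the scalar \<open>c\<close> makes it serve for the Cauchy-Schwarz inequality, the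
  parallelogram law and the variations of a minimising sequence.
\<close>

lemma sqnorm_diff:
  assumes "f \<in> L2 M" "g \<in> L2 M"
  shows "sqnorm M (\<lambda>x. f x - c * g x) = sqnorm M f - 2 * Re (cnj c * ip M f g) + (cmod c)\<^sup>2 * sqnorm M g"
proof -
  have *: "(cmod (a - c * b))\<^sup>2 = (cmod a)\<^sup>2 - 2 * Re (cnj c * (a * cnj b)) + (cmod c)\<^sup>2 * (cmod b)\<^sup>2" for a b
    unfolding cmod_power2 by (simp add: algebra_simps power2_eq_square)
  have i1: "integrable M (\<lambda>x. Re (cnj c * (f x * cnj (g x))))"
    using L2_mult_integrable[OF assms] by (intro integrable_Re integrable_mult_right)
  have i2: "integrable M (\<lambda>x. (cmod (f x))\<^sup>2)" "integrable M (\<lambda>x. (cmod c)\<^sup>2 * (cmod (g x))\<^sup>2)"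
    using assms by (auto simp: L2_def)
  have "sqnorm M (\<lambda>x. f x - c * g x) = (\<integral>x. (cmod (f x))\<^sup>2 - 2 * Re (cnj c * (f x * cnj (g x))) + (cmod c)\<^sup>2 * (cmod (g x))\<^sup>2 \<partial>M)"
    unfolding sqnorm_def * ..
  also have "\<dots> = (\<integral>x. (cmod (f x))\<^sup>2 \<partial>M) - 2 * (\<integral>x. Re (cnj c * (f x * cnj (g x))) \<partial>M) + (\<integral>x. (cmod c)\<^sup>2 * (cmod (g x))\<^sup>2 \<partial>M)"
    using i1 i2
    by (simp only: Bochner_Integration.integral_add Bochner_Integration.integral_diff Bochner_Integration.integrable_diff
        integrable_mult_right integral_mult_right_zero)
  also have "(\<integral>x. Re (cnj c * (f x * cnj (g x))) \<partial>M) = Re (\<integral>x. cnj c * (f x * cnj (g x)) \<partial>M)"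
    using L2_mult_integrable[OF assms] by (intro integral_Re integrable_mult_right)
  finally show ?thesis unfolding sqnorm_def ip_def by simp
qed

lemma sqnorm_triangle:
  assumes "f \<in> L2 M" "g \<in> L2 M"
  shows "sqnorm M (\<lambda>x. f x + g x) \<le> 2 * sqnorm M f + 2 * sqnorm M g"
proof -
  have "sqnorm M (\<lambda>x. f x + g x) \<le> (\<integral>x. 2 * (cmod (f x))\<^sup>2 + 2 * (cmod (g x))\<^sup>2 \<partial>M)"
    unfolding sqnorm_def
    by (rule integral_mono) (use L2_integrable[OF L2_add[OF assms]] assms cmod_add_sq_le in \<open>auto simp: L2_def\<close>)
  also have "\<dots> = 2 * sqnorm M f + 2 * sqnorm M g"
    unfolding sqnorm_def using assms by (subst Bochner_Integration.integral_add) (auto simp: L2_def)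
  finally show ?thesis .
qed

lemma sqnorm_le_diff:
  assumes "f \<in> L2 M" "g \<in> L2 M"
  shows "sqnorm M f \<le> 2 * sqnorm M g + 2 * sqnorm M (\<lambda>x. g x - f x)"
proof -
  have "sqnorm M f = sqnorm M (\<lambda>x. g x + - 1 * (g x - f x))" by simp
  also have "\<dots> \<le> 2 * sqnorm M g + 2 * sqnorm M (\<lambda>x. - 1 * (g x - f x))"
    by (rule sqnorm_triangle[OF assms(2) L2_cmult[OF L2_diff[OF assms(2,1)]]])
  also have "sqnorm M (\<lambda>x. - 1 * (g x - f x)) = sqnorm M (\<lambda>x. g x - f x)"
    unfolding sqnorm_def norm_mult by simp
  finally show ?thesis .
qed

lemma L2_Cauchy_Schwarz:
  assumes "f \<in> L2 M" "g \<in> L2 M"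
  shows "(cmod (ip M f g))\<^sup>2 \<le> sqnorm M f * sqnorm M g"
proof (cases "sqnorm M g = 0")
  case True
  have le: "2 * (s * (cmod (ip M f g))\<^sup>2) \<le> sqnorm M f" for s
  proof -
    have "cnj (of_real s * ip M f g) * ip M f g = of_real (s * (cmod (ip M f g))\<^sup>2)"
      unfolding of_real_mult complex_norm_square by (simp add: mult_ac)
    then have "Re (cnj (of_real s * ip M f g) * ip M f g) = s * (cmod (ip M f g))\<^sup>2" by (simp only: Re_complex_of_real)
    with sqnorm_nonneg[of M "\<lambda>x. f x - (of_real s * ip M f g) * g x"] show ?thesis
      unfolding sqnorm_diff[OF assms] True by simp
  qed
  have "(cmod (ip M f g))\<^sup>2 = 0"
  proof (rule ccontr)
    assume "(cmod (ip M f g))\<^sup>2 \<noteq> 0"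
    then show False using le[of "(sqnorm M f + 1) / (cmod (ip M f g))\<^sup>2"] sqnorm_nonneg[of M f] by simp
  qed
  then show ?thesis using True by simp
next
  case False
  then have pos: "sqnorm M g > 0" using sqnorm_nonneg[of M g] by simp
  have "0 \<le> sqnorm M (\<lambda>x. f x - (ip M f g / of_real (sqnorm M g)) * g x)" by (rule sqnorm_nonneg)
  also have "\<dots> = sqnorm M f - (cmod (ip M f g))\<^sup>2 / sqnorm M g"
  proof -
    have "cnj (ip M f g / of_real (sqnorm M g)) * ip M f g = of_real ((cmod (ip M f g))\<^sup>2 / sqnorm M g)"
      unfolding of_real_divide complex_norm_square by (simp add: mult_ac)
    then have "Re (cnj (ip M f g / of_real (sqnorm M g)) * ip M f g) = (cmod (ip M f g))\<^sup>2 / sqnorm M g"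
      by (simp only: Re_complex_of_real)
    moreover have "(cmod (ip M f g / of_real (sqnorm M g)))\<^sup>2 * sqnorm M g = (cmod (ip M f g))\<^sup>2 / sqnorm M g"
      using pos by (simp add: norm_divide power_divide power2_eq_square)
    ultimately show ?thesis unfolding sqnorm_diff[OF assms] by linarith
  qed
  finally show ?thesis using pos by (simp add: field_simps)
qed

text \<open>
  Completeness for sequences that converge fast, with the rate kept.  The integral of the sum of
  \<open>2\<^sup>n |f\<^sub>n\<^sub>+\<^sub>1 - f\<^sub>n|\<^sup>2\<close> is finite, hence at almost every point the increments decay
  geometrically; Fatou's lemma turns pointwise convergence into the estimate of the distance.
\<close>

lemma L2_complete:
  assumes f: "\<And>n. f n \<in> L2 M" and cauchy: "\<And>n m. n \<le> m \<Longrightarrow> sqnorm M (\<lambda>x. f m x - f n x) \<le> (1/4) ^ n"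
  shows "\<exists>g\<in>L2 M. \<forall>n. sqnorm M (\<lambda>x. g x - f n x) \<le> (1/4) ^ n"
proof -
  have fm [measurable]: "f n \<in> borel_measurable M" for n using f by (auto simp: L2_def)
  have nn: "(\<integral>\<^sup>+x. ennreal ((cmod (f m x - f n x))\<^sup>2) \<partial>M) \<le> ennreal ((1/4) ^ n)" if "n \<le> m" for n m
  proof -
    have "(\<integral>\<^sup>+x. ennreal ((cmod (f m x - f n x))\<^sup>2) \<partial>M) = ennreal (sqnorm M (\<lambda>x. f m x - f n x))"
      unfolding sqnorm_def by (rule nn_integral_eq_integral) (use L2_integrable[OF L2_diff[OF f f]] in auto)
    then show ?thesis using cauchy[OF that] by (simp add: ennreal_leI)
  qed
  define d where "d n x = ennreal (2 ^ n * (cmod (f (Suc n) x - f n x))\<^sup>2)" for n x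
  have dm [measurable]: "d n \<in> borel_measurable M" for n unfolding d_def by measurable
  have "(\<integral>\<^sup>+x. (\<Sum>n. d n x) \<partial>M) = (\<Sum>n. \<integral>\<^sup>+x. d n x \<partial>M)"
    by (rule nn_integral_suminf) simp
  also have "\<dots> \<le> (\<Sum>n. ennreal ((1/2) ^ n))"
  proof (intro suminf_le allI)
    fix n
    have "(\<integral>\<^sup>+x. d n x \<partial>M) = ennreal (2 ^ n) * (\<integral>\<^sup>+x. ennreal ((cmod (f (Suc n) x - f n x))\<^sup>2) \<partial>M)"
      unfolding d_def by (subst nn_integral_cmult[symmetric]) (auto simp: ennreal_mult)
    also have "\<dots> \<le> ennreal (2 ^ n) * ennreal ((1/4) ^ n)" by (intro mult_left_mono nn) auto
    also have "\<dots> = ennreal ((2 * (1/4)) ^ n)" unfolding power_mult_distrib by (rule ennreal_mult[symmetric]) auto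
    also have "\<dots> = ennreal ((1/2) ^ n)" by simp
    finally show "(\<integral>\<^sup>+x. d n x \<partial>M) \<le> ennreal ((1/2) ^ n)" .
  qed auto
  also have "\<dots> = ennreal (\<Sum>n. (1/2) ^ n)"
    by (rule suminf_ennreal2) (auto intro!: summable_geometric)
  also have "\<dots> < \<infinity>" by simp
  finally have "AE x in M. (\<Sum>n. d n x) \<noteq> \<infinity>"
    by (intro nn_integral_noteq_infinite) auto
  then have conv: "AE x in M. convergent (\<lambda>n. f n x)"
  proof eventually_elim
    case (elim x)
    define C where "C = enn2real (\<Sum>n. d n x)"
    have "d n x \<le> ennreal C" for n
    proof -
      have "d n x \<le> (\<Sum>n. d n x)" using sum_le_suminf[of "\<lambda>n. d n x" "{n}"] by simp
      then show ?thesis using elim by (simp add: C_def less_top)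
    qed
    moreover have "C \<ge> 0" by (simp add: C_def)
    ultimately have bd: "2 ^ n * (cmod (f (Suc n) x - f n x))\<^sup>2 \<le> C" for n
      unfolding d_def by (simp add: ennreal_le_iff)
    have "summable (\<lambda>n. f (Suc n) x - f n x)"
    proof (rule summable_comparison_test')
      show "summable (\<lambda>n. sqrt C * (1 / sqrt 2) ^ n)"
        by (intro summable_mult summable_geometric) simp
      fix n :: nat
      have "(cmod (f (Suc n) x - f n x))\<^sup>2 \<le> C / 2 ^ n" using bd[of n] by (simp add: field_simps)
      then have "cmod (f (Suc n) x - f n x) \<le> sqrt (C / 2 ^ n)" by (rule real_le_rsqrt)
      then show "norm (f (Suc n) x - f n x) \<le> sqrt C * (1 / sqrt 2) ^ n"
        by (simp add: real_sqrt_divide real_sqrt_power power_divide)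
    qed
    then have "convergent (\<lambda>n. \<Sum>i<n. f (Suc i) x - f i x)" by (simp add: summable_iff_convergent)
    then have "convergent (\<lambda>n. (\<Sum>i<n. f (Suc i) x - f i x) + f 0 x)" by (intro convergent_add convergent_const)
    moreover have "(\<Sum>i<n. f (Suc i) x - f i x) = f n x - f 0 x" for n by (induction n) auto
    ultimately show ?case by simp
  qed
  define g where "g x = lim (\<lambda>n. f n x)" for x
  have lim: "AE x in M. (\<lambda>n. f n x) \<longlonglongrightarrow> g x"
    using conv by eventually_elim (simp add: g_def convergent_LIMSEQ_iff)
  have gm [measurable]: "g \<in> borel_measurable M"
    unfolding g_def by (rule borel_measurable_lim_metric) (rule fm)
  have gle: "(\<integral>\<^sup>+x. ennreal ((cmod (g x - f n x))\<^sup>2) \<partial>M) \<le> ennreal ((1/4) ^ n)" for n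
  proof -
    have "(\<integral>\<^sup>+x. ennreal ((cmod (g x - f n x))\<^sup>2) \<partial>M) = (\<integral>\<^sup>+x. liminf (\<lambda>m. ennreal ((cmod (f m x - f n x))\<^sup>2)) \<partial>M)"
    proof (rule nn_integral_cong_AE)
      show "AE x in M. ennreal ((cmod (g x - f n x))\<^sup>2) = liminf (\<lambda>m. ennreal ((cmod (f m x - f n x))\<^sup>2))"
        using lim
      proof eventually_elim
        case (elim x)
        then have "(\<lambda>m. ennreal ((cmod (f m x - f n x))\<^sup>2)) \<longlonglongrightarrow> ennreal ((cmod (g x - f n x))\<^sup>2)"
          by (intro tendsto_intros tendsto_ennrealI)
        then show ?case by (intro lim_imp_Liminf[symmetric]) auto
      qed
    qed
    also have "\<dots> \<le> liminf (\<lambda>m. \<integral>\<^sup>+x. ennreal ((cmod (f m x - f n x))\<^sup>2) \<partial>M)"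
      by (rule nn_integral_liminf) measurable
    also have "\<dots> \<le> ennreal ((1/4) ^ n)"
    proof (rule Liminf_le)
      show "\<forall>\<^sub>F m in sequentially. (\<integral>\<^sup>+x. ennreal ((cmod (f m x - f n x))\<^sup>2) \<partial>M) \<le> ennreal ((1/4) ^ n)"
        by (rule eventually_sequentiallyI[of n]) (rule nn)
    qed simp
    finally show ?thesis .
  qed
  have dL2: "(\<lambda>x. g x - f n x) \<in> L2 M" for n
  proof -
    have "integrable M (\<lambda>x. (cmod (g x - f n x))\<^sup>2)"
      by (rule integrableI_nonneg) (use gle[of n] in \<open>auto intro: le_less_trans\<close>)
    then show ?thesis by (simp add: L2_def)
  qed
  have "sqnorm M (\<lambda>x. g x - f n x) \<le> (1/4) ^ n" for n
  proof -
    have "ennreal (sqnorm M (\<lambda>x. g x - f n x)) = (\<integral>\<^sup>+x. ennreal ((cmod (g x - f n x))\<^sup>2) \<partial>M)"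
      unfolding sqnorm_def by (rule nn_integral_eq_integral[symmetric]) (use L2_integrable[OF dL2] in auto)
    also have "\<dots> \<le> ennreal ((1/4) ^ n)" by (rule gle)
    finally show ?thesis by simp
  qed
  moreover have "g \<in> L2 M" using L2_add[OF dL2[of 0] f[of 0]] by simp
  ultimately show ?thesis by blast
qed

text \<open>
  A vector that is orthogonal to the orthogonal complement of \<open>V\<close> lies in the closure of \<open>V\<close>.
  A sequence in \<open>V\<close> that minimises the distance to \<open>u\<close> is Cauchy by the parallelogram law; the
  limit \<open>q\<close> of the differences is orthogonal to \<open>V\<close> by minimality, hence to \<open>u\<close> by hypothesis,
  hence to itself.
\<close>

lemma L2_double_orthogonal:
  assumes V: "V \<subseteq> L2 M" "V \<noteq> {}" "\<And>v w. v \<in> V \<Longrightarrow> w \<in> V \<Longrightarrow> (\<lambda>x. v x + w x) \<in> V" "\<And>c v. v \<in> V \<Longrightarrow> (\<lambda>x. c * v x) \<in> V"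
    and u: "u \<in> L2 M"
    and perp: "\<And>q. q \<in> L2 M \<Longrightarrow> (\<And>v. v \<in> V \<Longrightarrow> ip M q v = 0) \<Longrightarrow> ip M u q = 0"
  shows "\<exists>v. (\<forall>n. v n \<in> V) \<and> (\<lambda>n. sqnorm M (\<lambda>x. u x - v n x)) \<longlonglongrightarrow> 0"
proof -
  define m where "m = (INF v\<in>V. sqnorm M (\<lambda>x. u x - v x))"
  have bdd: "bdd_below ((\<lambda>v. sqnorm M (\<lambda>x. u x - v x)) ` V)"
    by (rule bdd_belowI2[of _ 0]) (rule sqnorm_nonneg)
  have m_le: "m \<le> sqnorm M (\<lambda>x. u x - v x)" if "v \<in> V" for v
    unfolding m_def by (rule cINF_lower[OF bdd that])
  define \<epsilon> :: "nat \<Rightarrow> real" where "\<epsilon> n = (1/4) ^ n / 4" for n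
  have \<epsilon>: "\<epsilon> n > 0" for n by (simp add: \<epsilon>_def)
  have "\<exists>v\<in>V. sqnorm M (\<lambda>x. u x - v x) < m + \<epsilon> n" for n
    using cINF_less_iff[OF V(2) bdd, of "m + \<epsilon> n"] \<epsilon>[of n] by (simp add: m_def)
  then obtain v where v: "\<And>n. v n \<in> V" "\<And>n. sqnorm M (\<lambda>x. u x - v n x) < m + \<epsilon> n" by metis
  have vL: "w \<in> V \<Longrightarrow> w \<in> L2 M" for w using V(1) by blast
  have fL: "(\<lambda>x. u x - v n x) \<in> L2 M" for n by (intro L2_diff u vL v)
  have cauchy: "sqnorm M (\<lambda>x. (u x - v i x) - (u x - v j x)) \<le> (1/4) ^ j" if "j \<le> i" for i j
  proof -
    have half: "(\<lambda>x. 1/2 * (v i x + v j x)) \<in> V" by (intro V v)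
    have "sqnorm M (\<lambda>x. (u x - v i x) - (u x - v j x)) + sqnorm M (\<lambda>x. (u x - v i x) - (-1) * (u x - v j x))
      = 2 * sqnorm M (\<lambda>x. u x - v i x) + 2 * sqnorm M (\<lambda>x. u x - v j x)"
      using sqnorm_diff[OF fL fL, of i 1 j] sqnorm_diff[OF fL fL, of i "-1" j] by simp
    moreover have "sqnorm M (\<lambda>x. (u x - v i x) - (-1) * (u x - v j x)) = 4 * sqnorm M (\<lambda>x. u x - 1/2 * (v i x + v j x))"
    proof -
      have "(cmod ((u x - v i x) - (-1) * (u x - v j x)))\<^sup>2 = 4 * (cmod (u x - 1/2 * (v i x + v j x)))\<^sup>2" for x
      proof -
        have "(u x - v i x) - (-1) * (u x - v j x) = 2 * (u x - 1/2 * (v i x + v j x))"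
          by (simp add: algebra_simps)
        then show ?thesis by (simp only: norm_mult power_mult_distrib) simp
      qed
      then show ?thesis unfolding sqnorm_def by simp
    qed
    moreover have "\<epsilon> i \<le> \<epsilon> j" using that by (simp add: \<epsilon>_def power_decreasing)
    ultimately have "sqnorm M (\<lambda>x. (u x - v i x) - (u x - v j x)) \<le> 4 * \<epsilon> j"
      using m_le[OF half] v(2)[of i] v(2)[of j] by linarith
    then show ?thesis by (simp add: \<epsilon>_def)
  qed
  obtain q where q: "q \<in> L2 M" "\<And>n. sqnorm M (\<lambda>x. q x - (u x - v n x)) \<le> (1/4) ^ n"
    using L2_complete[of "\<lambda>n x. u x - v n x", OF fL cauchy] by blast
  have pow: "(\<lambda>n. (1/4::real) ^ n * C) \<longlonglongrightarrow> 0" for C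
    using tendsto_mult_right[OF LIMSEQ_realpow_zero[of "1/4::real"], of C] by simp
  \<comment> \<open>Nearly minimal differences are nearly orthogonal to \<open>V\<close>: compare with the competitor
    \<open>v n + c w\<close>; the 1 added to \<open>sqnorm M w\<close> covers the case of norm 0.\<close>
  have orth: "(cmod (ip M (\<lambda>x. u x - v n x) w))\<^sup>2 \<le> \<epsilon> n * (sqnorm M w + 1)" if w: "w \<in> V" for n w
  proof -
    define I where "I = ip M (\<lambda>x. u x - v n x) w"
    define B where "B = sqnorm M w + 1"
    have B: "B > 0" "sqnorm M w \<le> B" using sqnorm_nonneg[of M w] by (auto simp: B_def)
    define c where "c = I / of_real B"
    have "(\<lambda>x. v n x + c * w x) \<in> V" by (intro V v w)
    from m_le[OF this] have "m \<le> sqnorm M (\<lambda>x. (u x - v n x) - c * w x)" by (simp add: algebra_simps)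
    also have "\<dots> = sqnorm M (\<lambda>x. u x - v n x) - 2 * Re (cnj c * I) + (cmod c)\<^sup>2 * sqnorm M w"
      unfolding I_def by (rule sqnorm_diff[OF fL vL[OF w]])
    also have "cnj c * I = of_real ((cmod I)\<^sup>2 / B)"
      unfolding c_def of_real_divide complex_norm_square by (simp add: mult_ac)
    also have "(cmod c)\<^sup>2 * sqnorm M w \<le> (cmod c)\<^sup>2 * B" using B by (intro mult_left_mono) auto
    also have "(cmod c)\<^sup>2 * B = (cmod I)\<^sup>2 / B"
      unfolding c_def using B by (simp add: norm_divide power_divide power2_eq_square)
    finally have "(cmod I)\<^sup>2 / B \<le> \<epsilon> n" using v(2)[of n] by (simp only: Re_complex_of_real) linarith
    then show ?thesis using B by (simp add: I_def B_def field_simps)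
  qed
  have qV: "ip M q w = 0" if w: "w \<in> V" for w
  proof -
    have "(cmod (ip M q w))\<^sup>2 \<le> (1/4) ^ n * (4 * (sqnorm M w + 1))" for n
    proof -
      have "ip M q w = ip M (\<lambda>x. q x - (u x - v n x)) w + ip M (\<lambda>x. u x - v n x) w"
        using ip_diff_left[OF q(1) fL vL[OF w]] by simp
      then have "(cmod (ip M q w))\<^sup>2 \<le> 2 * (cmod (ip M (\<lambda>x. q x - (u x - v n x)) w))\<^sup>2 + 2 * (cmod (ip M (\<lambda>x. u x - v n x) w))\<^sup>2"
        using cmod_add_sq_le by metis
      also have "(cmod (ip M (\<lambda>x. q x - (u x - v n x)) w))\<^sup>2 \<le> (1/4) ^ n * (sqnorm M w + 1)"
        using L2_Cauchy_Schwarz[OF L2_diff[OF q(1) fL] vL[OF w]]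
        by (rule order_trans) (intro mult_mono q(2), use sqnorm_nonneg in auto)
      also have "(cmod (ip M (\<lambda>x. u x - v n x) w))\<^sup>2 \<le> (1/4) ^ n * (sqnorm M w + 1)"
        using orth[OF w, of n] sqnorm_nonneg[of M w]
        by (rule_tac order_trans) (assumption, intro mult_right_mono, auto simp: \<epsilon>_def)
      finally show ?thesis by (simp add: algebra_simps)
    qed
    then have "(cmod (ip M q w))\<^sup>2 \<le> 0" by (intro LIMSEQ_le_const[OF pow]) blast
    then show ?thesis by simp
  qed
  from perp[OF q(1) qV] have "ip M u q = 0" by simp
  moreover have "ip M (v n) q = 0" for n using qV[OF v(1)[of n]] ip_cnj[of M q "v n"] by simp
  ultimately have uq: "ip M (\<lambda>x. u x - v n x) q = 0" for n using ip_diff_left[OF u vL[OF v(1)] q(1)] by simp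
  have "(sqnorm M q)\<^sup>2 \<le> (1/4) ^ n * sqnorm M q" for n
  proof -
    have "of_real (sqnorm M q) = ip M (\<lambda>x. q x - (u x - v n x)) q"
      using ip_diff_left[OF q(1) fL q(1)] uq ip_self[OF q(1)] by simp
    then have "(sqnorm M q)\<^sup>2 = (cmod (ip M (\<lambda>x. q x - (u x - v n x)) q))\<^sup>2"
      by (metis norm_of_real power2_abs)
    also have "\<dots> \<le> sqnorm M (\<lambda>x. q x - (u x - v n x)) * sqnorm M q"
      by (rule L2_Cauchy_Schwarz[OF L2_diff[OF q(1) fL] q(1)])
    also have "\<dots> \<le> (1/4) ^ n * sqnorm M q" by (intro mult_right_mono q(2) sqnorm_nonneg)
    finally show ?thesis .
  qed
  then have "(sqnorm M q)\<^sup>2 \<le> 0" by (intro LIMSEQ_le_const[OF pow]) blast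
  then have q0: "sqnorm M q = 0" by simp
  have "sqnorm M (\<lambda>x. u x - v n x) \<le> (1/4) ^ n * 2" for n
  proof -
    have "sqnorm M (\<lambda>x. u x - v n x) = sqnorm M (\<lambda>x. - 1 * (q x - (u x - v n x)) + q x)"
      by (simp add: algebra_simps)
    also have "\<dots> \<le> 2 * sqnorm M (\<lambda>x. - 1 * (q x - (u x - v n x))) + 2 * sqnorm M q"
      by (rule sqnorm_triangle[OF L2_cmult[OF L2_diff[OF q(1) fL]] q(1)])
    also have "sqnorm M (\<lambda>x. - 1 * (q x - (u x - v n x))) = sqnorm M (\<lambda>x. q x - (u x - v n x))"
      unfolding sqnorm_def norm_mult by simp
    finally show ?thesis using q(2)[of n] q0 by simp
  qed
  then have "(\<lambda>n. sqnorm M (\<lambda>x. u x - v n x)) \<longlonglongrightarrow> 0"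
    by (intro Lim_null_comparison[OF always_eventually pow[of 2]]) (simp add: sqnorm_nonneg)
  then show ?thesis using v(1) by blast
qed

section \<open>Mollification and Weyl's lemma\<close>

definition mollifier :: "real \<Rightarrow> complex \<Rightarrow> complex" where
  "mollifier e w = bump 3 (of_real (1 / e) * w) / of_real (bump_mass * e\<^sup>2)"

lemma mollifier_minus [simp]: "mollifier e (- w) = mollifier e w"
  by (simp add: mollifier_def)

lemma mollifier_commute: "mollifier e (z - w) = mollifier e (w - z)"
  using mollifier_minus[of e "z - w"] by simp

lemma mollifier_eq_0: "e > 0 \<Longrightarrow> e \<le> cmod w \<Longrightarrow> mollifier e w = 0"
  unfolding mollifier_def by (subst bump_eq_0) (auto simp: norm_mult norm_divide field_simps)

lemma mollifier_vanish: "e > 0 \<Longrightarrow> w \<notin> cball 0 e \<Longrightarrow> mollifier e w = 0"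
  by (rule mollifier_eq_0) auto

lemma mollifier_real_nonneg: "\<exists>t\<ge>0. mollifier e w = of_real t"
proof -
  have "mollifier e w = of_real (max 0 (1 - (cmod (of_real (1 / e) * w))\<^sup>2) ^ 3 / (bump_mass * e\<^sup>2))"
    by (simp add: mollifier_def bump_def)
  moreover have "0 \<le> max 0 (1 - (cmod (of_real (1 / e) * w))\<^sup>2) ^ 3 / (bump_mass * e\<^sup>2)"
    using bump_mass_pos by (intro divide_nonneg_nonneg) auto
  ultimately show ?thesis by blast
qed

lemma cnj_mollifier [simp]: "cnj (mollifier e w) = mollifier e w"
  using mollifier_real_nonneg[of e w] by auto

lemma continuous_on_mollifier: "continuous_on UNIV (mollifier e)"
  unfolding mollifier_def divide_inverse by (intro continuous_intros)

text \<open>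
  The derivative with respect to \<open>cnj w\<close> is spelled out because it is the kernel that Weyl's lemma
  is tested with.
\<close>

lemma mollifier_C2w_ex:
  obtains a aa c bb where "C2w UNIV (mollifier e) a
    (\<lambda>w. - 3 * of_real (1 / e) * (of_real (1 / e) * w) * bump 2 (of_real (1 / e) * w) / of_real (bump_mass * e\<^sup>2)) aa c bb"
proof -
  define K where "K = inverse (complex_of_real (bump_mass * e\<^sup>2))"
  let ?c = "complex_of_real (1 / e)"
  have aff: "C1w UNIV (\<lambda>w. K * f (?c * w)) (\<lambda>w. K * (?c * a (?c * w))) (\<lambda>w. K * (?c * b (?c * w)))"
    if "C1w UNIV f a b" for f a b
    using C1w_cmult[OF C1w_affine[OF that, of 0 ?c], of K] by simp
  have aff': "C1w UNIV (\<lambda>w. K * (?c * f (?c * w))) (\<lambda>w. K * (?c * (?c * a (?c * w)))) (\<lambda>w. K * (?c * (?c * b (?c * w))))"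
    if "C1w UNIV f a b" for f a b
    using C1w_cmult[OF aff[OF that], of ?c] by (simp only: mult.left_commute)
  from C2w_bump3 have 1: "C1w UNIV (bump 3) (\<lambda>z. - 3 * cnj z * bump 2 z) (\<lambda>z. - 3 * z * bump 2 z)"
    "C1w UNIV (\<lambda>z. - 3 * cnj z * bump 2 z) (\<lambda>z. 6 * cnj z * cnj z * bump 1 z) (\<lambda>z. 6 * z * cnj z * bump 1 z - 3 * bump 2 z)"
    "C1w UNIV (\<lambda>z. - 3 * z * bump 2 z) (\<lambda>z. 6 * z * cnj z * bump 1 z - 3 * bump 2 z) (\<lambda>z. 6 * z * z * bump 1 z)"
    by (auto simp: C2w_def)
  have m: "mollifier e = (\<lambda>w. K * bump 3 (?c * w))"
    by (simp add: mollifier_def K_def fun_eq_iff divide_inverse mult.commute)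
  have b: "(\<lambda>w. K * (?c * (- 3 * (?c * w) * bump 2 (?c * w)))) =
    (\<lambda>w. - 3 * ?c * (?c * w) * bump 2 (?c * w) / of_real (bump_mass * e\<^sup>2))"
    by (simp add: K_def fun_eq_iff divide_inverse mult_ac)
  have "C2w UNIV (mollifier e) (\<lambda>w. K * (?c * (- 3 * cnj (?c * w) * bump 2 (?c * w))))
     (\<lambda>w. - 3 * ?c * (?c * w) * bump 2 (?c * w) / of_real (bump_mass * e\<^sup>2))
     (\<lambda>w. K * (?c * (?c * (6 * cnj (?c * w) * cnj (?c * w) * bump 1 (?c * w)))))
     (\<lambda>w. K * (?c * (?c * (6 * (?c * w) * cnj (?c * w) * bump 1 (?c * w) - 3 * bump 2 (?c * w)))))
     (\<lambda>w. K * (?c * (?c * (6 * (?c * w) * (?c * w) * bump 1 (?c * w)))))"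
    unfolding m b[symmetric] C2w_def
    by (intro conjI aff[OF 1(1)] aff'[OF 1(2)] aff'[OF 1(3)])
  then show ?thesis by (rule that)
qed

lemma mollifier_bounded: "e > 0 \<Longrightarrow> \<exists>L. \<forall>w. cmod (mollifier e w) \<le> L"
proof -
  have "cmod (mollifier e w) \<le> 1 / (bump_mass * e\<^sup>2)" for w
    using bump_norm_le[of 3] bump_mass_pos
    by (simp add: mollifier_def norm_divide norm_mult norm_power divide_right_mono del: of_real_mult)
  then show ?thesis by blast
qed

text \<open>
  The substitution that makes the mollified function a mean value over the unit disc, to which the
  mean value theorems apply.
\<close>

lemma integral_mollifier_affine:
  fixes F :: "complex \<Rightarrow> complex"
  assumes e: "e > 0" and m: "(\<lambda>y. mollifier e (y - z) * F y) \<in> borel_measurable borel"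
  shows "(\<integral>y. mollifier e (y - z) * F y \<partial>lborel) = (\<integral>w. bump 3 w * F (z + of_real e * w) \<partial>lborel) / of_real bump_mass"
proof -
  have "(\<integral>y. mollifier e (y - z) * F y \<partial>lborel) =
     of_real (e\<^sup>2) * (\<integral>w. mollifier e (z + of_real e * w - z) * F (z + of_real e * w) \<partial>lborel)"
    by (rule lborel_integral_affine[where ?'a = complex, unfolded scaleR_conv_of_real, OF _ m]) (use e in simp)
  also have "(\<lambda>w. mollifier e (z + of_real e * w - z) * F (z + of_real e * w))
     = (\<lambda>w. (bump 3 w * F (z + of_real e * w)) / of_real (bump_mass * e\<^sup>2))"
    using e by (auto simp: mollifier_def fun_eq_iff)
  also have "of_real (e\<^sup>2) * (\<integral>w. (bump 3 w * F (z + of_real e * w)) / of_real (bump_mass * e\<^sup>2) \<partial>lborel)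
     = (\<integral>w. bump 3 w * F (z + of_real e * w) \<partial>lborel) / of_real bump_mass"
    unfolding Bochner_Integration.integral_divide_zero using e by simp
  finally show ?thesis .
qed

lemma integral_mollifier: "e > 0 \<Longrightarrow> (\<integral>y. mollifier e (y - z) \<partial>lborel) = 1"
proof -
  assume e: "e > 0"
  have "continuous_on UNIV (\<lambda>y. mollifier e (y - z) * 1)"
    by (intro continuous_intros continuous_on_compose2[OF continuous_on_mollifier]) auto
  from integral_mollifier_affine[OF e borel_measurable_continuous_onI[OF this]] show ?thesis
    using integral_bump3 bump_mass_pos by simp
qed

lemma integrable_mollifier: "e > 0 \<Longrightarrow> integrable lborel (\<lambda>y. mollifier e (y - z))"
proof (rule integrable_compact_support[of _ "cball z e"])
  show "continuous_on UNIV (\<lambda>y. mollifier e (y - z))"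
    by (intro continuous_intros continuous_on_compose2[OF continuous_on_mollifier]) auto
  show "e > 0 \<Longrightarrow> y \<notin> cball z e \<Longrightarrow> mollifier e (y - z) = 0" for y
    by (intro mollifier_eq_0) (auto simp: dist_norm norm_minus_commute)
qed simp

lemma mollifier_tendsto:
  assumes \<psi>: "continuous_on UNIV \<psi>" "\<And>z. cmod (\<psi> z) \<le> B"
  shows "(\<lambda>n. \<integral>z. \<psi> z * mollifier (1 / real (Suc n)) (z - w) \<partial>lborel) \<longlonglongrightarrow> \<psi> w"
proof -
  have c\<psi>: "isCont \<psi> x" for x using \<psi>(1) by (simp add: continuous_on_eq_continuous_at)
  have eq: "(\<integral>z. \<psi> z * mollifier e (z - w) \<partial>lborel) = (\<integral>u. bump 3 u * \<psi> (w + of_real e * u) \<partial>lborel) / of_real bump_mass"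
    if "e > 0" for e
  proof -
    have "continuous_on UNIV (\<lambda>y. mollifier e (y - w) * \<psi> y)"
      by (intro continuous_intros continuous_on_compose2[OF continuous_on_mollifier] \<psi>) auto
    from integral_mollifier_affine[OF that borel_measurable_continuous_onI[OF this]]
    show ?thesis by (simp add: mult.commute)
  qed
  have "(\<lambda>n. \<integral>u. bump 3 u * \<psi> (w + of_real (1 / real (Suc n)) * u) \<partial>lborel) \<longlonglongrightarrow> (\<integral>u. bump 3 u * \<psi> w \<partial>lborel)"
  proof (rule integral_dominated_convergence[where w = "\<lambda>u. cmod (bump 3 u) * B"])
    have "continuous_on UNIV (\<lambda>u. bump 3 u * \<psi> (w + c * u))" for c
      by (intro continuous_intros continuous_on_bump[where f = "\<lambda>x. x"] continuous_on_compose2[OF \<psi>(1)]) auto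
    then show "(\<lambda>u. bump 3 u * \<psi> (w + of_real (1 / real (Suc n)) * u)) \<in> borel_measurable lborel" for n
      unfolding measurable_lborel2 by (intro borel_measurable_continuous_onI)
    show "(\<lambda>u. bump 3 u * \<psi> w) \<in> borel_measurable lborel"
      using integrable_bump[of 3] by simp
    show "integrable lborel (\<lambda>u. cmod (bump 3 u) * B)" using integrable_bump[of 3] by simp
    show "AE u in lborel. norm (bump 3 u * \<psi> (w + of_real (1 / real (Suc n)) * u)) \<le> cmod (bump 3 u) * B" for n
      using \<psi>(2) by (simp add: norm_mult mult_left_mono)
    show "AE u in lborel. (\<lambda>n. bump 3 u * \<psi> (w + of_real (1 / real (Suc n)) * u)) \<longlonglongrightarrow> bump 3 u * \<psi> w"
    proof (rule AE_I2)
      fix u :: complex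
      have "(\<lambda>n. 1 / real (Suc n)) \<longlonglongrightarrow> 0" using LIMSEQ_inverse_real_of_nat by (simp only: inverse_eq_divide)
      then have "(\<lambda>n. w + of_real (1 / real (Suc n)) * u) \<longlonglongrightarrow> w + of_real 0 * u"
        by (intro tendsto_intros)
      then have "(\<lambda>n. \<psi> (w + of_real (1 / real (Suc n)) * u)) \<longlonglongrightarrow> \<psi> w"
        by (intro isCont_tendsto_compose[OF c\<psi>]) simp
      then show "(\<lambda>n. bump 3 u * \<psi> (w + of_real (1 / real (Suc n)) * u)) \<longlonglongrightarrow> bump 3 u * \<psi> w"
        by (intro tendsto_intros)
    qed
  qed
  then have "(\<lambda>n. (\<integral>u. bump 3 u * \<psi> (w + of_real (1 / real (Suc n)) * u) \<partial>lborel) / of_real bump_mass)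
      \<longlonglongrightarrow> (\<integral>u. bump 3 u * \<psi> w \<partial>lborel) / of_real bump_mass"
    by (intro tendsto_intros) (use bump_mass_pos in auto)
  also have "(\<integral>u. bump 3 u * \<psi> w \<partial>lborel) / of_real bump_mass = \<psi> w"
    using integral_bump3 bump_mass_pos by simp
  finally show ?thesis by (subst eq) simp_all
qed

lemma mollifier_average_bound:
  assumes e: "e > 0" and g: "integrable lborel g" and le: "\<And>w. cmod (w - z) < e \<Longrightarrow> cmod (g w) \<le> c" and c: "0 \<le> c"
  shows "cmod (\<integral>w. g w * mollifier e (z - w) \<partial>lborel) \<le> c"
proof -
  obtain L where L: "\<And>w. cmod (mollifier e w) \<le> L" using mollifier_bounded[OF e] by blast
  have nm: "complex_of_real (cmod (mollifier e u)) = mollifier e u" for u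
    using mollifier_real_nonneg[of e u] by auto
  have i: "integrable lborel (\<lambda>w. cmod (mollifier e (w - z)))" using integrable_mollifier[OF e] by simp
  have "complex_of_real (\<integral>w. cmod (mollifier e (w - z)) \<partial>lborel) = (\<integral>w. mollifier e (w - z) \<partial>lborel)"
    using integral_of_real[OF i, where ?'a = complex] unfolding nm by simp
  then have one: "(\<integral>w. cmod (mollifier e (w - z)) \<partial>lborel) = 1"
    using integral_mollifier[OF e] by (metis of_real_eq_1_iff)
  have "cmod (\<integral>w. g w * mollifier e (z - w) \<partial>lborel) \<le> (\<integral>w. c * cmod (mollifier e (w - z)) \<partial>lborel)"
  proof (rule Bochner_Integration.integral_norm_bound_integral)
    show "integrable lborel (\<lambda>w. g w * mollifier e (z - w))" by (rule convolution_integrable[OF g continuous_on_mollifier L])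
    show "integrable lborel (\<lambda>w. c * cmod (mollifier e (w - z)))" using i by simp
    fix w
    show "norm (g w * mollifier e (z - w)) \<le> c * cmod (mollifier e (w - z))"
    proof (cases "cmod (w - z) < e")
      case True
      then show ?thesis unfolding norm_mult mollifier_commute[of e z w] by (intro mult_right_mono le) auto
    next
      case False
      then have "mollifier e (w - z) = 0" by (intro mollifier_eq_0 e) simp
      then show ?thesis using c by (simp add: mollifier_commute[of e z w])
    qed
  qed
  also have "\<dots> = c" using one by simp
  finally show ?thesis .
qed

lemma mollifier_average_const: "e > 0 \<Longrightarrow> (\<integral>w. c * mollifier e (z - w) \<partial>lborel) = c"
  using integral_mollifier[of e z] by (simp add: mollifier_commute[of e z])

text \<open>
  The reflection \<open>y \<mapsto> z + w - y\<close> exchanges the two factors.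
\<close>

lemma mollifier_convolution_commute:
  "(\<integral>y. mollifier d (y - z) * mollifier e (y - w) \<partial>lborel) = (\<integral>y. mollifier e (y - z) * mollifier d (y - w) \<partial>lborel)"
proof -
  have "continuous_on UNIV (\<lambda>y. mollifier d (y - z) * mollifier e (y - w))"
    by (intro continuous_intros continuous_on_compose2[OF continuous_on_mollifier]) auto
  from lborel_integral_affine[OF _ borel_measurable_continuous_onI[OF this], of "-1" "z + w"]
  have "(\<integral>y. mollifier d (y - z) * mollifier e (y - w) \<partial>lborel) = (\<integral>y. mollifier d (w - y) * mollifier e (z - y) \<partial>lborel)"
    by (simp add: algebra_simps)
  also have "\<dots> = (\<integral>y. mollifier e (y - z) * mollifier d (y - w) \<partial>lborel)"
    by (simp add: mollifier_commute[of _ w] mollifier_commute[of _ z] mult.commute)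
  finally show ?thesis .
qed

text \<open>
  The kernel in \<open>weak\<close> is, up to a constant factor, the derivative of \<open>mollifier e (z - w)\<close> with
  respect to \<open>cnj z\<close>.  The hypothesis therefore says that the mollifications \<open>V e\<close> of \<open>v\<close> are
  holomorphic.  A holomorphic function equals its own mollification, so
  \<open>V e = V d * mollifier e = V e * mollifier d = V d\<close> (with \<open>*\<close> for convolution), that is, all \<open>V e\<close>
  coincide where they are defined.  Their common value is \<open>h\<close>; as \<open>e\<close> tends to 0, \<open>V e\<close> tends to
  \<open>v\<close> when tested against a continuous function.
\<close>

lemma Weyl_lemma:
  fixes v :: "complex \<Rightarrow> complex"
  assumes v: "\<And>R. R < 1 \<Longrightarrow> integrable lborel (\<lambda>w. indicator (cball 0 R) w *\<^sub>R v w)"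
    and weak: "\<And>z e. e > 0 \<Longrightarrow> cmod z + e < 1 \<Longrightarrow>
        (\<integral>w. v w * ((z - w) * bump 2 (of_real (1 / e) * (z - w))) \<partial>lborel) = 0"
  obtains h where "h holomorphic_on ball 0 1"
    "\<And>\<psi> R. continuous_on UNIV \<psi> \<Longrightarrow> R < 1 \<Longrightarrow> (\<And>z. z \<notin> cball 0 R \<Longrightarrow> \<psi> z = 0) \<Longrightarrow>
      (\<integral>z. v z * \<psi> z \<partial>lborel) = (\<integral>z. h z * \<psi> z \<partial>lborel)"
proof -
  define f where "f R w = indicator (cball 0 R) w *\<^sub>R v w" for R :: real and w
  define F where "F R e z = (\<integral>w. f R w * mollifier e (z - w) \<partial>lborel)" for R e z
  define V where "V e z = (\<integral>w. v w * mollifier e (z - w) \<partial>lborel)" for e z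
  have fi: "integrable lborel (f R)" if "R < 1" for R using v[OF that] by (simp add: f_def[abs_def])
  have out: "e \<le> cmod (z - w)" if "cmod z + e \<le> R" "w \<notin> cball 0 R" for z w :: complex and e R :: real
    using norm_triangle_ineq2[of w z] that by (simp add: norm_minus_commute)
  have FV: "F R e z = V e z" if "e > 0" "cmod z + e \<le> R" for R e z
  proof -
    have "f R w * mollifier e (z - w) = v w * mollifier e (z - w)" for w
      using mollifier_eq_0[OF that(1) out[OF that(2)], of w] by (cases "w \<in> cball 0 R") (auto simp: f_def)
    then show ?thesis by (simp only: F_def V_def)
  qed
  have Fcont: "continuous_on UNIV (F R e)" and Fhol: "F R e holomorphic_on ball 0 (R - e)"
    if R: "R < 1" and e: "e > 0" for R e
  proof -
    obtain a aa c bb where k: "C2w UNIV (mollifier e) a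
      (\<lambda>w. - 3 * of_real (1 / e) * (of_real (1 / e) * w) * bump 2 (of_real (1 / e) * w) / of_real (bump_mass * e\<^sup>2)) aa c bb"
      (is "C2w _ _ _ ?b _ _ _") by (rule mollifier_C2w_ex)
    have k1: "C1w UNIV (mollifier e) a ?b" using k by (simp only: C2w_def)
    have C: "C1w UNIV (F R e) (\<lambda>z. \<integral>w. f R w * a (z - w) \<partial>lborel) (\<lambda>z. \<integral>w. f R w * ?b (z - w) \<partial>lborel)"
      unfolding F_def[abs_def] by (rule C1w_convolution[OF fi[OF R] k1 compact_cball mollifier_vanish[OF e]])
    show "continuous_on UNIV (F R e)" by (rule C1w_continuous[OF C])
    show "F R e holomorphic_on ball 0 (R - e)"
    proof (rule C1w_imp_holomorphic[OF C1w_subset[OF C] open_ball])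
      fix z :: complex assume "z \<in> ball 0 (R - e)"
      then have z: "cmod z + e \<le> R" "cmod z + e < 1" using R by auto
      define K where "K = - 3 * complex_of_real (1 / e) * of_real (1 / e) / of_real (bump_mass * e\<^sup>2)"
      have "f R w * ?b (z - w) = K * (v w * ((z - w) * bump 2 (of_real (1 / e) * (z - w))))" for w
      proof (cases "w \<in> cball 0 R")
        case True then show ?thesis by (simp add: f_def K_def)
      next
        case False
        from out[OF z(1) this] have "bump 2 (of_real (1 / e) * (z - w)) = 0"
          using e by (intro bump_eq_0) (auto simp: norm_mult norm_divide field_simps)
        then show ?thesis by simp
      qed
      then show "(\<integral>w. f R w * ?b (z - w) \<partial>lborel) = 0"
        using weak[OF e z(2)] by (simp only: integral_mult_right_zero mult_zero_right)
    qed simp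
  qed
  \<comment> \<open>\<open>V e\<close>, being holomorphic, is equal to its own mollification; Fubini's theorem moves the
    second mollifier to the first one.\<close>
  have step: "V e z = (\<integral>w. f R w * (\<integral>y. mollifier d (y - z) * mollifier e (y - w) \<partial>lborel) \<partial>lborel)"
    if d: "d > 0" and e: "e > 0" and R: "cmod z + e + d < R" "R < 1" for d e z R
  proof -
    have hol: "F R e holomorphic_on ball z (R - e - cmod z)"
    proof (rule holomorphic_on_subset[OF Fhol[OF R(2) e]], rule subsetI)
      fix y assume "y \<in> ball z (R - e - cmod z)"
      then show "y \<in> ball 0 (R - e)" using norm_triangle_ineq2[of y z] by (simp add: dist_norm norm_minus_commute)
    qed
    have c: "continuous_on UNIV (\<lambda>y. mollifier d (y - z) * F R e y)"
      by (intro continuous_intros Fcont R e continuous_on_compose2[OF continuous_on_mollifier]) auto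
    have "V e z = F R e z" using FV[OF e, of z R] d R by simp
    also have "\<dots> = (\<integral>w. bump 3 w * F R e (z + of_real d * w) \<partial>lborel) / of_real bump_mass"
      using holomorphic_mean_value[OF hol, of d] d R bump_mass_pos by simp
    also have "\<dots> = (\<integral>y. mollifier d (y - z) * F R e y \<partial>lborel)"
      by (rule integral_mollifier_affine[symmetric, OF d borel_measurable_continuous_onI[OF c]])
    also have "\<dots> = (\<integral>w. f R w * (\<integral>y. mollifier d (y - z) * mollifier e (y - w) \<partial>lborel) \<partial>lborel)"
    proof -
      obtain L where "\<And>w. cmod (mollifier e w) \<le> L" using mollifier_bounded[OF e] by blast
      from convolution_Fubini[OF fi[OF R(2)] integrable_mollifier[OF d] continuous_on_mollifier this]
      show ?thesis unfolding F_def .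
    qed
    finally show ?thesis .
  qed
  have V_eq: "V e z = V d z" if "d > 0" "e > 0" "cmod z + e + d < 1" for d e z
  proof -
    from dense[OF that(3)] obtain R where R: "cmod z + e + d < R" "R < 1" by blast
    have "V e z = (\<integral>w. f R w * (\<integral>y. mollifier d (y - z) * mollifier e (y - w) \<partial>lborel) \<partial>lborel)"
      by (rule step) (use that R in auto)
    also have "\<dots> = (\<integral>w. f R w * (\<integral>y. mollifier e (y - z) * mollifier d (y - w) \<partial>lborel) \<partial>lborel)"
      by (subst mollifier_convolution_commute) (rule refl)
    also have "\<dots> = V d z"
      by (rule step[symmetric]) (use that R in auto)
    finally show ?thesis .
  qed
  define h where "h z = V ((1 - cmod z) / 3) z" for z
  have hV: "h z = V e z" if "e > 0" "e < 2 / 3 * (1 - cmod z)" for e z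
    unfolding h_def by (rule V_eq) (use that in \<open>auto simp: field_simps\<close>)
  have hol: "h holomorphic_on ball 0 1"
    unfolding holomorphic_on_def
  proof
    fix z0 :: complex assume z0: "z0 \<in> ball 0 1"
    define e where "e = (1 - cmod z0) / 3"
    have e: "e > 0" "cmod z0 = 1 - 3 * e" using z0 by (auto simp: e_def field_simps)
    have nz: "cmod z < 1 - 5 / 2 * e" if "z \<in> ball z0 (e / 2)" for z
      using norm_triangle_ineq2[of z z0] that e by (simp add: dist_norm norm_minus_commute)
    have "F (1 - e) e holomorphic_on ball z0 (e / 2)"
    proof (rule holomorphic_on_subset[OF Fhol])
      show "ball z0 (e / 2) \<subseteq> ball 0 (1 - e - e)"
      proof
        fix z assume "z \<in> ball z0 (e / 2)"
        then show "z \<in> ball 0 (1 - e - e)" using nz[of z] e(1) by simp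
      qed
    qed (use e in auto)
    moreover have "F (1 - e) e z = h z" if "z \<in> ball z0 (e / 2)" for z
      using FV[OF e(1), of z "1 - e"] hV[OF e(1), of z] nz[OF that] e(1) by simp
    ultimately have "h holomorphic_on ball z0 (e / 2)" by (rule holomorphic_transform)
    then have "h field_differentiable at z0"
      using e(1) by (intro holomorphic_on_imp_differentiable_at[of _ "ball z0 (e / 2)"]) auto
    then show "h field_differentiable at z0 within ball 0 1" by (rule field_differentiable_at_within)
  qed
  show ?thesis
  proof (rule that[OF hol])
    fix \<psi> :: "complex \<Rightarrow> complex" and R :: real
    assume \<psi>: "continuous_on UNIV \<psi>" "\<And>z. z \<notin> cball 0 R \<Longrightarrow> \<psi> z = 0" and R: "R < 1"
    define R' where "R' = (1 + R) / 2"
    have R': "R < R'" "R' < 1" using R by (auto simp: R'_def)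
    have "compact (\<psi> ` cball 0 R)" by (rule compact_continuous_image[OF continuous_on_subset[OF \<psi>(1)]]) auto
    then obtain B0 where B0: "\<And>y. y \<in> \<psi> ` cball 0 R \<Longrightarrow> norm y \<le> B0"
      using compact_imp_bounded bounded_iff by metis
    define B where "B = max 0 B0"
    have B: "cmod (\<psi> z) \<le> B" for z
    proof (cases "z \<in> cball 0 R")
      case True then show ?thesis using B0[OF imageI, of z] by (simp add: B_def)
    next
      case False then show ?thesis using \<psi>(2)[of z] by (simp add: B_def)
    qed
    have \<psi>i: "integrable lborel \<psi>" by (rule integrable_compact_support[OF \<psi>(1) compact_cball \<psi>(2)])
    define G where "G n w = (\<integral>z. \<psi> z * mollifier (1 / real (Suc n)) (z - w) \<partial>lborel)" for n w
    have lim: "(\<lambda>n. \<integral>w. f R' w * G n w \<partial>lborel) \<longlonglongrightarrow> (\<integral>w. f R' w * \<psi> w \<partial>lborel)"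
    proof (rule integral_dominated_convergence[where w = "\<lambda>w. cmod (f R' w) * B"])
      have fm: "f R' \<in> borel_measurable lborel" using fi[OF R'(2)] by simp
      show "(\<lambda>w. f R' w * \<psi> w) \<in> borel_measurable lborel"
        using fm \<psi>i by (intro borel_measurable_times) auto
      show "(\<lambda>w. f R' w * G n w) \<in> borel_measurable lborel" for n
      proof -
        obtain L where "\<And>w. cmod (mollifier (1 / real (Suc n)) w) \<le> L" using mollifier_bounded[of "1 / real (Suc n)"] by auto
        from convolution_continuous[OF \<psi>i continuous_on_mollifier this]
        have "continuous_on UNIV (G n)" unfolding G_def mollifier_commute[of "1 / real (Suc n)"] .
        then show ?thesis using fm by (intro borel_measurable_times) (auto intro: borel_measurable_continuous_onI)
      qed
      show "integrable lborel (\<lambda>w. cmod (f R' w) * B)" using fi[OF R'(2)] by simp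
      show "AE w in lborel. (\<lambda>n. f R' w * G n w) \<longlonglongrightarrow> f R' w * \<psi> w"
        unfolding G_def using mollifier_tendsto[OF \<psi>(1) B] by (intro AE_I2 tendsto_intros)
      have "cmod (G n w) \<le> B" for n w
        unfolding G_def mollifier_commute[of "1 / real (Suc n)" _ w]
        by (rule mollifier_average_bound[OF _ \<psi>i B]) (simp_all add: B_def)
      then show "AE w in lborel. norm (f R' w * G n w) \<le> cmod (f R' w) * B" for n
        by (simp add: norm_mult mult_left_mono)
    qed
    have ev: "eventually (\<lambda>n. (\<integral>w. f R' w * G n w \<partial>lborel) = (\<integral>z. h z * \<psi> z \<partial>lborel)) sequentially"
    proof -
      have "(\<lambda>n. 1 / real (Suc n)) \<longlonglongrightarrow> 0" using LIMSEQ_inverse_real_of_nat by (simp only: inverse_eq_divide)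
      then have "eventually (\<lambda>n. 1 / real (Suc n) < (1 - R) / 2) sequentially"
        by (rule order_tendstoD) (use R in simp)
      then show ?thesis
      proof eventually_elim
        case (elim n)
        define e where "e = 1 / real (Suc n)"
        have e: "e > 0" "e < (1 - R) / 2" using elim by (auto simp: e_def)
        obtain L where L: "\<And>w. cmod (mollifier e w) \<le> L" using mollifier_bounded[OF e(1)] by blast
        have "h z * \<psi> z = \<psi> z * F R' e z" for z
        proof (cases "z \<in> cball 0 R")
          case True
          then have "cmod z \<le> R" by simp
          then have "h z = V e z" "F R' e z = V e z"
            using e R by (auto intro!: hV FV simp: R'_def field_simps)
          then show ?thesis by simp
        next
          case False then show ?thesis using \<psi>(2) by simp
        qed
        then have "(\<integral>z. h z * \<psi> z \<partial>lborel) = (\<integral>z. \<psi> z * F R' e z \<partial>lborel)" by (simp only:)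
        also have "\<dots> = (\<integral>w. f R' w * (\<integral>z. \<psi> z * mollifier e (z - w) \<partial>lborel) \<partial>lborel)"
          unfolding F_def by (rule convolution_Fubini[OF fi[OF R'(2)] \<psi>i continuous_on_mollifier L])
        finally show ?case by (simp add: G_def e_def)
      qed
    qed
    have "(\<lambda>n. \<integral>w. f R' w * G n w \<partial>lborel) \<longlonglongrightarrow> (\<integral>z. h z * \<psi> z \<partial>lborel)"
      by (rule tendsto_eventually[OF ev])
    from LIMSEQ_unique[OF lim this] have "(\<integral>w. f R' w * \<psi> w \<partial>lborel) = (\<integral>z. h z * \<psi> z \<partial>lborel)" .
    moreover have "f R' w * \<psi> w = v w * \<psi> w" for w
    proof (cases "w \<in> cball 0 R'")
      case False
      then have "w \<notin> cball 0 R" using R'(1) by auto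
      then show ?thesis using \<psi>(2) by simp
    qed (simp add: f_def)
    ultimately show "(\<integral>z. v z * \<psi> z \<partial>lborel) = (\<integral>z. h z * \<psi> z \<partial>lborel)" by (simp only:)
  qed
qed

section \<open>Second derivatives of the weight\<close>

text \<open>
  The second difference in the directions \<open>u\<close> and \<open>v\<close> divided by \<open>t\<^sup>2\<close> tends to \<open>f'' v u\<close>: the
  mean value theorem for \<open>s \<mapsto> f (x + s u + t v) - f (x + s u)\<close> reduces it to a difference of first
  derivatives, to which differentiability of \<open>f'\<close> at the single point \<open>x\<close> applies.
\<close>

lemma mixed_difference:
  fixes f :: "complex \<Rightarrow> real" and f' :: "complex \<Rightarrow> complex \<Rightarrow>\<^sub>L real" and f'' :: "complex \<Rightarrow>\<^sub>L (complex \<Rightarrow>\<^sub>L real)"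
  assumes S: "open S" "x \<in> S"
    and f: "\<And>y. y \<in> S \<Longrightarrow> (f has_derivative f' y) (at y)"
    and f'': "(f' has_derivative f'') (at x)" and e: "e > 0"
  shows "\<exists>d>0. \<forall>t. 0 < t \<and> t < d \<longrightarrow>
    \<bar>f (x + t *\<^sub>R u + t *\<^sub>R v) - f (x + t *\<^sub>R u) - f (x + t *\<^sub>R v) + f x - t\<^sup>2 * f'' v u\<bar>
      \<le> e * t\<^sup>2 * (2 * (norm u + norm v) * norm u)"
proof -
  define N where "N = norm u + norm v + 1"
  have N: "N > 0" by (simp add: N_def add_nonneg_pos)
  obtain r where r: "r > 0" "ball x r \<subseteq> S" using S open_contains_ball by blast
  obtain d where d: "d > 0" "\<And>y. norm (y - x) < d \<Longrightarrow> norm (f' y - f' x - f'' (y - x)) \<le> e * norm (y - x)"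
    using f'' e unfolding has_derivative_at_alt by blast
  have "\<bar>f (x + t *\<^sub>R u + t *\<^sub>R v) - f (x + t *\<^sub>R u) - f (x + t *\<^sub>R v) + f x - t\<^sup>2 * f'' v u\<bar>
      \<le> e * t\<^sup>2 * (2 * (norm u + norm v) * norm u)" if t: "0 < t" "t < min r d / N" for t
  proof -
    have tN: "t * N < r" "t * N < d" using t N by (auto simp: field_simps)
    have near: "norm (s *\<^sub>R u + c *\<^sub>R v) \<le> t * (norm u + norm v)" "norm (s *\<^sub>R u + c *\<^sub>R v) < r" "norm (s *\<^sub>R u + c *\<^sub>R v) < d"
      if "0 \<le> s" "s \<le> t" "0 \<le> c" "c \<le> t" for s c
    proof -
      have "norm (s *\<^sub>R u + c *\<^sub>R v) \<le> s * norm u + c * norm v"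
        using norm_triangle_ineq[of "s *\<^sub>R u" "c *\<^sub>R v"] that by simp
      also have "\<dots> \<le> t * norm u + t * norm v" using that by (intro add_mono mult_right_mono) auto
      finally show 1: "norm (s *\<^sub>R u + c *\<^sub>R v) \<le> t * (norm u + norm v)" by (simp add: algebra_simps)
      also have "\<dots> \<le> t * N" using t by (simp add: N_def)
      finally show "norm (s *\<^sub>R u + c *\<^sub>R v) < r" "norm (s *\<^sub>R u + c *\<^sub>R v) < d" using tN by linarith+
    qed
    define h where "h s = f (x + s *\<^sub>R u + t *\<^sub>R v) - f (x + s *\<^sub>R u)" for s
    have mem: "x + s *\<^sub>R u + c *\<^sub>R v \<in> S" if "0 \<le> s" "s \<le> t" "0 \<le> c" "c \<le> t" for s c
    proof (rule subsetD[OF r(2)])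
      have "x + s *\<^sub>R u + c *\<^sub>R v = x + (s *\<^sub>R u + c *\<^sub>R v)" by simp
      then show "x + s *\<^sub>R u + c *\<^sub>R v \<in> ball x r"
        using near(2)[OF that] by (metis add_diff_cancel_left' dist_commute dist_norm mem_ball)
    qed
    have line: "((\<lambda>s. f (x + s *\<^sub>R u + c *\<^sub>R v)) has_real_derivative f' (x + s *\<^sub>R u + c *\<^sub>R v) u) (at s)"
      if "0 \<le> s" "s \<le> t" "0 \<le> c" "c \<le> t" for s c
    proof -
      have "((\<lambda>s. x + s *\<^sub>R u + c *\<^sub>R v) has_derivative (\<lambda>k. k *\<^sub>R u)) (at s)"
        by (auto intro!: derivative_eq_intros)
      from has_derivative_compose[OF this f[OF mem[OF that]]] show ?thesis
        unfolding has_field_derivative_def by (simp add: blinfun.scaleR_right mult_commute_abs)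
    qed
    have "(h has_real_derivative (f' (x + s *\<^sub>R u + t *\<^sub>R v) u - f' (x + s *\<^sub>R u) u)) (at s)" if "0 \<le> s" "s \<le> t" for s
      unfolding h_def using line[OF that, of t] line[OF that, of 0] t by (intro DERIV_diff) auto
    from MVT2[OF t(1) this] obtain \<xi> where \<xi>: "0 < \<xi>" "\<xi> < t"
      "h t - h 0 = (t - 0) * (f' (x + \<xi> *\<^sub>R u + t *\<^sub>R v) u - f' (x + \<xi> *\<^sub>R u) u)" by blast
    define g where "g c = f' (x + \<xi> *\<^sub>R u + c *\<^sub>R v) - f' x - f'' (\<xi> *\<^sub>R u + c *\<^sub>R v)" for c
    have g: "norm (g c) \<le> e * (t * (norm u + norm v))" if "0 \<le> c" "c \<le> t" for c
    proof -
      have "norm (g c) \<le> e * norm (\<xi> *\<^sub>R u + c *\<^sub>R v)"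
        using d(2)[of "x + \<xi> *\<^sub>R u + c *\<^sub>R v"] near(3)[of \<xi> c] \<xi> that by (simp add: g_def add.assoc)
      also have "\<dots> \<le> e * (t * (norm u + norm v))" using near(1)[of \<xi> c] \<xi> that e by (intro mult_left_mono) auto
      finally show ?thesis .
    qed
    have gd: "g t - g 0 = f' (x + \<xi> *\<^sub>R u + t *\<^sub>R v) - f' (x + \<xi> *\<^sub>R u) - t *\<^sub>R f'' v"
      by (simp add: g_def blinfun.add_right blinfun.scaleR_right)
    have "f (x + t *\<^sub>R u + t *\<^sub>R v) - f (x + t *\<^sub>R u) - f (x + t *\<^sub>R v) + f x = h t - h 0"
      by (simp add: h_def)
    also have "\<dots> - t\<^sup>2 * f'' v u = t * (g t - g 0) u"
      unfolding \<xi>(3) gd blinfun.diff_left blinfun.scaleR_left real_scaleR_def power2_eq_square by (simp add: algebra_simps)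
    finally have "\<bar>f (x + t *\<^sub>R u + t *\<^sub>R v) - f (x + t *\<^sub>R u) - f (x + t *\<^sub>R v) + f x - t\<^sup>2 * f'' v u\<bar> = t * \<bar>(g t - g 0) u\<bar>"
      using t(1) by (simp add: abs_mult)
    also have "\<bar>(g t - g 0) u\<bar> \<le> norm (g t - g 0) * norm u"
      using norm_blinfun[of "g t - g 0" u] by simp
    also have "norm (g t - g 0) \<le> e * (t * (norm u + norm v)) + e * (t * (norm u + norm v))"
      using norm_triangle_ineq4[of "g t" "g 0"] g[of t] g[of 0] t(1) by simp
    finally show ?thesis
      using t(1) by (simp add: mult_right_mono mult_left_mono power2_eq_square algebra_simps)
  qed
  moreover have "min r d / N > 0" using r d N by simp
  ultimately show ?thesis by blast
qed

text \<open>
  The second difference is symmetric in \<open>u\<close> and \<open>v\<close>.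
\<close>

lemma second_derivative_symmetric:
  fixes f :: "complex \<Rightarrow> real" and f' :: "complex \<Rightarrow> complex \<Rightarrow>\<^sub>L real" and f'' :: "complex \<Rightarrow>\<^sub>L (complex \<Rightarrow>\<^sub>L real)"
  assumes S: "open S" "x \<in> S"
    and f: "\<And>y. y \<in> S \<Longrightarrow> (f has_derivative f' y) (at y)"
    and f'': "(f' has_derivative f'') (at x)"
  shows "f'' u v = f'' v u"
proof -
  define C where "C = 2 * (norm u + norm v) * norm u + 2 * (norm v + norm u) * norm v"
  have "\<bar>f'' u v - f'' v u\<bar> \<le> e * C" if e: "e > 0" for e
  proof -
    obtain d1 where d1: "d1 > 0" "\<And>t. 0 < t \<and> t < d1 \<Longrightarrow>
      \<bar>f (x + t *\<^sub>R u + t *\<^sub>R v) - f (x + t *\<^sub>R u) - f (x + t *\<^sub>R v) + f x - t\<^sup>2 * f'' v u\<bar> \<le> e * t\<^sup>2 * (2 * (norm u + norm v) * norm u)"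
      using mixed_difference[OF S f f'' e] by blast
    obtain d2 where d2: "d2 > 0" "\<And>t. 0 < t \<and> t < d2 \<Longrightarrow>
      \<bar>f (x + t *\<^sub>R v + t *\<^sub>R u) - f (x + t *\<^sub>R v) - f (x + t *\<^sub>R u) + f x - t\<^sup>2 * f'' u v\<bar> \<le> e * t\<^sup>2 * (2 * (norm v + norm u) * norm v)"
      using mixed_difference[OF S f f'' e] by blast
    define t where "t = min d1 d2 / 2"
    have t: "0 < t" "t < d1" "t < d2" using d1(1) d2(1) by (auto simp: t_def)
    have comm: "x + t *\<^sub>R v + t *\<^sub>R u = x + t *\<^sub>R u + t *\<^sub>R v" by simp
    have "\<bar>t\<^sup>2 * f'' u v - t\<^sup>2 * f'' v u\<bar> \<le> e * t\<^sup>2 * (2 * (norm u + norm v) * norm u) + e * t\<^sup>2 * (2 * (norm v + norm u) * norm v)"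
      using d1(2)[of t] d2(2)[of t] t unfolding comm by linarith
    then have "t\<^sup>2 * \<bar>f'' u v - f'' v u\<bar> \<le> t\<^sup>2 * (e * C)"
      unfolding C_def right_diff_distrib[symmetric] abs_mult by (simp add: algebra_simps)
    then show ?thesis using t(1) by simp
  qed
  moreover have "C \<ge> 0" by (simp add: C_def)
  ultimately have "\<bar>f'' u v - f'' v u\<bar> \<le> 0 + e" if "e > 0" for e
  proof -
    assume *: "\<And>e. e > 0 \<Longrightarrow> \<bar>f'' u v - f'' v u\<bar> \<le> e * C" "C \<ge> 0"
    from *(1)[of "e / (C + 1)"] that *(2) have "\<bar>f'' u v - f'' v u\<bar> \<le> e / (C + 1) * C" by simp
    also have "\<dots> \<le> e" using *(2) that by (simp add: field_simps)
    finally show ?thesis by simp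
  qed
  then have "\<bar>f'' u v - f'' v u\<bar> \<le> 0" by (rule field_le_epsilon)
  then show ?thesis by simp
qed

text \<open>
  With \<open>p = \<partial>\<phi>/\<partial>z\<close>, the derivative of \<open>p\<close> with respect to \<open>cnj z\<close> is a quarter of the
  trace of the second derivative; its imaginary part is the difference of the mixed partial
  derivatives, which vanishes by symmetry.
\<close>

lemma C2_on_imp_wirtinger:
  assumes "C2_on disc \<phi>"
  obtains p pz where "C1w disc (\<lambda>z. of_real (\<phi> z)) p (\<lambda>z. cnj (p z))"
    "C1w disc p pz (\<lambda>z. of_real (laplacian \<phi> z / 4))"
proof -
  obtain f' f'' where f': "\<And>x. x \<in> disc \<Longrightarrow> (\<phi> has_derivative blinfun_apply (f' x)) (at x)"
    and f'': "\<And>x. x \<in> disc \<Longrightarrow> (f' has_derivative blinfun_apply (f'' x)) (at x)"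
    and cont: "continuous_on disc f''"
    using assms unfolding C2_on_def by blast
  have cont': "continuous_on disc f'"
    using f'' by (meson continuous_at_imp_continuous_on has_derivative_continuous)
  have sym: "f'' x u v = f'' x v u" if "x \<in> disc" for x u v
    by (rule second_derivative_symmetric[OF open_ball that f' f''[OF that]])
  define p where "p z = (of_real (f' z 1) - \<i> * of_real (f' z \<i>)) / 2" for z
  define L where "L z h = (complex_of_real (f'' z h 1) - \<i> * of_real (f'' z h \<i>)) / 2" for z h
  define pz where "pz z = (L z 1 - \<i> * L z \<i>) / 2" for z
  have 1: "C1w disc (\<lambda>z. of_real (\<phi> z)) p (\<lambda>z. cnj (p z))"
    unfolding C1w_def
  proof (intro conjI ballI)
    fix z assume z: "z \<in> disc"
    have "linear (\<lambda>h. complex_of_real (f' z h))"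
      by (rule linearI) (simp_all only: blinfun.add_right blinfun.scaleR_right of_real_add real_scaleR_def of_real_mult
          scaleR_conv_of_real[of _ "complex_of_real _"])
    note lin = wirtinger_real_linear[OF this]
    have "((\<lambda>z. complex_of_real (\<phi> z)) has_derivative (\<lambda>h. of_real (f' z h))) (at z)"
      by (rule has_derivative_of_real[OF f'[OF z]])
    moreover have "complex_of_real (f' z h) = p z * h + cnj (p z) * cnj h" for h
      using lin[of h] by (simp add: p_def)
    ultimately show "wirtinger (\<lambda>z. of_real (\<phi> z)) (p z) (cnj (p z)) z"
      unfolding wirtinger_def by simp
  next
    show "continuous_on disc p" unfolding p_def by (intro continuous_intros cont') auto
    then show "continuous_on disc (\<lambda>z. cnj (p z))" by (intro continuous_intros)
  qed
  \<comment> \<open>The Laplacian is defined by iterated derivatives along the coordinate lines, where the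
    inner derivative is known only near the point.\<close>
  have lap: "laplacian \<phi> z = f'' z 1 1 + f'' z \<i> \<i>" if z: "z \<in> disc" for z
  proof -
    have slice: "(deriv ^^ 2) (\<lambda>t. \<phi> (g t)) t0 = f'' z u u"
      if g: "\<And>t. (g has_derivative (\<lambda>k. k *\<^sub>R u)) (at t)" "g t0 = z" for g :: "real \<Rightarrow> complex" and t0 u
    proof -
      have gc: "continuous_on UNIV g" using g(1) has_derivative_continuous continuous_at_imp_continuous_on by blast
      have og: "open (g -` disc)" by (rule open_vimage[OF open_ball gc])
      have d1: "((\<lambda>t. \<phi> (g t)) has_real_derivative f' (g t) u) (at t)" if "t \<in> g -` disc" for t
        using has_derivative_compose[OF g(1) f'[of "g t"]] that
        unfolding has_field_derivative_def by (simp add: blinfun.scaleR_right mult_commute_abs)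
      have "((\<lambda>t. f' (g t)) has_derivative (\<lambda>k. k *\<^sub>R f'' z u)) (at t0)"
        using has_derivative_compose[OF g(1)[of t0], of f' "f'' z"] f''[OF z] g(2) by (simp add: blinfun.scaleR_right)
      then have "((\<lambda>t. f' (g t) u) has_derivative (\<lambda>k. k * f'' z u u)) (at t0)"
        by (auto intro!: derivative_eq_intros simp: blinfun.scaleR_left)
      then have "((\<lambda>t. f' (g t) u) has_real_derivative f'' z u u) (at t0)"
        unfolding has_field_derivative_def by (simp add: mult_commute_abs)
      then have "(deriv (\<lambda>t. \<phi> (g t)) has_real_derivative f'' z u u) (at t0)"
      proof (rule has_field_derivative_transform_within_open[OF _ og])
        show "t0 \<in> g -` disc" using z g(2) by simp
        show "f' (g t) u = deriv (\<lambda>t. \<phi> (g t)) t" if "t \<in> g -` disc" for t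
          by (rule DERIV_imp_deriv[OF d1[OF that], symmetric])
      qed
      then show ?thesis by (simp add: numeral_2_eq_2 DERIV_imp_deriv)
    qed
    have "((\<lambda>t. Complex t (Im z)) has_derivative (\<lambda>k. k *\<^sub>R 1)) (at t)" for t
    proof -
      have "((\<lambda>t. of_real t + \<i> * of_real (Im z)) has_derivative (\<lambda>k. of_real k)) (at t)"
        by (auto intro!: derivative_eq_intros)
      then show ?thesis by (simp add: Complex_eq scaleR_conv_of_real)
    qed
    moreover have "((\<lambda>t. Complex (Re z) t) has_derivative (\<lambda>k. k *\<^sub>R \<i>)) (at t)" for t
    proof -
      have "((\<lambda>t. of_real (Re z) + \<i> * of_real t) has_derivative (\<lambda>k. \<i> * of_real k)) (at t)"
        by (auto intro!: derivative_eq_intros)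
      then show ?thesis by (simp add: Complex_eq scaleR_conv_of_real mult.commute)
    qed
    ultimately show ?thesis
      unfolding laplacian_def using slice[of "\<lambda>t. Complex t (Im z)" 1 "Re z"] slice[of "\<lambda>t. Complex (Re z) t" \<i> "Im z"] by simp
  qed
  have L4: "(L z 1 + \<i> * L z \<i>) / 2 = of_real (laplacian \<phi> z / 4)" if z: "z \<in> disc" for z
    unfolding lap[OF z] L_def using sym[OF z, of 1 \<i>] by (simp add: complex_eq_iff)
  have 2: "C1w disc p pz (\<lambda>z. of_real (laplacian \<phi> z / 4))"
    unfolding C1w_def
  proof (intro conjI ballI)
    fix z assume z: "z \<in> disc"
    have "linear (L z)"
      by (rule linearI)
         (simp_all add: L_def blinfun.add_right blinfun.add_left blinfun.scaleR_right blinfun.scaleR_left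
           complex_eq_iff field_simps)
    note lin = wirtinger_real_linear[OF this]
    have d: "((\<lambda>z. complex_of_real (f' z u)) has_derivative (\<lambda>h. of_real (f'' z h u))) (at z)" for u
    proof (rule has_derivative_of_real)
      show "((\<lambda>z. f' z u) has_derivative (\<lambda>h. f'' z h u)) (at z)"
        by (rule bounded_linear.has_derivative[OF bounded_bilinear.bounded_linear_left[OF bounded_bilinear_blinfun_apply] f''[OF z]])
    qed
    have "(p has_derivative L z) (at z)"
      unfolding p_def L_def
      by (intro bounded_linear.has_derivative[OF bounded_linear_divide] has_derivative_diff has_derivative_mult_right d)
    moreover have "L z h = pz z * h + of_real (laplacian \<phi> z / 4) * cnj h" for h
      using lin[of h] L4[OF z] by (simp only: pz_def)
    then have "L z = (\<lambda>h. pz z * h + of_real (laplacian \<phi> z / 4) * cnj h)" by (rule ext)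
    ultimately show "wirtinger p (pz z) (of_real (laplacian \<phi> z / 4)) z"
      unfolding wirtinger_def by simp
  next
    have cL: "continuous_on disc (\<lambda>z. L z h)" for h
      unfolding L_def by (intro continuous_intros cont) auto
    then show "continuous_on disc pz" unfolding pz_def by (intro continuous_intros) auto
    have "continuous_on disc (\<lambda>z. (L z 1 + \<i> * L z \<i>) / 2)" using cL by (intro continuous_intros) auto
    then show "continuous_on disc (\<lambda>z. complex_of_real (laplacian \<phi> z / 4))"
      by (rule continuous_on_eq) (rule L4)
  qed
  show ?thesis by (rule that[OF 1 2])
qed

section \<open>Test functions in the disc\<close>

text \<open>
  The derivatives \<open>a\<close> and \<open>b\<close> of a test function are carried along as parameters, since the adjoint
  operator below is a function of \<open>\<alpha>\<close> and \<open>a\<close>.  Test functions are of class \<open>C\<^sup>2\<close> and not smooth,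
  because bumps multiplied by \<open>exp (2\<phi>)\<close> have to be among them.
\<close>

definition testfun :: "(complex \<Rightarrow> complex) \<Rightarrow> (complex \<Rightarrow> complex) \<Rightarrow> (complex \<Rightarrow> complex) \<Rightarrow> bool" where
  "testfun \<alpha> a b \<longleftrightarrow> (\<exists>aa c bb. C2w UNIV \<alpha> a b aa c bb) \<and> (\<exists>R<1. \<forall>z. z \<notin> cball 0 R \<longrightarrow> \<alpha> z = 0)"

lemma testfunE:
  assumes "testfun \<alpha> a b"
  obtains R aa c bb where "R < 1" "C1w UNIV \<alpha> a b" "C1w UNIV a aa c" "C1w UNIV b c bb"
    "\<And>z. z \<notin> cball 0 R \<Longrightarrow> \<alpha> z = 0" "\<And>z. z \<notin> cball 0 R \<Longrightarrow> a z = 0" "\<And>z. z \<notin> cball 0 R \<Longrightarrow> b z = 0"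
proof -
  from assms obtain R aa c bb where R: "R < 1" "\<And>z. z \<notin> cball 0 R \<Longrightarrow> \<alpha> z = 0" and C: "C2w UNIV \<alpha> a b aa c bb"
    unfolding testfun_def by blast
  then have 1: "C1w UNIV \<alpha> a b" "C1w UNIV a aa c" "C1w UNIV b c bb" by (auto simp: C2w_def)
  show ?thesis
    by (rule that[OF R(1) 1 R(2) C1w_vanish[OF 1(1) closed_cball R(2)]])
qed

lemma testfun_zero: "testfun (\<lambda>_. 0) (\<lambda>_. 0) (\<lambda>_. 0)"
  unfolding testfun_def C2w_def by (intro conjI exI[of _ "\<lambda>_. 0"] exI[of _ 0] C1w_const) auto

lemma testfun_add:
  assumes "testfun \<alpha> a b" "testfun \<beta> a' b'"
  shows "testfun (\<lambda>z. \<alpha> z + \<beta> z) (\<lambda>z. a z + a' z) (\<lambda>z. b z + b' z)"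
proof -
  obtain R aa c bb where R: "R < 1" "C2w UNIV \<alpha> a b aa c bb" "\<And>z. z \<notin> cball 0 R \<Longrightarrow> \<alpha> z = 0"
    using assms(1) unfolding testfun_def by blast
  obtain R' aa' c' bb' where R': "R' < 1" "C2w UNIV \<beta> a' b' aa' c' bb'" "\<And>z. z \<notin> cball 0 R' \<Longrightarrow> \<beta> z = 0"
    using assms(2) unfolding testfun_def by blast
  have "C2w UNIV (\<lambda>z. \<alpha> z + \<beta> z) (\<lambda>z. a z + a' z) (\<lambda>z. b z + b' z) (\<lambda>z. aa z + aa' z) (\<lambda>z. c z + c' z) (\<lambda>z. bb z + bb' z)"
    using R(2) R'(2) unfolding C2w_def by (intro conjI C1w_add) auto
  moreover have "\<alpha> z + \<beta> z = 0" if "z \<notin> cball 0 (max R R')" for z using R(3)[of z] R'(3)[of z] that by simp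
  moreover have "max R R' < 1" using R(1) R'(1) by simp
  ultimately show ?thesis unfolding testfun_def by blast
qed

lemma testfun_cmult:
  assumes "testfun \<alpha> a b"
  shows "testfun (\<lambda>z. k * \<alpha> z) (\<lambda>z. k * a z) (\<lambda>z. k * b z)"
proof -
  obtain R aa c bb where R: "R < 1" "C2w UNIV \<alpha> a b aa c bb" "\<And>z. z \<notin> cball 0 R \<Longrightarrow> \<alpha> z = 0"
    using assms(1) unfolding testfun_def by blast
  have "C2w UNIV (\<lambda>z. k * \<alpha> z) (\<lambda>z. k * a z) (\<lambda>z. k * b z) (\<lambda>z. k * aa z) (\<lambda>z. k * c z) (\<lambda>z. k * bb z)"
    using R(2) unfolding C2w_def by (intro conjI C1w_cmult) auto
  then show ?thesis using R(1,3) unfolding testfun_def by fastforce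
qed

lemma testfun_mult:
  assumes "testfun \<alpha> a b" "C2w disc \<eta> a' b' aa' c' bb'"
  shows "testfun (\<lambda>z. \<alpha> z * \<eta> z) (\<lambda>z. a z * \<eta> z + \<alpha> z * a' z) (\<lambda>z. b z * \<eta> z + \<alpha> z * b' z)"
proof -
  obtain R aa c bb where R: "R < 1" "C2w UNIV \<alpha> a b aa c bb" "\<And>z. z \<notin> cball 0 R \<Longrightarrow> \<alpha> z = 0"
    using assms(1) unfolding testfun_def by blast
  have "cball 0 R \<subseteq> disc" using R(1) by auto
  from C2w_cutoff[OF R(2) closed_cball R(3) this open_ball assms(2)] show ?thesis
    using R(1,3) unfolding testfun_def by fastforce
qed

text \<open>
  Continuous functions of compact support in the disc that increase to 1 there; they are used to
  approximate integrals over the disc.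
\<close>

definition disc_cutoff :: "nat \<Rightarrow> complex \<Rightarrow> real" where
  "disc_cutoff n z = min 1 (max 0 (real (Suc n) * (1 - cmod z) - 1))"

lemma disc_cutoff_bounds: "0 \<le> disc_cutoff n z" "disc_cutoff n z \<le> 1"
  by (auto simp: disc_cutoff_def)

lemma continuous_on_dcut: "continuous_on UNIV (disc_cutoff n)"
  unfolding disc_cutoff_def by (intro continuous_intros)

lemma disc_cutoff_eq_0: "z \<notin> cball 0 (1 - 1 / real (Suc n)) \<Longrightarrow> disc_cutoff n z = 0"
  by (auto simp: disc_cutoff_def field_simps)

lemma disc_cutoff_tendsto:
  assumes "cmod z < 1"
  shows "(\<lambda>n. disc_cutoff n z) \<longlonglongrightarrow> 1"
proof (rule tendsto_eventually)
  obtain N :: nat where N: "2 / (1 - cmod z) < real N" using reals_Archimedean2 by blast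
  have "disc_cutoff n z = 1" if "n \<ge> N" for n
  proof -
    have "2 / (1 - cmod z) < real (Suc n)" using N that by linarith
    then have "2 < real (Suc n) * (1 - cmod z)" using assms by (simp add: field_simps)
    then show ?thesis by (simp add: disc_cutoff_def)
  qed
  then show "eventually (\<lambda>n. disc_cutoff n z = 1) sequentially" by (auto simp: eventually_sequentially)
qed

lemma disc_cutoff_outside:
  assumes "1 \<le> cmod z"
  shows "disc_cutoff n z = 0"
proof -
  have "real (Suc n) * (1 - cmod z) \<le> 0" using assms by (intro mult_nonneg_nonpos) auto
  then show ?thesis by (simp add: disc_cutoff_def max_def del: of_nat_Suc)
qed

section \<open>The weighted adjoint of the Cauchy-Riemann operator\<close>

locale weight =
  fixes \<phi> :: "complex \<Rightarrow> real" and p pz :: "complex \<Rightarrow> complex"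
  assumes phi1: "C1w disc (\<lambda>z. of_real (\<phi> z)) p (\<lambda>z. cnj (p z))"
    and phi2: "C1w disc p pz (\<lambda>z. of_real (laplacian \<phi> z / 4))"
begin

text \<open>
  The weight as a complex function, so that it can be differentiated.
\<close>

definition E :: "complex \<Rightarrow> complex" where "E z = exp (- 2 * of_real (\<phi> z))"

text \<open>
  The same weight, cut off to the disc, as a density.  The weighted measure lives on the whole
  plane, so that compactly supported functions need no restriction to the disc.
\<close>

definition W :: "complex \<Rightarrow> real" where "W z = indicator disc z * exp (- 2 * \<phi> z)"

definition meas :: "complex measure" where "meas = density lborel (\<lambda>z. ennreal (W z))"

text \<open>
  If \<open>a = \<partial>\<alpha>/\<partial>z\<close>, this is \<open>- exp (2\<phi>)\<close> times the \<open>z\<close>-derivative of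
  \<open>\<alpha> exp (-2\<phi>)\<close>, the formal adjoint of \<open>\<partial>/\<partial>cnj z\<close>.
\<close>

definition dstar :: "(complex \<Rightarrow> complex) \<Rightarrow> (complex \<Rightarrow> complex) \<Rightarrow> complex \<Rightarrow> complex" where
  "dstar \<alpha> a z = 2 * (\<alpha> z * p z) - a z"

lemma phi_C2w: "C2w disc (\<lambda>z. of_real (\<phi> z)) p (\<lambda>z. cnj (p z)) pz (\<lambda>z. of_real (laplacian \<phi> z / 4)) (\<lambda>z. cnj (pz z))"
  unfolding C2w_def using phi1 phi2 C1w_cnj[OF phi2] by simp

lemma continuous_phi: "continuous_on disc \<phi>"
proof -
  have "continuous_on disc (\<lambda>z. Re (of_real (\<phi> z)))"
    by (intro continuous_on_Re C1w_continuous[OF phi1])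
  then show ?thesis by simp
qed

lemma continuous_laplacian: "continuous_on disc (laplacian \<phi>)"
proof -
  have "continuous_on disc (\<lambda>z. 4 * Re (of_real (laplacian \<phi> z / 4)))"
    by (intro continuous_on_mult_left continuous_on_Re C1w_continuous_d(2)[OF phi2])
  then show ?thesis by simp
qed

lemma continuous_p: "continuous_on disc p"
  by (rule C1w_continuous[OF phi2])

lemma C1w_E: "C1w disc E (\<lambda>z. E z * (- 2 * p z)) (\<lambda>z. E z * (- 2 * cnj (p z)))"
  unfolding E_def[abs_def] by (rule C1w_exp[OF C1w_cmult[OF phi1]])

lemma continuous_E: "continuous_on disc E"
  by (rule C1w_continuous[OF C1w_E])

lemma E_of_real: "E z = of_real (exp (- 2 * \<phi> z))"
  by (simp add: E_def exp_of_real[symmetric])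

lemma W_nonneg: "0 \<le> W z"
  by (simp add: W_def)

lemma W_disc: "z \<in> disc \<Longrightarrow> W z = exp (- 2 * \<phi> z)"
  by (simp add: W_def)

lemma W_outside: "z \<notin> disc \<Longrightarrow> W z = 0"
  by (simp add: W_def)

lemma W_measurable [measurable]: "W \<in> borel_measurable borel"
proof -
  have "continuous_on disc (\<lambda>z. exp (- 2 * \<phi> z))" by (intro continuous_intros continuous_phi)
  from borel_measurable_continuous_on_indicator[OF _ this] show ?thesis
    unfolding W_def[abs_def] by simp
qed

lemma sets_meas [simp, measurable_cong]: "sets meas = sets borel"
  by (simp add: meas_def)

lemma space_meas [simp]: "space meas = UNIV"
  by (simp add: meas_def)

lemma meas_integral:
  fixes f :: "complex \<Rightarrow> 'b::{banach, second_countable_topology}"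
  assumes "f \<in> borel_measurable borel"
  shows "(\<integral>z. f z \<partial>meas) = (\<integral>z. W z *\<^sub>R f z \<partial>lborel)"
  unfolding meas_def by (rule integral_density) (use assms W_nonneg in auto)

lemma meas_integrable:
  fixes f :: "complex \<Rightarrow> 'b::{banach, second_countable_topology}"
  assumes "f \<in> borel_measurable borel"
  shows "integrable meas f \<longleftrightarrow> integrable lborel (\<lambda>z. W z *\<^sub>R f z)"
  unfolding meas_def by (rule integrable_density) (use assms W_nonneg in auto)

lemma compact_support_E:
  fixes f :: "complex \<Rightarrow> complex"
  assumes f: "continuous_on UNIV f" "\<forall>z. z \<notin> cball 0 R \<longrightarrow> f z = 0" "R < 1"
  shows "integrable meas f" "(\<integral>z. f z \<partial>meas) = (\<integral>z. f z * E z \<partial>lborel)" "integrable lborel (\<lambda>z. f z * E z)"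
    "f \<in> L2 meas"
proof -
  have sub: "cball 0 R \<subseteq> disc" using f(3) by auto
  have eq: "W z *\<^sub>R g z = g z * E z" if "\<forall>z. z \<notin> cball 0 R \<longrightarrow> g z = 0" for z and g :: "complex \<Rightarrow> complex"
  proof (cases "z \<in> disc")
    case True
    then show ?thesis by (simp add: W_disc E_of_real scaleR_conv_of_real)
  next
    case False
    then have "z \<notin> cball 0 R" using sub by blast
    then show ?thesis using that False by (simp add: W_outside)
  qed
  have int: "integrable lborel (\<lambda>z. g z * E z)" if g: "continuous_on UNIV g" "\<forall>z. z \<notin> cball 0 R \<longrightarrow> g z = 0" for g :: "complex \<Rightarrow> complex"
    by (rule integrable_compact_support[OF continuous_on_cutoff[OF g(1) closed_cball _ sub open_ball continuous_E] compact_cball[of 0 R]])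
       (use g(2) in auto)
  have imeas: "integrable meas g" if g: "continuous_on UNIV g" "\<forall>z. z \<notin> cball 0 R \<longrightarrow> g z = 0" for g :: "complex \<Rightarrow> complex"
    using int[OF g] by (simp add: meas_integrable[OF borel_measurable_continuous_onI[OF g(1)]] eq[OF g(2)])
  show "integrable meas f" by (rule imeas[OF f(1,2)])
  show "integrable lborel (\<lambda>z. f z * E z)" by (rule int[OF f(1,2)])
  show "(\<integral>z. f z \<partial>meas) = (\<integral>z. f z * E z \<partial>lborel)"
    by (simp add: meas_integral[OF borel_measurable_continuous_onI[OF f(1)]] eq[OF f(2)])
  have "integrable meas (\<lambda>z. f z * cnj (f z))"
    by (rule imeas) (use f in \<open>auto intro!: continuous_intros\<close>)
  then have "integrable meas (\<lambda>z. Re (f z * cnj (f z)))" by (rule integrable_Re)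
  moreover have "Re (f z * cnj (f z)) = (cmod (f z))\<^sup>2" for z
    by (metis Re_complex_of_real complex_norm_square)
  ultimately have "integrable meas (\<lambda>z. (cmod (f z))\<^sup>2)" by simp
  then show "f \<in> L2 meas" using borel_measurable_continuous_onI[OF f(1)] by (simp add: L2_def meas_def)
qed

lemma dstar_compact_support:
  assumes "testfun \<alpha> a b"
  obtains R where "R < 1" "continuous_on UNIV (dstar \<alpha> a)" "\<And>z. z \<notin> cball 0 R \<Longrightarrow> dstar \<alpha> a z = 0"
proof -
  obtain R aa c bb where R: "R < 1" "C1w UNIV \<alpha> a b" "C1w UNIV a aa c" "C1w UNIV b c bb"
    "\<And>z. z \<notin> cball 0 R \<Longrightarrow> \<alpha> z = 0" "\<And>z. z \<notin> cball 0 R \<Longrightarrow> a z = 0"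
    using testfunE[OF assms] by metis
  have sub: "cball 0 R \<subseteq> disc" using R(1) by auto
  have "continuous_on UNIV (dstar \<alpha> a)"
    unfolding dstar_def[abs_def]
    by (intro continuous_on_diff continuous_on_mult_left C1w_continuous[OF R(3)]
        continuous_on_cutoff[OF C1w_continuous[OF R(2)] closed_cball R(5) sub open_ball continuous_p])
  then show ?thesis using R by (intro that[of R]) (auto simp: dstar_def)
qed

lemma dstar_L2: "testfun \<alpha> a b \<Longrightarrow> dstar \<alpha> a \<in> L2 meas"
  using dstar_compact_support compact_support_E(4) by metis

text \<open>
  The integrand of the difference of both sides is the derivative of
  \<open>cnj \<beta> * F * exp (-2\<phi>)\<close> with respect to \<open>cnj z\<close>.
\<close>

lemma dstar_adjoint:
  assumes \<beta>: "testfun \<beta> \<beta>1 \<beta>2" and F: "C1w disc F F1 F2"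
  shows "ip meas F (dstar \<beta> \<beta>1) = ip meas F2 \<beta>"
proof -
  obtain R aa c bb where R: "R < 1" "C1w UNIV \<beta> \<beta>1 \<beta>2" "C1w UNIV \<beta>1 aa c" "C1w UNIV \<beta>2 c bb"
    "\<And>z. z \<notin> cball 0 R \<Longrightarrow> \<beta> z = 0" "\<And>z. z \<notin> cball 0 R \<Longrightarrow> \<beta>1 z = 0"
    using testfunE[OF \<beta>] by metis
  have sub: "cball 0 R \<subseteq> disc" using R(1) by auto
  obtain R' where R': "R' < 1" "continuous_on UNIV (dstar \<beta> \<beta>1)" "\<And>z. z \<notin> cball 0 R' \<Longrightarrow> dstar \<beta> \<beta>1 z = 0"
    using dstar_compact_support[OF \<beta>] by metis
  have sub': "cball 0 R' \<subseteq> disc" using R'(1) by auto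
  have G: "C1w disc (\<lambda>z. F z * E z) (\<lambda>z. F1 z * E z + F z * (E z * (- 2 * p z))) (\<lambda>z. F2 z * E z + F z * (E z * (- 2 * cnj (p z))))"
    by (rule C1w_mult[OF F C1w_E])
  have Z: "C1w UNIV (\<lambda>z. cnj (\<beta> z) * (F z * E z)) (\<lambda>z. cnj (\<beta>2 z) * (F z * E z) + cnj (\<beta> z) * (F1 z * E z + F z * (E z * (- 2 * p z))))
    (\<lambda>z. cnj (\<beta>1 z) * (F z * E z) + cnj (\<beta> z) * (F2 z * E z + F z * (E z * (- 2 * cnj (p z)))))"
    by (rule C1w_cutoff[OF C1w_cnj[OF R(2)] closed_cball _ sub open_ball G]) (simp add: R(5))
  have Z0: "(\<integral>z. cnj (\<beta>1 z) * (F z * E z) + cnj (\<beta> z) * (F2 z * E z + F z * (E z * (- 2 * cnj (p z)))) \<partial>lborel) = 0"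
    by (rule integral_wirtinger_zero(2)[OF Z compact_cball[of 0 R]]) (use R(5) in auto)
  have c1: "continuous_on UNIV (\<lambda>z. cnj (dstar \<beta> \<beta>1 z) * F z)"
    by (rule continuous_on_cutoff[OF continuous_on_cnj[OF R'(2)] closed_cball _ sub' open_ball C1w_continuous[OF F]])
       (simp add: R'(3))
  have s1: "\<forall>z. z \<notin> cball 0 R' \<longrightarrow> cnj (dstar \<beta> \<beta>1 z) * F z = 0" using R'(3) by auto
  have c2: "continuous_on UNIV (\<lambda>z. cnj (\<beta> z) * F2 z)"
    by (rule continuous_on_cutoff[OF continuous_on_cnj[OF C1w_continuous[OF R(2)]] closed_cball _ sub open_ball C1w_continuous_d(2)[OF F]])
       (simp add: R(5))
  have s2: "\<forall>z. z \<notin> cball 0 R \<longrightarrow> cnj (\<beta> z) * F2 z = 0" using R(5) by auto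
  note i1 = compact_support_E[OF c1 s1 R'(1)] and i2 = compact_support_E[OF c2 s2 R(1)]
  have "ip meas F (dstar \<beta> \<beta>1) = (\<integral>z. cnj (dstar \<beta> \<beta>1 z) * F z * E z \<partial>lborel)"
    using i1(2) by (simp add: ip_def mult.commute)
  moreover have "ip meas F2 \<beta> = (\<integral>z. cnj (\<beta> z) * F2 z * E z \<partial>lborel)"
    using i2(2) by (simp add: ip_def mult.commute)
  moreover have "(\<integral>z. cnj (\<beta> z) * F2 z * E z \<partial>lborel) - (\<integral>z. cnj (dstar \<beta> \<beta>1 z) * F z * E z \<partial>lborel) = 0"
  proof -
    have "(\<integral>z. cnj (\<beta> z) * F2 z * E z \<partial>lborel) - (\<integral>z. cnj (dstar \<beta> \<beta>1 z) * F z * E z \<partial>lborel)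
       = (\<integral>z. cnj (\<beta> z) * F2 z * E z - cnj (dstar \<beta> \<beta>1 z) * F z * E z \<partial>lborel)"
      by (rule Bochner_Integration.integral_diff[symmetric]) (use i1(3) i2(3) in simp_all)
    also have "\<dots> = (\<integral>z. cnj (\<beta>1 z) * (F z * E z) + cnj (\<beta> z) * (F2 z * E z + F z * (E z * (- 2 * cnj (p z)))) \<partial>lborel)"
      by (rule Bochner_Integration.integral_cong) (simp_all add: dstar_def algebra_simps)
    finally show ?thesis using Z0 by simp
  qed
  ultimately show ?thesis by simp
qed

text \<open>
  The one-dimensional case of the Bochner-Kodaira identity.  The integrals of the derivatives of
  \<open>\<alpha> * cnj (dstar \<alpha> a) * E\<close> with respect to \<open>z\<close> and of \<open>\<alpha> * cnj b * E\<close> with respect to \<open>cnj z\<close>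
  vanish.  The commutator of the two first order operators is multiplication by \<open>\<Delta>\<phi>/2\<close>, hence the
  sum of the two identities reads \<open>\<parallel>dstar \<alpha> a\<parallel>\<^sup>2 = \<parallel>b\<parallel>\<^sup>2 + (1/2) \<integral> \<Delta>\<phi> |\<alpha>|\<^sup>2\<close>.
\<close>

lemma basic_inequality:
  assumes \<alpha>: "testfun \<alpha> a b"
  shows "(\<integral>z. laplacian \<phi> z * (cmod (\<alpha> z))\<^sup>2 \<partial>meas) \<le> 2 * sqnorm meas (dstar \<alpha> a)"
    and "integrable meas (\<lambda>z. laplacian \<phi> z * (cmod (\<alpha> z))\<^sup>2)"
proof -
  obtain R aa c bb where R: "R < 1" "C1w UNIV \<alpha> a b" "C1w UNIV a aa c" "C1w UNIV b c bb"
    "\<And>z. z \<notin> cball 0 R \<Longrightarrow> \<alpha> z = 0" "\<And>z. z \<notin> cball 0 R \<Longrightarrow> a z = 0" "\<And>z. z \<notin> cball 0 R \<Longrightarrow> b z = 0"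
    using testfunE[OF \<alpha>] by metis
  have sub: "cball 0 R \<subseteq> disc" using R(1) by auto
  define L where "L z = complex_of_real (laplacian \<phi> z / 4)" for z
  have cL: "continuous_on disc L" unfolding L_def[abs_def] by (intro continuous_intros continuous_laplacian) auto
  have R': "C1w disc \<alpha> a b" "C1w disc a aa c" "C1w disc b c bb" using R C1w_subset by blast+
  have D: "C1w disc (dstar \<alpha> a) (\<lambda>z. 2 * (a z * p z + \<alpha> z * pz z) + - 1 * aa z) (\<lambda>z. 2 * (b z * p z + \<alpha> z * L z) + - 1 * c z)"
    by (rule C1w_cong[OF C1w_add[OF C1w_cmult[OF C1w_mult[OF R'(1) phi2], where c = 2] C1w_cmult[OF R'(2), where c = "- 1"]]])
       (auto simp: dstar_def L_def fun_eq_iff)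
  have G: "C1w disc (\<lambda>z. cnj (dstar \<alpha> a z) * E z)
      (\<lambda>z. cnj (2 * (b z * p z + \<alpha> z * L z) + - 1 * c z) * E z + cnj (dstar \<alpha> a z) * (E z * (- 2 * p z)))
      (\<lambda>z. cnj (2 * (a z * p z + \<alpha> z * pz z) + - 1 * aa z) * E z + cnj (dstar \<alpha> a z) * (E z * (- 2 * cnj (p z))))"
    by (rule C1w_mult[OF C1w_cnj[OF D] C1w_E])
  have H: "C1w disc (\<lambda>z. cnj (b z) * E z) (\<lambda>z. cnj (bb z) * E z + cnj (b z) * (E z * (- 2 * p z)))
      (\<lambda>z. cnj (c z) * E z + cnj (b z) * (E z * (- 2 * cnj (p z))))"
    by (rule C1w_mult[OF C1w_cnj[OF R'(3)] C1w_E])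
  note X = C1w_cutoff[OF R(2) closed_cball R(5) sub open_ball G]
  note Y = C1w_cutoff[OF R(2) closed_cball R(5) sub open_ball H]
  note X0 = integral_wirtinger_zero(1)[OF X compact_cball[of 0 R]]
  note Y0 = integral_wirtinger_zero(2)[OF Y compact_cball[of 0 R]]
  define X' where "X' z = a z * (cnj (dstar \<alpha> a z) * E z) + \<alpha> z * (cnj (2 * (b z * p z + \<alpha> z * L z) + - 1 * c z) * E z + cnj (dstar \<alpha> a z) * (E z * (- 2 * p z)))" for z
  define Y' where "Y' z = b z * (cnj (b z) * E z) + \<alpha> z * (cnj (c z) * E z + cnj (b z) * (E z * (- 2 * cnj (p z))))" for z
  have X0: "(\<integral>z. X' z \<partial>lborel) = 0" unfolding X'_def by (rule X0) (use R(5) in auto)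
  have Y0: "(\<integral>z. Y' z \<partial>lborel) = 0" unfolding Y'_def by (rule Y0) (use R(5) in auto)
  have iX: "integrable lborel X'"
    by (rule integrable_compact_support[OF _ compact_cball[of 0 R]])
       (use C1w_continuous_d(1)[OF X] R(5,6) in \<open>auto simp: X'_def[abs_def]\<close>)
  have iY: "integrable lborel Y'"
    by (rule integrable_compact_support[OF _ compact_cball[of 0 R]])
       (use C1w_continuous_d(2)[OF Y] R(5,7) in \<open>auto simp: Y'_def[abs_def]\<close>)
  have cD: "continuous_on UNIV (dstar \<alpha> a)"
    using dstar_compact_support[OF \<alpha>] by metis
  have D0: "dstar \<alpha> a z = 0" if "z \<notin> cball 0 R" for z using R(5,6)[OF that] by (simp add: dstar_def)
  have cL\<alpha>: "continuous_on UNIV (\<lambda>z. \<alpha> z * (cnj (\<alpha> z) * L z))"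
    by (rule continuous_on_cutoff[OF C1w_continuous[OF R(2)] closed_cball R(5) sub open_ball])
       (use C1w_continuous[OF R'(1)] cL in \<open>auto intro!: continuous_intros\<close>)
  have cDD: "continuous_on UNIV (\<lambda>z. dstar \<alpha> a z * cnj (dstar \<alpha> a z))" by (intro continuous_intros cD)
  have cbb: "continuous_on UNIV (\<lambda>z. b z * cnj (b z))" by (intro continuous_intros C1w_continuous[OF R(4)])
  have s: "\<forall>z. z \<notin> cball 0 R \<longrightarrow> \<alpha> z * (cnj (\<alpha> z) * L z) = 0"
    "\<forall>z. z \<notin> cball 0 R \<longrightarrow> dstar \<alpha> a z * cnj (dstar \<alpha> a z) = 0"
    "\<forall>z. z \<notin> cball 0 R \<longrightarrow> b z * cnj (b z) = 0"
    using R(5,7) D0 by auto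
  note iL = compact_support_E[OF cL\<alpha> s(1) R(1)] and iD = compact_support_E[OF cDD s(2) R(1)] and ib = compact_support_E[OF cbb s(3) R(1)]
  \<comment> \<open>The second derivatives \<open>c\<close> of \<open>\<alpha>\<close> in \<open>X'\<close> and \<open>Y'\<close> cancel.\<close>
  have "X' z + Y' z = 2 * (\<alpha> z * (cnj (\<alpha> z) * L z) * E z) + b z * cnj (b z) * E z - dstar \<alpha> a z * cnj (dstar \<alpha> a z) * E z" for z
    by (simp add: X'_def Y'_def dstar_def L_def algebra_simps)
  then have total: "(\<integral>z. X' z + Y' z \<partial>lborel) = (\<integral>z. 2 * (\<alpha> z * (cnj (\<alpha> z) * L z) * E z) + b z * cnj (b z) * E z - dstar \<alpha> a z * cnj (dstar \<alpha> a z) * E z \<partial>lborel)"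
    by (simp only:)
  also have "\<dots> = 2 * (\<integral>z. \<alpha> z * (cnj (\<alpha> z) * L z) * E z \<partial>lborel) + (\<integral>z. b z * cnj (b z) * E z \<partial>lborel) - (\<integral>z. dstar \<alpha> a z * cnj (dstar \<alpha> a z) * E z \<partial>lborel)"
    using iL(3) iD(3) ib(3)
    by (simp only: Bochner_Integration.integral_add Bochner_Integration.integral_diff Bochner_Integration.integrable_add
        integrable_mult_right integral_mult_right_zero)
  finally have total: "(\<integral>z. X' z + Y' z \<partial>lborel) = 2 * (\<integral>z. \<alpha> z * (cnj (\<alpha> z) * L z) * E z \<partial>lborel) + (\<integral>z. b z * cnj (b z) * E z \<partial>lborel) - (\<integral>z. dstar \<alpha> a z * cnj (dstar \<alpha> a z) * E z \<partial>lborel)" .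
  moreover have "(\<integral>z. X' z + Y' z \<partial>lborel) = 0" using iX iY X0 Y0 by simp
  ultimately have total: "2 * (\<integral>z. \<alpha> z * (cnj (\<alpha> z) * L z) * E z \<partial>lborel) + (\<integral>z. b z * cnj (b z) * E z \<partial>lborel) - (\<integral>z. dstar \<alpha> a z * cnj (dstar \<alpha> a z) * E z \<partial>lborel) = 0"
    by (simp only:)
  have cancel: "2 * A + B - C = 0 \<Longrightarrow> 2 * Re A + Re B = Re C" for A B C :: complex by (simp add: complex_eq_iff)
  from total have "2 * (\<integral>z. \<alpha> z * (cnj (\<alpha> z) * L z) \<partial>meas) + (\<integral>z. b z * cnj (b z) \<partial>meas) - (\<integral>z. dstar \<alpha> a z * cnj (dstar \<alpha> a z) \<partial>meas) = 0"
    unfolding iL(2) iD(2) ib(2) .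
  then have eq: "2 * Re (\<integral>z. \<alpha> z * (cnj (\<alpha> z) * L z) \<partial>meas) + Re (\<integral>z. b z * cnj (b z) \<partial>meas) = Re (\<integral>z. dstar \<alpha> a z * cnj (dstar \<alpha> a z) \<partial>meas)"
    by (rule cancel)
  have Lz: "Re (\<alpha> z * (cnj (\<alpha> z) * L z)) = 1/4 * (laplacian \<phi> z * (cmod (\<alpha> z))\<^sup>2)" for z
  proof -
    have "\<alpha> z * (cnj (\<alpha> z) * L z) = complex_of_real ((cmod (\<alpha> z))\<^sup>2 * (laplacian \<phi> z / 4))"
      unfolding of_real_mult complex_norm_square L_def by simp
    then show ?thesis by (simp only: Re_complex_of_real) simp
  qed
  have sq: "Re (y * cnj y) = (cmod y)\<^sup>2" for y by (metis Re_complex_of_real complex_norm_square)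
  have "integrable meas (\<lambda>z. 4 * Re (\<alpha> z * (cnj (\<alpha> z) * L z)))" by (intro integrable_mult_right integrable_Re iL(1))
  then show "integrable meas (\<lambda>z. laplacian \<phi> z * (cmod (\<alpha> z))\<^sup>2)" unfolding Lz by simp
  have 1: "Re (\<integral>z. \<alpha> z * (cnj (\<alpha> z) * L z) \<partial>meas) = 1/4 * (\<integral>z. laplacian \<phi> z * (cmod (\<alpha> z))\<^sup>2 \<partial>meas)"
    unfolding integral_Re[OF iL(1), symmetric] Lz by simp
  have 2: "Re (\<integral>z. b z * cnj (b z) \<partial>meas) \<ge> 0"
    unfolding integral_Re[OF ib(1), symmetric] sq by simp
  have 3: "Re (\<integral>z. dstar \<alpha> a z * cnj (dstar \<alpha> a z) \<partial>meas) = sqnorm meas (dstar \<alpha> a)"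
    unfolding integral_Re[OF iD(1), symmetric] sq sqnorm_def ..
  show "(\<integral>z. laplacian \<phi> z * (cmod (\<alpha> z))\<^sup>2 \<partial>meas) \<le> 2 * sqnorm meas (dstar \<alpha> a)"
    using eq 1 2 3 by linarith
qed

end

section \<open>Functions orthogonal to the holomorphic ones\<close>

context weight
begin

lemma meas_L2_measurable: "f \<in> L2 meas \<Longrightarrow> f \<in> borel_measurable borel"
  by (simp add: L2_def meas_def)

lemma C2w_exp_2phi:
  "\<exists>aa c bb. C2w disc (\<lambda>z. exp (2 * of_real (\<phi> z))) (\<lambda>z. exp (2 * of_real (\<phi> z)) * (2 * p z)) (\<lambda>z. exp (2 * of_real (\<phi> z)) * (2 * cnj (p z))) aa c bb"
proof -
  have "C2w disc (\<lambda>z. 2 * of_real (\<phi> z)) (\<lambda>z. 2 * p z) (\<lambda>z. 2 * cnj (p z)) (\<lambda>z. 2 * pz z) (\<lambda>z. 2 * of_real (laplacian \<phi> z / 4)) (\<lambda>z. 2 * cnj (pz z))"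
    using phi_C2w unfolding C2w_def by (intro conjI C1w_cmult) auto
  from C2w_exp[OF this] show ?thesis by blast
qed

text \<open>
  On the test function \<open>mollifier e (w - z) * exp (2\<phi>)\<close> the weights cancel in \<open>dstar\<close>, and what
  remains is the hypothesis of Weyl's lemma, whose kernel is free of the weight.
\<close>

lemma weak_orthogonality_kernel:
  assumes e: "e > 0" "cmod z + e < 1" and v: "v \<in> borel_measurable borel"
    and orth: "\<And>\<alpha> a b. testfun \<alpha> a b \<Longrightarrow> ip meas v (dstar \<alpha> a) = 0"
  shows "(\<integral>w. v w * ((z - w) * bump 2 (of_real (1 / e) * (z - w))) \<partial>lborel) = 0"
proof -
  obtain a aa c bb where k: "C2w UNIV (mollifier e) a
    (\<lambda>w. - 3 * of_real (1 / e) * (of_real (1 / e) * w) * bump 2 (of_real (1 / e) * w) / of_real (bump_mass * e\<^sup>2)) aa c bb"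
    (is "C2w _ _ _ ?b _ _ _") by (rule mollifier_C2w_ex)
  have k1: "C1w UNIV (mollifier e) a ?b" using k by (simp only: C2w_def)
  have "wirtinger (mollifier e) (cnj (?b w)) (cnj (a w)) w" for w
    using wirtinger_cnj[OF C1wD[OF k1 UNIV_I, of w]] by simp
  from wirtinger_unique(1)[OF C1wD[OF k1 UNIV_I] this] have a: "cnj (a w) = ?b w" for w by simp
  define R where "R = cmod z + e"
  have "cball z e \<subseteq> cball 0 R" unfolding R_def
  proof
    fix w assume "w \<in> cball z e"
    then show "w \<in> cball 0 (cmod z + e)"
      using norm_triangle_ineq2[of w z] by (simp add: dist_norm norm_minus_commute)
  qed
  moreover have k0: "mollifier e (w - z) = 0" if "w \<notin> cball z e" for w
    using that e(1) by (intro mollifier_eq_0) (auto simp: dist_norm norm_minus_commute)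
  ultimately have k0': "\<forall>w. w \<notin> cball 0 R \<longrightarrow> mollifier e (w - z) = 0" by blast
  have "testfun (\<lambda>w. mollifier e (w - z)) (\<lambda>w. a (w - z)) (\<lambda>w. ?b (w - z))"
    unfolding testfun_def using C2w_translate[OF k, of z] k0' e(2) unfolding R_def by blast
  from C2w_exp_2phi testfun_mult[OF this] have
    "testfun (\<lambda>w. mollifier e (w - z) * exp (2 * of_real (\<phi> w)))
      (\<lambda>w. a (w - z) * exp (2 * of_real (\<phi> w)) + mollifier e (w - z) * (exp (2 * of_real (\<phi> w)) * (2 * p w)))
      (\<lambda>w. ?b (w - z) * exp (2 * of_real (\<phi> w)) + mollifier e (w - z) * (exp (2 * of_real (\<phi> w)) * (2 * cnj (p w))))"
    (is "testfun ?\<alpha> ?a1 ?b1") by blast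
  note t = this
  have d: "dstar ?\<alpha> ?a1 w = - a (w - z) * exp (2 * of_real (\<phi> w))" for w
    by (simp add: dstar_def algebra_simps)
  have b0: "a (w - z) = 0" if "w \<notin> disc" for w
  proof -
    have "w \<notin> cball 0 R" using that e(2) by (auto simp: R_def)
    then have "w \<notin> cball z e" using \<open>cball z e \<subseteq> cball 0 R\<close> by blast
    then have "w - z \<notin> cball 0 e" by (simp add: dist_norm norm_minus_commute)
    then show ?thesis using C1w_vanish(1)[OF k1 closed_cball, of 0 e "w - z"] mollifier_vanish[OF e(1)] by blast
  qed
  have "W w *\<^sub>R (v w * cnj (dstar ?\<alpha> ?a1 w)) = (3 * of_real (1 / e) * of_real (1 / e) / of_real (bump_mass * e\<^sup>2)) * (- (v w * ((z - w) * bump 2 (of_real (1 / e) * (z - w)))))" for w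
  proof -
    have "bump 2 (of_real (1 / e) * (z - w)) = bump 2 (of_real (1 / e) * (w - z))"
      by (metis bump_minus minus_diff_eq mult_minus_right)
    moreover have "W w *\<^sub>R (v w * cnj (dstar ?\<alpha> ?a1 w)) = v w * (- ?b (w - z))"
    proof (cases "w \<in> disc")
      case True
      have "complex_of_real (exp (- 2 * \<phi> w)) * exp (2 * of_real (\<phi> w)) = 1"
        by (simp flip: exp_of_real exp_add)
      moreover have "cnj (exp (2 * of_real (\<phi> w))) = exp (2 * of_real (\<phi> w))"
        by (simp add: exp_cnj)
      ultimately show ?thesis
        unfolding d W_disc[OF True] scaleR_conv_of_real complex_cnj_mult complex_cnj_minus a
        by (simp add: mult.assoc mult.left_commute)
    next
      case False
      then show ?thesis using b0[OF False] a[of "w - z"] by (simp add: W_outside)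
    qed
    ultimately show ?thesis by (simp add: algebra_simps divide_inverse)
  qed
  note eq = this
  have dm: "dstar ?\<alpha> ?a1 \<in> borel_measurable borel"
    using dstar_L2[OF t] by (rule meas_L2_measurable)
  have [measurable]: "cnj \<in> borel_measurable borel" by (intro borel_measurable_continuous_onI continuous_intros)
  have "ip meas v (dstar ?\<alpha> ?a1) = (\<integral>w. W w *\<^sub>R (v w * cnj (dstar ?\<alpha> ?a1 w)) \<partial>lborel)"
    unfolding ip_def by (rule meas_integral) (use v dm in measurable)
  also have "\<dots> = (3 * of_real (1 / e) * of_real (1 / e) / of_real (bump_mass * e\<^sup>2)) * - (\<integral>w. v w * ((z - w) * bump 2 (of_real (1 / e) * (z - w))) \<partial>lborel)"
    unfolding eq integral_mult_right_zero Bochner_Integration.integral_minus ..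
  finally show ?thesis using orth[OF t] e(1) bump_mass_pos by simp
qed

lemma L2_locally_integrable:
  assumes v: "v \<in> L2 meas" and R: "R < 1"
  shows "integrable lborel (\<lambda>w. indicator (cball 0 R) w *\<^sub>R v w)"
proof -
  have vm [measurable]: "v \<in> borel_measurable borel" using v by (rule meas_L2_measurable)
  have vi: "integrable lborel (\<lambda>w. W w * (cmod (v w))\<^sup>2)"
    using L2_integrable[OF v] by (subst (asm) meas_integrable) auto
  have sub: "cball 0 R \<subseteq> disc" using R by auto
  have "compact (\<phi> ` cball 0 R)" by (rule compact_continuous_image[OF continuous_on_subset[OF continuous_phi sub] compact_cball])
  from bounded_imp_bdd_above[OF compact_imp_bounded[OF this]]
  obtain B where B: "\<And>y. y \<in> \<phi> ` cball 0 R \<Longrightarrow> y \<le> B" unfolding bdd_above_def by blast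
  have Bw: "\<phi> w \<le> B" if "w \<in> cball 0 R" for w using B that by blast
  have ii: "integrable lborel (indicator (cball 0 R) :: complex \<Rightarrow> real)"
    by (rule integrable_real_indicator) (simp, rule emeasure_bounded_finite, simp)
  show ?thesis
  proof (rule Bochner_Integration.integrable_bound)
    show "integrable lborel (\<lambda>w. indicator (cball 0 R) w + exp (2 * B) * (W w * (cmod (v w))\<^sup>2))"
      using ii vi by (intro Bochner_Integration.integrable_add integrable_mult_right)
    show "(\<lambda>w. indicator (cball 0 R) w *\<^sub>R v w) \<in> borel_measurable lborel"
      unfolding measurable_lborel2 using vm by (intro borel_measurable_scaleR borel_measurable_indicator) auto
    have "norm (indicator (cball 0 R) w *\<^sub>R v w) \<le> indicator (cball 0 R) w + exp (2 * B) * (W w * (cmod (v w))\<^sup>2)" for w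
    proof (cases "w \<in> cball 0 R")
      case True
      have "1 \<le> exp (2 * B) * W w"
        using Bw[OF True] sub True W_disc[of w] by (auto simp flip: exp_add)
      then have "1 * (cmod (v w))\<^sup>2 \<le> (exp (2 * B) * W w) * (cmod (v w))\<^sup>2" by (rule mult_right_mono) simp
      moreover have "cmod (v w) \<le> 1 + (cmod (v w))\<^sup>2"
      proof -
        have "0 \<le> (cmod (v w) - 1)\<^sup>2" "0 \<le> cmod (v w)" by simp_all
        then show ?thesis unfolding power2_diff by (simp, linarith)
      qed
      ultimately show ?thesis using True by (simp add: mult.assoc)
    qed (simp add: W_nonneg)
    then have "norm (indicator (cball 0 R) w *\<^sub>R v w) \<le> \<bar>indicator (cball 0 R) w + exp (2 * B) * (W w * (cmod (v w))\<^sup>2)\<bar>" for w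
      using abs_ge_self order_trans by blast
    then show "AE w in lborel. norm (indicator (cball 0 R) w *\<^sub>R v w) \<le> norm (indicator (cball 0 R) w + exp (2 * B) * (W w * (cmod (v w))\<^sup>2))"
      by simp
  qed
qed

lemma AE_meas_disc: "AE z in meas. z \<in> disc"
proof -
  have "AE z in lborel. 0 < W z \<longrightarrow> z \<in> disc" by (rule AE_I2) (auto simp: W_def indicator_def)
  then show ?thesis unfolding meas_def by (subst AE_density) auto
qed

text \<open>
  By Weyl's lemma \<open>v\<close> acts on compactly supported continuous functions as some holomorphic \<open>h\<close>.
  That \<open>h\<close> is square-integrable follows by duality: with a cutoff \<open>\<chi>\<close>, the number
  \<open>S = \<integral> \<chi> |h|\<^sup>2\<close> is the pairing of \<open>v\<close> with \<open>\<chi> h\<close>, hence \<open>S\<^sup>2 \<le> \<parallel>v\<parallel>\<^sup>2 S\<close>, a bound that does not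
  depend on \<open>\<chi>\<close>.  Equality of the pairings, which avoids the almost everywhere equality of \<open>v\<close> and
  \<open>h\<close>, is all that the density argument below requires.
\<close>

lemma weakly_holomorphic:
  assumes v: "v \<in> L2 meas" and orth: "\<And>\<alpha> a b. testfun \<alpha> a b \<Longrightarrow> ip meas v (dstar \<alpha> a) = 0"
  obtains h where "h holomorphic_on disc" "(\<lambda>z. indicator disc z *\<^sub>R h z) \<in> L2 meas"
    "\<And>u. continuous_on disc u \<Longrightarrow> u \<in> L2 meas \<Longrightarrow> ip meas v u = ip meas (\<lambda>z. indicator disc z *\<^sub>R h z) u"
proof -
  have vm [measurable]: "v \<in> borel_measurable borel" using v by (rule meas_L2_measurable)
  obtain h where h: "h holomorphic_on disc"
    and hv: "\<And>\<psi> R. continuous_on UNIV \<psi> \<Longrightarrow> R < 1 \<Longrightarrow> (\<And>z. z \<notin> cball 0 R \<Longrightarrow> \<psi> z = 0) \<Longrightarrow>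
      (\<integral>z. v z * \<psi> z \<partial>lborel) = (\<integral>z. h z * \<psi> z \<partial>lborel)"
  proof (rule Weyl_lemma)
    show "integrable lborel (\<lambda>w. indicator (cball 0 R) w *\<^sub>R v w)" if "R < 1" for R
      by (rule L2_locally_integrable[OF v that])
    show "(\<integral>w. v w * ((z - w) * bump 2 (of_real (1 / e) * (z - w))) \<partial>lborel) = 0" if "e > 0" "cmod z + e < 1" for z e
      by (rule weak_orthogonality_kernel[OF that vm]) (rule orth)
  qed (rule that, assumption, blast)
  define H where "H z = indicator disc z *\<^sub>R h z" for z
  have hc: "continuous_on disc h" using h by (rule holomorphic_on_imp_continuous_on)
  have Hm [measurable]: "H \<in> borel_measurable borel"
    unfolding H_def[abs_def] by (rule borel_measurable_continuous_on_indicator[OF _ hc]) simp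
  have [measurable]: "disc_cutoff n \<in> borel_measurable borel" for n
    by (rule borel_measurable_continuous_onI[OF continuous_on_dcut])
  have [measurable]: "cnj \<in> borel_measurable borel" by (intro borel_measurable_continuous_onI continuous_intros)
  define R where "R n = 1 - 1 / real (Suc n)" for n
  have R: "R n < 1" for n by (simp add: R_def)
  have sub: "cball 0 (R n) \<subseteq> disc" for n using R[of n] by auto
  have cutc: "continuous_on UNIV (\<lambda>z. of_real (disc_cutoff n z) * F z)" if "continuous_on disc F" for F :: "complex \<Rightarrow> complex" and n
  proof (rule continuous_on_cutoff[OF continuous_on_of_real[OF continuous_on_dcut] closed_cball _ sub open_ball that])
    show "complex_of_real (disc_cutoff n z) = 0" if "z \<notin> cball 0 (R n)" for z
      using disc_cutoff_eq_0[of z n] that by (simp add: R_def)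
  qed
  have cut0: "of_real (disc_cutoff n z) * F z = 0" if "z \<notin> cball 0 (R n)" for n z and F :: "complex \<Rightarrow> complex"
    using disc_cutoff_eq_0[of z n] that by (simp add: R_def)
  have key: "(\<integral>z. v z * (of_real (disc_cutoff n z) * F z) \<partial>meas) = (\<integral>z. H z * (of_real (disc_cutoff n z) * F z) \<partial>meas)"
    if F: "continuous_on disc F" for F n
  proof -
    have FE: "continuous_on disc (\<lambda>z. F z * E z)" using F continuous_E by (intro continuous_intros)
    have [measurable]: "(\<lambda>z. of_real (disc_cutoff n z) * F z) \<in> borel_measurable borel"
      by (rule borel_measurable_continuous_onI[OF cutc[OF F]])
    have "W z *\<^sub>R (v z * (of_real (disc_cutoff n z) * F z)) = v z * (of_real (disc_cutoff n z) * (F z * E z))" for z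
      by (cases "z \<in> disc") (simp_all add: W_disc W_outside E_of_real scaleR_conv_of_real disc_cutoff_outside)
    moreover have "W z *\<^sub>R (H z * (of_real (disc_cutoff n z) * F z)) = h z * (of_real (disc_cutoff n z) * (F z * E z))" for z
      by (cases "z \<in> disc") (simp_all add: H_def W_disc W_outside E_of_real scaleR_conv_of_real disc_cutoff_outside)
    moreover have "(\<integral>z. v z * (of_real (disc_cutoff n z) * (F z * E z)) \<partial>lborel) = (\<integral>z. h z * (of_real (disc_cutoff n z) * (F z * E z)) \<partial>lborel)"
      by (rule hv[OF cutc[OF FE] R]) (rule cut0)
    moreover have m1: "(\<lambda>z. v z * (of_real (disc_cutoff n z) * F z)) \<in> borel_measurable borel"
      and m2: "(\<lambda>z. H z * (of_real (disc_cutoff n z) * F z)) \<in> borel_measurable borel" by measurable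
    ultimately show ?thesis unfolding meas_integral[OF m1] meas_integral[OF m2] by (simp only:)
  qed
  define N where "N = sqnorm meas v"
  have cutH: "(\<lambda>z. of_real (disc_cutoff n z) * H z) = (\<lambda>z. of_real (disc_cutoff n z) * h z)" for n
    by (auto simp: H_def fun_eq_iff indicator_def disc_cutoff_outside)
  have HL: "(\<lambda>z. of_real (disc_cutoff n z) * H z) \<in> L2 meas" for n
    unfolding cutH by (rule compact_support_E(4)[OF cutc[OF hc] _ R]) (use cut0 in auto)
  have SN: "integrable meas (\<lambda>z. disc_cutoff n z * (cmod (H z))\<^sup>2)" "(\<integral>z. disc_cutoff n z * (cmod (H z))\<^sup>2 \<partial>meas) \<le> N" for n
  proof -
    have c: "continuous_on UNIV (\<lambda>z. of_real (disc_cutoff n z) * (h z * cnj (h z)))"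
      by (rule cutc) (intro continuous_intros hc)
    have "integrable meas (\<lambda>z. of_real (disc_cutoff n z) * (h z * cnj (h z)))"
      by (rule compact_support_E(1)[OF c _ R]) (use cut0 in auto)
    moreover have "of_real (disc_cutoff n z) * (h z * cnj (h z)) = of_real (disc_cutoff n z * (cmod (H z))\<^sup>2)" for z
      unfolding of_real_mult complex_norm_square by (cases "z \<in> disc") (simp_all add: H_def disc_cutoff_outside)
    ultimately have i: "integrable meas (\<lambda>z. complex_of_real (disc_cutoff n z * (cmod (H z))\<^sup>2))" by simp
    from integrable_Re[OF this] show i': "integrable meas (\<lambda>z. disc_cutoff n z * (cmod (H z))\<^sup>2)" by simp
    define S where "S = (\<integral>z. disc_cutoff n z * (cmod (H z))\<^sup>2 \<partial>meas)"
    have S0: "0 \<le> S" unfolding S_def by (intro integral_nonneg_AE AE_I2 mult_nonneg_nonneg) (auto simp: disc_cutoff_bounds)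
    have "of_real S = (\<integral>z. H z * (of_real (disc_cutoff n z) * cnj (h z)) \<partial>meas)"
    proof -
      have "of_real S = (\<integral>z. complex_of_real (disc_cutoff n z * (cmod (H z))\<^sup>2) \<partial>meas)"
        unfolding S_def by (rule integral_of_real[symmetric, OF i'])
      also have "\<dots> = (\<integral>z. H z * (of_real (disc_cutoff n z) * cnj (h z)) \<partial>meas)"
      proof (rule Bochner_Integration.integral_cong)
        fix z
        show "complex_of_real (disc_cutoff n z * (cmod (H z))\<^sup>2) = H z * (of_real (disc_cutoff n z) * cnj (h z))"
          unfolding of_real_mult complex_norm_square by (auto simp: H_def indicator_def)
      qed simp
      finally show ?thesis .
    qed
    also have "\<dots> = (\<integral>z. v z * (of_real (disc_cutoff n z) * cnj (h z)) \<partial>meas)"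
      by (rule key[symmetric]) (intro continuous_intros hc)
    also have "\<dots> = ip meas v (\<lambda>z. of_real (disc_cutoff n z) * H z)"
      unfolding ip_def cutH by simp
    finally have "S\<^sup>2 = (cmod (ip meas v (\<lambda>z. of_real (disc_cutoff n z) * H z)))\<^sup>2"
      by (metis norm_of_real power2_abs)
    also have "\<dots> \<le> N * sqnorm meas (\<lambda>z. of_real (disc_cutoff n z) * H z)"
      unfolding N_def by (rule L2_Cauchy_Schwarz[OF v HL])
    also have "\<dots> \<le> N * S"
    proof (rule mult_left_mono)
      show "sqnorm meas (\<lambda>z. of_real (disc_cutoff n z) * H z) \<le> S"
        unfolding sqnorm_def S_def
      proof (rule integral_mono)
        show "integrable meas (\<lambda>z. (cmod (of_real (disc_cutoff n z) * H z))\<^sup>2)" using L2_integrable[OF HL] .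
        show "integrable meas (\<lambda>z. disc_cutoff n z * (cmod (H z))\<^sup>2)" by (rule i')
        have "(disc_cutoff n z)\<^sup>2 \<le> disc_cutoff n z" for z
          using disc_cutoff_bounds[of n z] by (simp add: power2_eq_square mult_left_le)
        then show "(cmod (of_real (disc_cutoff n z) * H z))\<^sup>2 \<le> disc_cutoff n z * (cmod (H z))\<^sup>2" for z
          by (simp add: norm_mult power_mult_distrib mult_right_mono)
      qed
      show "0 \<le> N" by (simp add: N_def sqnorm_nonneg)
    qed
    finally have "S * S \<le> N * S" by (simp add: power2_eq_square)
    then have "S \<le> N"
    proof (cases "S = 0")
      case True then show ?thesis by (simp add: N_def sqnorm_nonneg)
    next
      case False then show ?thesis using S0 \<open>S * S \<le> N * S\<close> by simp
    qed
    then show "(\<integral>z. disc_cutoff n z * (cmod (H z))\<^sup>2 \<partial>meas) \<le> N" by (simp add: S_def)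
  qed
  have HL2: "H \<in> L2 meas"
  proof -
    have "(\<integral>\<^sup>+z. ennreal ((cmod (H z))\<^sup>2) \<partial>meas) \<le> (\<integral>\<^sup>+z. liminf (\<lambda>n. ennreal (disc_cutoff n z * (cmod (H z))\<^sup>2)) \<partial>meas)"
    proof (rule nn_integral_mono)
      fix z
      show "ennreal ((cmod (H z))\<^sup>2) \<le> liminf (\<lambda>n. ennreal (disc_cutoff n z * (cmod (H z))\<^sup>2))"
      proof (cases "cmod z < 1")
        case True
        have "(\<lambda>n. ennreal (disc_cutoff n z * (cmod (H z))\<^sup>2)) \<longlonglongrightarrow> ennreal (1 * (cmod (H z))\<^sup>2)"
          by (intro tendsto_ennrealI tendsto_mult tendsto_const disc_cutoff_tendsto True)
        then show ?thesis using lim_imp_Liminf[OF trivial_limit_sequentially] by fastforce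
      next
        case False then show ?thesis by (simp add: H_def)
      qed
    qed
    also have "\<dots> \<le> liminf (\<lambda>n. \<integral>\<^sup>+z. ennreal (disc_cutoff n z * (cmod (H z))\<^sup>2) \<partial>meas)"
      by (rule nn_integral_liminf) measurable
    also have "\<dots> \<le> ennreal N"
    proof (rule Liminf_le)
      show "\<forall>\<^sub>F n in sequentially. (\<integral>\<^sup>+z. ennreal (disc_cutoff n z * (cmod (H z))\<^sup>2) \<partial>meas) \<le> ennreal N"
      proof (rule always_eventually, rule allI)
        fix n
        have "(\<integral>\<^sup>+z. ennreal (disc_cutoff n z * (cmod (H z))\<^sup>2) \<partial>meas) = ennreal (\<integral>z. disc_cutoff n z * (cmod (H z))\<^sup>2 \<partial>meas)"
          by (rule nn_integral_eq_integral[OF SN(1)]) (simp add: disc_cutoff_bounds)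
        then show "(\<integral>\<^sup>+z. ennreal (disc_cutoff n z * (cmod (H z))\<^sup>2) \<partial>meas) \<le> ennreal N"
          using SN(2)[of n] by (simp add: ennreal_leI)
      qed
    qed simp
    finally have le: "(\<integral>\<^sup>+z. ennreal ((cmod (H z))\<^sup>2) \<partial>meas) \<le> ennreal N" .
    have "integrable meas (\<lambda>z. (cmod (H z))\<^sup>2)"
      by (rule integrableI_nonneg) (use le in \<open>auto intro: le_less_trans\<close>)
    then show ?thesis using Hm by (simp add: L2_def meas_def)
  qed
  show ?thesis
  proof (rule that[OF h])
    show "(\<lambda>z. indicator disc z *\<^sub>R h z) \<in> L2 meas" using HL2 by (simp add: H_def[abs_def])
    fix u :: "complex \<Rightarrow> complex" assume u: "continuous_on disc u" "u \<in> L2 meas"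
    have um [measurable]: "u \<in> borel_measurable borel" using u(2) by (rule meas_L2_measurable)
    have lim: "(\<lambda>n. \<integral>z. g z * (of_real (disc_cutoff n z) * cnj (u z)) \<partial>meas) \<longlonglongrightarrow> ip meas g u" if g: "g \<in> L2 meas" for g
      unfolding ip_def
    proof (rule integral_dominated_convergence[where w = "\<lambda>z. cmod (g z * cnj (u z))"])
      have [measurable]: "g \<in> borel_measurable borel" using g by (rule meas_L2_measurable)
      show "(\<lambda>z. g z * cnj (u z)) \<in> borel_measurable meas" by measurable
      show "(\<lambda>z. g z * (of_real (disc_cutoff n z) * cnj (u z))) \<in> borel_measurable meas" for n by measurable
      show "integrable meas (\<lambda>z. cmod (g z * cnj (u z)))" by (rule integrable_norm[OF L2_mult_integrable[OF g u(2)]])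
      show "AE z in meas. norm (g z * (of_real (disc_cutoff n z) * cnj (u z))) \<le> cmod (g z * cnj (u z))" for n
        using disc_cutoff_bounds[of n] by (intro AE_I2) (simp add: norm_mult mult_left_mono mult_left_le_one_le)
      show "AE z in meas. (\<lambda>n. g z * (of_real (disc_cutoff n z) * cnj (u z))) \<longlonglongrightarrow> g z * cnj (u z)"
        using AE_meas_disc
      proof eventually_elim
        case (elim z)
        have "(\<lambda>n. g z * (of_real (disc_cutoff n z) * cnj (u z))) \<longlonglongrightarrow> g z * (of_real 1 * cnj (u z))"
          by (intro tendsto_mult tendsto_const tendsto_of_real disc_cutoff_tendsto) (use elim in simp)
        then show ?case by simp
      qed
    qed
    have "continuous_on disc (\<lambda>z. cnj (u z))" by (intro continuous_intros u)
    note keyu = key[OF this]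
    from LIMSEQ_unique[OF lim[OF v] lim[OF HL2, folded keyu]]
    show "ip meas v u = ip meas (\<lambda>z. indicator disc z *\<^sub>R h z) u" by (simp add: H_def[abs_def])
  qed
qed

text \<open>
  The orthogonal complement of the functions \<open>dstar \<alpha> a\<close> acts as holomorphic functions do, by
  \<open>weakly_holomorphic\<close>, so \<open>u\<close> is orthogonal to it and lies in the closure of these functions.
\<close>

lemma dstar_approximation:
  assumes u: "u \<in> L2 meas" "continuous_on disc u"
    and orth: "\<And>h. h holomorphic_on disc \<Longrightarrow> (\<lambda>z. indicator disc z *\<^sub>R h z) \<in> L2 meas \<Longrightarrow> ip meas u (\<lambda>z. indicator disc z *\<^sub>R h z) = 0"
  obtains \<alpha> a b where "\<And>n. testfun (\<alpha> n) (a n) (b n)"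
    "(\<lambda>n. sqnorm meas (\<lambda>z. u z - dstar (\<alpha> n) (a n) z)) \<longlonglongrightarrow> 0"
proof -
  define V where "V = {dstar \<alpha> a | \<alpha> a b. testfun \<alpha> a b}"
  have "\<exists>v. (\<forall>n. v n \<in> V) \<and> (\<lambda>n. sqnorm meas (\<lambda>x. u x - v n x)) \<longlonglongrightarrow> 0"
  proof (rule L2_double_orthogonal[OF _ _ _ _ u(1)])
    show "V \<subseteq> L2 meas" using dstar_L2 by (auto simp: V_def)
    show "V \<noteq> {}" using testfun_zero by (auto simp: V_def)
    show "(\<lambda>x. v x + w x) \<in> V" if vw: "v \<in> V" "w \<in> V" for v w
    proof -
      obtain \<alpha> a b \<beta> a' b' where *: "testfun \<alpha> a b" "testfun \<beta> a' b'" "v = dstar \<alpha> a" "w = dstar \<beta> a'"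
        using vw by (auto simp: V_def)
      have "(\<lambda>x. v x + w x) = dstar (\<lambda>z. \<alpha> z + \<beta> z) (\<lambda>z. a z + a' z)"
        by (simp add: * dstar_def fun_eq_iff algebra_simps)
      then show ?thesis using testfun_add[OF *(1,2)] unfolding V_def by blast
    qed
    show "(\<lambda>x. k * v x) \<in> V" if v: "v \<in> V" for k v
    proof -
      obtain \<alpha> a b where *: "testfun \<alpha> a b" "v = dstar \<alpha> a" using v by (auto simp: V_def)
      have "(\<lambda>x. k * v x) = dstar (\<lambda>z. k * \<alpha> z) (\<lambda>z. k * a z)"
        by (simp add: * dstar_def fun_eq_iff algebra_simps)
      then show ?thesis using testfun_cmult[OF *(1)] unfolding V_def by blast
    qed
    fix q assume q: "q \<in> L2 meas" "\<And>v. v \<in> V \<Longrightarrow> ip meas q v = 0"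
    have qorth: "ip meas q (dstar \<alpha> a) = 0" if "testfun \<alpha> a b" for \<alpha> a b
      by (rule q(2)) (use that in \<open>auto simp: V_def\<close>)
    obtain h where h12: "h holomorphic_on disc" "(\<lambda>z. indicator disc z *\<^sub>R h z) \<in> L2 meas"
      and h3: "\<And>u. continuous_on disc u \<Longrightarrow> u \<in> L2 meas \<Longrightarrow> ip meas q u = ip meas (\<lambda>z. indicator disc z *\<^sub>R h z) u"
    proof (rule weakly_holomorphic[OF q(1)])
      show "ip meas q (dstar \<alpha> a) = 0" if "testfun \<alpha> a b" for \<alpha> a b by (rule qorth[OF that])
    qed (rule that, assumption, assumption, blast)
    note h = h12 h3[OF u(2,1)]
    have "cnj (ip meas u q) = cnj (ip meas u (\<lambda>z. indicator disc z *\<^sub>R h z))"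
      unfolding ip_cnj by (rule h(3))
    then show "ip meas u q = 0" using orth[OF h(1,2)] by simp
  qed
  then obtain v where v: "\<And>n. v n \<in> V" "(\<lambda>n. sqnorm meas (\<lambda>x. u x - v n x)) \<longlonglongrightarrow> 0" by blast
  have "\<exists>\<alpha> a b. testfun \<alpha> a b \<and> v n = dstar \<alpha> a" for n using v(1)[of n] by (auto simp: V_def)
  then obtain \<alpha> a b where "\<And>n. testfun (\<alpha> n) (a n) (b n)" "\<And>n. v n = dstar (\<alpha> n) (a n)" by metis
  then show ?thesis using v(2) by (intro that[of \<alpha> a b]) auto
qed

end

section \<open>Submean values and exponential weights\<close>

locale pos_weight = weight +
  assumes lap_pos: "z \<in> disc \<Longrightarrow> 0 < laplacian \<phi> z"
begin

text \<open>
  The function \<open>|f|\<^sup>2 exp (-2\<phi> + A |w - z|\<^sup>2)\<close> with \<open>A = M / 2\<close> is subharmonic on the disc: where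
  \<open>f \<noteq> 0\<close>, the Laplacian of its logarithm is \<open>- 2 \<Delta>\<phi> + 2 M\<close>.  The submean inequality for it
  yields the claim, and the quadratic correction is bounded by \<open>exp (A r\<^sup>2)\<close> on the support of the
  bump.  The function \<open>g\<close> agrees with \<open>f\<close> near \<open>z\<close> only, since a minimal solution of the
  Cauchy-Riemann equation is holomorphic only away from the support of the right-hand side.
\<close>

lemma weighted_mean_value:
  assumes f: "f holomorphic_on ball z (2 * r)" and r: "0 < r" and sub: "ball z (2 * r) \<subseteq> disc"
    and M: "\<And>w. w \<in> ball z (2 * r) \<Longrightarrow> laplacian \<phi> w \<le> M"
    and fm: "g \<in> borel_measurable borel" "\<And>w. w \<in> ball z (2 * r) \<Longrightarrow> g w = f w"
  shows "bump_mass * r\<^sup>2 * ((cmod (f z))\<^sup>2 * exp (- 2 * \<phi> z)) \<le>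
      exp (M * r\<^sup>2 / 2) * (\<integral>w. cmod (bump 3 (of_real (1 / r) * (w - z))) * (cmod (g w))\<^sup>2 \<partial>meas)"
proof -
  define B where "B = ball z (2 * r)"
  have zB: "z \<in> B" using r by (simp add: B_def)
  define A where "A = M / 2"
  have M0: "0 \<le> M" 
  proof -
    have zb: "z \<in> ball z (2 * r)" using r by simp
    from M[OF zb] lap_pos[OF subsetD[OF sub zb]] show ?thesis by linarith
  qed
  define f1 where "f1 = deriv f"
  have C1: "C1w B f f1 (\<lambda>_. 0)" unfolding f1_def B_def by (rule C1w_holomorphic[OF f]) simp
  have C1': "C1w B f1 (deriv f1) (\<lambda>_. 0)"
    unfolding f1_def B_def by (rule C1w_holomorphic[OF holomorphic_deriv[OF f]]) simp_all
  have C2: "C2w B f f1 (\<lambda>_. 0) (deriv f1) (\<lambda>_. 0) (\<lambda>_. 0)" unfolding C2w_def using C1 C1' C1w_const by blast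
  have C3: "C2w B (\<lambda>w. cnj (f w)) (\<lambda>_. 0) (\<lambda>w. cnj (f1 w)) (\<lambda>_. 0) (\<lambda>_. 0) (\<lambda>w. cnj (deriv f1 w))"
    unfolding C2w_def using C1w_cnj[OF C1] C1w_cnj[OF C1'] C1w_const[of B 0] by simp
  have idt: "C1w B (\<lambda>w. w - z) (\<lambda>_. 1) (\<lambda>_. 0)"
    by (rule C1w_cong[OF C1w_add[OF C1w_id C1w_const[of _ "- z"]]]) auto
  have Q: "C2w B (\<lambda>w. (w - z) * cnj (w - z)) (\<lambda>w. cnj (w - z)) (\<lambda>w. w - z) (\<lambda>_. 0) (\<lambda>_. 1) (\<lambda>_. 0)"
    unfolding C2w_def
    by (intro conjI C1w_cong[OF C1w_mult[OF idt C1w_cnj[OF idt]]] C1w_cong[OF C1w_cnj[OF idt]] C1w_cong[OF idt]) auto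
  define q where "q w = - 2 * p w + of_real A * cnj (w - z)" for w
  define L where "L w = - 2 * complex_of_real (laplacian \<phi> w / 4) + of_real A * 1" for w
  define \<psi> where "\<psi> w = - 2 * complex_of_real (\<phi> w) + of_real A * ((w - z) * cnj (w - z))" for w
  have "C2w B \<psi> q (\<lambda>w. - 2 * cnj (p w) + of_real A * (w - z)) (\<lambda>w. - 2 * pz w + of_real A * 0) L (\<lambda>w. - 2 * cnj (pz w) + of_real A * 0)"
    unfolding \<psi>_def[abs_def] q_def[abs_def] L_def[abs_def]
    by (rule C2w_add[OF C2w_cmult[OF C2w_subset[OF phi_C2w]] C2w_cmult[OF Q]]) (use sub in \<open>simp add: B_def\<close>)
  moreover have "(\<lambda>w. - 2 * cnj (p w) + of_real A * (w - z)) = (\<lambda>w. cnj (q w))" by (simp add: q_def fun_eq_iff)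
  ultimately have psi: "\<exists>aa bb. C2w B \<psi> q (\<lambda>w. cnj (q w)) aa L bb" by auto
  then obtain aa bb where psi: "C2w B \<psi> q (\<lambda>w. cnj (q w)) aa L bb" by blast
  note S = C2w_mult[OF C2w_mult[OF C2 C3] C2w_exp[OF psi]]
  define s where "s w = f w * cnj (f w) * exp (\<psi> w)" for w
  define c where "c w = (0 * cnj (f w) + f1 w * cnj (f1 w) + (0 * 0 + f w * 0)) * exp (\<psi> w) +
        (f1 w * cnj (f w) + f w * 0) * (exp (\<psi> w) * cnj (q w)) +
        ((0 * cnj (f w) + f w * cnj (f1 w)) * (exp (\<psi> w) * q w) + f w * cnj (f w) * (exp (\<psi> w) * (q w * cnj (q w) + L w)))" for w
  obtain a b aa' bb' where sC: "C1w B s a b" "C1w B a aa' c" "C1w B b c bb'"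
    using S unfolding C2w_def s_def[abs_def] c_def[abs_def] by blast
  have psi_real: "\<psi> w = of_real (- 2 * \<phi> w + A * (cmod (w - z))\<^sup>2)" for w
    unfolding \<psi>_def complex_norm_square[symmetric] by simp
  have c_eq: "c w = of_real (exp (- 2 * \<phi> w + A * (cmod (w - z))\<^sup>2) * ((cmod (f1 w + f w * q w))\<^sup>2 + (cmod (f w))\<^sup>2 * (A - laplacian \<phi> w / 2)))" for w
  proof -
    have "c w = exp (\<psi> w) * ((f1 w + f w * q w) * cnj (f1 w + f w * q w) + f w * cnj (f w) * L w)"
      by (simp add: c_def algebra_simps)
    moreover have "exp (\<psi> w) = of_real (exp (- 2 * \<phi> w + A * (cmod (w - z))\<^sup>2))" unfolding psi_real by (rule exp_of_real)
    moreover have "L w = of_real (A - laplacian \<phi> w / 2)" by (simp add: L_def)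
    ultimately show ?thesis unfolding of_real_mult of_real_add complex_norm_square by simp
  qed
  have sub0: "0 \<le> Re (c w + c w)" if "w \<in> B" for w
  proof -
    have "0 \<le> A - laplacian \<phi> w / 2" using M[of w] that by (simp add: A_def B_def)
    then have "0 \<le> exp (- 2 * \<phi> w + A * (cmod (w - z))\<^sup>2) * ((cmod (f1 w + f w * q w))\<^sup>2 + (cmod (f w))\<^sup>2 * (A - laplacian \<phi> w / 2))"
      by (intro mult_nonneg_nonneg add_nonneg_nonneg) auto
    then show ?thesis unfolding c_eq by simp
  qed
  have s_real: "s w = of_real ((cmod (f w))\<^sup>2 * exp (- 2 * \<phi> w + A * (cmod (w - z))\<^sup>2))" for w
    unfolding s_def psi_real exp_of_real of_real_mult complex_norm_square ..
  have le1: "bump_mass * Re (s z) \<le> Re (\<integral>w. bump 3 w * s (z + of_real r * w) \<partial>lborel)"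
    by (rule subharmonic_mean_value[OF sC[unfolded B_def]]) (use r sub0 in \<open>auto simp: B_def\<close>)
  define G where "G w = cmod (bump 3 (of_real (1 / r) * (w - z))) * (cmod (g w))\<^sup>2" for w
  have [measurable]: "g \<in> borel_measurable borel" by (rule fm(1))
  have bm: "(\<lambda>w. bump 3 (of_real (1 / r) * (w - z))) \<in> borel_measurable borel"
    by (intro borel_measurable_continuous_onI continuous_intros)
  have Gm: "G \<in> borel_measurable borel" unfolding G_def[abs_def] using bm by measurable
  have nb: "complex_of_real (cmod (bump 3 w)) = bump 3 w" for w by (simp add: bump_def del: of_real_power)
  have Wm: "(\<lambda>w. W w * G w) \<in> borel_measurable borel" using Gm by measurable
  have pos_eq: "bump 3 w * s (z + of_real r * w) = of_real (exp (A * (cmod (of_real r * w))\<^sup>2)) * complex_of_real (W (z + of_real r * w) * G (z + of_real r * w))" for w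
  proof (cases "cmod w < 1")
    case True
    then have "cmod (of_real r * w) < 2 * r" using r by (simp add: norm_mult)
    then have mem: "z + of_real r * w \<in> ball z (2 * r)" by (simp add: dist_norm)
    then have "g (z + of_real r * w) = f (z + of_real r * w)" "z + of_real r * w \<in> disc" using fm(2) sub by auto
    then have WG: "W (z + of_real r * w) * G (z + of_real r * w) = exp (- 2 * \<phi> (z + of_real r * w)) * (cmod (bump 3 w) * (cmod (f (z + of_real r * w)))\<^sup>2)"
      using r by (simp add: W_disc G_def)
    have zz: "z + of_real r * w - z = of_real r * w" by simp
    show ?thesis
      unfolding WG unfolding s_real zz exp_add of_real_mult nb by (simp only: mult_ac)
  next
    case False
    then have "bump 3 w = 0" by (intro bump_eq_0) auto
    moreover have "G (z + of_real r * w) = 0" using r calculation by (simp add: G_def)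
    ultimately show ?thesis by simp
  qed
  define I where "I = (\<integral>w. W (z + of_real r * w) * G (z + of_real r * w) \<partial>lborel)"
  have G0: "0 \<le> W w * G w" for w by (simp add: W_nonneg G_def)
  have e_le: "exp (A * (cmod (of_real r * w))\<^sup>2) \<le> exp (A * r\<^sup>2)" if "cmod w < 1" for w
  proof -
    have "(cmod (of_real r * w))\<^sup>2 = r\<^sup>2 * (cmod w)\<^sup>2" by (simp add: norm_mult power_mult_distrib)
    also have "\<dots> \<le> r\<^sup>2 * 1" using that by (intro mult_left_mono) (auto simp: power_le_one)
    finally show ?thesis using M0 by (simp add: A_def mult_left_mono)
  qed
  have int_s: "integrable lborel (\<lambda>w. bump 3 w * s (z + of_real r * w))"
    by (rule radial_mean_derivative(2)[OF sC[unfolded B_def]]) (use r in auto)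
  have WGm: "(\<lambda>w. W (z + of_real r * w) * G (z + of_real r * w)) \<in> borel_measurable borel"
    using Gm by measurable
  have out0: "G (z + of_real r * w) = 0" if "\<not> cmod w < 1" for w
    using bump_eq_0[of 3 w] that r by (simp add: G_def)
  have int_WG: "integrable lborel (\<lambda>w. W (z + of_real r * w) * G (z + of_real r * w))"
  proof (rule Bochner_Integration.integrable_bound[OF int_s])
    show "(\<lambda>w. W (z + of_real r * w) * G (z + of_real r * w)) \<in> borel_measurable lborel" using WGm by simp
    show "AE w in lborel. norm (W (z + of_real r * w) * G (z + of_real r * w)) \<le> norm (bump 3 w * s (z + of_real r * w))"
    proof (rule AE_I2)
      fix w
      have "0 \<le> A * (cmod (of_real r * w))\<^sup>2" using M0 by (simp add: A_def)
      then have "1 \<le> exp (A * (cmod (of_real r * w))\<^sup>2)" by simp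
      from mult_right_mono[OF this G0[of "z + of_real r * w"]]
      have le: "W (z + of_real r * w) * G (z + of_real r * w) \<le>
          exp (A * (cmod (of_real r * w))\<^sup>2) * (W (z + of_real r * w) * G (z + of_real r * w))" by simp
      have "norm (W (z + of_real r * w) * G (z + of_real r * w)) = W (z + of_real r * w) * G (z + of_real r * w)"
        unfolding real_norm_def by (rule abs_of_nonneg[OF G0])
      moreover have "norm (bump 3 w * s (z + of_real r * w)) = exp (A * (cmod (of_real r * w))\<^sup>2) * (W (z + of_real r * w) * G (z + of_real r * w))"
        unfolding pos_eq of_real_mult[symmetric] norm_of_real by (rule abs_of_nonneg) (intro mult_nonneg_nonneg[OF exp_ge_zero] G0)
      ultimately show "norm (W (z + of_real r * w) * G (z + of_real r * w)) \<le> norm (bump 3 w * s (z + of_real r * w))"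
        using le by (simp only:)
    qed
  qed
  have "Re (\<integral>w. bump 3 w * s (z + of_real r * w) \<partial>lborel) = (\<integral>w. Re (bump 3 w * s (z + of_real r * w)) \<partial>lborel)"
    by (rule integral_Re[symmetric, OF int_s])
  also have "\<dots> \<le> (\<integral>w. exp (A * r\<^sup>2) * (W (z + of_real r * w) * G (z + of_real r * w)) \<partial>lborel)"
  proof (rule integral_mono)
    show "integrable lborel (\<lambda>w. Re (bump 3 w * s (z + of_real r * w)))" by (rule integrable_Re[OF int_s])
    show "integrable lborel (\<lambda>w. exp (A * r\<^sup>2) * (W (z + of_real r * w) * G (z + of_real r * w)))" using int_WG by simp
    fix w
    have "Re (bump 3 w * s (z + of_real r * w)) = exp (A * (cmod (of_real r * w))\<^sup>2) * (W (z + of_real r * w) * G (z + of_real r * w))"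
      unfolding pos_eq of_real_mult[symmetric] by (rule Re_complex_of_real)
    also have "\<dots> \<le> exp (A * r\<^sup>2) * (W (z + of_real r * w) * G (z + of_real r * w))"
    proof (cases "cmod w < 1")
      case True then show ?thesis by (intro mult_right_mono e_le G0)
    next
      case False then show ?thesis using out0[of w] by simp
    qed
    finally show "Re (bump 3 w * s (z + of_real r * w)) \<le> exp (A * r\<^sup>2) * (W (z + of_real r * w) * G (z + of_real r * w))" .
  qed
  also have "\<dots> = exp (A * r\<^sup>2) * I" by (simp add: I_def)
  finally have le2: "bump_mass * Re (s z) \<le> exp (A * r\<^sup>2) * I" using le1 by simp
  have "(\<integral>w. G w \<partial>meas) = r\<^sup>2 * I"
  proof -
    have "(\<integral>w. G w \<partial>meas) = (\<integral>w. W w * G w \<partial>lborel)" using meas_integral[OF Gm] by simp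
    moreover have "(\<integral>w. W w * G w \<partial>lborel) = r\<^sup>2 * I"
      unfolding I_def by (rule lborel_integral_affine[where ?'a = real, unfolded real_scaleR_def, OF _ Wm]) (use r in simp)
    ultimately show ?thesis by simp
  qed
  then have GI: "r\<^sup>2 * I = (\<integral>w. cmod (bump 3 (of_real (1 / r) * (w - z))) * (cmod (g w))\<^sup>2 \<partial>meas)"
    by (simp add: G_def[abs_def])
  have "Re (s z) = (cmod (f z))\<^sup>2 * exp (- 2 * \<phi> z)" unfolding s_real by simp
  then have "r\<^sup>2 * (bump_mass * ((cmod (f z))\<^sup>2 * exp (- 2 * \<phi> z))) \<le> r\<^sup>2 * (exp (A * r\<^sup>2) * I)"
    using le2 by (intro mult_left_mono) auto
  then have "bump_mass * r\<^sup>2 * ((cmod (f z))\<^sup>2 * exp (- 2 * \<phi> z)) \<le> exp (A * r\<^sup>2) * (r\<^sup>2 * I)"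
    by (simp add: mult_ac)
  then show ?thesis unfolding GI by (simp add: A_def)
qed

text \<open>
  Put \<open>\<eta> = exp \<rho>\<close>, \<open>D = dstar \<alpha> a\<close> and \<open>X = \<parallel>dstar (\<eta> \<alpha>)\<parallel>\<^sup>2\<close>.  Expansion of the squares gives
  \<open>Re \<langle>D, dstar (\<eta>\<^sup>2 \<alpha>)\<rangle> = X - \<parallel>(\<partial>\<rho>) \<eta> \<alpha>\<parallel>\<^sup>2\<close>; by the basic inequality and \<open>grad\<close> the last term is at most
  \<open>X / 2\<close>.  On the left, \<open>u\<close> may replace \<open>D\<close> at the cost of the term with \<open>u - D\<close>, and then \<open>weak\<close>
  turns the pairing into \<open>\<langle>f, \<eta>\<^sup>2 \<alpha>\<rangle>\<close>, which the Cauchy-Schwarz inequality with the weights \<open>1/\<Delta>\<phi>\<close> and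
  \<open>\<Delta>\<phi>\<close> bounds by \<open>X / 4\<close> plus twice the integral of \<open>\<eta>\<^sup>2 |f|\<^sup>2 / \<Delta>\<phi>\<close>.  So \<open>X\<close> is bounded, and
  with it \<open>\<parallel>\<eta> D\<parallel>\<close>.

  The error term tends to 0 when \<open>dstar \<alpha> a\<close> tends to \<open>u\<close>, as long as \<open>B\<close> stays fixed, because
  \<open>sqnorm meas (dstar \<alpha> a)\<close> stays bounded.
\<close>

lemma Agmon_step:
  assumes u: "u \<in> L2 meas"
    and f: "continuous_on UNIV f" "\<forall>z. z \<notin> cball 0 R \<longrightarrow> f z = 0" and R: "R < 1"
    and weak: "\<And>\<beta> b1 b2. testfun \<beta> b1 b2 \<Longrightarrow> ip meas u (dstar \<beta> b1) = ip meas f \<beta>"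
    and \<alpha>: "testfun \<alpha> a b" "\<And>z. z \<notin> cball 0 R \<Longrightarrow> \<alpha> z = 0" "\<And>z. z \<notin> cball 0 R \<Longrightarrow> a z = 0"
    and \<rho>: "C2w UNIV (\<lambda>z. of_real (\<rho> z)) r (\<lambda>z. cnj (r z)) raa rc rbb"
    and grad: "\<And>z. z \<in> cball 0 R \<Longrightarrow> 4 * (cmod (r z))\<^sup>2 \<le> laplacian \<phi> z"
    and B: "\<And>z. z \<in> cball 0 R \<Longrightarrow> \<rho> z \<le> B"
  shows "sqnorm meas (\<lambda>z. of_real (exp (\<rho> z)) * dstar \<alpha> a z) \<le>
      24 * (\<integral>z. exp (2 * \<rho> z) * (cmod (f z))\<^sup>2 / laplacian \<phi> z \<partial>meas) +
      12 * sqrt (sqnorm meas (\<lambda>z. u z - dstar \<alpha> a z) * (6 * exp (4 * B) * sqnorm meas (dstar \<alpha> a)))"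
proof -
  have sub: "cball 0 R \<subseteq> disc" using R by auto
  define \<eta> where "\<eta> z = exp (complex_of_real (\<rho> z))" for z
  have \<eta>_real: "\<eta> z = of_real (exp (\<rho> z))" for z unfolding \<eta>_def by (rule exp_of_real)
  have cnj_\<eta>: "cnj (\<eta> z) = \<eta> z" for z by (simp add: \<eta>_real)
  obtain e1 e2 e3 where \<eta>2: "C2w UNIV \<eta> (\<lambda>z. \<eta> z * r z) (\<lambda>z. \<eta> z * cnj (r z)) e1 e2 e3"
    using C2w_exp[OF \<rho>] unfolding \<eta>_def[abs_def] by blast
  note \<eta>2d = C2w_subset[OF \<eta>2 subset_UNIV, of disc]
  have \<eta>1: "C1w UNIV \<eta> (\<lambda>z. \<eta> z * r z) (\<lambda>z. \<eta> z * cnj (r z))" using \<eta>2 by (simp add: C2w_def)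
  have r1: "continuous_on UNIV r"
    using \<rho> C1w_continuous_d(1) unfolding C2w_def by blast
  have c\<eta>: "continuous_on UNIV \<eta>" by (rule C1w_continuous[OF \<eta>1])
  have c\<alpha>: "continuous_on UNIV \<alpha>" using testfunE[OF \<alpha>(1)] C1w_continuous by metis
  have cD: "continuous_on UNIV (dstar \<alpha> a)" using dstar_compact_support[OF \<alpha>(1)] by metis
  define D where "D = dstar \<alpha> a"
  have D0: "D z = 0" if "z \<notin> cball 0 R" for z using \<alpha>(2,3)[OF that] by (simp add: D_def dstar_def)
  define G where "G z = \<eta> z * D z" for z
  define H where "H z = r z * (\<alpha> z * \<eta> z)" for z
  have G0: "\<forall>z. z \<notin> cball 0 R \<longrightarrow> G z = 0" using D0 by (simp add: G_def)
  have H0: "\<forall>z. z \<notin> cball 0 R \<longrightarrow> H z = 0" using \<alpha>(2) by (simp add: H_def)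
  have cG: "continuous_on UNIV G" unfolding G_def[abs_def] D_def by (intro continuous_intros c\<eta> cD)
  have cH: "continuous_on UNIV H" unfolding H_def[abs_def] by (intro continuous_intros c\<eta> c\<alpha> r1)
  have GL: "G \<in> L2 meas" by (rule compact_support_E(4)[OF cG G0 R])
  have HL: "H \<in> L2 meas" by (rule compact_support_E(4)[OF cH H0 R])
  have DL: "D \<in> L2 meas" unfolding D_def by (rule dstar_L2[OF \<alpha>(1)])
  note t1 = testfun_mult[OF \<alpha>(1) \<eta>2d]
  note t2 = testfun_mult[OF t1 \<eta>2d]
  define \<alpha>1 where "\<alpha>1 z = \<alpha> z * \<eta> z" for z
  define a1 where "a1 z = a z * \<eta> z + \<alpha> z * (\<eta> z * r z)" for z
  define \<alpha>2 where "\<alpha>2 z = \<alpha> z * \<eta> z * \<eta> z" for z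
  define a2 where "a2 z = (a z * \<eta> z + \<alpha> z * (\<eta> z * r z)) * \<eta> z + \<alpha> z * \<eta> z * (\<eta> z * r z)" for z
  obtain b1 b2 where t1: "testfun \<alpha>1 a1 b1" and t2: "testfun \<alpha>2 a2 b2"
    using t1 t2 unfolding \<alpha>1_def[abs_def] a1_def[abs_def] \<alpha>2_def[abs_def] a2_def[abs_def] by blast
  have d1: "dstar \<alpha>1 a1 = (\<lambda>z. G z - 1 * H z)"
    by (simp add: fun_eq_iff dstar_def \<alpha>1_def a1_def G_def H_def D_def algebra_simps)
  have d2: "dstar \<alpha>2 a2 z = \<eta> z * (G z - 2 * H z)" for z
    by (simp add: dstar_def \<alpha>2_def a2_def G_def H_def D_def algebra_simps)
  have D2L: "dstar \<alpha>2 a2 \<in> L2 meas" by (rule dstar_L2[OF t2])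
  define X where "X = sqnorm meas (dstar \<alpha>1 a1)"
  define S where "S = sqnorm meas D"
  define F where "F = (\<integral>z. exp (2 * \<rho> z) * (cmod (f z))\<^sup>2 / laplacian \<phi> z \<partial>meas)"
  define N where "N = (\<integral>z. laplacian \<phi> z * (cmod (\<alpha>1 z))\<^sup>2 \<partial>meas)"
  have N: "N \<le> 2 * X" "integrable meas (\<lambda>z. laplacian \<phi> z * (cmod (\<alpha>1 z))\<^sup>2)"
    unfolding N_def X_def by (rule basic_inequality[OF t1])+
  have Hle: "sqnorm meas H \<le> X / 2"
  proof -
    have "sqnorm meas H \<le> (\<integral>z. 1/4 * (laplacian \<phi> z * (cmod (\<alpha>1 z))\<^sup>2) \<partial>meas)"
      unfolding sqnorm_def
    proof (rule integral_mono)
      show "integrable meas (\<lambda>z. (cmod (H z))\<^sup>2)" by (rule L2_integrable[OF HL])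
      show "integrable meas (\<lambda>z. 1/4 * (laplacian \<phi> z * (cmod (\<alpha>1 z))\<^sup>2))" using N(2) by (rule integrable_mult_right)
      fix z
      show "(cmod (H z))\<^sup>2 \<le> 1/4 * (laplacian \<phi> z * (cmod (\<alpha>1 z))\<^sup>2)"
      proof (cases "z \<in> cball 0 R")
        case True
        have "(4 * (cmod (r z))\<^sup>2) * (cmod (\<alpha>1 z))\<^sup>2 \<le> laplacian \<phi> z * (cmod (\<alpha>1 z))\<^sup>2"
          by (rule mult_right_mono[OF grad[OF True]]) simp
        then show ?thesis by (simp add: H_def \<alpha>1_def norm_mult power_mult_distrib)
      next
        case False then show ?thesis using \<alpha>(2)[OF False] by (simp add: H_def \<alpha>1_def)
      qed
    qed
    also have "\<dots> = 1/4 * N" unfolding N_def by (rule integral_mult_right_zero)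
    finally show ?thesis using N(1) by simp
  qed
  have ipD: "Re (ip meas D (dstar \<alpha>2 a2)) = X - sqnorm meas H"
  proof -
    have "ip meas D (dstar \<alpha>2 a2) = (\<integral>z. G z * cnj (G z) - 2 * (G z * cnj (H z)) \<partial>meas)"
      unfolding ip_def d2 by (rule Bochner_Integration.integral_cong) (simp_all add: G_def cnj_\<eta> algebra_simps)
    also have "\<dots> = ip meas G G - 2 * ip meas G H"
      unfolding ip_def using L2_mult_integrable[OF GL GL] L2_mult_integrable[OF GL HL]
      by (simp only: Bochner_Integration.integral_diff integrable_mult_right integral_mult_right_zero)
    finally have "Re (ip meas D (dstar \<alpha>2 a2)) = sqnorm meas G - 2 * Re (ip meas G H)" by (simp add: ip_self[OF GL])
    then show ?thesis unfolding X_def d1 sqnorm_diff[OF GL HL] by simp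
  qed
  have D2le: "sqnorm meas (dstar \<alpha>2 a2) \<le> 6 * exp (4 * B) * S"
  proof -
    note bi = basic_inequality[OF \<alpha>(1)]
    have I1: "integrable meas (\<lambda>z. (cmod (dstar \<alpha>2 a2 z))\<^sup>2)" by (rule L2_integrable[OF D2L])
    have I2: "integrable meas (\<lambda>z. exp (4 * B) * (2 * (cmod (D z))\<^sup>2 + 2 * (laplacian \<phi> z * (cmod (\<alpha> z))\<^sup>2)))"
    proof -
      have "integrable meas (\<lambda>z. 2 * (cmod (D z))\<^sup>2)" by (rule integrable_mult_right) (rule L2_integrable[OF DL])
      moreover have "integrable meas (\<lambda>z. 2 * (laplacian \<phi> z * (cmod (\<alpha> z))\<^sup>2))" by (rule integrable_mult_right) (rule bi(2))
      ultimately have "integrable meas (\<lambda>z. 2 * (cmod (D z))\<^sup>2 + 2 * (laplacian \<phi> z * (cmod (\<alpha> z))\<^sup>2))"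
        by (rule Bochner_Integration.integrable_add)
      then show ?thesis by (rule integrable_mult_right)
    qed
    have pt: "(cmod (dstar \<alpha>2 a2 z))\<^sup>2 \<le> exp (4 * B) * (2 * (cmod (D z))\<^sup>2 + 2 * (laplacian \<phi> z * (cmod (\<alpha> z))\<^sup>2))" for z
    proof (cases "z \<in> cball 0 R")
      case True
      have e2: "complex_of_real (exp (2 * \<rho> z)) = \<eta> z * \<eta> z"
        unfolding \<eta>_real exp_double power2_eq_square by (rule of_real_mult)
      have e4: "exp (4 * \<rho> z) = (exp (2 * \<rho> z))\<^sup>2" using exp_double[of "2 * \<rho> z"] by simp
      have "dstar \<alpha>2 a2 z = of_real (exp (2 * \<rho> z)) * (D z + (- 2 * (r z * \<alpha> z)))"
        unfolding d2 G_def H_def e2 by (simp add: algebra_simps)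
      then have "(cmod (dstar \<alpha>2 a2 z))\<^sup>2 = exp (4 * \<rho> z) * (cmod (D z + (- 2 * (r z * \<alpha> z))))\<^sup>2"
        unfolding e4 by (simp only: norm_mult power_mult_distrib norm_of_real abs_exp_cancel)
      also have "\<dots> \<le> exp (4 * B) * (2 * (cmod (D z))\<^sup>2 + 2 * (cmod (- 2 * (r z * \<alpha> z)))\<^sup>2)"
        using B[OF True] by (intro mult_mono cmod_add_sq_le) auto
      also have "(cmod (- 2 * (r z * \<alpha> z)))\<^sup>2 = (4 * (cmod (r z))\<^sup>2) * (cmod (\<alpha> z))\<^sup>2"
        by (simp add: norm_mult power_mult_distrib)
      also have "exp (4 * B) * (2 * (cmod (D z))\<^sup>2 + 2 * ((4 * (cmod (r z))\<^sup>2) * (cmod (\<alpha> z))\<^sup>2)) \<le>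
          exp (4 * B) * (2 * (cmod (D z))\<^sup>2 + 2 * (laplacian \<phi> z * (cmod (\<alpha> z))\<^sup>2))"
        by (intro mult_left_mono add_left_mono mult_right_mono grad[OF True]) auto
      finally show ?thesis .
    next
      case False
      then show ?thesis using \<alpha>(2)[OF False] D0[OF False] by (simp add: d2 G_def H_def)
    qed
    have "sqnorm meas (dstar \<alpha>2 a2) \<le> (\<integral>z. exp (4 * B) * (2 * (cmod (D z))\<^sup>2 + 2 * (laplacian \<phi> z * (cmod (\<alpha> z))\<^sup>2)) \<partial>meas)"
      unfolding sqnorm_def by (rule integral_mono[OF I1 I2 pt])
    also have "\<dots> = exp (4 * B) * (2 * S + 2 * (\<integral>z. laplacian \<phi> z * (cmod (\<alpha> z))\<^sup>2 \<partial>meas))"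
      unfolding S_def sqnorm_def using L2_integrable[OF DL] bi(2)
      by (simp only: integral_mult_right_zero Bochner_Integration.integral_add integrable_mult_right)
    also have "\<dots> \<le> exp (4 * B) * (2 * S + 2 * (2 * S))"
      using bi(1) by (intro mult_left_mono add_left_mono) (auto simp: S_def D_def)
    finally show ?thesis by simp
  qed
  have clap: "continuous_on disc (\<lambda>z. complex_of_real (sqrt (laplacian \<phi> z)))"
    by (intro continuous_intros continuous_laplacian)
  \<comment> \<open>The factorisation \<open>f * cnj (\<eta>\<^sup>2 \<alpha>) = f1 * cnj g1\<close> distributes \<open>\<Delta>\<phi>\<close> for the Cauchy-Schwarz inequality.\<close>
  define f1 where "f1 z = f z * (\<eta> z / of_real (sqrt (laplacian \<phi> z)))" for z
  define g1 where "g1 z = \<alpha> z * (\<eta> z * of_real (sqrt (laplacian \<phi> z)))" for z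
  have cf1: "continuous_on UNIV f1"
    unfolding f1_def[abs_def]
  proof (rule continuous_on_cutoff[OF f(1) closed_cball _ sub open_ball])
    show "continuous_on disc (\<lambda>z. \<eta> z / complex_of_real (sqrt (laplacian \<phi> z)))"
      using lap_pos by (intro continuous_on_divide clap continuous_on_subset[OF c\<eta>]) fastforce+
  qed (use f(2) in auto)
  have f10: "\<forall>z. z \<notin> cball 0 R \<longrightarrow> f1 z = 0" using f(2) by (simp add: f1_def)
  have cg1: "continuous_on UNIV g1"
    unfolding g1_def[abs_def]
    by (rule continuous_on_cutoff[OF c\<alpha> closed_cball \<alpha>(2) sub open_ball])
       (auto intro!: continuous_on_mult clap continuous_on_subset[OF c\<eta>])
  have g10: "\<forall>z. z \<notin> cball 0 R \<longrightarrow> g1 z = 0" using \<alpha>(2) by (simp add: g1_def)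
  have f1L: "f1 \<in> L2 meas" by (rule compact_support_E(4)[OF cf1 f10 R])
  have g1L: "g1 \<in> L2 meas" by (rule compact_support_E(4)[OF cg1 g10 R])
  have ipf: "ip meas f \<alpha>2 = ip meas f1 g1"
    unfolding ip_def
  proof (rule Bochner_Integration.integral_cong)
    fix z
    show "f z * cnj (\<alpha>2 z) = f1 z * cnj (g1 z)"
    proof (cases "z \<in> cball 0 R")
      case True
      then have "complex_of_real (sqrt (laplacian \<phi> z)) \<noteq> 0" using lap_pos[of z] sub by auto
      then show ?thesis by (simp add: f1_def g1_def \<alpha>2_def cnj_\<eta>)
    next
      case False then show ?thesis using f(2) by (simp add: f1_def)
    qed
  qed simp
  have "sqnorm meas f1 = F"
    unfolding sqnorm_def F_def
  proof (rule Bochner_Integration.integral_cong)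
    fix z
    show "(cmod (f1 z))\<^sup>2 = exp (2 * \<rho> z) * (cmod (f z))\<^sup>2 / laplacian \<phi> z"
    proof (cases "z \<in> cball 0 R")
      case True
      then have "0 < laplacian \<phi> z" using lap_pos[of z] sub by auto
      then show ?thesis by (simp add: f1_def norm_mult norm_divide power_mult_distrib power_divide \<eta>_real exp_double[symmetric])
    next
      case False then show ?thesis using f(2) by (simp add: f1_def)
    qed
  qed simp
  moreover have "sqnorm meas g1 = N"
    unfolding sqnorm_def N_def
  proof (rule Bochner_Integration.integral_cong)
    fix z
    show "(cmod (g1 z))\<^sup>2 = laplacian \<phi> z * (cmod (\<alpha>1 z))\<^sup>2"
    proof (cases "z \<in> cball 0 R")
      case True
      then have "0 < laplacian \<phi> z" using lap_pos[of z] sub by auto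
      then show ?thesis by (simp add: g1_def \<alpha>1_def norm_mult power_mult_distrib)
    next
      case False then show ?thesis using \<alpha>(2)[OF False] by (simp add: g1_def \<alpha>1_def)
    qed
  qed simp
  ultimately have CS1: "(cmod (ip meas f \<alpha>2))\<^sup>2 \<le> F * N" using L2_Cauchy_Schwarz[OF f1L g1L] by (simp add: ipf)
  have F0: "0 \<le> F" using \<open>sqnorm meas f1 = F\<close> sqnorm_nonneg by metis
  have X0: "0 \<le> X" by (simp add: X_def sqnorm_nonneg)
  have "(cmod (ip meas f \<alpha>2))\<^sup>2 \<le> F * (2 * X)" using CS1 mult_left_mono[OF N(1) F0] by simp
  also have "\<dots> \<le> (X / 4 + 2 * F)\<^sup>2"
  proof -
    have "0 \<le> (X / 4 - 2 * F)\<^sup>2" by simp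
    then show ?thesis unfolding power2_diff power2_sum by (simp add: mult.commute)
  qed
  finally have "cmod (ip meas f \<alpha>2) \<le> X / 4 + 2 * F" by (rule power2_le_imp_le) (use X0 F0 in simp)
  moreover define P where "P = sqnorm meas (\<lambda>z. u z - D z) * (6 * exp (4 * B) * S)"
  have uD: "(\<lambda>z. u z - D z) \<in> L2 meas" by (rule L2_diff[OF u DL])
  have "(cmod (ip meas (\<lambda>z. u z - D z) (dstar \<alpha>2 a2)))\<^sup>2 \<le> P"
    unfolding P_def by (rule order_trans[OF L2_Cauchy_Schwarz[OF uD D2L]]) (intro mult_left_mono D2le sqnorm_nonneg)
  then have "cmod (ip meas (\<lambda>z. u z - D z) (dstar \<alpha>2 a2)) \<le> sqrt P" by (rule real_le_rsqrt)
  moreover have "ip meas D (dstar \<alpha>2 a2) = ip meas f \<alpha>2 - ip meas (\<lambda>z. u z - D z) (dstar \<alpha>2 a2)"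
    using ip_diff_left[OF u DL D2L] weak[OF t2] by simp
  then have "Re (ip meas D (dstar \<alpha>2 a2)) \<le> cmod (ip meas f \<alpha>2) + cmod (ip meas (\<lambda>z. u z - D z) (dstar \<alpha>2 a2))"
    using complex_Re_le_cmod norm_triangle_ineq4 order_trans by metis
  ultimately have XF: "X \<le> 8 * F + 4 * sqrt P" using ipD Hle by linarith
  have "sqnorm meas G = sqnorm meas (\<lambda>z. dstar \<alpha>1 a1 z + H z)" by (simp add: d1)
  also have "\<dots> \<le> 2 * X + 2 * sqnorm meas H"
    unfolding X_def by (rule sqnorm_triangle[OF dstar_L2[OF t1] HL])
  finally have "sqnorm meas G \<le> 24 * F + 12 * sqrt P" using Hle XF by linarith
  then show ?thesis unfolding F_def P_def S_def D_def G_def[abs_def] \<eta>_real .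
qed

end

section \<open>Smoothing of locally Lipschitz functions\<close>

text \<open>
  For real \<open>f\<close> the gradient has length \<open>2 |a|\<close> and points in the direction of \<open>cnj a\<close>.
\<close>

lemma wirtinger_bound_of_Lipschitz:
  assumes f: "wirtinger f a (cnj a) z" and \<delta>: "\<delta> > 0"
    and lip: "\<And>w. cmod (w - z) < \<delta> \<Longrightarrow> cmod (f w - f z) \<le> L * cmod (w - z)"
  shows "2 * cmod a \<le> L"
proof (rule ccontr)
  assume neg: "\<not> 2 * cmod a \<le> L"
  define e where "e = (2 * cmod a - L) / 2"
  have e: "e > 0" using neg by (simp add: e_def)
  have L0: "0 \<le> L"
  proof -
    have n: "cmod (z + of_real (\<delta> / 2) - z) = \<delta> / 2" using \<delta> by simp
    have "0 \<le> cmod (f (z + of_real (\<delta> / 2)) - f z)" by simp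
    also have "\<dots> \<le> L * cmod (z + of_real (\<delta> / 2) - z)" by (rule lip) (unfold n, use \<delta> in simp)
    finally show ?thesis unfolding n using \<delta> by (simp add: zero_le_mult_iff)
  qed
  then have a: "a \<noteq> 0" using neg by auto
  obtain d where d: "d > 0" "\<And>w. cmod (w - z) < d \<Longrightarrow> cmod (f w - f z - (a * (w - z) + cnj a * cnj (w - z))) \<le> e * cmod (w - z)"
    using f e unfolding wirtinger_def has_derivative_at_alt by blast
  define t where "t = min d \<delta> / 2"
  have t: "t > 0" "t < d" "t < \<delta>" using d(1) \<delta> by (auto simp: t_def)
  define w where "w = z + of_real (t / cmod a) * cnj a"
  have wz: "w - z = of_real (t / cmod a) * cnj a" by (simp add: w_def)
  have nw: "cmod (w - z) = t" unfolding wz norm_mult using a t by (simp add: norm_divide)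
  have aa: "a * cnj a = of_real ((cmod a)\<^sup>2)" by (rule complex_norm_square[symmetric])
  have "a * (w - z) + cnj a * cnj (w - z) = of_real (2 * t * cmod a)"
  proof -
    have "a * (w - z) = of_real (t / cmod a) * (a * cnj a)" unfolding wz by simp
    also have "\<dots> = of_real (t * cmod a)" unfolding aa using a by (simp add: power2_eq_square)
    finally have 1: "a * (w - z) = of_real (t * cmod a)" .
    have "cnj a * cnj (w - z) = cnj (a * (w - z))" by simp
    also have "\<dots> = of_real (t * cmod a)" unfolding 1 by simp
    finally show ?thesis using 1 by simp
  qed
  then have "2 * t * cmod a = cmod (a * (w - z) + cnj a * cnj (w - z))" using t by (simp add: norm_mult)
  also have "\<dots> \<le> cmod (f w - f z) + cmod (f w - f z - (a * (w - z) + cnj a * cnj (w - z)))"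
    by (metis norm_triangle_sub norm_minus_commute)
  also have "\<dots> \<le> L * t + e * t" using lip[of w] d(2)[of w] nw t by simp
  finally have "(2 * cmod a) * t \<le> (L + e) * t" by (simp add: algebra_simps)
  then have "2 * cmod a \<le> L + e" using t by simp
  then show False using neg by (simp add: e_def field_simps)
qed

text \<open>
  The hypothesis on \<open>d\<close> says that it is 1-Lipschitz for the metric \<open>|dz|/\<tau>\<close>.  On discs of radius \<open>2\<delta>\<close>
  around the points of \<open>cball 0 R\<close> the function \<open>\<tau>\<close> loses at most half of its value at the centre \<open>z\<close>,
  provided that \<open>\<delta>\<close> is small, so \<open>d\<close> has Lipschitz constant \<open>2 / \<tau> z\<close> there.  An average
  over a disc of radius \<open>\<delta>\<close> inherits this constant, hence its gradient \<open>2 |a z|\<close> is at most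
  \<open>2 / \<tau> z\<close>; and \<open>\<delta> \<le> \<tau> z\<close> makes it differ from \<open>d z\<close> by at most 2.
  A single \<open>\<delta>\<close> works because \<open>\<tau>\<close> is bounded below on compact subsets of the disc.
\<close>

lemma Lipschitz_regularization:
  fixes \<tau> d :: "complex \<Rightarrow> real"
  assumes \<tau>: "\<And>z. z \<in> disc \<Longrightarrow> 0 < \<tau> z" "0 \<le> C" "\<And>z w. z \<in> disc \<Longrightarrow> w \<in> disc \<Longrightarrow> \<bar>\<tau> z - \<tau> w\<bar> \<le> C * cmod (z - w)"
    and d: "\<And>z. z \<in> disc \<Longrightarrow> 0 \<le> d z \<and> d z \<le> B"
      "\<And>x y m. x \<in> disc \<Longrightarrow> y \<in> disc \<Longrightarrow> 0 < m \<Longrightarrow> (\<And>\<zeta>. \<zeta> \<in> closed_segment x y \<Longrightarrow> m \<le> \<tau> \<zeta>) \<Longrightarrow> \<bar>d x - d y\<bar> \<le> cmod (x - y) / m"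
    and R: "0 \<le> R" "R < 1"
  obtains \<rho> :: "complex \<Rightarrow> real" and a aa c bb where
    "C2w UNIV (\<lambda>z. of_real (\<rho> z)) a (\<lambda>z. cnj (a z)) aa c bb"
    "\<And>z. z \<in> cball 0 R \<Longrightarrow> \<bar>\<rho> z - d z\<bar> \<le> 2"
    "\<And>z. z \<in> cball 0 R \<Longrightarrow> cmod (a z) \<le> 1 / \<tau> z"
proof -
  define R' where "R' = (1 + R) / 2"
  have R': "R < R'" "R' < 1" "0 \<le> R'" using R by (auto simp: R'_def)
  have sub: "cball 0 R' \<subseteq> disc" using R' by auto
  have "compact (\<tau> ` cball 0 R')"
  proof (rule compact_continuous_image[OF _ compact_cball])
    have "C-lipschitz_on disc \<tau>"
      by (rule lipschitz_onI) (use \<tau> in \<open>auto simp: dist_real_def dist_norm\<close>)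
    then show "continuous_on (cball 0 R') \<tau>" using sub continuous_on_subset lipschitz_on_continuous_on by blast
  qed
  moreover have "\<tau> ` cball 0 R' \<noteq> {}" using R' by auto
  ultimately obtain z1 where z1: "z1 \<in> cball 0 R'" "\<And>z. z \<in> cball 0 R' \<Longrightarrow> \<tau> z1 \<le> \<tau> z"
    using compact_attains_inf[of "\<tau> ` cball 0 R'"] by auto
  define t where "t = \<tau> z1"
  have t: "t > 0" "\<And>z. z \<in> cball 0 R' \<Longrightarrow> t \<le> \<tau> z" using z1 \<tau>(1) sub by (auto simp: t_def)
  \<comment> \<open>The three bounds keep the discs of radius \<open>2\<delta>\<close> inside \<open>cball 0 R'\<close>, make \<open>\<delta> \<le> \<tau>\<close>, and limit
    the variation of \<open>\<tau>\<close> on these discs to \<open>t / 2\<close>; the summand 1 avoids a division by 0.\<close>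
  define \<delta> where "\<delta> = min ((R' - R) / 2) (min t (t / (4 * C + 1)))"
  have \<delta>: "\<delta> > 0" using t(1) R' \<tau>(2) by (simp add: \<delta>_def)
  have \<delta>1: "\<delta> \<le> (R' - R) / 2" unfolding \<delta>_def by (rule min.cobounded1)
  have \<delta>t: "\<delta> \<le> t" unfolding \<delta>_def by (rule order_trans[OF min.cobounded2 min.cobounded1])
  have \<delta>2: "\<delta> \<le> t / (4 * C + 1)" unfolding \<delta>_def by (rule order_trans[OF min.cobounded2 min.cobounded2])
  have \<delta>R: "R + 2 * \<delta> \<le> R'" using \<delta>1 by simp
  have \<delta>C: "2 * \<delta> * C \<le> t / 2"
  proof -
    have "\<delta> * (4 * C + 1) \<le> t / (4 * C + 1) * (4 * C + 1)"
      using \<tau>(2) \<delta>2 by (intro mult_right_mono) auto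
    then have "\<delta> * (4 * C + 1) \<le> t" using \<tau>(2) by simp
    then have "4 * (\<delta> * C) \<le> t" using \<delta> by (simp add: algebra_simps)
    then show ?thesis by simp
  qed
  have near: "w \<in> cball 0 R'" if "z \<in> cball 0 R" "cmod (w - z) \<le> 2 * \<delta>" for w z
    using norm_triangle_ineq2[of w z] that \<delta>R by simp
  have dlip: "\<bar>d x - d y\<bar> \<le> cmod (x - y) * (2 / \<tau> z)"
    if z: "z \<in> cball 0 R" and xy: "cmod (x - z) \<le> 2 * \<delta>" "cmod (y - z) \<le> 2 * \<delta>" for x y z
  proof -
    have zR: "z \<in> cball 0 R'" using near[OF z, of z] \<delta> by simp
    have "\<tau> z / 2 \<le> \<tau> \<zeta>" if \<zeta>: "\<zeta> \<in> closed_segment x y" for \<zeta>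
    proof -
      have "closed_segment x y \<subseteq> cball z (2 * \<delta>)"
        using xy by (intro closed_segment_subset) (auto simp: dist_norm norm_minus_commute)
      then have dz: "cmod (\<zeta> - z) \<le> 2 * \<delta>" using \<zeta> by (auto simp: dist_norm norm_minus_commute)
      have "\<tau> z - \<tau> \<zeta> \<le> C * cmod (z - \<zeta>)"
        using \<tau>(3)[of z \<zeta>] near[OF z dz] zR sub by (meson abs_le_D1 subsetD)
      also have "\<dots> \<le> C * (2 * \<delta>)" using dz \<tau>(2) by (intro mult_left_mono) (auto simp: norm_minus_commute)
      also have "\<dots> \<le> t / 2" using \<delta>C by (simp add: mult.commute)
      also have "\<dots> \<le> \<tau> z / 2" using t(2)[OF zR] by simp
      finally show ?thesis by simp
    qed
    moreover have "x \<in> disc" "y \<in> disc" using near[OF z xy(1)] near[OF z xy(2)] sub by blast+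
    moreover have "0 < \<tau> z / 2" using t(1) t(2)[OF zR] by simp
    ultimately show ?thesis using d(2)[of x y "\<tau> z / 2"] by simp
  qed
  define f where "f w = complex_of_real (indicator (cball 0 R') w * d w)" for w
  have dcont: "continuous_on (cball 0 R') d"
  proof (rule lipschitz_on_continuous_on)
    show "(1 / t)-lipschitz_on (cball 0 R') d"
    proof (rule lipschitz_onI)
      fix x y :: complex assume xy: "x \<in> cball 0 R'" "y \<in> cball 0 R'"
      have "closed_segment x y \<subseteq> cball 0 R'" using xy by (intro closed_segment_subset) auto
      then have "\<bar>d x - d y\<bar> \<le> cmod (x - y) / t" using xy sub t by (intro d(2)) auto
      then show "dist (d x) (d y) \<le> 1 / t * dist x y" by (simp add: dist_real_def dist_norm)
    qed (use t in simp)
  qed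
  have fi: "integrable lborel f"
  proof -
    have "integrable lborel (\<lambda>w. indicator (cball 0 R') w *\<^sub>R d w)"
      by (rule borel_integrable_compact[OF compact_cball dcont])
    then have "integrable lborel (\<lambda>w. complex_of_real (indicator (cball 0 R') w *\<^sub>R d w))" by (rule integrable_of_real)
    then show ?thesis by (simp add: f_def[abs_def])
  qed
  obtain k1 k3 k4 k5 where k0: "C2w UNIV (mollifier \<delta>) k1
      (\<lambda>w. - 3 * of_real (1 / \<delta>) * (of_real (1 / \<delta>) * w) * bump 2 (of_real (1 / \<delta>) * w) / of_real (bump_mass * \<delta>\<^sup>2)) k3 k4 k5"
    by (rule mollifier_C2w_ex)
  define k2 where "k2 w = - 3 * of_real (1 / \<delta>) * (of_real (1 / \<delta>) * w) * bump 2 (of_real (1 / \<delta>) * w) / of_real (bump_mass * \<delta>\<^sup>2)" for w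
  have k: "C2w UNIV (mollifier \<delta>) k1 k2 k3 k4 k5" unfolding k2_def[abs_def] by (rule k0)
  define F where "F z = (\<integral>w. f w * mollifier \<delta> (z - w) \<partial>lborel)" for z
  define a where "a z = (\<integral>w. f w * k1 (z - w) \<partial>lborel)" for z
  define b where "b z = (\<integral>w. f w * k2 (z - w) \<partial>lborel)" for z
  have "\<exists>aa c bb. C2w UNIV F a b aa c bb"
    unfolding F_def[abs_def] a_def[abs_def] b_def[abs_def]
    by (intro exI, rule C2w_convolution[OF fi k compact_cball mollifier_vanish[OF \<delta>]])
  then obtain aa c bb where C2: "C2w UNIV F a b aa c bb" by blast
  define \<rho> where "\<rho> z = Re (F z)" for z
  have real: "F z = of_real (\<rho> z)" for z
  proof -
    have "cnj (F z) = F z"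
      unfolding F_def Bochner_Integration.integral_cnj[symmetric]
      by (intro Bochner_Integration.integral_cong) (auto simp: f_def intro: arg_cong[where f = "\<lambda>x. _ * x"]
          simp: mollifier_def)
    then show ?thesis by (simp add: \<rho>_def complex_eq_iff)
  qed
  then have Feq: "F = (\<lambda>z. of_real (\<rho> z))" by auto
  have W: "wirtinger F (a z) (b z) z" for z using C2 by (auto simp: C2w_def C1w_def)
  have "wirtinger F (cnj (b z)) (cnj (a z)) z" for z using wirtinger_cnj[OF W[of z]] by (simp add: Feq)
  from wirtinger_unique(2)[OF W this] have beq: "b = (\<lambda>z. cnj (a z))" by auto
  have close: "\<bar>\<rho> z - d z\<bar> \<le> 2" if z: "z \<in> cball 0 R" for z
  proof -
    obtain L where L: "\<And>w. cmod (mollifier \<delta> w) \<le> L" using mollifier_bounded[OF \<delta>] by blast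
    have zR: "z \<in> cball 0 R'" using near[OF z, of z] \<delta> by simp
    define g where "g w = complex_of_real (indicator (cball 0 R') w * d z)" for w :: complex
    have gi: "integrable lborel g"
    proof -
      have "integrable lborel (\<lambda>w. indicator (cball 0 R') w *\<^sub>R d z)"
        by (rule borel_integrable_compact[OF compact_cball continuous_on_const])
      then have "integrable lborel (\<lambda>w. complex_of_real (indicator (cball 0 R') w *\<^sub>R d z))" by (rule integrable_of_real)
      then show ?thesis by (simp add: g_def[abs_def])
    qed
    have "g w * mollifier \<delta> (z - w) = of_real (d z) * mollifier \<delta> (z - w)" for w
    proof (cases "w \<in> cball 0 R'")
      case False
      then have "\<not> cmod (w - z) \<le> 2 * \<delta>" using near[OF z] by blast
      then have "mollifier \<delta> (z - w) = 0" using \<delta> by (intro mollifier_eq_0) (auto simp: norm_minus_commute)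
      then show ?thesis by simp
    qed (simp add: g_def)
    then have "(\<integral>w. g w * mollifier \<delta> (z - w) \<partial>lborel) = of_real (d z)"
      using mollifier_average_const[OF \<delta>] by (simp only:)
    then have "F z - of_real (d z) = (\<integral>w. (f w - g w) * mollifier \<delta> (z - w) \<partial>lborel)"
      unfolding F_def left_diff_distrib
      using convolution_integrable[OF fi continuous_on_mollifier L, of z] convolution_integrable[OF gi continuous_on_mollifier L, of z]
      by (simp add: Bochner_Integration.integral_diff)
    moreover have "cmod (\<integral>w. (f w - g w) * mollifier \<delta> (z - w) \<partial>lborel) \<le> 2"
    proof (rule mollifier_average_bound[OF \<delta> Bochner_Integration.integrable_diff[OF fi gi]])
      fix w assume w: "cmod (w - z) < \<delta>"
      then have w2: "cmod (w - z) \<le> 2 * \<delta>" using \<delta> by simp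
      have "f w - g w = of_real (d w - d z)" using near[OF z w2] by (simp add: f_def g_def)
      then have "cmod (f w - g w) = \<bar>d w - d z\<bar>" by (simp only: norm_of_real)
      also have "\<dots> \<le> cmod (w - z) * (2 / \<tau> z)" by (rule dlip[OF z w2]) (use \<delta> in simp)
      also have "\<dots> \<le> \<tau> z * (2 / \<tau> z)"
        using w \<delta>t t zR by (intro mult_right_mono) (auto intro: order_trans[of _ \<delta>] less_imp_le order_trans[of \<delta> t] simp: less_imp_le[of 0 "\<tau> z"] less_le_trans[OF t(1) t(2)])
      also have "\<dots> = 2" using less_le_trans[OF t(1) t(2)[OF zR]] by simp
      finally show "cmod (f w - g w) \<le> 2" .
    qed simp
    ultimately have "cmod (F z - of_real (d z)) \<le> 2" by simp
    then show ?thesis unfolding real of_real_diff[symmetric] norm_of_real .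
  qed
  have lipF: "cmod (F w - F z) \<le> 2 / \<tau> z * cmod (w - z)" if z: "z \<in> cball 0 R" and w: "cmod (w - z) < \<delta>" for w z
  proof -
    obtain L where L: "\<And>w. cmod (mollifier \<delta> w) \<le> L" using mollifier_bounded[OF \<delta>] by blast
    define h where "h = w - z"
    have ft: "integrable lborel (\<lambda>x. f (x + h))"
      by (rule lborel_integrable_translation[OF fi])
    have "F w = (\<integral>x. f (x + h) * mollifier \<delta> (w - (x + h)) \<partial>lborel)"
      unfolding F_def
      by (rule lborel_integral_translation[symmetric]) 
         (use convolution_integrable[OF fi continuous_on_mollifier L, of w] in simp)
    also have "\<dots> = (\<integral>x. f (x + h) * mollifier \<delta> (z - x) \<partial>lborel)"
      by (simp add: h_def algebra_simps)
    finally have "F w - F z = (\<integral>x. (f (x + h) - f x) * mollifier \<delta> (z - x) \<partial>lborel)"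
      unfolding F_def left_diff_distrib
      using convolution_integrable[OF ft continuous_on_mollifier L, of z] convolution_integrable[OF fi continuous_on_mollifier L, of z]
      by (simp add: Bochner_Integration.integral_diff)
    moreover have "cmod (\<integral>x. (f (x + h) - f x) * mollifier \<delta> (z - x) \<partial>lborel) \<le> 2 / \<tau> z * cmod (w - z)"
    proof (rule mollifier_average_bound[OF \<delta> Bochner_Integration.integrable_diff[OF ft fi]])
      show "0 \<le> 2 / \<tau> z * cmod (w - z)" using \<tau>(1)[of z] z R by auto
      fix x assume x: "cmod (x - z) < \<delta>"
      have "cmod (x + h - z) \<le> cmod (x - z) + cmod h" using norm_triangle_ineq[of "x - z" h] by (simp add: algebra_simps)
      then have 1: "cmod (x + h - z) \<le> 2 * \<delta>" "cmod (x - z) \<le> 2 * \<delta>" using x w \<delta> by (auto simp: h_def)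
      have "f (x + h) - f x = of_real (d (x + h) - d x)"
        using near[OF z 1(1)] near[OF z 1(2)] by (simp add: f_def)
      then have "cmod (f (x + h) - f x) = \<bar>d (x + h) - d x\<bar>" by (simp only: norm_of_real)
      also have "\<dots> \<le> cmod (x + h - x) * (2 / \<tau> z)" by (rule dlip[OF z 1])
      finally show "cmod (f (x + h) - f x) \<le> 2 / \<tau> z * cmod (w - z)" by (simp add: h_def mult.commute)
    qed
    ultimately show ?thesis by simp
  qed
  have grad: "cmod (a z) \<le> 1 / \<tau> z" if z: "z \<in> cball 0 R" for z
    using wirtinger_bound_of_Lipschitz[OF W[of z, unfolded beq] \<delta> lipF[OF z]] by simp
  show ?thesis
    by (rule that[OF C2[unfolded Feq beq]]) (use close grad in auto)
qed

section \<open>The distance of the conformal metric\<close>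

lemma adjacent_points:
  fixes S :: "real set"
  assumes "finite S" "0 \<in> S" "1 \<in> S" "0 < t" "t < 1" "t \<notin> S"
  obtains a b where "a \<in> S" "b \<in> S" "a < t" "t < b" "{a<..<b} \<inter> S = {}"
proof -
  define a where "a = Max {s \<in> S. s < t}"
  define b where "b = Min {s \<in> S. t < s}"
  have a: "a \<in> {s \<in> S. s < t}" unfolding a_def by (rule Max_in) (use assms in auto)
  have b: "b \<in> {s \<in> S. t < s}" unfolding b_def by (rule Min_in) (use assms in auto)
  have "s \<le> a \<or> b \<le> s" if "s \<in> S" for s
  proof -
    have "s \<noteq> t" using that assms by auto
    then consider "s < t" | "t < s" by linarith
    then show ?thesis
    proof cases
      case 1
      then have "s \<le> a" unfolding a_def using that assms by (intro Max_ge) auto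
      then show ?thesis ..
    next
      case 2
      then have "b \<le> s" unfolding b_def using that assms by (intro Min_le) auto
      then show ?thesis ..
    qed
  qed
  then have "{a<..<b} \<inter> S = {}" by force
  then show ?thesis using that a b by blast
qed

text \<open>
  Induction along the partition, by the number of points to the left of \<open>b\<close>.
\<close>

lemma integrable_on_partition:
  fixes f :: "real \<Rightarrow> real"
  assumes S: "finite S" "S \<subseteq> {0..1}" "0 \<in> S" "1 \<in> S"
    and f: "\<And>a b. a \<in> S \<Longrightarrow> b \<in> S \<Longrightarrow> a < b \<Longrightarrow> {a<..<b} \<inter> S = {} \<Longrightarrow> f integrable_on {a..b}"
  shows "f integrable_on {0..1}"
proof -
  have "f integrable_on {0..b}" if "b \<in> S" for b
    using that
  proof (induction "card {s \<in> S. s < b}" arbitrary: b rule: less_induct)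
    case less
    show ?case
    proof (cases "b = 0")
      case True then show ?thesis using integrable_on_refl[of f 0] by simp
    next
      case False
      then have b: "0 < b" using S less.prems by fastforce
      define a where "a = Max {s \<in> S. s < b}"
      have a: "a \<in> {s \<in> S. s < b}" unfolding a_def by (rule Max_in) (use S b in auto)
      have "{s \<in> S. s < a} \<subset> {s \<in> S. s < b}" using a by force
      then have "card {s \<in> S. s < a} < card {s \<in> S. s < b}" using S by (intro psubset_card_mono) auto
      from less.hyps[OF this] a have ia: "f integrable_on {0..a}" by auto
      have "s \<le> a" if "s \<in> S" "s < b" for s
        unfolding a_def using that S by (intro Max_ge) auto
      then have "{a<..<b} \<inter> S = {}" by force
      then have "f integrable_on {a..b}" using a less.prems by (intro f) auto
      moreover have "0 \<le> a" "a \<le> b" using a S by auto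
      ultimately show ?thesis by (intro Henstock_Kurzweil_Integration.integrable_combine[OF _ _ ia])
    qed
  qed
  then show ?thesis using S by blast
qed

lemma vector_derivative_within_interior:
  assumes "(\<gamma> has_vector_derivative D) (at t within {a..b})" "a < t" "t < (b::real)"
  shows "(\<gamma> has_vector_derivative D) (at t)"
  using assms by (metis at_within_Icc_at)

lemma piecewise_C1_curveE:
  assumes "piecewise_C1_curve \<gamma>"
  obtains S where "finite S" "S \<subseteq> {0..1}" "0 \<in> S" "1 \<in> S"
    "\<And>a b. a \<in> S \<Longrightarrow> b \<in> S \<Longrightarrow> a < b \<Longrightarrow> {a<..<b} \<inter> S = {} \<Longrightarrow>
      \<exists>\<gamma>'. continuous_on {a..b} \<gamma>' \<and> (\<forall>t\<in>{a..b}. (\<gamma> has_vector_derivative \<gamma>' t) (at t within {a..b}))"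
proof -
  from assms obtain S where S: "finite S \<and> S \<subseteq> {0..1} \<and> 0 \<in> S \<and> 1 \<in> S \<and>
        (\<forall>a\<in>S. \<forall>b\<in>S. a < b \<longrightarrow> {a<..<b} \<inter> S = {} \<longrightarrow>
           (\<exists>\<gamma>'. continuous_on {a..b} \<gamma>' \<and>
              (\<forall>t\<in>{a..b}. (\<gamma> has_vector_derivative \<gamma>' t) (at t within {a..b}))))"
    unfolding piecewise_C1_curve_def by (elim conjE exE) simp
  show ?thesis
  proof (rule that)
    show "finite S" "S \<subseteq> {0..1}" "0 \<in> S" "1 \<in> S" using S by simp_all
    show "\<exists>\<gamma>'. continuous_on {a..b} \<gamma>' \<and> (\<forall>t\<in>{a..b}. (\<gamma> has_vector_derivative \<gamma>' t) (at t within {a..b}))"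
      if "a \<in> S" "b \<in> S" "a < b" "{a<..<b} \<inter> S = {}" for a b
      using S that by simp
  qed
qed

lemma tau_nonneg: "0 \<le> tau \<phi> z"
  by (simp add: tau_def)

lemma curve_length_nonneg: "0 \<le> curve_length_phi \<phi> \<gamma>"
proof (cases "(\<lambda>t. cmod (vector_derivative \<gamma> (at t)) / tau \<phi> (\<gamma> t)) integrable_on {0..1}")
  case True
  then show ?thesis unfolding curve_length_phi_def by (intro integral_nonneg) (simp_all add: tau_nonneg)
next
  case False
  then show ?thesis unfolding curve_length_phi_def by (simp add: not_integrable_integral)
qed

definition admissible :: "complex \<Rightarrow> complex \<Rightarrow> (real \<Rightarrow> complex) set" where
  "admissible z w = {\<gamma>. piecewise_C1_curve \<gamma> \<and> \<gamma> ` {0..1} \<subseteq> disc \<and> \<gamma> 0 = z \<and> \<gamma> 1 = w}"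

lemma d_phi_admissible: "d_phi \<phi> z w = (INF \<gamma>\<in>admissible z w. curve_length_phi \<phi> \<gamma>)"
  by (simp add: d_phi_def admissible_def)

lemma linepath_admissible:
  assumes "z \<in> disc" "w \<in> disc"
  shows "linepath z w \<in> admissible z w"
proof -
  have "piecewise_C1_curve (linepath z w)"
    unfolding piecewise_C1_curve_def
  proof (intro conjI exI[of _ "{0, 1}"])
    show "continuous_on {0..1} (linepath z w)" by (rule continuous_on_linepath)
    show "\<forall>a\<in>{0, 1}. \<forall>b\<in>{0, 1}. a < b \<longrightarrow> {a<..<b} \<inter> {0, 1} = {} \<longrightarrow>
        (\<exists>\<gamma>'. continuous_on {a..b} \<gamma>' \<and> (\<forall>t\<in>{a..b}. (linepath z w has_vector_derivative \<gamma>' t) (at t within {a..b})))"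
      by (intro ballI impI exI[of _ "\<lambda>_. w - z"] conjI continuous_on_const has_vector_derivative_linepath_within)
  qed auto
  moreover have "linepath z w ` {0..1} \<subseteq> disc"
  proof -
    have "linepath z w ` {0..1} = closed_segment z w" by (rule path_image_linepath[unfolded path_image_def])
    also have "\<dots> \<subseteq> disc" using assms by (intro closed_segment_subset convex_ball)
    finally show ?thesis .
  qed
  ultimately show ?thesis by (simp add: admissible_def linepath_0' linepath_1')
qed

lemma d_phi_nonneg:
  assumes "z \<in> disc" "w \<in> disc"
  shows "0 \<le> d_phi \<phi> z w"
  unfolding d_phi_admissible
  by (rule cINF_greatest) (use linepath_admissible[OF assms] curve_length_nonneg in auto)

lemma d_phi_le: "\<gamma> \<in> admissible z w \<Longrightarrow> d_phi \<phi> z w \<le> curve_length_phi \<phi> \<gamma>"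
  unfolding d_phi_admissible
  by (rule cINF_lower) (auto intro!: bdd_belowI2[of _ 0] curve_length_nonneg)

lemma d_phi_refl:
  assumes "z \<in> disc"
  shows "d_phi \<phi> z z = 0"
proof -
  have "vector_derivative (linepath z z) (at t) = 0" for t
    by (simp add: vector_derivative_linepath_at)
  then have "curve_length_phi \<phi> (linepath z z) = 0" by (simp add: curve_length_phi_def)
  then show ?thesis using d_phi_le[OF linepath_admissible[OF assms assms], of \<phi>] d_phi_nonneg[OF assms assms, of \<phi>] by simp
qed

text \<open>
  The length of a curve is defined by an integral that is 0 when it does not exist.  Additivity of
  the length under concatenation thus rests on the integrability of the speed, which holds because
  the derivative extends continuously to the end points of each piece.
\<close>

lemma curve_speed_integrable:
  assumes \<tau>: "continuous_on disc (tau \<phi>)" "\<And>z. z \<in> disc \<Longrightarrow> 0 < tau \<phi> z" and \<gamma>: "\<gamma> \<in> admissible z w"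
  obtains T where "finite T" "\<And>t. t \<in> {0..1} - T \<Longrightarrow> (\<gamma> has_vector_derivative vector_derivative \<gamma> (at t)) (at t)"
    "(\<lambda>t. cmod (vector_derivative \<gamma> (at t)) / tau \<phi> (\<gamma> t)) integrable_on {0..1}"
proof -
  from \<gamma> have im: "\<gamma> ` {0..1} \<subseteq> disc" and c: "continuous_on {0..1} \<gamma>" by (auto simp: admissible_def piecewise_C1_curve_def)
  from \<gamma> have "piecewise_C1_curve \<gamma>" by (simp add: admissible_def)
  then obtain S where S: "finite S" "S \<subseteq> {0..1}" "0 \<in> S" "1 \<in> S"
    and D: "\<And>a b. a \<in> S \<Longrightarrow> b \<in> S \<Longrightarrow> a < b \<Longrightarrow> {a<..<b} \<inter> S = {} \<Longrightarrow>
      \<exists>\<gamma>'. continuous_on {a..b} \<gamma>' \<and> (\<forall>t\<in>{a..b}. (\<gamma> has_vector_derivative \<gamma>' t) (at t within {a..b}))"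
    by (rule piecewise_C1_curveE) (rule that, assumption, assumption, assumption, assumption, blast)
  have diff: "(\<gamma> has_vector_derivative vector_derivative \<gamma> (at t)) (at t)" if t: "t \<in> {0..1} - S" for t
  proof -
    have "t \<noteq> 0" "t \<noteq> 1" using t S by auto
    then have "0 < t" "t < 1" "t \<notin> S" using t by auto
    then obtain a b where ab: "a \<in> S" "b \<in> S" "a < t" "t < b" "{a<..<b} \<inter> S = {}"
      using adjacent_points[OF S(1,3,4)] by metis
    then obtain \<gamma>' where "(\<gamma> has_vector_derivative \<gamma>' t) (at t within {a..b})"
      using D[of a b] by fastforce
    from vector_derivative_within_interior[OF this ab(3,4)] show ?thesis
      using vector_derivative_at by metis
  qed
  have "(\<lambda>t. cmod (vector_derivative \<gamma> (at t)) / tau \<phi> (\<gamma> t)) integrable_on {0..1}"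
  proof (rule integrable_on_partition[OF S])
    fix a b assume ab: "a \<in> S" "b \<in> S" "a < b" "{a<..<b} \<inter> S = {}"
    obtain \<gamma>' where \<gamma>': "continuous_on {a..b} \<gamma>'" "\<And>t. t \<in> {a..b} \<Longrightarrow> (\<gamma> has_vector_derivative \<gamma>' t) (at t within {a..b})"
      using D[OF ab] by blast
    have sub: "{a..b} \<subseteq> {0..1}" using ab S by auto
    have "continuous_on {a..b} (\<lambda>t. tau \<phi> (\<gamma> t))"
      by (rule continuous_on_compose2[OF \<tau>(1) continuous_on_subset[OF c sub]]) (use im sub in blast)
    then have "continuous_on {a..b} (\<lambda>t. cmod (\<gamma>' t) / tau \<phi> (\<gamma> t))"
    proof (intro continuous_on_divide continuous_on_norm \<gamma>'(1) ballI)
      fix t assume "t \<in> {a..b}"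
      then have "\<gamma> t \<in> disc" using im sub by blast
      from \<tau>(2)[OF this] show "tau \<phi> (\<gamma> t) \<noteq> 0" by simp
    qed
    then have "(\<lambda>t. cmod (\<gamma>' t) / tau \<phi> (\<gamma> t)) integrable_on {a..b}" by (rule integrable_continuous_interval)
    then show "(\<lambda>t. cmod (vector_derivative \<gamma> (at t)) / tau \<phi> (\<gamma> t)) integrable_on {a..b}"
    proof (rule integrable_spike_finite[of "{a, b}", rotated 2])
      show "cmod (vector_derivative \<gamma> (at t)) / tau \<phi> (\<gamma> t) = cmod (\<gamma>' t) / tau \<phi> (\<gamma> t)" if "t \<in> {a..b} - {a, b}" for t
      proof -
        have "a < t" "t < b" "t \<in> {a..b}" using that by auto
        from vector_derivative_at[OF vector_derivative_within_interior[OF \<gamma>'(2)[OF this(3)] this(1,2)]]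
        show ?thesis by simp
      qed
    qed simp
  qed
  then show ?thesis using that S(1) diff by blast
qed

text \<open>
  The halved partition of \<open>\<gamma>\<close> together with 1 is a partition for the concatenation; it contains 1/2
  because the partition of \<open>\<gamma>\<close> contains 1.
\<close>

lemma piecewise_C1_join_linepath:
  assumes \<gamma>: "piecewise_C1_curve \<gamma>" "\<gamma> 1 = x"
  shows "piecewise_C1_curve (\<gamma> +++ linepath x y)"
proof -
  from \<gamma> have c: "continuous_on {0..1} \<gamma>" by (simp add: piecewise_C1_curve_def)
  from \<gamma>(1) obtain S where S: "finite S" "S \<subseteq> {0..1}" "0 \<in> S" "1 \<in> S"
    and D: "\<And>a b. a \<in> S \<Longrightarrow> b \<in> S \<Longrightarrow> a < b \<Longrightarrow> {a<..<b} \<inter> S = {} \<Longrightarrow>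
      \<exists>\<gamma>'. continuous_on {a..b} \<gamma>' \<and> (\<forall>t\<in>{a..b}. (\<gamma> has_vector_derivative \<gamma>' t) (at t within {a..b}))"
    by (rule piecewise_C1_curveE) (rule that, assumption, assumption, assumption, assumption, blast)
  define S' where "S' = insert 1 ((\<lambda>s. s / 2) ` S)"
  have half: "1 / 2 \<in> S'" using S(4) by (auto simp: S'_def)
  have cont: "continuous_on {0..1} (\<gamma> +++ linepath x y)"
    using c by (intro continuous_on_joinpaths continuous_on_linepath) (simp_all add: pathfinish_def pathstart_def linepath_0' \<gamma>)
  have pieces: "\<exists>\<gamma>'. continuous_on {a..b} \<gamma>' \<and> (\<forall>t\<in>{a..b}. ((\<gamma> +++ linepath x y) has_vector_derivative \<gamma>' t) (at t within {a..b}))"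
    if ab: "a \<in> S'" "b \<in> S'" "a < b" "{a<..<b} \<inter> S' = {}" for a b
  proof (cases "b \<le> 1 / 2")
    case True
    then have "a \<noteq> 1" "b \<noteq> 1" using ab by auto
    then have 1: "2 * a \<in> S" "2 * b \<in> S" using ab by (auto simp: S'_def)
    have 2: "{2 * a<..<2 * b} \<inter> S = {}"
    proof (rule ccontr)
      assume "{2 * a<..<2 * b} \<inter> S \<noteq> {}"
      then obtain s where "s \<in> S" "2 * a < s" "s < 2 * b" by auto
      then have "s / 2 \<in> {a<..<b} \<inter> S'" by (auto simp: S'_def)
      then show False using ab by auto
    qed
    obtain \<gamma>' where \<gamma>': "continuous_on {2 * a..2 * b} \<gamma>'" "\<And>t. t \<in> {2 * a..2 * b} \<Longrightarrow> (\<gamma> has_vector_derivative \<gamma>' t) (at t within {2 * a..2 * b})"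
      using D[OF 1 _ 2] ab by auto
    have im: "(*) 2 ` {a..b} = {2 * a..2 * b}"
      using image_mult_atLeastAtMost[of 2 a b] ab by simp
    show ?thesis
    proof (intro exI conjI ballI)
      show "continuous_on {a..b} (\<lambda>t. 2 *\<^sub>R \<gamma>' (2 * t))"
        by (intro continuous_on_scaleR continuous_on_const continuous_on_compose2[OF \<gamma>'(1)] continuous_intros) auto
      fix t assume t: "t \<in> {a..b}"
      have "((*) 2 has_vector_derivative 2) (at t within {a..b})"
        by (simp add: has_vector_derivative_def has_derivative_def bounded_linear_mult_left)
      moreover have "(\<gamma> has_vector_derivative \<gamma>' (2 * t)) (at (2 * t) within (*) 2 ` {a..b})"
        unfolding im by (rule \<gamma>'(2)) (use t in auto)
      ultimately have "((\<gamma> \<circ> (*) 2) has_vector_derivative 2 *\<^sub>R \<gamma>' (2 * t)) (at t within {a..b})"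
        by (rule vector_diff_chain_within)
      then show "((\<gamma> +++ linepath x y) has_vector_derivative 2 *\<^sub>R \<gamma>' (2 * t)) (at t within {a..b})"
        by (rule has_vector_derivative_transform[rotated 2]) (use t True in \<open>auto simp: joinpaths_def\<close>)
    qed
  next
    case False
    have "b = 1"
    proof (rule ccontr)
      assume "b \<noteq> 1"
      then obtain s where "s \<in> S" "b = s / 2" using ab by (auto simp: S'_def)
      then show False using S(2) False by auto
    qed
    have "a = 1 / 2"
    proof (rule ccontr)
      assume ne: "a \<noteq> 1 / 2"
      have "a \<noteq> 1" using ab \<open>b = 1\<close> by auto
      then obtain s where "s \<in> S" "a = s / 2" using ab by (auto simp: S'_def)
      then have "a \<le> 1 / 2" using S(2) by auto
      then have "1 / 2 \<in> {a<..<b} \<inter> S'" using half ne False by auto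
      then show False using ab by auto
    qed
    show ?thesis
    proof (intro exI conjI ballI)
      show "continuous_on {a..b} (\<lambda>_::real. 2 *\<^sub>R (y - x))" by (rule continuous_on_const)
      fix t assume t: "t \<in> {a..b}"
      have hv: "((\<lambda>t. linepath x y (2 * t - 1)) has_vector_derivative 2 *\<^sub>R (y - x)) (at t within {a..b})"
      proof -
        have "((\<lambda>t. 2 * t - 1) has_vector_derivative 2) (at t within {a..b})"
          by (auto intro!: derivative_eq_intros)
        from vector_diff_chain_within[OF this has_vector_derivative_linepath_within[of x y]] show ?thesis
          by (simp add: o_def)
      qed
      have heq: "(\<gamma> +++ linepath x y) s = linepath x y (2 * s - 1)" if "s \<in> {a..b}" for s
      proof (cases "s = 1 / 2")
        case True
        show ?thesis unfolding True using \<gamma>(2) by (simp add: joinpaths_def linepath_0')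
      next
        case False
        then have "\<not> s \<le> 1 / 2" using that \<open>a = 1 / 2\<close> by auto
        then show ?thesis by (simp add: joinpaths_def)
      qed
      show "((\<gamma> +++ linepath x y) has_vector_derivative 2 *\<^sub>R (y - x)) (at t within {a..b})"
        by (rule has_vector_derivative_transform[OF t heq hv])
    qed
  qed
  have "0 / 2 \<in> (\<lambda>s. s / 2) ` S" using S(3) by (rule imageI)
  then have S0: "0 \<in> S'" by (simp add: S'_def)
  show ?thesis
    unfolding piecewise_C1_curve_def
  proof (intro conjI cont exI[of _ S'] ballI impI)
    show "finite S'" using S(1) by (simp add: S'_def)
    show "S' \<subseteq> {0..1}" using S(2) by (force simp: S'_def)
    show "1 \<in> S'" by (simp add: S'_def)
  qed (rule S0, rule pieces)
qed

lemma join_linepath_admissible: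
  assumes "\<gamma> \<in> admissible z x" "y \<in> disc"
  shows "\<gamma> +++ linepath x y \<in> admissible z y"
proof -
  have \<gamma>: "piecewise_C1_curve \<gamma>" "\<gamma> ` {0..1} \<subseteq> disc" "\<gamma> 0 = z" "\<gamma> 1 = x" using assms by (auto simp: admissible_def)
  have x: "x \<in> disc" using \<gamma>(2,4) by force
  have "path_image (\<gamma> +++ linepath x y) \<subseteq> path_image \<gamma> \<union> path_image (linepath x y)" by (rule path_image_join_subset)
  moreover have "path_image (linepath x y) \<subseteq> disc"
    using linepath_admissible[OF x assms(2)] by (simp add: admissible_def path_image_def)
  ultimately have "(\<gamma> +++ linepath x y) ` {0..1} \<subseteq> disc" using \<gamma>(2) unfolding path_image_def by blast
  moreover have "(\<gamma> +++ linepath x y) 0 = z" "(\<gamma> +++ linepath x y) 1 = y"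
    using \<gamma> by (auto simp: joinpaths_def linepath_1')
  ultimately show ?thesis using piecewise_C1_join_linepath[OF \<gamma>(1,4)] by (simp add: admissible_def)
qed

lemma curve_length_join_linepath:
  assumes \<tau>: "continuous_on disc (tau \<phi>)" "\<And>z. z \<in> disc \<Longrightarrow> 0 < tau \<phi> z"
    and \<gamma>: "\<gamma> \<in> admissible z x" and y: "y \<in> disc"
    and m: "0 < m" "\<And>\<zeta>. \<zeta> \<in> closed_segment x y \<Longrightarrow> m \<le> tau \<phi> \<zeta>"
  shows "curve_length_phi \<phi> (\<gamma> +++ linepath x y) \<le> curve_length_phi \<phi> \<gamma> + cmod (x - y) / m"
proof -
  define g where "g t = cmod (vector_derivative (\<gamma> +++ linepath x y) (at t)) / tau \<phi> ((\<gamma> +++ linepath x y) t)" for t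
  define g0 where "g0 t = cmod (vector_derivative \<gamma> (at t)) / tau \<phi> (\<gamma> t)" for t
  obtain T where T: "finite T" "\<And>t. t \<in> {0..1} - T \<Longrightarrow> (\<gamma> has_vector_derivative vector_derivative \<gamma> (at t)) (at t)"
    and i0: "g0 integrable_on {0..1}"
    using curve_speed_integrable[OF \<tau> \<gamma>] unfolding g0_def by metis
  obtain T' where ig: "g integrable_on {0..1}"
    using curve_speed_integrable[OF \<tau> join_linepath_admissible[OF \<gamma> y]] unfolding g_def by metis
  have "(g0 has_integral integral {0..1} g0) {0..1}" using i0 by (rule integrable_integral)
  from has_integral_affinity01[OF this, of 2 0, THEN has_integral_cmul[where c = 2]]
  have h0: "((\<lambda>t. 2 * g0 (2 * t)) has_integral integral {0..1} g0) {0..1/2}"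
    by (simp_all only: image_affinity_atLeastAtMost_div_diff, simp_all)
  have h1: "(g has_integral integral {0..1} g0) {0..1/2}"
  proof (rule has_integral_spike_finite[OF _ _ h0])
    show "finite (insert (1/2) ((\<lambda>s. s / 2) ` T))" using T by simp
    fix t :: real assume "t \<in> {0..1/2} - insert (1/2) ((\<lambda>s. s / 2) ` T)"
    then have t: "0 \<le> t" "t < 1 / 2" by auto
    have t2: "2 * t \<notin> T"
    proof
      assume "2 * t \<in> T"
      then have "(2 * t) / 2 \<in> (\<lambda>s. s / 2) ` T" by (rule imageI)
      then show False using \<open>t \<in> {0..1/2} - insert (1/2) ((\<lambda>s. s / 2) ` T)\<close> by simp
    qed
    have "((*) 2 has_vector_derivative 2) (at t)"
      by (simp add: has_vector_derivative_def has_derivative_def bounded_linear_mult_left)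
    moreover have "(\<gamma> has_vector_derivative vector_derivative \<gamma> (at (2 * t))) (at (2 * t))"
      by (rule T(2)) (use t t2 in auto)
    ultimately have "((\<gamma> \<circ> (*) 2) has_vector_derivative 2 *\<^sub>R vector_derivative \<gamma> (at (2 * t))) (at t)"
      by (rule vector_diff_chain_at)
    then have "((\<gamma> +++ linepath x y) has_vector_derivative 2 *\<^sub>R vector_derivative \<gamma> (at (2 * t))) (at t)"
      by (rule has_vector_derivative_transform_within_open[of _ _ _ "{..<1/2}"])
         (use t in \<open>auto simp: joinpaths_def\<close>)
    then have "vector_derivative (\<gamma> +++ linepath x y) (at t) = 2 *\<^sub>R vector_derivative \<gamma> (at (2 * t))"
      by (rule vector_derivative_at)
    moreover have "(\<gamma> +++ linepath x y) t = \<gamma> (2 * t)" using t by (simp add: joinpaths_def)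
    ultimately show "g t = 2 * g0 (2 * t)" by (simp add: g_def g0_def)
  qed
  have ig2: "g integrable_on {1/2..1}" using ig by (rule integrable_on_subinterval) auto
  define k where "k = 2 * cmod (x - y) / m"
  have "integral {1/2..1} g \<le> k * (1 - 1/2)"
  proof -
    have kint: "((\<lambda>_. k) has_integral (1 - 1/2) *\<^sub>R k) {1/2..(1::real)}"
      using has_integral_const_real[of k "1/2" "1::real"] by simp
    have "(g has_integral integral {1/2..1} g) {1/2..1}" using ig2 by (rule integrable_integral)
    then have hg: "((\<lambda>t. if t \<in> {1/2} then 0 else g t) has_integral integral {1/2..1} g) {1/2..1}"
      by (rule has_integral_spike_finite[of "{1/2}", rotated 2]) auto
    have hle: "(if t \<in> {1/2} then 0 else g t) \<le> k" if t: "t \<in> {1/2..1}" for t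
    proof (cases "t = 1/2")
      case True
      have "0 \<le> k" using m(1) by (simp add: k_def)
      then show ?thesis using True by simp
    next
      case False
      then have t': "1/2 < t" "t \<le> 1" using t by auto
      have "((\<lambda>t. 2 * t - 1) has_vector_derivative 2) (at t)"
        by (auto intro!: derivative_eq_intros)
      from vector_diff_chain_at[OF this has_vector_derivative_linepath_within[of x y]]
      have "((\<lambda>t. linepath x y (2 * t - 1)) has_vector_derivative 2 *\<^sub>R (y - x)) (at t)"
        by (simp add: o_def)
      then have "((\<gamma> +++ linepath x y) has_vector_derivative 2 *\<^sub>R (y - x)) (at t)"
        by (rule has_vector_derivative_transform_within_open[of _ _ _ "{1/2<..}"])
           (use t' in \<open>auto simp: joinpaths_def\<close>)
      then have vd: "vector_derivative (\<gamma> +++ linepath x y) (at t) = 2 *\<^sub>R (y - x)"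
        by (rule vector_derivative_at)
      have "(\<gamma> +++ linepath x y) t = linepath x y (2 * t - 1)" using t' by (simp add: joinpaths_def)
      moreover have "linepath x y (2 * t - 1) \<in> closed_segment x y"
        using t' by (intro linepath_in_path) auto
      ultimately have "m \<le> tau \<phi> ((\<gamma> +++ linepath x y) t)" using m(2) by simp
      then have "g t \<le> cmod (2 *\<^sub>R (y - x)) / m"
        unfolding g_def vd using m(1) by (intro divide_left_mono) auto
      then show ?thesis using False by (simp add: k_def norm_minus_commute)
    qed
    have "integral {1/2..1} g \<le> (1 - 1/2) *\<^sub>R k" by (rule has_integral_le[OF hg kint hle])
    then show ?thesis by (simp add: mult.commute)
  qed
  moreover have "integral {0..1} g = integral {0..1} g0 + integral {1/2..1} g"
    by (rule integral_unique, rule has_integral_combine[OF _ _ h1 integrable_integral[OF ig2]]) auto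
  ultimately show ?thesis unfolding curve_length_phi_def g_def[symmetric] g0_def[symmetric] by (simp add: k_def)
qed

text \<open>
  Any curve from \<open>z\<close> to \<open>x\<close> can be continued by the segment from \<open>x\<close> to \<open>y\<close>, whose length in the
  metric is at most \<open>|x - y| / m\<close>.
\<close>

lemma d_phi_Lipschitz:
  assumes \<tau>: "continuous_on disc (tau \<phi>)" "\<And>z. z \<in> disc \<Longrightarrow> 0 < tau \<phi> z"
    and z: "z \<in> disc" "x \<in> disc" "y \<in> disc"
    and m: "0 < m" "\<And>\<zeta>. \<zeta> \<in> closed_segment x y \<Longrightarrow> m \<le> tau \<phi> \<zeta>"
  shows "d_phi \<phi> z y \<le> d_phi \<phi> z x + cmod (x - y) / m"
proof -
  have "d_phi \<phi> z y - cmod (x - y) / m \<le> (INF \<gamma>\<in>admissible z x. curve_length_phi \<phi> \<gamma>)"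
  proof (rule cINF_greatest)
    show "admissible z x \<noteq> {}" using linepath_admissible[OF z(1,2)] by auto
    fix \<gamma> assume \<gamma>: "\<gamma> \<in> admissible z x"
    show "d_phi \<phi> z y - cmod (x - y) / m \<le> curve_length_phi \<phi> \<gamma>"
      using d_phi_le[OF join_linepath_admissible[OF \<gamma> z(3)], of \<phi>] curve_length_join_linepath[OF \<tau> \<gamma> z(3) m] by simp
  qed
  then show ?thesis by (simp add: d_phi_admissible)
qed

section \<open>Exponential decay of minimal solutions\<close>

context pos_weight
begin

lemma tau_pos: "z \<in> disc \<Longrightarrow> 0 < tau \<phi> z"
  using lap_pos[of z] by (simp add: tau_def)

lemma laplacian_tau: "z \<in> disc \<Longrightarrow> laplacian \<phi> z = (1 / tau \<phi> z)\<^sup>2"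
proof -
  assume z: "z \<in> disc"
  have "(tau \<phi> z)\<^sup>2 = laplacian \<phi> z powr (- 1)"
    unfolding tau_def power2_eq_square powr_add[symmetric] by simp
  also have "\<dots> = 1 / laplacian \<phi> z" using lap_pos[OF z] by (simp add: powr_minus_divide)
  finally show ?thesis using lap_pos[OF z] by (simp add: power_divide)
qed

lemma integrable_cutoff_sq:
  assumes f: "continuous_on UNIV f" "\<forall>z. z \<notin> cball 0 R \<longrightarrow> f z = 0" "R < 1" and h: "continuous_on disc h"
  shows "integrable meas (\<lambda>z. h z * (cmod (f z))\<^sup>2)"
proof -
  have sub: "cball 0 R \<subseteq> disc" using f(3) by auto
  have c: "continuous_on UNIV (\<lambda>z. f z * (cnj (f z) * of_real (h z)))"
    by (rule continuous_on_cutoff[OF f(1) closed_cball _ sub open_ball])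
       (use f(2) continuous_on_subset[OF f(1)] h in \<open>auto intro!: continuous_intros\<close>)
  have "integrable meas (\<lambda>z. f z * (cnj (f z) * of_real (h z)))"
    by (rule compact_support_E(1)[OF c _ f(3)]) (use f(2) in auto)
  then have "integrable meas (\<lambda>z. Re (f z * (cnj (f z) * of_real (h z))))" by (rule integrable_Re)
  moreover have "Re (f z * (cnj (f z) * of_real (h z))) = h z * (cmod (f z))\<^sup>2" for z
  proof -
    have "f z * (cnj (f z) * of_real (h z)) = of_real ((cmod (f z))\<^sup>2 * h z)"
      unfolding of_real_mult complex_norm_square by simp
    then show ?thesis by (simp only: Re_complex_of_real mult.commute)
  qed
  ultimately show ?thesis by simp
qed

text \<open>
  The weight is \<open>\<rho> = \<sigma> / 2\<close>, where \<open>\<sigma>\<close> is a smooth approximation of \<open>d\<close>; then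
  \<open>4 |\<partial>\<rho>|\<^sup>2 = |\<partial>\<sigma>|\<^sup>2 \<le> 1/\<tau>\<^sup>2 = \<Delta>\<phi>\<close> and \<open>exp (2\<rho>)\<close> is comparable with \<open>exp d\<close>.  This weight is at least
  \<open>exp (c - 2)\<close> on \<open>A\<close> and at most \<open>exp (c0 + 2)\<close> on the support of \<open>f\<close>; the summand 4 in the exponent
  comes from this loss.  The step is applied to functions \<open>dstar (\<alpha> n) (a n)\<close> that converge to
  \<open>u\<close>.  The weight changes with \<open>n\<close>, since it is smoothed on a disc that contains the support of
  \<open>\<alpha> n\<close>, but its bounds do not.
\<close>

lemma Agmon_estimate:
  assumes C: "0 \<le> C" "\<And>z w. z \<in> disc \<Longrightarrow> w \<in> disc \<Longrightarrow> \<bar>tau \<phi> z - tau \<phi> w\<bar> \<le> C * cmod (z - w)"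
    and u: "u \<in> L2 meas" "continuous_on disc u"
      "\<And>h. h holomorphic_on disc \<Longrightarrow> (\<lambda>z. indicator disc z *\<^sub>R h z) \<in> L2 meas \<Longrightarrow> ip meas u (\<lambda>z. indicator disc z *\<^sub>R h z) = 0"
    and f: "continuous_on UNIV f" "\<forall>z. z \<notin> cball 0 R1 \<longrightarrow> f z = 0" "R1 < 1"
    and weak: "\<And>\<beta> b1 b2. testfun \<beta> b1 b2 \<Longrightarrow> ip meas u (dstar \<beta> b1) = ip meas f \<beta>"
    and d: "\<And>z. z \<in> disc \<Longrightarrow> 0 \<le> d z \<and> d z \<le> B0"
      "\<And>x y m. x \<in> disc \<Longrightarrow> y \<in> disc \<Longrightarrow> 0 < m \<Longrightarrow> (\<And>\<zeta>. \<zeta> \<in> closed_segment x y \<Longrightarrow> m \<le> tau \<phi> \<zeta>) \<Longrightarrow> \<bar>d x - d y\<bar> \<le> cmod (x - y) / m"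
    and A: "A \<in> sets borel" "\<And>z. z \<in> A \<Longrightarrow> c \<le> d z"
    and c0: "\<And>z. f z \<noteq> 0 \<Longrightarrow> d z \<le> c0"
  shows "(\<integral>z. indicator A z * (cmod (u z))\<^sup>2 \<partial>meas) \<le> 48 * exp (c0 - c + 4) * (\<integral>z. (cmod (f z))\<^sup>2 / laplacian \<phi> z \<partial>meas)"
proof -
  obtain \<alpha> a b where \<alpha>: "\<And>n. testfun (\<alpha> n) (a n) (b n)"
    and lim0: "(\<lambda>n. sqnorm meas (\<lambda>z. u z - dstar (\<alpha> n) (a n) z)) \<longlonglongrightarrow> 0"
    by (rule dstar_approximation[OF u(1,2)]) (rule u(3), assumption, assumption, rule that, assumption+)
  define D where "D n = dstar (\<alpha> n) (a n)" for n
  have DL: "D n \<in> L2 meas" for n unfolding D_def by (rule dstar_L2[OF \<alpha>])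
  define e where "e n = sqnorm meas (\<lambda>z. u z - D n z)" for n
  have e0: "e \<longlonglongrightarrow> 0" using lim0 by (simp add: e_def[abs_def] D_def)
  define F0 where "F0 = (\<integral>z. (cmod (f z))\<^sup>2 / laplacian \<phi> z \<partial>meas)"
  define B where "B = (B0 + 2) / 2"
  define U where "U = sqnorm meas u"
  have As: "A \<in> sets meas" using A(1) by simp
  have iA: "integrable meas (\<lambda>z. indicator A z * (cmod (v z))\<^sup>2)" if "v \<in> L2 meas" for v
    using integrable_mult_indicator[OF As L2_integrable[OF that]] by simp
  have ilap: "continuous_on disc (\<lambda>z. 1 / laplacian \<phi> z)"
    using lap_pos by (intro continuous_on_divide continuous_on_const continuous_laplacian) fastforce
  have step: "(\<integral>z. indicator A z * (cmod (D n z))\<^sup>2 \<partial>meas) \<le>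
      exp (2 - c) * (24 * (exp (c0 + 2) * F0) + 12 * sqrt (e n * (6 * exp (4 * B) * sqnorm meas (D n))))" for n
  proof -
    obtain R0 where R0: "R0 < 1" "C1w UNIV (\<alpha> n) (a n) (b n)"
      "\<And>z. z \<notin> cball 0 R0 \<Longrightarrow> \<alpha> n z = 0" "\<And>z. z \<notin> cball 0 R0 \<Longrightarrow> a n z = 0"
      using testfunE[OF \<alpha>] by metis
    define R where "R = max 0 (max R0 R1)"
    have R: "0 \<le> R" "R < 1" using R0(1) f(3) by (auto simp: R_def)
    have R0R: "z \<notin> cball 0 R0" "z \<notin> cball 0 R1" if "z \<notin> cball 0 R" for z :: complex using that by (auto simp: R_def)
    have sub: "cball 0 R \<subseteq> disc" using R by auto
    obtain \<sigma> s s2 s3 s4 where \<sigma>: "C2w UNIV (\<lambda>z. of_real (\<sigma> z)) s (\<lambda>z. cnj (s z)) s2 s3 s4"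
      and \<sigma>d: "\<And>z. z \<in> cball 0 R \<Longrightarrow> \<bar>\<sigma> z - d z\<bar> \<le> 2"
      and \<sigma>g: "\<And>z. z \<in> cball 0 R \<Longrightarrow> cmod (s z) \<le> 1 / tau \<phi> z"
    proof (rule Lipschitz_regularization[of "tau \<phi>" C d B0 R])
      show "0 < tau \<phi> z" if "z \<in> disc" for z by (rule tau_pos[OF that])
      show "0 \<le> C" by (rule C(1))
      show "\<bar>tau \<phi> z - tau \<phi> w\<bar> \<le> C * cmod (z - w)" if "z \<in> disc" "w \<in> disc" for z w by (rule C(2)[OF that])
      show "0 \<le> d z \<and> d z \<le> B0" if "z \<in> disc" for z by (rule d(1)[OF that])
      show "\<bar>d x - d y\<bar> \<le> cmod (x - y) / m" if "x \<in> disc" "y \<in> disc" "0 < m" "\<And>\<zeta>. \<zeta> \<in> closed_segment x y \<Longrightarrow> m \<le> tau \<phi> \<zeta>" for x y m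
        by (rule d(2)[OF that])
    qed (rule R, rule R, rule that, assumption, blast, blast)
    define \<rho> where "\<rho> z = \<sigma> z / 2" for z
    define r where "r z = 1 / 2 * s z" for z
    have e1: "(\<lambda>z. 1 / 2 * complex_of_real (\<sigma> z)) = (\<lambda>z. of_real (\<rho> z))" by (simp add: \<rho>_def)
    have e2: "(\<lambda>z. 1 / 2 * cnj (s z)) = (\<lambda>z. cnj (r z))" by (simp add: r_def)
    have \<rho>: "C2w UNIV (\<lambda>z. of_real (\<rho> z)) r (\<lambda>z. cnj (r z)) (\<lambda>z. 1 / 2 * s2 z) (\<lambda>z. 1 / 2 * s3 z) (\<lambda>z. 1 / 2 * s4 z)"
      using C2w_cmult[OF \<sigma>, of "1 / 2"] unfolding e1 e2 r_def[abs_def] .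
    have grad: "4 * (cmod (r z))\<^sup>2 \<le> laplacian \<phi> z" if z: "z \<in> cball 0 R" for z
    proof -
      have "4 * (cmod (r z))\<^sup>2 = (cmod (s z))\<^sup>2" by (simp add: r_def norm_mult power_mult_distrib power_divide)
      also have "\<dots> \<le> (1 / tau \<phi> z)\<^sup>2" by (intro power_mono \<sigma>g z) simp
      also have "\<dots> = laplacian \<phi> z" using laplacian_tau[of z] z sub by auto
      finally show ?thesis .
    qed
    have \<rho>B: "\<rho> z \<le> B" if z: "z \<in> cball 0 R" for z
      using \<sigma>d[OF z] d(1)[of z] z sub by (fastforce simp: \<rho>_def B_def abs_le_iff)
    have f0: "\<forall>z. z \<notin> cball 0 R \<longrightarrow> f z = 0" using f(2) R0R by blast
    have as: "sqnorm meas (\<lambda>z. of_real (exp (\<rho> z)) * D n z) \<le>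
      24 * (\<integral>z. exp (2 * \<rho> z) * (cmod (f z))\<^sup>2 / laplacian \<phi> z \<partial>meas) +
      12 * sqrt (e n * (6 * exp (4 * B) * sqnorm meas (D n)))"
      unfolding D_def e_def
      by (rule Agmon_step[OF u(1) f(1) f0 R(2) weak \<alpha> _ _ \<rho> grad \<rho>B]) (use R0(3,4) R0R in blast)+
    have c\<rho>: "continuous_on UNIV (\<lambda>z. complex_of_real (\<rho> z))" using \<rho> C1w_continuous unfolding C2w_def by blast
    have c\<rho>': "continuous_on UNIV \<rho>"
      using continuous_on_Re[OF c\<rho>] by simp
    have Fn: "(\<integral>z. exp (2 * \<rho> z) * (cmod (f z))\<^sup>2 / laplacian \<phi> z \<partial>meas) \<le> exp (c0 + 2) * F0"
    proof -
      have I1: "integrable meas (\<lambda>z. (exp (2 * \<rho> z) * (1 / laplacian \<phi> z)) * (cmod (f z))\<^sup>2)"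
        by (rule integrable_cutoff_sq[OF f]) (intro continuous_on_mult ilap continuous_on_exp continuous_on_const continuous_on_subset[OF c\<rho>'] subset_UNIV)
      have I2: "integrable meas (\<lambda>z. exp (c0 + 2) * ((1 / laplacian \<phi> z) * (cmod (f z))\<^sup>2))"
        by (rule integrable_mult_right[OF integrable_cutoff_sq[OF f ilap]])
      have pt: "(exp (2 * \<rho> z) * (1 / laplacian \<phi> z)) * (cmod (f z))\<^sup>2 \<le> exp (c0 + 2) * ((1 / laplacian \<phi> z) * (cmod (f z))\<^sup>2)" for z
      proof (cases "f z = 0")
        case False
        then have z: "z \<in> cball 0 R" using f0 by blast
        have "2 * \<rho> z \<le> c0 + 2" using \<sigma>d[OF z] c0[OF False] by (simp add: \<rho>_def abs_le_iff)
        moreover have "0 < laplacian \<phi> z" using lap_pos[of z] z sub by auto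
        ultimately show ?thesis unfolding mult.assoc by (intro mult_right_mono) auto
      qed simp
      have "(\<integral>z. (exp (2 * \<rho> z) * (1 / laplacian \<phi> z)) * (cmod (f z))\<^sup>2 \<partial>meas) \<le> (\<integral>z. exp (c0 + 2) * ((1 / laplacian \<phi> z) * (cmod (f z))\<^sup>2) \<partial>meas)"
        by (rule integral_mono[OF I1 I2 pt])
      also have "\<dots> = exp (c0 + 2) * F0" unfolding integral_mult_right_zero F0_def by simp
      finally show ?thesis by simp
    qed
    have D0: "\<forall>z. z \<notin> cball 0 R \<longrightarrow> D n z = 0" using R0(3,4) R0R by (auto simp: D_def dstar_def)
    have cD: "continuous_on UNIV (D n)" using dstar_compact_support[OF \<alpha>] unfolding D_def by metis
    have cG: "continuous_on UNIV (\<lambda>z. of_real (exp (\<rho> z)) * D n z)"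
      by (intro continuous_on_mult continuous_on_of_real continuous_on_exp c\<rho>' cD)
    have GL: "(\<lambda>z. of_real (exp (\<rho> z)) * D n z) \<in> L2 meas"
      by (rule compact_support_E(4)[OF cG _ R(2)]) (use D0 in auto)
    have pt: "indicator A z * (cmod (D n z))\<^sup>2 \<le> exp (2 - c) * (cmod (of_real (exp (\<rho> z)) * D n z))\<^sup>2" for z
    proof (cases "z \<in> A \<and> z \<in> cball 0 R")
      case True
      have "c - 2 \<le> \<sigma> z" using \<sigma>d[of z] A(2)[of z] True by (simp add: abs_le_iff)
      then have "1 \<le> exp (2 - c) * exp (\<sigma> z)" by (simp flip: exp_add)
      from mult_right_mono[OF this, of "(cmod (D n z))\<^sup>2"]
      have "(cmod (D n z))\<^sup>2 \<le> exp (2 - c) * (exp (\<sigma> z) * (cmod (D n z))\<^sup>2)" by (simp add: mult.assoc)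
      moreover have "(cmod (of_real (exp (\<rho> z)) * D n z))\<^sup>2 = exp (\<sigma> z) * (cmod (D n z))\<^sup>2"
        unfolding norm_mult norm_of_real power_mult_distrib \<rho>_def using exp_double[of "\<sigma> z / 2"] by simp
      ultimately show ?thesis using True by simp
    next
      case False
      then show ?thesis using D0 by (cases "z \<in> A") auto
    qed
    have "(\<integral>z. indicator A z * (cmod (D n z))\<^sup>2 \<partial>meas) \<le> (\<integral>z. exp (2 - c) * (cmod (of_real (exp (\<rho> z)) * D n z))\<^sup>2 \<partial>meas)"
      by (rule integral_mono[OF iA[OF DL] integrable_mult_right[OF L2_integrable[OF GL]] pt])
    also have "\<dots> = exp (2 - c) * sqnorm meas (\<lambda>z. of_real (exp (\<rho> z)) * D n z)"
      unfolding sqnorm_def by (rule integral_mult_right_zero)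
    also have "\<dots> \<le> exp (2 - c) * (24 * (exp (c0 + 2) * F0) + 12 * sqrt (e n * (6 * exp (4 * B) * sqnorm meas (D n))))"
      using as Fn by (intro mult_left_mono) auto
    finally show ?thesis .
  qed
  define T where "T n = 2 * (exp (2 - c) * (24 * (exp (c0 + 2) * F0) + 12 * sqrt (e n * (6 * exp (4 * B) * (2 * U + 2 * e n))))) + 2 * e n" for n
  have e_nn: "0 \<le> e n" for n by (simp add: e_def sqnorm_nonneg)
  have le: "(\<integral>z. indicator A z * (cmod (u z))\<^sup>2 \<partial>meas) \<le> T n" for n
  proof -
    have uD: "(\<lambda>z. u z - D n z) \<in> L2 meas" by (rule L2_diff[OF u(1) DL])
    have pt: "indicator A z * (cmod (u z))\<^sup>2 \<le> 2 * (indicator A z * (cmod (D n z))\<^sup>2) + 2 * (cmod (u z - D n z))\<^sup>2" for z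
      using cmod_add_sq_le[of "D n z" "u z - D n z"] by (cases "z \<in> A") auto
    have "(\<integral>z. indicator A z * (cmod (u z))\<^sup>2 \<partial>meas) \<le> (\<integral>z. 2 * (indicator A z * (cmod (D n z))\<^sup>2) + 2 * (cmod (u z - D n z))\<^sup>2 \<partial>meas)"
      by (rule integral_mono[OF iA[OF u(1)] Bochner_Integration.integrable_add[OF integrable_mult_right[OF iA[OF DL]] integrable_mult_right[OF L2_integrable[OF uD]]] pt])
    also have "\<dots> = 2 * (\<integral>z. indicator A z * (cmod (D n z))\<^sup>2 \<partial>meas) + 2 * e n"
      using iA[OF DL, of n] L2_integrable[OF uD] unfolding e_def sqnorm_def
      by (simp only: Bochner_Integration.integral_add integrable_mult_right integral_mult_right_zero)
    also have "\<dots> \<le> T n"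
    proof -
      have "sqnorm meas (D n) \<le> 2 * U + 2 * e n" unfolding U_def e_def by (rule sqnorm_le_diff[OF DL u(1)])
      then have "sqrt (e n * (6 * exp (4 * B) * sqnorm meas (D n))) \<le> sqrt (e n * (6 * exp (4 * B) * (2 * U + 2 * e n)))"
        by (intro real_sqrt_le_mono mult_left_mono e_nn) auto
      then have "exp (2 - c) * (24 * (exp (c0 + 2) * F0) + 12 * sqrt (e n * (6 * exp (4 * B) * sqnorm meas (D n)))) \<le>
        exp (2 - c) * (24 * (exp (c0 + 2) * F0) + 12 * sqrt (e n * (6 * exp (4 * B) * (2 * U + 2 * e n))))"
        by (intro mult_left_mono add_left_mono) auto
      with step[of n] show ?thesis unfolding T_def by linarith
    qed
    finally show ?thesis .
  qed
  have "T \<longlonglongrightarrow> 2 * (exp (2 - c) * (24 * (exp (c0 + 2) * F0) + 12 * sqrt (0 * (6 * exp (4 * B) * (2 * U + 2 * 0))))) + 2 * 0"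
    unfolding T_def[abs_def]
    by (intro tendsto_add tendsto_mult tendsto_real_sqrt tendsto_const e0)
  then have "(\<integral>z. indicator A z * (cmod (u z))\<^sup>2 \<partial>meas) \<le> 2 * (exp (2 - c) * (24 * (exp (c0 + 2) * F0) + 12 * sqrt (0 * (6 * exp (4 * B) * (2 * U + 2 * 0))))) + 2 * 0"
    by (rule LIMSEQ_le_const) (use le in blast)
  also have "\<dots> = 48 * (exp (2 - c) * exp (c0 + 2)) * F0" by simp
  also have "exp (2 - c) * exp (c0 + 2) = exp (c0 - c + 4)" by (simp flip: exp_add)
  finally show ?thesis by (simp add: F0_def)
qed

end

section \<open>Integrals over the disc\<close>

lemma measurable_cutoff_disc:
  fixes F :: "complex \<Rightarrow> 'b::real_normed_vector"
  assumes "continuous_on disc F"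
  shows "(\<lambda>z. indicator disc z *\<^sub>R F z) \<in> borel_measurable borel"
  by (rule borel_measurable_continuous_on_indicator[OF _ assms]) simp

lemma lebesgue_disc_integral:
  fixes F :: "complex \<Rightarrow> 'b::{banach, second_countable_topology}"
  assumes F: "continuous_on disc F"
  shows "(\<integral>w. F w \<partial>lebesgue_on disc) = (\<integral>w. indicator disc w *\<^sub>R F w \<partial>lborel)"
    and "integrable (lebesgue_on disc) F \<longleftrightarrow> integrable lborel (\<lambda>w. indicator disc w *\<^sub>R F w)"
proof -
  have m: "(\<lambda>w. indicator disc w *\<^sub>R F w) \<in> borel_measurable lborel"
    using measurable_cutoff_disc[OF F] by simp
  show "(\<integral>w. F w \<partial>lebesgue_on disc) = (\<integral>w. indicator disc w *\<^sub>R F w \<partial>lborel)"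
    using integral_completion[OF m] by (subst integral_restrict_space) auto
  show "integrable (lebesgue_on disc) F \<longleftrightarrow> integrable lborel (\<lambda>w. indicator disc w *\<^sub>R F w)"
    using integrable_completion[OF m] by (subst integrable_restrict_space) auto
qed

text \<open>
  Functions on the disc are arbitrary outside of it; the weighted measure on the plane sees only
  this normalised version.
\<close>

definition zero_extension :: "(complex \<Rightarrow> complex) \<Rightarrow> complex \<Rightarrow> complex" where
  "zero_extension F z = indicator disc z *\<^sub>R F z"

lemma zero_extension_disc: "z \<in> disc \<Longrightarrow> zero_extension F z = F z"
  and zero_extension_outside: "z \<notin> disc \<Longrightarrow> zero_extension F z = 0"
  by (simp_all add: zero_extension_def)

context weight
begin

lemma weighted_disc_integral:
  assumes F: "continuous_on disc F"
  shows "(\<integral>w. F w * of_real (exp (- 2 * \<phi> w)) \<partial>lebesgue_on disc) = (\<integral>w. zero_extension F w \<partial>meas)"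
proof -
  have "continuous_on disc (\<lambda>w. F w * complex_of_real (exp (- 2 * \<phi> w)))"
    by (intro continuous_intros F continuous_phi)
  note eq = lebesgue_disc_integral(1)[OF this]
  have pt: "indicator disc w *\<^sub>R (F w * complex_of_real (exp (- 2 * \<phi> w))) = W w *\<^sub>R zero_extension F w" for w
    by (cases "w \<in> disc") (simp_all add: W_def zero_extension_def scaleR_conv_of_real mult.commute)
  have "(\<integral>w. F w * of_real (exp (- 2 * \<phi> w)) \<partial>lebesgue_on disc) = (\<integral>w. W w *\<^sub>R zero_extension F w \<partial>lborel)"
    unfolding eq pt ..
  also have "\<dots> = (\<integral>w. zero_extension F w \<partial>meas)"
    by (rule meas_integral[symmetric]) (use measurable_cutoff_disc[OF F] in \<open>simp add: zero_extension_def[abs_def]\<close>)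
  finally show ?thesis .
qed

lemma L2_phi_iff:
  assumes F: "continuous_on disc F"
  shows "F \<in> L2_phi \<phi> \<longleftrightarrow> zero_extension F \<in> L2 meas"
proof -
  have m: "zero_extension F \<in> borel_measurable borel" using measurable_cutoff_disc[OF F] by (simp add: zero_extension_def[abs_def])
  have mF: "F \<in> borel_measurable (lebesgue_on disc)"
    by (rule continuous_imp_measurable_on_sets_lebesgue[OF F]) simp
  have c: "continuous_on disc (\<lambda>w. (cmod (F w))\<^sup>2 * exp (- 2 * \<phi> w))" by (intro continuous_intros F continuous_phi)
  have "(\<lambda>w. indicator disc w *\<^sub>R ((cmod (F w))\<^sup>2 * exp (- 2 * \<phi> w))) = (\<lambda>w. W w *\<^sub>R (cmod (zero_extension F w))\<^sup>2)"
    by (auto simp: W_def zero_extension_def indicator_def)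
  then have "integrable (lebesgue_on disc) (\<lambda>w. (cmod (F w))\<^sup>2 * exp (- 2 * \<phi> w)) \<longleftrightarrow> integrable lborel (\<lambda>w. W w *\<^sub>R (cmod (zero_extension F w))\<^sup>2)"
    using lebesgue_disc_integral(2)[OF c] by simp
  also have "\<dots> \<longleftrightarrow> integrable meas (\<lambda>w. (cmod (zero_extension F w))\<^sup>2)"
    by (rule meas_integrable[symmetric]) (use m in measurable)
  finally show ?thesis using m mF by (simp add: L2_phi_def L2_def meas_def)
qed

lemma inner_phi_ip:
  assumes "continuous_on disc F" "continuous_on disc G"
  shows "inner_phi \<phi> F G = ip meas (zero_extension F) (zero_extension G)"
proof -
  have "continuous_on disc (\<lambda>w. F w * cnj (G w))" by (intro continuous_intros assms)
  note eq = weighted_disc_integral[OF this]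
  have pt: "zero_extension (\<lambda>w. F w * cnj (G w)) w = zero_extension F w * cnj (zero_extension G w)" for w
    by (cases "w \<in> disc") (simp_all add: zero_extension_def)
  show ?thesis unfolding inner_phi_def ip_def eq pt ..
qed

lemma AL2_phi_iff: "h \<in> AL2_phi \<phi> \<longleftrightarrow> h holomorphic_on disc \<and> zero_extension h \<in> L2 meas"
  using L2_phi_iff holomorphic_on_imp_continuous_on unfolding AL2_phi_def by blast

end

section \<open>The Bergman kernel near the diagonal\<close>

locale bergman_weight = pos_weight +
  fixes K :: "complex \<Rightarrow> complex \<Rightarrow> complex" and C1 C2 :: real
  assumes K: "is_bergman_kernel \<phi> K"
    and C1: "0 < C1" "\<And>z w. z \<in> disc \<Longrightarrow> w \<in> disc \<Longrightarrow> \<bar>tau \<phi> z - tau \<phi> w\<bar> \<le> C1 * cmod (z - w)"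
    and C2: "0 < C2" "\<And>z. z \<in> disc \<Longrightarrow> tau \<phi> z \<le> C2 * (1 - cmod z)"
begin

text \<open>
  Chosen such that the discs \<open>ball z (2 * rad z)\<close> stay inside the unit disc, with \<open>\<tau>\<close> comparable to
  \<open>\<tau> z\<close> on them.
\<close>

definition \<delta> :: real where "\<delta> = min (1 / 4) (min (1 / (4 * C1)) (1 / (4 * C2)))"

definition rad :: "complex \<Rightarrow> real" where "rad z = \<delta> * tau \<phi> z"

definition bump_at :: "complex \<Rightarrow> complex \<Rightarrow> complex" where "bump_at z \<zeta> = bump 3 (of_real (1 / rad z) * (\<zeta> - z))"

text \<open>
  The constant of the submean inequality on discs of radius \<open>rad z\<close>.
\<close>

definition C0 :: real where "C0 = exp 1 / (bump_mass * \<delta>\<^sup>2)"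

definition Kw :: "complex \<Rightarrow> complex \<Rightarrow> complex" where "Kw w = zero_extension (\<lambda>\<zeta>. K \<zeta> w)"

text \<open>
  The mass of \<open>K (\<cdot>, w)\<close> near \<open>z\<close>.  It controls the value of the kernel at \<open>(z, w)\<close> and is itself a
  value of the projection of a function supported near \<open>z\<close>.
\<close>

definition J :: "complex \<Rightarrow> complex \<Rightarrow> real" where
  "J z w = (\<integral>\<zeta>. cmod (bump_at z \<zeta>) * (cmod (Kw w \<zeta>))\<^sup>2 \<partial>meas)"

lemma \<delta>: "0 < \<delta>" "\<delta> \<le> 1 / 4" "C1 * \<delta> \<le> 1 / 4" "C2 * \<delta> \<le> 1 / 4"
proof -
  show "0 < \<delta>" using C1(1) C2(1) by (simp add: \<delta>_def)
  show "\<delta> \<le> 1 / 4" unfolding \<delta>_def by (rule min.cobounded1)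
  have "\<delta> \<le> 1 / (4 * C1)" unfolding \<delta>_def by (rule order_trans[OF min.cobounded2 min.cobounded1])
  then show "C1 * \<delta> \<le> 1 / 4" using C1(1) by (simp add: field_simps)
  have "\<delta> \<le> 1 / (4 * C2)" unfolding \<delta>_def by (rule order_trans[OF min.cobounded2 min.cobounded2])
  then show "C2 * \<delta> \<le> 1 / 4" using C2(1) by (simp add: field_simps)
qed

lemma C0_pos: "0 < C0"
  using bump_mass_pos \<delta>(1) by (simp add: C0_def)

lemma rad_pos: "z \<in> disc \<Longrightarrow> 0 < rad z"
  using tau_pos \<delta>(1) by (simp add: rad_def)

text \<open>
  The second condition on \<open>\<tau>\<close> keeps the disc inside the unit disc, the first one bounds the variation
  of \<open>\<tau>\<close> by \<open>2 C1 \<delta> \<tau> z \<le> \<tau> z / 2\<close>.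
\<close>

lemma ball_rad:
  assumes z: "z \<in> disc" and w: "w \<in> ball z (2 * rad z)"
  shows "w \<in> disc" "tau \<phi> z / 2 \<le> tau \<phi> w" "tau \<phi> w \<le> 3 / 2 * tau \<phi> z"
proof -
  have d: "cmod (w - z) < 2 * rad z" using w by (simp add: dist_norm norm_minus_commute)
  have "rad z \<le> \<delta> * (C2 * (1 - cmod z))" unfolding rad_def using C2(2)[OF z] \<delta>(1) by (intro mult_left_mono) auto
  also have "\<dots> = (C2 * \<delta>) * (1 - cmod z)" by simp
  also have "\<dots> \<le> 1 / 4 * (1 - cmod z)" using \<delta>(4) z by (intro mult_right_mono) auto
  finally have "2 * rad z \<le> (1 - cmod z) / 2" by simp
  then show wd: "w \<in> disc" using norm_triangle_ineq2[of w z] d z by simp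
  have "\<bar>tau \<phi> z - tau \<phi> w\<bar> \<le> C1 * cmod (z - w)" by (rule C1(2)[OF z wd])
  also have "\<dots> \<le> C1 * (2 * rad z)" using d C1(1) by (intro mult_left_mono) (auto simp: norm_minus_commute)
  also have "\<dots> = 2 * (C1 * \<delta>) * tau \<phi> z" by (simp add: rad_def)
  also have "\<dots> \<le> 2 * (1 / 4) * tau \<phi> z" using \<delta>(3) tau_pos[OF z] by (intro mult_right_mono) auto
  finally have "tau \<phi> z - tau \<phi> w \<le> 2 * (1 / 4) * tau \<phi> z" "- (tau \<phi> z - tau \<phi> w) \<le> 2 * (1 / 4) * tau \<phi> z"
    unfolding abs_le_iff by blast+
  then show "tau \<phi> z / 2 \<le> tau \<phi> w" "tau \<phi> w \<le> 3 / 2 * tau \<phi> z" by simp_all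
qed

lemma cball_rad_subset: "z \<in> disc \<Longrightarrow> cball z (rad z) \<subseteq> ball z (2 * rad z)"
  using rad_pos[of z] by auto

lemma continuous_tau: "continuous_on disc (tau \<phi>)"
proof (rule lipschitz_on_continuous_on)
  show "C1-lipschitz_on disc (tau \<phi>)"
    by (rule lipschitz_onI) (use C1 in \<open>auto simp: dist_real_def dist_norm\<close>)
qed

lemma d_local:
  assumes "z0 \<in> disc" "z \<in> disc" and \<zeta>: "\<zeta> \<in> ball z (2 * rad z)" and r: "cmod (\<zeta> - z) \<le> k * rad z"
  shows "d_phi \<phi> z0 \<zeta> \<le> d_phi \<phi> z0 z + 2 * (k * \<delta>)" "d_phi \<phi> z0 z \<le> d_phi \<phi> z0 \<zeta> + 2 * (k * \<delta>)"
proof -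
  have zd: "\<zeta> \<in> disc" by (rule ball_rad(1)[OF assms(2) \<zeta>])
  have zb: "z \<in> ball z (2 * rad z)" using rad_pos[OF assms(2)] by simp
  have seg: "closed_segment z \<zeta> \<subseteq> ball z (2 * rad z)" by (rule closed_segment_subset[OF zb \<zeta>]) simp
  have m: "tau \<phi> z / 2 \<le> tau \<phi> x" if "x \<in> closed_segment z \<zeta>" for x
    using ball_rad(2)[OF assms(2)] that seg by blast
  have m0: "0 < tau \<phi> z / 2" using tau_pos[OF assms(2)] by simp
  have le: "cmod (\<zeta> - z) / (tau \<phi> z / 2) \<le> 2 * (k * \<delta>)"
    using r tau_pos[OF assms(2)] by (simp add: rad_def field_simps)
  show "d_phi \<phi> z0 \<zeta> \<le> d_phi \<phi> z0 z + 2 * (k * \<delta>)"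
    using d_phi_Lipschitz[OF continuous_tau tau_pos assms(1,2) zd m0 m] le by (simp add: norm_minus_commute)
  show "d_phi \<phi> z0 z \<le> d_phi \<phi> z0 \<zeta> + 2 * (k * \<delta>)"
    using d_phi_Lipschitz[OF continuous_tau tau_pos assms(1) zd assms(2) m0] m le
    by (simp add: closed_segment_commute)
qed

text \<open>
  On \<open>ball z (2 * rad z)\<close> one has \<open>\<Delta>\<phi> = 1/\<tau>\<^sup>2 \<le> 4/(\<tau> z)\<^sup>2\<close>, so the exponent in the submean inequality is
  at most \<open>2 \<delta>\<^sup>2 \<le> 1\<close>.
\<close>

lemma pointwise_bound:
  assumes z: "z \<in> disc" and f: "f holomorphic_on ball z (2 * rad z)"
    and g: "g \<in> borel_measurable borel" "\<And>w. w \<in> ball z (2 * rad z) \<Longrightarrow> g w = f w"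
  shows "(cmod (f z))\<^sup>2 * exp (- 2 * \<phi> z) \<le> C0 / (tau \<phi> z)\<^sup>2 * (\<integral>w. cmod (bump_at z w) * (cmod (g w))\<^sup>2 \<partial>meas)"
proof -
  define I where "I = (\<integral>w. cmod (bump_at z w) * (cmod (g w))\<^sup>2 \<partial>meas)"
  define Q where "Q = (cmod (f z))\<^sup>2 * exp (- 2 * \<phi> z)"
  have I0: "0 \<le> I" unfolding I_def by (rule integral_nonneg_AE) simp
  have t: "0 < tau \<phi> z" by (rule tau_pos[OF z])
  have M: "laplacian \<phi> w \<le> 4 / (tau \<phi> z)\<^sup>2" if w: "w \<in> ball z (2 * rad z)" for w
  proof -
    have "1 / tau \<phi> w \<le> 1 / (tau \<phi> z / 2)" using ball_rad(2)[OF z w] t by (intro divide_left_mono mult_pos_pos) auto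
    then have "(1 / tau \<phi> w)\<^sup>2 \<le> (1 / (tau \<phi> z / 2))\<^sup>2"
      using tau_pos[OF ball_rad(1)[OF z w]] by (intro power_mono) auto
    then show ?thesis using laplacian_tau[OF ball_rad(1)[OF z w]] by (simp add: power_divide)
  qed
  have sub: "ball z (2 * rad z) \<subseteq> disc" using ball_rad(1)[OF z] by blast
  have "bump_mass * (rad z)\<^sup>2 * Q \<le> exp (4 / (tau \<phi> z)\<^sup>2 * (rad z)\<^sup>2 / 2) * I"
    using weighted_mean_value[OF f rad_pos[OF z] sub M g] by (simp add: I_def Q_def bump_at_def)
  also have "\<dots> \<le> exp 1 * I"
  proof (rule mult_right_mono[OF _ I0])
    have "4 / (tau \<phi> z)\<^sup>2 * (rad z)\<^sup>2 / 2 = 2 * \<delta>\<^sup>2" using t by (simp add: rad_def power_mult_distrib)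
    also have "\<dots> \<le> 2 * (1 / 4)\<^sup>2" using \<delta>(1,2) by (intro mult_left_mono power_mono) auto
    also have "\<dots> \<le> 1" by (simp add: power2_eq_square)
    finally show "exp (4 / (tau \<phi> z)\<^sup>2 * (rad z)\<^sup>2 / 2) \<le> exp 1" by simp
  qed
  finally have "Q \<le> exp 1 * I / (bump_mass * (rad z)\<^sup>2)"
    using bump_mass_pos rad_pos[OF z] by (simp add: pos_le_divide_eq mult.commute)
  also have "\<dots> = C0 / (tau \<phi> z)\<^sup>2 * I" by (simp add: C0_def rad_def power_mult_distrib mult_ac)
  finally show ?thesis by (simp add: I_def Q_def)
qed

lemma K_AL2: "w \<in> disc \<Longrightarrow> (\<lambda>z. K z w) \<in> AL2_phi \<phi>"
  and K_sym: "z \<in> disc \<Longrightarrow> w \<in> disc \<Longrightarrow> K z w = cnj (K w z)"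
  and K_proj: "f \<in> L2_phi \<phi> \<Longrightarrow> is_bergman_projection \<phi> f (\<lambda>z. \<integral>w. K z w * f w * of_real (exp (- 2 * \<phi> w)) \<partial>lebesgue_on disc)"
  using K unfolding is_bergman_kernel_def by blast+

lemma K_hol: "w \<in> disc \<Longrightarrow> (\<lambda>z. K z w) holomorphic_on disc"
  and Kw_L2: "w \<in> disc \<Longrightarrow> Kw w \<in> L2 meas"
  using K_AL2[of w] by (auto simp: AL2_phi_iff Kw_def)

lemma bump_at_le: "cmod (bump_at z w) \<le> 1"
  unfolding bump_at_def by (rule bump_norm_le)

lemma bump_at_eq_0: "z \<in> disc \<Longrightarrow> w \<notin> cball z (rad z) \<Longrightarrow> bump_at z w = 0"
  unfolding bump_at_def using rad_pos[of z]
  by (intro bump_eq_0) (auto simp: norm_mult norm_divide dist_norm norm_minus_commute field_simps)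

lemma bump_at_real: "complex_of_real (cmod (bump_at z w)) = bump_at z w"
  unfolding bump_at_def bump_def by (simp del: of_real_power)

lemma continuous_bump_at: "continuous_on UNIV (bump_at z)"
  unfolding bump_at_def[abs_def] by (intro continuous_intros)

lemma bump_at_measurable: "bump_at z \<in> borel_measurable borel"
  by (rule borel_measurable_continuous_onI[OF continuous_bump_at])

lemma bump_at_integrable:
  assumes g: "g \<in> L2 meas"
  shows "integrable meas (\<lambda>w. cmod (bump_at z w) * (cmod (g w))\<^sup>2)"
proof (rule Bochner_Integration.integrable_bound[OF L2_integrable[OF g]])
  have [measurable]: "g \<in> borel_measurable borel" "bump_at z \<in> borel_measurable borel"
    using meas_L2_measurable[OF g] bump_at_measurable by auto
  show "(\<lambda>w. cmod (bump_at z w) * (cmod (g w))\<^sup>2) \<in> borel_measurable meas" by measurable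
  show "AE w in meas. norm (cmod (bump_at z w) * (cmod (g w))\<^sup>2) \<le> norm ((cmod (g w))\<^sup>2)"
    using bump_at_le by (intro AE_I2) (simp add: mult_left_le_one_le)
qed

lemma bump_at_integral_le:
  assumes g: "g \<in> L2 meas"
  shows "(\<integral>w. cmod (bump_at z w) * (cmod (g w))\<^sup>2 \<partial>meas) \<le> sqnorm meas g"
  unfolding sqnorm_def
  by (rule integral_mono[OF bump_at_integrable[OF g] L2_integrable[OF g]]) (simp add: bump_at_le mult_left_le_one_le)

lemma AL2_pointwise_zero:
  assumes g: "g holomorphic_on disc" "zero_extension g \<in> L2 meas" "sqnorm meas (zero_extension g) = 0" and z: "z \<in> disc"
  shows "g z = 0"
proof -
  have "g holomorphic_on ball z (2 * rad z)"
    by (rule holomorphic_on_subset[OF g(1)]) (use ball_rad(1)[OF z] in blast)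
  from pointwise_bound[OF z this meas_L2_measurable[OF g(2)]]
  have "(cmod (g z))\<^sup>2 * exp (- 2 * \<phi> z) \<le> C0 / (tau \<phi> z)\<^sup>2 * (\<integral>w. cmod (bump_at z w) * (cmod (zero_extension g w))\<^sup>2 \<partial>meas)"
    using ball_rad(1)[OF z] by (simp add: zero_extension_disc)
  also have "\<dots> \<le> C0 / (tau \<phi> z)\<^sup>2 * 0"
    using bump_at_integral_le[OF g(2), of z] g(3) C0_pos by (intro mult_left_mono) auto
  finally have "(cmod (g z))\<^sup>2 * exp (- 2 * \<phi> z) \<le> 0" by simp
  then have "(cmod (g z))\<^sup>2 \<le> 0" by (simp add: mult_le_0_iff)
  then show ?thesis by simp
qed

lemma zero_extension_diff: "zero_extension (\<lambda>z. f z - g z) = (\<lambda>z. zero_extension f z - zero_extension g z)"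
  by (simp add: zero_extension_def scaleR_diff_right fun_eq_iff)

text \<open>
  The difference of \<open>f\<close> and its projection is orthogonal to itself, hence 0 almost everywhere, hence
  0 at every point by the submean inequality.
\<close>

lemma reproducing:
  assumes f: "f \<in> AL2_phi \<phi>" and z: "z \<in> disc"
  shows "f z = (\<integral>w. K z w * f w * of_real (exp (- 2 * \<phi> w)) \<partial>lebesgue_on disc)"
proof -
  define P where "P z = (\<integral>w. K z w * f w * of_real (exp (- 2 * \<phi> w)) \<partial>lebesgue_on disc)" for z
  have "f \<in> L2_phi \<phi>" using f by (simp add: AL2_phi_def)
  from K_proj[OF this] have P: "P \<in> AL2_phi \<phi>" "\<And>h. h \<in> AL2_phi \<phi> \<Longrightarrow> inner_phi \<phi> (\<lambda>z. f z - P z) h = 0"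
    by (auto simp: is_bergman_projection_def P_def[abs_def])
  have fP: "f holomorphic_on disc" "P holomorphic_on disc" "zero_extension f \<in> L2 meas" "zero_extension P \<in> L2 meas"
    using f P(1) by (auto simp: AL2_phi_iff)
  have g: "(\<lambda>z. f z - P z) holomorphic_on disc" using fP by (intro holomorphic_intros)
  have gL: "zero_extension (\<lambda>z. f z - P z) \<in> L2 meas" unfolding zero_extension_diff by (rule L2_diff[OF fP(3,4)])
  note gc = holomorphic_on_imp_continuous_on[OF g]
  have "ip meas (zero_extension (\<lambda>z. f z - P z)) (zero_extension (\<lambda>z. f z - P z)) = 0"
    using P(2)[of "\<lambda>z. f z - P z"] g gL unfolding AL2_phi_iff inner_phi_ip[OF gc gc] by blast
  then have "sqnorm meas (zero_extension (\<lambda>z. f z - P z)) = 0" unfolding ip_self[OF gL] by simp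
  from AL2_pointwise_zero[OF g gL this z] show ?thesis by (simp add: P_def)
qed

lemma K_diag:
  assumes w: "w \<in> disc"
  shows "K w w = of_real (sqnorm meas (Kw w))"
proof -
  have Kc: "continuous_on disc (\<lambda>z. K z w)" by (rule holomorphic_on_imp_continuous_on[OF K_hol[OF w]])
  have "K w w = (\<integral>\<zeta>. K w \<zeta> * K \<zeta> w * of_real (exp (- 2 * \<phi> \<zeta>)) \<partial>lebesgue_on disc)"
    by (rule reproducing[OF K_AL2[OF w] w])
  also have "\<dots> = inner_phi \<phi> (\<lambda>z. K z w) (\<lambda>z. K z w)"
    unfolding inner_phi_def
  proof (rule Bochner_Integration.integral_cong)
    fix \<zeta> assume "\<zeta> \<in> space (lebesgue_on disc)"
    then have "\<zeta> \<in> disc" by simp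
    from K_sym[OF w this] show "K w \<zeta> * K \<zeta> w * of_real (exp (- 2 * \<phi> \<zeta>)) = K \<zeta> w * cnj (K \<zeta> w) * of_real (exp (- 2 * \<phi> \<zeta>))"
      by (simp only: mult.commute)
  qed simp
  also have "\<dots> = of_real (sqnorm meas (Kw w))"
    unfolding inner_phi_ip[OF Kc Kc] Kw_def using ip_self[OF Kw_L2[OF w]] by (simp add: Kw_def)
  finally show ?thesis .
qed

lemma K_bound_J:
  assumes z: "z \<in> disc" and w: "w \<in> disc"
  shows "(cmod (K z w))\<^sup>2 * exp (- 2 * \<phi> z) \<le> C0 / (tau \<phi> z)\<^sup>2 * J z w"
  unfolding J_def
proof (rule pointwise_bound[OF z])
  show "(\<lambda>z. K z w) holomorphic_on ball z (2 * rad z)"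
    by (rule holomorphic_on_subset[OF K_hol[OF w]]) (use ball_rad(1)[OF z] in blast)
  show "Kw w \<in> borel_measurable borel" by (rule meas_L2_measurable[OF Kw_L2[OF w]])
  show "Kw w \<zeta> = K \<zeta> w" if "\<zeta> \<in> ball z (2 * rad z)" for \<zeta>
    using ball_rad(1)[OF z that] by (simp add: Kw_def zero_extension_disc)
qed

lemma J_le: "w \<in> disc \<Longrightarrow> J z w \<le> sqnorm meas (Kw w)"
  unfolding J_def by (rule bump_at_integral_le[OF Kw_L2])

text \<open>
  The submean inequality for \<open>K (\<cdot>, w)\<close> at \<open>w\<close> bounds the square of \<open>K w w = \<parallel>K (\<cdot>, w)\<parallel>\<^sup>2\<close> by a
  multiple of the same quantity; one factor cancels.
\<close>

lemma diagonal_bound: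
  assumes w: "w \<in> disc"
  shows "sqnorm meas (Kw w) * exp (- 2 * \<phi> w) \<le> C0 / (tau \<phi> w)\<^sup>2"
proof -
  define k where "k = sqnorm meas (Kw w)"
  have k0: "0 \<le> k" by (simp add: k_def sqnorm_nonneg)
  have "k\<^sup>2 * exp (- 2 * \<phi> w) \<le> C0 / (tau \<phi> w)\<^sup>2 * J w w"
    using K_bound_J[OF w w] unfolding K_diag[OF w] by (simp add: k_def)
  also have "\<dots> \<le> C0 / (tau \<phi> w)\<^sup>2 * k"
    using J_le[OF w, of w] C0_pos by (intro mult_left_mono) (auto simp: k_def)
  finally have "k * (k * exp (- 2 * \<phi> w)) \<le> k * (C0 / (tau \<phi> w)\<^sup>2)" by (simp add: power2_eq_square mult_ac)
  then show ?thesis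
  proof (cases "k = 0")
    case True then show ?thesis using C0_pos by (simp add: k_def)
  next
    case False
    then have "0 < k" using k0 by simp
    with \<open>k * (k * exp (- 2 * \<phi> w)) \<le> k * (C0 / (tau \<phi> w)\<^sup>2)\<close> show ?thesis
      unfolding k_def by (metis mult_le_cancel_left_pos)
  qed
qed

end

section \<open>The Bergman kernel away from the diagonal\<close>

context bergman_weight
begin

text \<open>
  Let \<open>u\<close> be the difference of \<open>bump_at z * K (\<cdot>, w)\<close> and its projection \<open>P\<close>.  It is orthogonal to
  the holomorphic functions, and its derivative with respect to the conjugate variable is
  \<open>f = b * K (\<cdot>, w)\<close>, where \<open>b\<close> is that of the bump.  Exponential decay makes \<open>u\<close> small around \<open>w\<close>.
  There \<open>u = - P\<close> is holomorphic, because the disc around \<open>w\<close> does not meet the support of the bump,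
  and \<open>P w = J z w\<close>.
\<close>

lemma cutoff_estimate:
  assumes z: "z \<in> disc" and w: "w \<in> disc" and far: "cball z (rad z) \<inter> ball w (2 * rad w) = {}"
  shows "(J z w)\<^sup>2 * exp (- 2 * \<phi> w) \<le>
    C0 / (tau \<phi> w)\<^sup>2 * (48 * exp (6 - d_phi \<phi> z w) * (25 / \<delta>\<^sup>2 * sqnorm meas (Kw w)))"
proof -
  define R1 where "R1 = cmod z + rad z"
  have cz: "cball z (rad z) \<subseteq> disc" using cball_rad_subset[OF z] ball_rad(1)[OF z] by blast
  have R1: "R1 < 1"
  proof -
    have "rad z \<le> \<delta> * (C2 * (1 - cmod z))" unfolding rad_def using C2(2)[OF z] \<delta>(1) by (intro mult_left_mono) auto
    also have "\<dots> = (C2 * \<delta>) * (1 - cmod z)" by simp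
    also have "\<dots> \<le> 1 / 4 * (1 - cmod z)" using \<delta>(4) z by (intro mult_right_mono) auto
    finally show ?thesis using z by (simp add: R1_def)
  qed
  have cR: "cball z (rad z) \<subseteq> cball 0 R1"
  proof
    fix x assume "x \<in> cball z (rad z)"
    then show "x \<in> cball 0 R1"
      using norm_triangle_ineq2[of x z] by (simp add: R1_def dist_norm norm_minus_commute)
  qed
  have Kh: "(\<lambda>\<zeta>. K \<zeta> w) holomorphic_on disc" by (rule K_hol[OF w])
  have Kc: "continuous_on disc (\<lambda>\<zeta>. K \<zeta> w)" by (rule holomorphic_on_imp_continuous_on[OF Kh])
  have b0: "bump_at z \<zeta> = 0" if "\<zeta> \<notin> cball z (rad z)" for \<zeta> by (rule bump_at_eq_0[OF z that])
  have b0': "bump_at z \<zeta> = 0" if "\<zeta> \<notin> disc" for \<zeta> using b0[of \<zeta>] cz that by blast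
  define g where "g \<zeta> = bump_at z \<zeta> * K \<zeta> w" for \<zeta>
  have gc: "continuous_on UNIV g"
    unfolding g_def[abs_def] by (rule continuous_on_cutoff[OF continuous_bump_at closed_cball b0 cz open_ball Kc])
  have g0: "\<forall>\<zeta>. \<zeta> \<notin> cball 0 R1 \<longrightarrow> g \<zeta> = 0" using b0 cR unfolding g_def by (metis mult_zero_left subsetD)
  have rg: "zero_extension g = g"
  proof
    fix \<zeta> show "zero_extension g \<zeta> = g \<zeta>"
      by (cases "\<zeta> \<in> disc") (simp_all add: zero_extension_disc zero_extension_outside g_def b0')
  qed
  have gL: "g \<in> L2 meas" by (rule compact_support_E(4)[OF gc g0 R1])
  have gcd: "continuous_on disc g" by (rule continuous_on_subset[OF gc subset_UNIV])
  have gphi: "g \<in> L2_phi \<phi>" using gL by (simp add: L2_phi_iff[OF gcd] rg)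
  define P where "P y = (\<integral>x. K y x * g x * of_real (exp (- 2 * \<phi> x)) \<partial>lebesgue_on disc)" for y
  from K_proj[OF gphi] have P: "P \<in> AL2_phi \<phi>" "\<And>h. h \<in> AL2_phi \<phi> \<Longrightarrow> inner_phi \<phi> (\<lambda>y. g y - P y) h = 0"
    by (auto simp: is_bergman_projection_def P_def[abs_def])
  have Ph: "P holomorphic_on disc" "zero_extension P \<in> L2 meas" using P(1) by (auto simp: AL2_phi_iff)
  have Pc: "continuous_on disc P" by (rule holomorphic_on_imp_continuous_on[OF Ph(1)])
  define u where "u = zero_extension (\<lambda>y. g y - P y)"
  have uL: "u \<in> L2 meas" unfolding u_def zero_extension_diff rg by (rule L2_diff[OF gL Ph(2)])
  have gPc: "continuous_on disc (\<lambda>y. g y - P y)" by (intro continuous_intros gcd Pc)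
  have uc: "continuous_on disc u"
    by (rule continuous_on_eq[OF gPc]) (simp add: u_def zero_extension_disc del: mem_ball mem_ball_0)
  have orth: "ip meas u (\<lambda>y. indicator disc y *\<^sub>R h y) = 0"
    if h: "h holomorphic_on disc" "(\<lambda>y. indicator disc y *\<^sub>R h y) \<in> L2 meas" for h
  proof -
    have rh: "zero_extension h = (\<lambda>y. indicator disc y *\<^sub>R h y)" by (simp add: zero_extension_def[abs_def])
    have "h \<in> AL2_phi \<phi>" using h by (simp add: AL2_phi_iff rh)
    from P(2)[OF this] show ?thesis
      unfolding inner_phi_ip[OF gPc holomorphic_on_imp_continuous_on[OF h(1)]] u_def rh .
  qed
  \<comment> \<open>The bump varies on the scale \<open>rad z = \<delta> * \<tau> z\<close>, so \<open>b\<close> has size \<open>1 / (\<delta> * \<tau> z)\<close>; in the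
    weighted integral of \<open>|f|\<^sup>2\<close> below this is cancelled by \<open>1 / \<Delta>\<phi> = \<tau>\<^sup>2\<close>.\<close>
  define y where "y \<zeta> = complex_of_real (1 / rad z) * (\<zeta> - z)" for \<zeta>
  define b where "b \<zeta> = complex_of_real (1 / rad z) * (- 3 * y \<zeta> * bump 2 (y \<zeta>))" for \<zeta>
  obtain a where Cb: "C1w UNIV (bump_at z) a b"
  proof -
    have k: "C1w UNIV (bump 3) (\<lambda>z. - 3 * cnj z * bump 2 z) (\<lambda>z. - 3 * z * bump 2 z)"
      using C2w_bump3 by (simp add: C2w_def)
    have y': "- (complex_of_real (1 / rad z) * z) + complex_of_real (1 / rad z) * \<zeta> = y \<zeta>" for \<zeta>
      unfolding y_def by (simp only: right_diff_distrib uminus_add_conv_diff)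
    have e: "bump_at z = (\<lambda>\<zeta>. bump 3 (y \<zeta>))" by (simp add: bump_at_def y_def fun_eq_iff)
    have "C1w UNIV (bump_at z) (\<lambda>\<zeta>. complex_of_real (1 / rad z) * (- 3 * cnj (y \<zeta>) * bump 2 (y \<zeta>))) b"
      unfolding e b_def[abs_def]
      using C1w_affine[OF k, of "- (complex_of_real (1 / rad z) * z)" "complex_of_real (1 / rad z)"] unfolding y' by simp
    then show ?thesis by (rule that)
  qed
  have bv: "b \<zeta> = 0" if "\<zeta> \<notin> cball z (rad z)" for \<zeta>
    by (rule C1w_vanish(2)[OF Cb closed_cball _ that]) (rule b0)
  have ble: "cmod (b \<zeta>) \<le> 3 / rad z" for \<zeta>
  proof (cases "\<zeta> \<in> cball z (rad z)")
    case True
    have r: "0 < rad z" by (rule rad_pos[OF z])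
    have "cmod (y \<zeta>) \<le> 1" using True r by (simp add: y_def norm_mult norm_divide dist_norm norm_minus_commute)
    then have "3 * cmod (y \<zeta>) * cmod (bump 2 (y \<zeta>)) \<le> 3 * 1 * 1" by (intro mult_mono bump_norm_le) auto
    then have "cmod (- 3 * y \<zeta> * bump 2 (y \<zeta>)) \<le> 3" by (simp add: norm_mult)
    then have "1 / rad z * cmod (- 3 * y \<zeta> * bump 2 (y \<zeta>)) \<le> 1 / rad z * 3" using r by (intro mult_left_mono) auto
    moreover have "cmod (b \<zeta>) = 1 / rad z * cmod (- 3 * y \<zeta> * bump 2 (y \<zeta>))"
      unfolding b_def norm_mult[of "complex_of_real (1 / rad z)"] norm_of_real using r by simp
    ultimately show ?thesis by simp
  next
    case False then show ?thesis using rad_pos[OF z] bv[OF False] by simp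
  qed
  define f where "f \<zeta> = b \<zeta> * K \<zeta> w" for \<zeta>
  have fc: "continuous_on UNIV f"
    unfolding f_def[abs_def] by (rule continuous_on_cutoff[OF C1w_continuous_d(2)[OF Cb] closed_cball bv cz open_ball Kc])
  have f0': "f \<zeta> = 0" if "\<zeta> \<notin> cball z (rad z)" for \<zeta> using bv[OF that] by (simp add: f_def)
  have f0: "\<forall>\<zeta>. \<zeta> \<notin> cball 0 R1 \<longrightarrow> f \<zeta> = 0" using f0' cR by blast
  have weak: "ip meas u (dstar \<beta> b1) = ip meas f \<beta>" if \<beta>: "testfun \<beta> b1 b2" for \<beta> b1 b2
  proof -
    have 1: "C1w disc g (\<lambda>\<zeta>. a \<zeta> * K \<zeta> w + bump_at z \<zeta> * deriv (\<lambda>\<zeta>. K \<zeta> w) \<zeta>) (\<lambda>\<zeta>. b \<zeta> * K \<zeta> w + bump_at z \<zeta> * 0)"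
      unfolding g_def[abs_def]
      by (rule C1w_mult[OF C1w_subset[OF Cb subset_UNIV] C1w_holomorphic[OF Kh open_ball]])
    have 2: "C1w disc (\<lambda>\<zeta>. - 1 * P \<zeta>) (\<lambda>\<zeta>. - 1 * deriv P \<zeta>) (\<lambda>\<zeta>. - 1 * 0)"
      by (rule C1w_cmult[OF C1w_holomorphic[OF Ph(1) open_ball]])
    have 3: "C1w disc u (\<lambda>\<zeta>. a \<zeta> * K \<zeta> w + bump_at z \<zeta> * deriv (\<lambda>\<zeta>. K \<zeta> w) \<zeta> + - 1 * deriv P \<zeta>) (\<lambda>\<zeta>. b \<zeta> * K \<zeta> w + bump_at z \<zeta> * 0 + - 1 * 0)"
      by (rule C1w_transform[OF C1w_add[OF 1 2] open_ball]) (simp add: u_def zero_extension_disc del: mem_ball mem_ball_0)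
    from dstar_adjoint[OF \<beta> 3] show ?thesis by (simp add: f_def[abs_def])
  qed
  \<comment> \<open>The distance from \<open>z\<close> is truncated at its value in \<open>w\<close>, as the weight has to be bounded;
    larger values would be of no use around \<open>w\<close>.\<close>
  define d where "d \<zeta> = min (d_phi \<phi> z \<zeta>) (d_phi \<phi> z w)" for \<zeta>
  have d1: "0 \<le> d \<zeta> \<and> d \<zeta> \<le> d_phi \<phi> z w" if "\<zeta> \<in> disc" for \<zeta>
    using d_phi_nonneg[OF z that, of \<phi>] d_phi_nonneg[OF z w, of \<phi>] by (simp add: d_def)
  have d2: "\<bar>d x - d v\<bar> \<le> cmod (x - v) / m"
    if xv: "x \<in> disc" "v \<in> disc" and m: "0 < m" "\<And>\<zeta>. \<zeta> \<in> closed_segment x v \<Longrightarrow> m \<le> tau \<phi> \<zeta>" for x v m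
  proof -
    have m': "\<And>\<zeta>. \<zeta> \<in> closed_segment v x \<Longrightarrow> m \<le> tau \<phi> \<zeta>" using m(2) by (simp add: closed_segment_commute)
    have "d_phi \<phi> z v \<le> d_phi \<phi> z x + cmod (x - v) / m"
      by (rule d_phi_Lipschitz[OF continuous_tau tau_pos z xv m])
    moreover have "d_phi \<phi> z x \<le> d_phi \<phi> z v + cmod (v - x) / m"
      by (rule d_phi_Lipschitz[OF continuous_tau tau_pos z xv(2,1) m(1) m'])
    moreover have "0 \<le> cmod (x - v) / m" using m(1) by simp
    ultimately show ?thesis unfolding d_def norm_minus_commute[of v x] by linarith
  qed
  define A where "A = cball w (rad w)"
  have dA: "d_phi \<phi> z w - 1 \<le> d \<zeta>" if \<zeta>: "\<zeta> \<in> A" for \<zeta>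
  proof -
    have "\<zeta> \<in> ball w (2 * rad w)" using \<zeta> cball_rad_subset[OF w] by (auto simp: A_def)
    moreover have "cmod (\<zeta> - w) \<le> 1 * rad w" using \<zeta> by (simp add: A_def dist_norm norm_minus_commute)
    ultimately have "d_phi \<phi> z w \<le> d_phi \<phi> z \<zeta> + 2 * (1 * \<delta>)" by (rule d_local(2)[OF z w])
    then show ?thesis using \<delta>(2) by (simp add: d_def)
  qed
  have df: "d \<zeta> \<le> 1" if \<zeta>: "f \<zeta> \<noteq> 0" for \<zeta>
  proof -
    have zc: "\<zeta> \<in> cball z (rad z)" using f0' \<zeta> by blast
    then have "\<zeta> \<in> ball z (2 * rad z)" using cball_rad_subset[OF z] by blast
    moreover have "cmod (\<zeta> - z) \<le> 1 * rad z" using zc by (simp add: dist_norm norm_minus_commute)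
    ultimately have "d_phi \<phi> z \<zeta> \<le> d_phi \<phi> z z + 2 * (1 * \<delta>)" by (rule d_local(1)[OF z z])
    then show ?thesis using \<delta>(2) d_phi_refl[OF z, of \<phi>] by (simp add: d_def)
  qed
  have As: "A \<in> sets borel" by (simp add: A_def)
  have agmon: "(\<integral>\<zeta>. indicator A \<zeta> * (cmod (u \<zeta>))\<^sup>2 \<partial>meas) \<le>
      48 * exp (1 - (d_phi \<phi> z w - 1) + 4) * (\<integral>\<zeta>. (cmod (f \<zeta>))\<^sup>2 / laplacian \<phi> \<zeta> \<partial>meas)"
    by (rule Agmon_estimate[OF less_imp_le[OF C1(1)] C1(2) uL uc orth fc f0 R1 weak d1 d2 As dA df])
  have "(\<integral>\<zeta>. (cmod (f \<zeta>))\<^sup>2 / laplacian \<phi> \<zeta> \<partial>meas) \<le> 25 / \<delta>\<^sup>2 * sqnorm meas (Kw w)"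
  proof -
    have ilap: "continuous_on disc (\<lambda>z. 1 / laplacian \<phi> z)"
      using lap_pos by (intro continuous_on_divide continuous_on_const continuous_laplacian) fastforce
    have I1: "integrable meas (\<lambda>\<zeta>. 1 / laplacian \<phi> \<zeta> * (cmod (f \<zeta>))\<^sup>2)"
      by (rule integrable_cutoff_sq[OF fc f0 R1 ilap])
    have I2: "integrable meas (\<lambda>\<zeta>. 25 / \<delta>\<^sup>2 * (cmod (Kw w \<zeta>))\<^sup>2)"
      by (rule integrable_mult_right[OF L2_integrable[OF Kw_L2[OF w]]])
    have pt: "1 / laplacian \<phi> \<zeta> * (cmod (f \<zeta>))\<^sup>2 \<le> 25 / \<delta>\<^sup>2 * (cmod (Kw w \<zeta>))\<^sup>2" for \<zeta>
    proof (cases "\<zeta> \<in> cball z (rad z)")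
      case True
      then have zb: "\<zeta> \<in> ball z (2 * rad z)" using cball_rad_subset[OF z] by blast
      note br = ball_rad[OF z zb]
      have t: "0 < tau \<phi> z" "0 < tau \<phi> \<zeta>" using tau_pos z br(1) by auto
      have "tau \<phi> \<zeta> * cmod (b \<zeta>) \<le> (3 / 2 * tau \<phi> z) * (3 / rad z)"
        using br(3) ble[of \<zeta>] t by (intro mult_mono) auto
      also have "\<dots> = 9 / 2 / \<delta>" using t \<delta>(1) by (simp add: rad_def)
      also have "\<dots> \<le> 5 / \<delta>" using \<delta>(1) by (intro divide_right_mono) auto
      finally have "(tau \<phi> \<zeta> * cmod (b \<zeta>))\<^sup>2 \<le> (5 / \<delta>)\<^sup>2" using t by (intro power_mono) auto
      then have le: "(tau \<phi> \<zeta> * cmod (b \<zeta>))\<^sup>2 * (cmod (K \<zeta> w))\<^sup>2 \<le> 25 / \<delta>\<^sup>2 * (cmod (K \<zeta> w))\<^sup>2"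
        by (intro mult_right_mono) (auto simp: power_divide)
      have "1 / laplacian \<phi> \<zeta> = (tau \<phi> \<zeta>)\<^sup>2" using laplacian_tau[OF br(1)] t by (simp add: power_divide)
      then have "1 / laplacian \<phi> \<zeta> * (cmod (f \<zeta>))\<^sup>2 = (tau \<phi> \<zeta> * cmod (b \<zeta>))\<^sup>2 * (cmod (K \<zeta> w))\<^sup>2"
        by (simp only: f_def norm_mult power_mult_distrib mult.assoc)
      then show ?thesis using le br(1) by (simp only: Kw_def zero_extension_disc)
    next
      case False then show ?thesis using f0'[OF False] by simp
    qed
    have "(\<integral>\<zeta>. 1 / laplacian \<phi> \<zeta> * (cmod (f \<zeta>))\<^sup>2 \<partial>meas) \<le> (\<integral>\<zeta>. 25 / \<delta>\<^sup>2 * (cmod (Kw w \<zeta>))\<^sup>2 \<partial>meas)"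
      by (rule integral_mono[OF I1 I2 pt])
    also have "\<dots> = 25 / \<delta>\<^sup>2 * sqnorm meas (Kw w)" unfolding sqnorm_def by (rule integral_mult_right_zero)
    finally show ?thesis by simp
  qed
  then have "48 * exp (1 - (d_phi \<phi> z w - 1) + 4) * (\<integral>\<zeta>. (cmod (f \<zeta>))\<^sup>2 / laplacian \<phi> \<zeta> \<partial>meas) \<le>
      48 * exp (1 - (d_phi \<phi> z w - 1) + 4) * (25 / \<delta>\<^sup>2 * sqnorm meas (Kw w))"
    by (intro mult_left_mono) auto
  also have "1 - (d_phi \<phi> z w - 1) + 4 = 6 - d_phi \<phi> z w" by simp
  finally have est: "(\<integral>\<zeta>. indicator A \<zeta> * (cmod (u \<zeta>))\<^sup>2 \<partial>meas) \<le> 48 * exp (6 - d_phi \<phi> z w) * (25 / \<delta>\<^sup>2 * sqnorm meas (Kw w))"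
    using agmon by simp
  \<comment> \<open>By the symmetry of the kernel, the projection evaluated at \<open>w\<close> pairs \<open>bump_at z * K (\<cdot>, w)\<close>
    with \<open>K (\<cdot>, w)\<close> itself.\<close>
  have Pw: "P w = of_real (J z w)"
  proof -
    have c: "continuous_on disc (\<lambda>x. K x w * cnj (K x w) * bump_at z x)"
      by (intro continuous_intros Kc continuous_on_subset[OF continuous_bump_at subset_UNIV])
    have "P w = (\<integral>x. (K x w * cnj (K x w) * bump_at z x) * of_real (exp (- 2 * \<phi> x)) \<partial>lebesgue_on disc)"
      unfolding P_def
    proof (rule Bochner_Integration.integral_cong)
      fix x assume "x \<in> space (lebesgue_on disc)"
      then have "x \<in> disc" by simp
      from K_sym[OF w this] show "K w x * g x * of_real (exp (- 2 * \<phi> x)) = (K x w * cnj (K x w) * bump_at z x) * of_real (exp (- 2 * \<phi> x))"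
        unfolding g_def by (simp only: mult_ac)
    qed simp
    also have "\<dots> = (\<integral>x. zero_extension (\<lambda>x. K x w * cnj (K x w) * bump_at z x) x \<partial>meas)" by (rule weighted_disc_integral[OF c])
    also have "\<dots> = (\<integral>x. complex_of_real (cmod (bump_at z x) * (cmod (Kw w x))\<^sup>2) \<partial>meas)"
    proof (rule Bochner_Integration.integral_cong)
      fix x
      show "zero_extension (\<lambda>x. K x w * cnj (K x w) * bump_at z x) x = complex_of_real (cmod (bump_at z x) * (cmod (Kw w x))\<^sup>2)"
        unfolding of_real_mult complex_norm_square bump_at_real Kw_def
        by (cases "x \<in> disc") (simp_all add: zero_extension_disc zero_extension_outside mult_ac del: mem_ball mem_ball_0)
    qed simp
    also have "\<dots> = of_real (J z w)" unfolding J_def by (rule integral_complex_of_real)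
    finally show ?thesis .
  qed
  have hol: "(\<lambda>y. - P y) holomorphic_on ball w (2 * rad w)"
    by (intro holomorphic_intros holomorphic_on_subset[OF Ph(1)]) (use ball_rad(1)[OF w] in blast)
  have uP: "u y = - P y" if "y \<in> ball w (2 * rad w)" for y
  proof -
    have "y \<notin> cball z (rad z)" using that far by blast
    then have "g y = 0" using b0 by (simp add: g_def)
    then show ?thesis using ball_rad(1)[OF w that] by (simp only: u_def zero_extension_disc) simp
  qed
  have "(cmod (- P w))\<^sup>2 * exp (- 2 * \<phi> w) \<le> C0 / (tau \<phi> w)\<^sup>2 * (\<integral>x. cmod (bump_at w x) * (cmod (u x))\<^sup>2 \<partial>meas)"
    by (rule pointwise_bound[OF w hol meas_L2_measurable[OF uL] uP])
  also have "\<dots> \<le> C0 / (tau \<phi> w)\<^sup>2 * (\<integral>x. indicator A x * (cmod (u x))\<^sup>2 \<partial>meas)"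
  proof (rule mult_left_mono)
    have iA: "integrable meas (\<lambda>x. indicator A x * (cmod (u x))\<^sup>2)"
      using integrable_mult_indicator[OF _ L2_integrable[OF uL], of A] As by simp
    have pt: "cmod (bump_at w x) * (cmod (u x))\<^sup>2 \<le> indicator A x * (cmod (u x))\<^sup>2" for x
    proof (cases "x \<in> A")
      case True then show ?thesis using bump_at_le[of w x] by (simp add: mult_left_le_one_le)
    next
      case False then show ?thesis using bump_at_eq_0[OF w, of x] by (simp add: A_def)
    qed
    show "(\<integral>x. cmod (bump_at w x) * (cmod (u x))\<^sup>2 \<partial>meas) \<le> (\<integral>x. indicator A x * (cmod (u x))\<^sup>2 \<partial>meas)"
      by (rule integral_mono[OF bump_at_integrable[OF uL] iA pt])
    show "0 \<le> C0 / (tau \<phi> w)\<^sup>2" using C0_pos by simp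
  qed
  also have "\<dots> \<le> C0 / (tau \<phi> w)\<^sup>2 * (48 * exp (6 - d_phi \<phi> z w) * (25 / \<delta>\<^sup>2 * sqnorm meas (Kw w)))"
    using est C0_pos by (intro mult_left_mono) auto
  finally show ?thesis unfolding Pw by simp
qed

text \<open>
  The constants of \<open>cutoff_estimate\<close> collected: \<open>1200 = 48 * 25\<close>.
\<close>

definition C3 :: real where "C3 = 1200 * exp 6 / \<delta>\<^sup>2"

lemma C3_ge_1: "1 \<le> C3"
proof -
  have "\<delta>\<^sup>2 \<le> 1" using \<delta>(1,2) by (intro power_le_one) auto
  moreover have "1 \<le> exp (6::real)" by simp
  ultimately have "\<delta>\<^sup>2 \<le> 1200 * exp 6" by linarith
  then show ?thesis using \<delta>(1) by (simp add: C3_def)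
qed

text \<open>
  The diagonal bound at \<open>w\<close> replaces the norm of \<open>K (\<cdot>, w)\<close> in \<open>cutoff_estimate\<close>; a square root gives
  the exponent \<open>- d_phi z w / 2\<close>.
\<close>

lemma far_estimate:
  assumes z: "z \<in> disc" and w: "w \<in> disc" and far: "cball z (rad z) \<inter> ball w (2 * rad w) = {}"
  shows "J z w * exp (- 2 * \<phi> w) \<le> C0 / (tau \<phi> w)\<^sup>2 * (C3 * exp (- d_phi \<phi> z w / 2))"
proof (rule power2_le_imp_le)
  define q where "q = C0 / (tau \<phi> w)\<^sup>2"
  define D where "D = d_phi \<phi> z w"
  have q: "0 \<le> q" using C0_pos by (simp add: q_def)
  have ee: "exp (6 - D) = exp 6 * exp (- D)" by (simp flip: exp_add)
  have "(J z w * exp (- 2 * \<phi> w))\<^sup>2 = ((J z w)\<^sup>2 * exp (- 2 * \<phi> w)) * exp (- 2 * \<phi> w)"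
    by (simp add: power2_eq_square)
  also have "\<dots> \<le> (q * (48 * exp (6 - D) * (25 / \<delta>\<^sup>2 * sqnorm meas (Kw w)))) * exp (- 2 * \<phi> w)"
    using cutoff_estimate[OF assms] by (intro mult_right_mono) (auto simp: q_def D_def)
  also have "\<dots> = q * (C3 * exp (- D)) * (sqnorm meas (Kw w) * exp (- 2 * \<phi> w))"
    by (simp add: C3_def ee)
  also have "\<dots> \<le> q * (C3 * exp (- D)) * q"
    using diagonal_bound[OF w] q C3_ge_1 by (intro mult_left_mono mult_nonneg_nonneg) (auto simp: q_def)
  also have "\<dots> = q\<^sup>2 * (exp (- D) * C3)" by (simp add: power2_eq_square)
  also have "\<dots> \<le> q\<^sup>2 * (exp (- D) * C3\<^sup>2)"
    using C3_ge_1 by (intro mult_left_mono) (auto simp: power2_eq_square)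
  also have "\<dots> = (q * (C3 * exp (- D / 2)))\<^sup>2"
    using exp_double[of "- D / 2"] by (simp add: power_mult_distrib mult.commute)
  finally show "(J z w * exp (- 2 * \<phi> w))\<^sup>2 \<le> (C0 / (tau \<phi> w)\<^sup>2 * (C3 * exp (- d_phi \<phi> z w / 2)))\<^sup>2"
    by (simp add: q_def D_def)
  show "0 \<le> C0 / (tau \<phi> w)\<^sup>2 * (C3 * exp (- d_phi \<phi> z w / 2))"
    using C0_pos C3_ge_1 by simp
qed

lemma near_distance:
  assumes z: "z \<in> disc" and w: "w \<in> disc" and near: "cball z (rad z) \<inter> ball w (2 * rad w) \<noteq> {}"
  shows "d_phi \<phi> z w \<le> 2"
proof -
  obtain \<zeta> where \<zeta>: "\<zeta> \<in> cball z (rad z)" "\<zeta> \<in> ball w (2 * rad w)" using near by blast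
  have zb: "\<zeta> \<in> ball z (2 * rad z)" using cball_rad_subset[OF z] \<zeta>(1) by blast
  have 1: "cmod (\<zeta> - z) \<le> 1 * rad z" using \<zeta>(1) by (simp add: dist_norm norm_minus_commute)
  have 2: "cmod (\<zeta> - w) \<le> 2 * rad w" using \<zeta>(2) by (simp add: dist_norm norm_minus_commute)
  have "d_phi \<phi> z \<zeta> \<le> 0 + 2 * (1 * \<delta>)" using d_local(1)[OF z z zb 1] d_phi_refl[OF z, of \<phi>] by simp
  moreover have "d_phi \<phi> z w \<le> d_phi \<phi> z \<zeta> + 2 * (2 * \<delta>)" by (rule d_local(2)[OF z w \<zeta>(2) 2])
  ultimately show ?thesis using \<delta>(2) by simp
qed

text \<open>
  When the two discs meet, the distance is at most 2, and the factor \<open>exp 1\<close> compensates for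
  \<open>exp (- d_phi z w / 2)\<close>; then the mass near \<open>z\<close> is bounded by the total mass.
\<close>

lemma J_estimate:
  assumes z: "z \<in> disc" and w: "w \<in> disc"
  shows "J z w * exp (- 2 * \<phi> w) \<le> C0 / (tau \<phi> w)\<^sup>2 * (C3 * exp 1 * exp (- d_phi \<phi> z w / 2))"
proof (cases "cball z (rad z) \<inter> ball w (2 * rad w) = {}")
  case True
  have "C3 * exp (- d_phi \<phi> z w / 2) \<le> C3 * exp 1 * exp (- d_phi \<phi> z w / 2)"
    using C3_ge_1 by simp
  then have "C0 / (tau \<phi> w)\<^sup>2 * (C3 * exp (- d_phi \<phi> z w / 2)) \<le> C0 / (tau \<phi> w)\<^sup>2 * (C3 * exp 1 * exp (- d_phi \<phi> z w / 2))"
    using C0_pos by (intro mult_left_mono) auto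
  then show ?thesis using far_estimate[OF z w True] by linarith
next
  case False
  have "1 \<le> exp (1 - d_phi \<phi> z w / 2)" using near_distance[OF z w False] by simp
  also have "\<dots> = exp 1 * exp (- d_phi \<phi> z w / 2)" by (simp flip: exp_add)
  finally have "1 * 1 \<le> C3 * (exp 1 * exp (- d_phi \<phi> z w / 2))" using C3_ge_1 by (intro mult_mono) auto
  then have "C0 / (tau \<phi> w)\<^sup>2 * 1 \<le> C0 / (tau \<phi> w)\<^sup>2 * (C3 * exp 1 * exp (- d_phi \<phi> z w / 2))"
    using C0_pos by (intro mult_left_mono) (auto simp: mult.assoc)
  moreover have "J z w * exp (- 2 * \<phi> w) \<le> sqnorm meas (Kw w) * exp (- 2 * \<phi> w)"
    using J_le[OF w] by (intro mult_right_mono) auto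
  ultimately show ?thesis using diagonal_bound[OF w] by linarith
qed

text \<open>
  The submean inequality at \<open>z\<close> followed by the bound for the mass near \<open>z\<close>; a further square root
  leads to the rate 1/4.
\<close>

lemma kernel_estimate:
  assumes z: "z \<in> disc" and w: "w \<in> disc"
  shows "cmod (K z w) * exp (- (\<phi> z + \<phi> w)) \<le>
    C0 * C3 * exp 1 * (1 / (tau \<phi> z * tau \<phi> w)) * exp (- (1 / 4) * d_phi \<phi> z w)"
proof (rule power2_le_imp_le)
  define c where "c = C3 * exp (1::real)"
  define D where "D = d_phi \<phi> z w"
  have c1: "1 \<le> c" using mult_mono[of 1 C3 1 "exp 1"] C3_ge_1 by (simp add: c_def)
  have t: "0 < tau \<phi> z" "0 < tau \<phi> w" using tau_pos z w by auto
  have e2: "(exp x)\<^sup>2 = exp (2 * x)" for x :: real by (simp add: exp_double)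
  have "(cmod (K z w) * exp (- (\<phi> z + \<phi> w)))\<^sup>2 = ((cmod (K z w))\<^sup>2 * exp (- 2 * \<phi> z)) * exp (- 2 * \<phi> w)"
    unfolding power_mult_distrib e2 by (simp add: exp_add[symmetric] algebra_simps)
  also have "\<dots> \<le> (C0 / (tau \<phi> z)\<^sup>2 * J z w) * exp (- 2 * \<phi> w)"
    by (intro mult_right_mono K_bound_J[OF z w]) simp
  also have "\<dots> = C0 / (tau \<phi> z)\<^sup>2 * (J z w * exp (- 2 * \<phi> w))" by simp
  also have "\<dots> \<le> C0 / (tau \<phi> z)\<^sup>2 * (C0 / (tau \<phi> w)\<^sup>2 * (c * exp (- D / 2)))"
    using J_estimate[OF z w] C0_pos by (intro mult_left_mono) (auto simp: c_def D_def)
  also have "\<dots> = (C0\<^sup>2 / ((tau \<phi> z)\<^sup>2 * (tau \<phi> w)\<^sup>2) * exp (- D / 2)) * c" by (simp add: power2_eq_square)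
  also have "\<dots> \<le> (C0\<^sup>2 / ((tau \<phi> z)\<^sup>2 * (tau \<phi> w)\<^sup>2) * exp (- D / 2)) * c\<^sup>2"
    using c1 by (intro mult_left_mono) (auto simp: power2_eq_square)
  also have "\<dots> = (C0 * c * (1 / (tau \<phi> z * tau \<phi> w)) * exp (- (1 / 4) * D))\<^sup>2"
    unfolding power_mult_distrib e2 by (simp add: power_mult_distrib power_divide)
  finally show "(cmod (K z w) * exp (- (\<phi> z + \<phi> w)))\<^sup>2 \<le>
      (C0 * C3 * exp 1 * (1 / (tau \<phi> z * tau \<phi> w)) * exp (- (1 / 4) * d_phi \<phi> z w))\<^sup>2"
    by (simp add: c_def D_def mult.assoc)
  show "0 \<le> C0 * C3 * exp 1 * (1 / (tau \<phi> z * tau \<phi> w)) * exp (- (1 / 4) * d_phi \<phi> z w)"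
    using C0_pos C3_ge_1 t by simp
qed

end

theorem theorem1p2:
  fixes \<phi> :: "complex \<Rightarrow> real" and K :: "complex \<Rightarrow> complex \<Rightarrow> complex"
  assumes "\<phi> \<in> OP_disc"
    and "is_bergman_kernel \<phi> K"
  shows "\<exists>C \<sigma>. C > 0 \<and> \<sigma> > 0 \<and>
    (\<forall>z\<in>disc. \<forall>w\<in>disc.
       cmod (K z w) * exp (- (\<phi> z + \<phi> w))
         \<le> C * (1 / (tau \<phi> z * tau \<phi> w)) * exp (- \<sigma> * d_phi \<phi> z w))"
proof -
  have C2: "C2_on disc \<phi>" and pos: "\<And>z. z \<in> disc \<Longrightarrow> 0 < laplacian \<phi> z"
    and L: "\<exists>C>0. \<forall>z\<in>disc. \<forall>w\<in>disc. \<bar>tau \<phi> z - tau \<phi> w\<bar> \<le> C * cmod (z - w)"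
    and B: "\<exists>C>0. \<forall>z\<in>disc. tau \<phi> z \<le> C * (1 - cmod z)"
    using assms(1) unfolding OP_disc_def by blast+
  obtain A1 where A1: "0 < A1" "\<And>z w. z \<in> disc \<Longrightarrow> w \<in> disc \<Longrightarrow> \<bar>tau \<phi> z - tau \<phi> w\<bar> \<le> A1 * cmod (z - w)"
    using L by blast
  obtain A2 where A2: "0 < A2" "\<And>z. z \<in> disc \<Longrightarrow> tau \<phi> z \<le> A2 * (1 - cmod z)"
    using B by blast
  obtain p pz where p: "C1w disc (\<lambda>z. of_real (\<phi> z)) p (\<lambda>z. cnj (p z))"
    "C1w disc p pz (\<lambda>z. of_real (laplacian \<phi> z / 4))"
    by (rule C2_on_imp_wirtinger[OF C2])
  interpret bergman_weight \<phi> p pz K A1 A2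
    by unfold_locales (fact p pos assms(2) A1 A2)+
  show ?thesis
  proof (intro exI conjI ballI)
    show "0 < C0 * C3 * exp 1" using C0_pos C3_ge_1 by simp
    show "(0::real) < 1 / 4" by simp
    fix z w :: complex assume "z \<in> disc" "w \<in> disc"
    then show "cmod (K z w) * exp (- (\<phi> z + \<phi> w)) \<le>
        C0 * C3 * exp 1 * (1 / (tau \<phi> z * tau \<phi> w)) * exp (- (1 / 4) * d_phi \<phi> z w)"
      by (rule kernel_estimate)
  qed
qed

end
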